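(* Let $r\ge 2$ and $N\ge r$ be integers and let $\lambda=1^{\lambda_1}2^{\lambda_2}\cdots k^{\lambda_k}$ be a partition with $|\lambda|:=\lambda_1+2\lambda_2+\cdots+k\lambda_k<\frac{rN}{2r-2}$. Then, as $q\to\infty$ through prime powers with $q\equiv 1 \pmod{2r}$, $$\lim_{q\to\infty}\frac{1}{|\mathcal{H}_r(N)|}\sum_{G\in\mathcal{H}_r(N)} q^{\frac{r-2}{2r}|\lambda|}P_\lambda(\Theta_G)=\int_{U(N)}P_\lambda(U)\,\overline{\omega_r(U)}\,dU,$$ where $dU$ is Haar probability measure on the unitary group $U(N)$ and $$\omega_r(U)=\prod_{1\le i_1<i_2<\cdots<i_r\le N}\left(1-x_{i_1}x_{i_2}\cdots x_{i_r}\right)^{(-1)^{r+1}},$$ with $x_1,\dots,x_N$ the eigenvalues of $U$.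
   Context: $q$ is a prime power and $\mathbb{F}_q[T]$ the polynomial ring over the field with $q$ elements; "prime" means monic irreducible polynomial, $|F|=q^{\deg F}$. Since $q\equiv1\pmod r$, for a prime $P$ and $A\in\mathbb{F}_q[T]$ the $r$-th power residue symbol $\left(\frac{A}{P}\right)_r$ is $0$ if $P\mid A$ and otherwise the unique $r$-th root of unity in $\mathbb{F}_q^*\subset\mathbb{C}^*$ (via a fixed embedding) congruent to $A^{(|P|-1)/r}$ mod $P$; it is extended multiplicatively in the lower argument to all monic $G$. For monic $G$ put $\chi_G(F)=\left(\frac{F}{G}\right)_r$ and $L(u,\chi_G)=\sum_{F\text{ monic}}\chi_G(F)u^{\deg F}$. $\mathcal{H}_r(N)$ is the set of monic $r$-th power free polynomials (not divisible by $P^r$ for any prime $P$) of degree $N$. For $G\in\mathcal{H}_r(N)$, $L(u,\chi_G)$ is a polynomial and $\Theta_G$ denotes its Frobenius, an $N\times N$ matrix with $L(u,\chi_G)=\det(I-\sqrt q\,u\,\Theta_G)$; equivalently for all $n\ge1$, $\mathrm{Tr}(\Theta_G^n)=-q^{-n/2}\sum_{F\text{ monic},\,\deg F=n}\Lambda(F)\chi_G(F)$, where $\Lambda(F)=\deg P$ if $F=P^m$ for a prime $P$ and $m\ge1$, and $\Lambda(F)=0$ otherwise. For a partition $\lambda=1^{\lambda_1}2^{\lambda_2}\cdots k^{\lambda_k}$ (i.e. $\lambda_j$ parts equal to $j$) and a square matrix $U$, $P_\lambda(U)=\prod_{j=1}^k\mathrm{Tr}(U^j)^{\lambda_j}$.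
   Formalization: For even r, ω_r has non-integrable poles on U(N) (e.g. 1/(1-det U) for N=r), so the integral on the right is taken as the limit as t→1- of the integrals of P_λ(U) times the conjugate of ω_r(tU); for odd r it is the literal Haar integral. *)

theory Defs
  imports
    "HOL-Probability.Probability"
    "HOL-Number_Theory.Prime_Powers"
    "HOL-Number_Theory.Cong"
    "HOL-Algebra.Polynomial_Divisibility"
begin

subsection \<open>Polynomials over a finite field and residue symbols\<close>

text \<open>
  The field with \<open>q\<close> elements varies with \<open>q\<close>, so it is a carrier-based field \<open>R\<close> of
  HOL-Algebra; \<open>poly_ring R\<close> consists of coefficient lists with the leading coefficient first.
\<close>

definition monic_polys :: "'a ring \<Rightarrow> nat \<Rightarrow> 'a list set" where
  "monic_polys R n =
     {f \<in> carrier (poly_ring R). f \<noteq> [] \<and> Polynomials.lead_coeff f = \<one>\<^bsub>R\<^esub> \<and> Polynomials.degree f = n}"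

definition prime_polys :: "'a ring \<Rightarrow> 'a list set" where
  "prime_polys R = {p. (\<exists>n. p \<in> monic_polys R n) \<and> pirreducible\<^bsub>R\<^esub> (carrier R) p}"

definition poly_norm :: "'a ring \<Rightarrow> 'a list \<Rightarrow> nat" where
  "poly_norm R f = card (carrier R) ^ Polynomials.degree f"

definition power_free_polys :: "'a ring \<Rightarrow> nat \<Rightarrow> nat \<Rightarrow> 'a list set" where
  "power_free_polys R r N =
     {g \<in> monic_polys R N. \<forall>p \<in> prime_polys R. \<not> (p [^]\<^bsub>poly_ring R\<^esub> r) pdivides\<^bsub>R\<^esub> g}"

definition units_embedding :: "'a ring \<Rightarrow> ('a \<Rightarrow> complex) \<Rightarrow> bool" where
  "units_embedding R \<psi> \<longleftrightarrow>
     inj_on \<psi> (carrier (mult_of R)) \<and>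
     (\<forall>x \<in> carrier (mult_of R). \<psi> x \<noteq> 0) \<and>
     (\<forall>x \<in> carrier (mult_of R). \<forall>y \<in> carrier (mult_of R). \<psi> (x \<otimes>\<^bsub>R\<^esub> y) = \<psi> x * \<psi> y)"

definition residue_symbol ::
    "'a ring \<Rightarrow> ('a \<Rightarrow> complex) \<Rightarrow> nat \<Rightarrow> 'a list \<Rightarrow> 'a list \<Rightarrow> complex" where
  "residue_symbol R \<psi> r a p =
     (if p pdivides\<^bsub>R\<^esub> a then 0
      else \<psi> (THE z. z \<in> carrier R \<and> z [^]\<^bsub>R\<^esub> r = \<one>\<^bsub>R\<^esub> \<and>
             p pdivides\<^bsub>R\<^esub> ((a [^]\<^bsub>poly_ring R\<^esub> ((poly_norm R p - 1) div r))
                            \<ominus>\<^bsub>poly_ring R\<^esub> ring.poly_of_const R z)))"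

definition prime_multiplicity :: "'a ring \<Rightarrow> 'a list \<Rightarrow> 'a list \<Rightarrow> nat" where
  "prime_multiplicity R p g = (GREATEST m. (p [^]\<^bsub>poly_ring R\<^esub> (m::nat)) pdivides\<^bsub>R\<^esub> g)"

definition residue_char ::
    "'a ring \<Rightarrow> ('a \<Rightarrow> complex) \<Rightarrow> nat \<Rightarrow> 'a list \<Rightarrow> 'a list \<Rightarrow> complex" where
  "residue_char R \<psi> r g f =
     (\<Prod>p \<in> {p \<in> prime_polys R. p pdivides\<^bsub>R\<^esub> g}.
        residue_symbol R \<psi> r f p ^ prime_multiplicity R p g)"

text \<open>
  Terms are grouped by degree. For a nonprincipal character almost all the inner sums vanish,
  so that the series is a polynomial in \<open>u\<close> and converges for every complex \<open>u\<close>.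
\<close>

definition L_function ::
    "'a ring \<Rightarrow> ('a \<Rightarrow> complex) \<Rightarrow> nat \<Rightarrow> 'a list \<Rightarrow> complex \<Rightarrow> complex" where
  "L_function R \<psi> r g u = (\<Sum>n. (\<Sum>f \<in> monic_polys R n. residue_char R \<psi> r g f) * u ^ n)"

text \<open>
  Only the characteristic polynomial of the Frobenius matrix is prescribed. For characters of
  conductor of degree at most \<open>N\<close> the polynomial \<open>L(u)\<close> has degree less than \<open>N\<close>, so
  an \<open>N\<close>-by-\<open>N\<close> matrix with this property has \<open>0\<close> as an eigenvalue.
\<close>

definition is_Frobenius ::
    "'a ring \<Rightarrow> ('a \<Rightarrow> complex) \<Rightarrow> nat \<Rightarrow> 'a list \<Rightarrow> complex^'n^'n \<Rightarrow> bool" where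
  "is_Frobenius R \<psi> r g \<Theta> \<longleftrightarrow>
     (\<forall>u. L_function R \<psi> r g u =
          det (mat 1 - mat (complex_of_real (sqrt (real (card (carrier R)))) * u) ** \<Theta>))"

subsection \<open>Matrices and the unitary group\<close>

text \<open>The operation \<open>(^)\<close> on \<open>complex^'n^'n\<close> is the entrywise power, hence the explicit
  matrix power.\<close>

primrec matrix_power :: "complex^'n^'n \<Rightarrow> nat \<Rightarrow> complex^'n^'n" where
  "matrix_power A 0 = mat 1"
| "matrix_power A (Suc m) = A ** matrix_power A m"

text \<open>The partition with \<open>l j\<close> parts equal to \<open>j\<close> for \<open>1 \<le> j \<le> k\<close> is given by \<open>k\<close> and \<open>l\<close>.\<close>

definition partition_size :: "nat \<Rightarrow> (nat \<Rightarrow> nat) \<Rightarrow> nat" where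
  "partition_size k l = (\<Sum>j = 1..k. j * l j)"

definition power_sum :: "nat \<Rightarrow> (nat \<Rightarrow> nat) \<Rightarrow> complex^'n^'n \<Rightarrow> complex" where
  "power_sum k l U = (\<Prod>j = 1..k. trace (matrix_power U j) ^ l j)"

definition unitary_group :: "(complex^'n^'n) set" where
  "unitary_group = {U. U ** (\<chi> i j. cnj (U $ j $ i)) = mat 1}"

definition is_Haar_probability :: "(complex^'n^'n) measure \<Rightarrow> bool" where
  "is_Haar_probability \<mu> \<longleftrightarrow>
     prob_space \<mu> \<and>
     sets \<mu> = sets (restrict_space borel (unitary_group :: (complex^'n^'n) set)) \<and>
     (\<forall>V \<in> unitary_group. distr \<mu> \<mu> (\<lambda>U. V ** U) = \<mu>)"

definition is_eigenvalues :: "complex^'n^'n \<Rightarrow> ('n \<Rightarrow> complex) \<Rightarrow> bool" where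
  "is_eigenvalues U x \<longleftrightarrow> (\<forall>z. det (mat z - U) = (\<Prod>i\<in>UNIV. z - x i))"

text \<open>The sets \<open>S\<close> are the index sets \<open>{i\<^sub>1 < \<dots> < i\<^sub>r}\<close>. The product does not depend
  on the chosen enumeration of the eigenvalues.\<close>

definition omega :: "nat \<Rightarrow> complex^'n^'n \<Rightarrow> complex" where
  "omega r U =
     (let x = (SOME x. is_eigenvalues U x)
      in \<Prod>S \<in> {S :: 'n set. card S = r}. (1 - (\<Prod>i\<in>S. x i)) powi ((- 1) ^ (r + 1)))"

text \<open>
  \<open>has_omega_integral \<mu> r f I\<close>: the integral of \<open>f \<cdot> cnj \<omega>\<^sub>r\<close> has the value \<open>I\<close>.

  For odd \<open>r\<close> the function \<open>\<omega>\<^sub>r\<close> is a polynomial in the eigenvalues and this is the Lebesgue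
  integral. For even \<open>r\<close> the exponent is \<open>-1\<close>, and \<open>\<omega>\<^sub>r\<close> has poles along the hypersurfaces
  \<open>x\<^bsub>i\<^sub>1\<^esub> \<cdots> x\<^bsub>i\<^sub>r\<^esub> = 1\<close> of codimension one in the unitary group, so that it is not Lebesgue
  integrable. There \<open>\<omega>\<^sub>r\<close> stands for its expansion as a power series in the eigenvalues, and the
  integral is the limit of the integrals with \<open>\<omega>\<^sub>r(t U)\<close>, \<open>t < 1\<close>, as \<open>t\<close> tends to \<open>1\<close>; this is
  the termwise integral of the series when \<open>f\<close> is a polynomial in the eigenvalues.
  For odd \<open>r\<close> the limit would give the same value as the Lebesgue integral.
\<close>

definition has_omega_integral ::
    "(complex^'n^'n) measure \<Rightarrow> nat \<Rightarrow> (complex^'n^'n \<Rightarrow> complex) \<Rightarrow> complex \<Rightarrow> bool" where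
  "has_omega_integral \<mu> r f I \<longleftrightarrow>
     (if odd r then has_bochner_integral \<mu> (\<lambda>U. f U * cnj (omega r U)) I
      else (\<exists>J. (\<forall>t \<in> {0<..<1}.
                   has_bochner_integral \<mu> (\<lambda>U. f U * cnj (omega r (t *\<^sub>R U))) (J t)) \<and>
                (J \<longlongrightarrow> I) (at_left 1)))"

definition admissible_q :: "nat \<Rightarrow> nat set" where
  "admissible_q r = {q. primepow q \<and> [q = 1] (mod (2 * r))}"

definition family_average ::
    "'a ring \<Rightarrow> nat \<Rightarrow> nat \<Rightarrow> nat \<Rightarrow> (nat \<Rightarrow> nat) \<Rightarrow> ('a list \<Rightarrow> complex^'n^'n) \<Rightarrow> complex" where
  "family_average R r N k l \<Theta> =
     (1 / of_nat (card (power_free_polys R r N))) *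
     (\<Sum>g \<in> power_free_polys R r N.
        complex_of_real
          (real (card (carrier R)) powr
             ((real r - 2) / (2 * real r) * real (partition_size k l))) *
        power_sum k l (\<Theta> g))"

end

(* The explicit formula turns the product of the traces Tr(Theta_G^j) into a sum of chi_G(F) over
   products F of prime powers of prescribed degrees, to be averaged over the r-th power free G.

   If F is not an r-th power, then chi_G(F) = chi_F(G) by reciprocity, which holds without sign
   because 2r divides q - 1, and the sum over G is bounded by a Polya-Vinogradov inequality; the
   bound on |lambda| makes these terms negligible. Reciprocity comes from writing the residue
   symbol of a modulo b as the product over monic x of degree below deg b of the characters of the
   leading coefficients of a x mod b, an expression that can be seen to be symmetric in a and b.

   If F is an r-th power, then chi_G(F) only tests coprimality of F and G. To leading order the
   weighted number t(A) of such tuples, indexed by the set A of parts of the partition, satisfies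
   m t(A) = sum over k and subsets B of A of (-k)^|B| t(A - B), where r m is the sum of the parts
   in A, the parts in B add up to r k and are divisible by k.

   On the side of the unitary group, invariance of Haar measure gives Schwinger-Dyson equations,
   which determine the moments of the traces up to degree N. The Newton identities for the power
   series of omega_r then yield the same recurrence for the integral. *)
theory Submission
  imports Defs "HOL-Computational_Algebra.Fundamental_Theorem_Algebra"
begin

text \<open>The normalisation q^((r-2)d/(2r)), with d = |lambda|, is q^(d/2) q^(-d/r): the first
  factor clears the square roots of q in the explicit formula, the second divides by the order of
  the weighted number of tuples whose product is an r-th power. All other tuples together have
  weight at most q^d, each of them meets a sum over G of order at most q^((d+1)/2), and the family
  has about q^N members. The error exponent is therefore d (1 - 1/r) + (d + 1)/2 - N, which the
  hypothesis on d makes negative; the same hypothesis gives d \<le> N, the range in which the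
  moments of the traces are determined.

  Neither side is evaluated in closed form. Parts are kept as an indexed set, so that equal parts
  are told apart and the two recurrences over subsets agree literally.

  Only q varies, so every constant must be independent of q. Hence the counting is done for abstract
  primes with degrees, of which just the number q^n of products of degree n is used, and the
  character sums rest on the size of Gauss sums.\<close>

section \<open>Matrix algebra and traces of powers in terms of eigenvalues\<close>

lemma mat_nth: "mat c $ i $ j = (if i = j then c else 0)"
  by (simp add: mat_def)

text \<open>Complex multiples of a matrix are written \<open>mat c ** A\<close> throughout, so that
  scalars move by associativity and \<open>mat_mul_commute\<close>.\<close>

lemma mat_mul_nth: "(mat c ** A) $ i $ j = c * A $ i $ j" for A :: "complex^'n^'m"
proof -
  have "(mat c ** A) $ i $ j = (\<Sum>k\<in>UNIV. if k = i then c * A $ k $ j else 0)"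
    unfolding matrix_matrix_mult_def mat_def vec_lambda_beta by (intro sum.cong) auto
  then show ?thesis by (simp add: sum.delta)
qed

lemma mat_mul_commute: "mat c ** A = A ** mat c" for A :: "complex^'n^'n"
proof -
  have "(A ** mat c) $ i $ j = c * A $ i $ j" for i j
  proof -
    have "(A ** mat c) $ i $ j = (\<Sum>k\<in>UNIV. if k = j then c * A $ i $ k else 0)"
      unfolding matrix_matrix_mult_def mat_def vec_lambda_beta by (intro sum.cong) auto
    then show ?thesis by (simp add: sum.delta)
  qed
  then show ?thesis by (simp add: vec_eq_iff mat_mul_nth)
qed

lemma mat_mul_mat: "mat a ** mat b = (mat (a * b) :: complex^'n^'n)"
  unfolding vec_eq_iff mat_mul_nth by (auto simp: mat_nth)

lemma det_mat: "det (mat c :: complex^'n^'n) = c ^ CARD('n)"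
  by (simp add: det_diagonal mat_nth)

lemma matrix_mul_sum: "A ** (\<Sum>i\<in>S. f i) = (\<Sum>i\<in>S. A ** f i)" for A :: "complex^'n^'n"
  by (induction S rule: infinite_finite_induct) (auto simp: matrix_add_ldistrib)

lemma matrix_diff_rdistrib: "(A - B) ** C = A ** C - B ** C" for A :: "complex^'n^'m"
  by (vector matrix_matrix_mult_def sum_subtractf left_diff_distrib)

lemma matrix_diff_ldistrib: "C ** (A - B) = C ** A - C ** B" for A :: "complex^'n^'m"
  by (vector matrix_matrix_mult_def sum_subtractf right_diff_distrib)

definition peval :: "complex poly \<Rightarrow> complex^'n^'n \<Rightarrow> complex^'n^'n" where
  "peval p U = (\<Sum>i\<le>Polynomial.degree p. mat (Polynomial.coeff p i) ** matrix_power U i)"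

lemma peval_superset:
  assumes "Polynomial.degree p \<le> n"
  shows "peval p U = (\<Sum>i\<le>n. mat (Polynomial.coeff p i) ** matrix_power U i)"
  unfolding peval_def using assms
  by (intro sum.mono_neutral_left) (auto simp: coeff_eq_0)

lemma peval_linear_mult:
  "peval ([:- a, 1:] * p) U = (U - mat a) ** peval p U"
proof -
  let ?n = "Polynomial.degree p"
  have "Polynomial.degree ([:- a, 1:] * p) \<le> Suc ?n"
    using degree_mult_le[of "[:- a, 1:]" p] by simp
  then have "peval ([:- a, 1:] * p) U =
      (\<Sum>i\<le>Suc ?n. mat (Polynomial.coeff ([:- a, 1:] * p) i) ** matrix_power U i)"
    by (rule peval_superset)
  also have "\<dots> = (\<Sum>i\<le>Suc ?n. mat (Polynomial.coeff (pCons 0 p) i) ** matrix_power U i)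
        - (\<Sum>i\<le>Suc ?n. mat (a * Polynomial.coeff p i) ** matrix_power U i)"
    unfolding sum_subtractf[symmetric]
    by (intro sum.cong) (auto simp: vec_eq_iff mat_mul_nth algebra_simps)
  also have "(\<Sum>i\<le>Suc ?n. mat (Polynomial.coeff (pCons 0 p) i) ** matrix_power U i) = U ** peval p U"
    unfolding sum.atMost_Suc_shift peval_def matrix_mul_sum
    by (simp add: matrix_mul_assoc mat_mul_commute[of _ U])
  also have "(\<Sum>i\<le>Suc ?n. mat (a * Polynomial.coeff p i) ** matrix_power U i) = mat a ** peval p U"
    by (simp add: peval_def matrix_mul_sum matrix_mul_assoc mat_mul_mat coeff_eq_0)
  finally show ?thesis by (simp add: matrix_diff_rdistrib)
qed

text \<open>Over the complex numbers the polynomial splits, so multiplicativity of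
  \<open>det\<close> reduces the claim to the linear factors \<open>U - mat a\<close>.\<close>

lemma det_peval:
  assumes "is_eigenvalues U x"
  shows "det (peval p U) = (\<Prod>i\<in>UNIV. poly p (x i))"
proof -
  have lin: "det (U - mat a) = (\<Prod>i\<in>UNIV. x i - a)" for a
  proof -
    have "U - mat a = mat (-1) ** (mat a - U)"
      by (auto simp: vec_eq_iff mat_mul_nth)
    then have "det (U - mat a) = (-1) ^ CARD('a) * (\<Prod>i\<in>UNIV. a - x i)"
      using assms by (simp add: det_mul det_mat is_eigenvalues_def)
    also have "\<dots> = (\<Prod>i\<in>UNIV. (-1) * (a - x i))"
      by (simp only: prod.distrib prod_constant)
    finally show ?thesis by simp
  qed
  have main: "det (peval (Polynomial.smult c (\<Prod>a\<in>#A. [:- a, 1:])) U) =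
      (\<Prod>i\<in>UNIV. poly (Polynomial.smult c (\<Prod>a\<in>#A. [:- a, 1:])) (x i))" for c A
  proof (induction A)
    case empty
    then show ?case by (simp add: peval_def det_mat)
  next
    case (add a A)
    have "peval (Polynomial.smult c (\<Prod>a\<in>#add_mset a A. [:- a, 1:])) U =
          (U - mat a) ** peval (Polynomial.smult c (\<Prod>a\<in>#A. [:- a, 1:])) U"
      by (simp only: peval_linear_mult[symmetric]) (simp only: image_mset_add_mset prod_mset.add_mset mult_smult_right)
    then show ?case
      using add by (simp add: det_mul lin prod.distrib[symmetric] algebra_simps)
  qed
  show ?thesis
    using main[of "Polynomial.lead_coeff p" "proots p"] complex_poly_decompose_multiset[of p] by metis
qed

text \<open>In the Leibniz formula only the identity permutation has a nonzero derivative at u = 0: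
  any other permutation moves at least two points, so after one factor is differentiated its product
  still contains an off-diagonal factor, which vanishes at 0.\<close>

lemma has_field_derivative_det_I_minus:
  fixes A :: "complex^'n^'n"
  shows "((\<lambda>u. det (mat 1 - mat u ** A)) has_field_derivative - trace A) (at 0)"
proof -
  let ?f = "\<lambda>p i u. (mat 1 - mat u ** A) $ i $ (p i)"
  have f: "(?f p i has_field_derivative - (A $ i $ p i)) (at 0)" for p i
    by (auto simp: mat_mul_nth intro!: derivative_eq_intros)
  have "((\<lambda>u. det (mat 1 - mat u ** A)) has_field_derivative
     (\<Sum>p | p permutes UNIV. of_int (sign p) *
       (\<Sum>i\<in>UNIV. - (A $ i $ p i) * (\<Prod>j\<in>UNIV-{i}. ?f p j 0)))) (at 0)"
    unfolding det_def
    by (intro DERIV_sum DERIV_cmult has_field_derivative_prod f)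
  moreover have "(\<Sum>p | p permutes (UNIV::'n set). of_int (sign p) *
       (\<Sum>i\<in>UNIV. - (A $ i $ p i) * (\<Prod>j\<in>UNIV-{i}. ?f p j 0))) =
     (\<Sum>p\<in>{id}. of_int (sign p) *
       (\<Sum>i\<in>UNIV. - (A $ i $ p i) * (\<Prod>j\<in>UNIV-{i}. ?f p j 0)))"
  proof (rule sum.mono_neutral_right)
    show "\<forall>p\<in>{p. p permutes (UNIV::'n set)} - {id}. of_int (sign p) *
       (\<Sum>i\<in>UNIV. - (A $ i $ p i) * (\<Prod>j\<in>UNIV-{i}. ?f p j 0)) = 0"
    proof
      fix p :: "'n \<Rightarrow> 'n" assume "p \<in> {p. p permutes UNIV} - {id}"
      then have p: "p permutes UNIV" "p \<noteq> id" by auto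
      have "(\<Prod>j\<in>UNIV-{i}. ?f p j 0) = 0" for i
      proof -
        have "\<exists>j. j \<noteq> i \<and> p j \<noteq> j"
        proof (rule ccontr)
          assume "\<not> (\<exists>j. j \<noteq> i \<and> p j \<noteq> j)"
          then have *: "\<And>j. j \<noteq> i \<Longrightarrow> p j = j" by auto
          then have "p i = i"
            using permutes_inj[OF p(1)] by (metis injD)
          with * p(2) show False by (metis eq_id_iff)
        qed
        then obtain j where "j \<noteq> i" "p j \<noteq> j" by auto
        then show ?thesis
          by (intro prod_zero) (auto simp: mat_mul_nth mat_nth intro!: bexI[of _ j])
      qed
      then show "of_int (sign p) *
       (\<Sum>i\<in>UNIV. - (A $ i $ p i) * (\<Prod>j\<in>UNIV-{i}. ?f p j 0)) = 0"
        by (simp only: mult_zero_right sum.neutral_const)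
    qed
  qed (auto simp: permutes_id)
  moreover have "\<dots> = - trace A"
    by (simp add: trace_def sum_negf mat_mul_nth mat_nth)
  ultimately show ?thesis by simp
qed

lemma peval_one_minus_monom:
  "peval (1 - Polynomial.monom u j) U = mat 1 - mat u ** matrix_power U j"
proof -
  have "Polynomial.degree (1 - Polynomial.monom u j) \<le> j"
    by (intro degree_diff_le) (auto simp: degree_monom_le)
  then have "peval (1 - Polynomial.monom u j) U =
     (\<Sum>i\<le>j. mat (Polynomial.coeff (1 - Polynomial.monom u j) i) ** matrix_power U i)"
    by (rule peval_superset)
  also have "\<dots> = (\<Sum>i\<le>j. (if i = 0 then mat 1 else 0) - (if i = j then mat u ** matrix_power U j else 0))"
    by (intro sum.cong) (auto simp: vec_eq_iff mat_mul_nth coeff_1 if_distrib algebra_simps mat_nth)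
  finally show ?thesis by (simp add: sum_subtractf)
qed

text \<open>Both sides are minus the derivative at u = 0 of det (1 - u U^j), which
  \<open>det_peval\<close> evaluates for the polynomial 1 - u X^j.\<close>

lemma trace_matrix_power:
  assumes "is_eigenvalues U x"
  shows "trace (matrix_power U j) = (\<Sum>i\<in>UNIV. x i ^ j)"
proof -
  have "det (mat 1 - mat u ** matrix_power U j) = (\<Prod>i\<in>UNIV. 1 - u * x i ^ j)" for u
    using det_peval[OF assms, of "1 - Polynomial.monom u j"] by (simp add: peval_one_minus_monom poly_monom)
  moreover have "((\<lambda>u. \<Prod>i\<in>UNIV. 1 - u * x i ^ j) has_field_derivative
      (\<Sum>i\<in>UNIV. - (x i ^ j) * (\<Prod>k\<in>UNIV-{i}. 1 - 0 * x k ^ j))) (at 0)"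
    by (intro has_field_derivative_prod) (auto intro!: derivative_eq_intros)
  ultimately have "- trace (matrix_power U j) = (\<Sum>i\<in>UNIV. - (x i ^ j) * (\<Prod>k\<in>UNIV-{i}. 1 - 0 * x k ^ j))"
    using has_field_derivative_det_I_minus[of "matrix_power U j"]
    by (auto intro: DERIV_unique)
  then show ?thesis by (simp add: sum_negf)
qed

text \<open>The characteristic polynomial is assembled from the Leibniz formula with the polynomial
  entries \<open>e i j\<close>. A permutation contributes degree at most its number of fixed points,
  so the identity alone reaches degree \<open>CARD('n)\<close> and makes the polynomial monic; then
  it splits over the complex numbers.\<close>

lemma exists_eigenvalues: "\<exists>x. is_eigenvalues (U :: complex^'n^'n) x"
proof -
  let ?n = "CARD('n)"
  define e where "e i j = (if i = j then [:- (U $ i $ j), 1:] else [:- (U $ i $ j):])" for i j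
  define P where "P = (\<Sum>p | p permutes (UNIV::'n set). of_int (sign p) * (\<Prod>i\<in>UNIV. e i (p i)))"
  have deg_le: "Polynomial.degree (e i j) \<le> (if i = j then 1 else 0)" for i j
    by (simp add: e_def)
  have deg: "Polynomial.degree (\<Prod>i\<in>UNIV. e i (p i)) \<le> card {i. p i = i}" for p
  proof -
    have "Polynomial.degree (\<Prod>i\<in>UNIV. e i (p i)) \<le> (\<Sum>i\<in>UNIV. Polynomial.degree (e i (p i)))"
      using degree_prod_sum_le[of UNIV "\<lambda>i. e i (p i)"] by (simp add: o_def)
    also have "\<dots> \<le> (\<Sum>i\<in>UNIV. if p i = i then 1 else 0)"
      using deg_le by (intro sum_mono) (metis (full_types))
    finally show ?thesis by (simp add: sum.If_cases)
  qed
  have deg': "Polynomial.degree (\<Prod>i\<in>UNIV. e i (p i)) < ?n" if "p \<noteq> id" for p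
  proof -
    have "{i. p i = i} \<noteq> UNIV" using that by (auto simp: fun_eq_iff)
    then have "card {i. p i = i} < ?n" by (intro psubset_card_mono) auto
    with deg[of p] show ?thesis by simp
  qed
  have poly_P: "poly P z = det (mat z - U)" for z
    unfolding P_def det_def poly_sum poly_mult poly_prod poly_of_int
    by (intro sum.cong refl arg_cong2[of _ _ _ _ "(*)"] prod.cong) (auto simp: e_def mat_nth)
  have degP: "Polynomial.degree P \<le> ?n"
    unfolding P_def
  proof (intro degree_sum_le)
    fix p :: "'n \<Rightarrow> 'n"
    have "Polynomial.degree (of_int (sign p) * (\<Prod>i\<in>UNIV. e i (p i))) \<le>
        Polynomial.degree (of_int (sign p) :: complex poly) + Polynomial.degree (\<Prod>i\<in>UNIV. e i (p i))"
      by (rule degree_mult_le)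
    also have "\<dots> \<le> ?n" using deg[of p] card_mono[of UNIV "{i. p i = i}"] by simp
    finally show "Polynomial.degree (of_int (sign p) * (\<Prod>i\<in>UNIV. e i (p i))) \<le> ?n" .
  qed auto
  have "Polynomial.coeff P ?n = (\<Sum>p | p permutes (UNIV::'n set). of_int (sign p) * Polynomial.coeff (\<Prod>i\<in>UNIV. e i (p i)) ?n)"
    unfolding P_def coeff_sum by (intro sum.cong) (auto simp: of_int_poly)
  also have "\<dots> = (\<Sum>p\<in>{id}. of_int (sign p) * Polynomial.coeff (\<Prod>i\<in>UNIV. e i (p i)) ?n)"
    by (intro sum.mono_neutral_right) (auto simp: permutes_id coeff_eq_0[OF deg'])
  also have "\<dots> = 1"
  proof -
    have l: "Polynomial.lead_coeff (\<Prod>i\<in>UNIV. e i i) = 1"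
      by (simp add: lead_coeff_prod e_def)
    have d: "Polynomial.degree (\<Prod>i\<in>UNIV. e i i) = ?n"
      by (subst degree_prod_eq_sum_degree) (auto simp: e_def)
    show ?thesis using l unfolding d by simp
  qed
  finally have c: "Polynomial.coeff P ?n = 1" .
  with degP have d: "Polynomial.degree P = ?n"
    by (metis antisym le_degree zero_neq_one)
  obtain root where "Polynomial.smult (Polynomial.lead_coeff P) (\<Prod>i<Polynomial.degree P. [:-root i, 1:]) = P"
    using complex_poly_decompose' by blast
  then have P: "P = (\<Prod>i<?n. [:-root i, 1:])" using c d by simp
  obtain b :: "'n \<Rightarrow> nat" where b: "bij_betw b UNIV {..<?n}"
    using ex_bij_betw_finite_nat[of "UNIV :: 'n set"] by (auto simp: atLeast0LessThan)
  have "det (mat z - U) = (\<Prod>i\<in>UNIV. z - root (b i))" for z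
    unfolding poly_P[symmetric] P poly_prod
    by (subst prod.reindex_bij_betw[OF b, symmetric]) simp
  then show ?thesis by (auto simp: is_eigenvalues_def)
qed

section \<open>Newton's identities for products of linear factors\<close>

unbundle fps_syntax

text \<open>The term of index 0 is suppressed, so that the series is -X D'/D for D the product of
  the factors 1 - b X.\<close>

definition power_sum_fps :: "'i set \<Rightarrow> ('i \<Rightarrow> complex) \<Rightarrow> complex fps" where
  "power_sum_fps I b = Abs_fps (\<lambda>j. if j = 0 then 0 else (\<Sum>i\<in>I. b i ^ j))"

lemma fps_X_deriv_prod_linear:
  assumes "finite I"
  shows "fps_X * fps_deriv (\<Prod>i\<in>I. 1 - fps_const (b i) * fps_X) =
           - (power_sum_fps I b * (\<Prod>i\<in>I. 1 - fps_const (b i) * fps_X))"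
  using assms
proof (induction I)
  case empty
  then show ?case by (simp add: power_sum_fps_def fps_eq_iff)
next
  case (insert x I)
  define E where "E = (\<Prod>i\<in>I. 1 - fps_const (b i) * fps_X)"
  define G where "G = Abs_fps (\<lambda>j. if j = 0 then 0 else b x ^ j)"
  have N: "power_sum_fps (insert x I) b = G + power_sum_fps I b"
    using insert by (auto simp: fps_eq_iff G_def power_sum_fps_def)
  have G: "G * (1 - fps_const (b x) * fps_X) = fps_const (b x) * fps_X"
  proof (rule fps_ext)
    fix n
    have "(G * (1 - fps_const (b x) * fps_X)) $ n = G $ n - (fps_X * (fps_const (b x) * G)) $ n"
      by (simp add: algebra_simps)
    also have "\<dots> = (fps_const (b x) * fps_X) $ n"
      by (cases n) (auto simp: G_def fps_X_nth)
    finally show "(G * (1 - fps_const (b x) * fps_X)) $ n = (fps_const (b x) * fps_X) $ n" .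
  qed
  have IH: "fps_X * fps_deriv E = - (power_sum_fps I b * E)"
    using insert by (simp add: E_def)
  define L where "L = 1 - fps_const (b x) * fps_X"
  have dL: "fps_X * fps_deriv L = - (fps_const (b x) * fps_X)"
    by (simp add: L_def)
  have "fps_X * fps_deriv (L * E) = L * (fps_X * fps_deriv E) + (fps_X * fps_deriv L) * E"
    by (simp add: ring_distribs mult_ac)
  also have "\<dots> = L * (- (power_sum_fps I b * E)) - (G * L) * E"
    unfolding IH dL G[folded L_def] by simp
  also have "\<dots> = - ((G + power_sum_fps I b) * (L * E))"
    by (simp add: ring_distribs mult_ac)
  finally show ?case using insert by (simp add: N E_def L_def)
qed

lemma fps_X_deriv_inverse_prod_linear:
  assumes "finite I"
  shows "fps_X * fps_deriv (inverse (\<Prod>i\<in>I. 1 - fps_const (b i) * fps_X)) =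
           power_sum_fps I b * inverse (\<Prod>i\<in>I. 1 - fps_const (b i) * fps_X)"
proof -
  define D where "D = (\<Prod>i\<in>I. 1 - fps_const (b i) * fps_X)"
  have D0: "fps_nth D 0 = 1"
    using assms unfolding D_def by (induction I) auto
  then have nz: "D \<noteq> 0" by auto
  have inv: "D * inverse D = 1" using D0 by (simp add: inverse_mult_eq_1')
  have "fps_deriv (D * inverse D) = 0" unfolding inv by simp
  then have "D * fps_deriv (inverse D) = - (fps_deriv D * inverse D)"
    by (simp only: fps_deriv_mult eq_neg_iff_add_eq_0)
  then have "fps_X * (D * fps_deriv (inverse D)) = fps_X * (- (fps_deriv D * inverse D))"
    by simp
  then have "D * (fps_X * fps_deriv (inverse D)) = - (fps_X * fps_deriv D) * inverse D"
    by (simp add: mult_ac)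
  also have "\<dots> = D * (power_sum_fps I b * inverse D)"
    using fps_X_deriv_prod_linear[OF assms, of b] by (simp add: D_def mult_ac)
  finally show ?thesis using nz unfolding D_def[symmetric] by simp
qed

text \<open>Comparison of coefficients in X F' = c p F. The constant c is -1 for a product of
  factors 1 - b X and 1 for its inverse.\<close>

lemma newton_recurrence:
  fixes F :: "complex fps"
  assumes "fps_X * fps_deriv F = fps_const c * power_sum_fps I b * F"
  shows "of_nat n * fps_nth F n = c * (\<Sum>j=1..n. (\<Sum>i\<in>I. b i ^ j) * fps_nth F (n - j))"
proof -
  have "of_nat n * fps_nth F n = fps_nth (fps_X * fps_deriv F) n"
    by (cases n) auto
  also have "\<dots> = c * (\<Sum>j=0..n. power_sum_fps I b $ j * F $ (n - j))"
    unfolding assms mult.assoc fps_mult_left_const_nth by (simp add: fps_mult_nth)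
  also have "(\<Sum>j=0..n. power_sum_fps I b $ j * F $ (n - j)) = (\<Sum>j=1..n. power_sum_fps I b $ j * F $ (n - j))"
    by (intro sum.mono_neutral_right) (auto simp: power_sum_fps_def not_le)
  also have "\<dots> = (\<Sum>j=1..n. (\<Sum>i\<in>I. b i ^ j) * fps_nth F (n - j))"
    by (intro sum.cong) (auto simp: power_sum_fps_def)
  finally show ?thesis .
qed

lemma newton_prod_linear:
  fixes b :: "'i \<Rightarrow> complex"
  assumes "finite I"
  shows "of_nat n * (\<Prod>i\<in>I. 1 - fps_const (b i) * fps_X) $ n =
    - (\<Sum>j=1..n. (\<Sum>i\<in>I. b i ^ j) * (\<Prod>i\<in>I. 1 - fps_const (b i) * fps_X) $ (n - j))"
proof -
  have "fps_X * fps_deriv (\<Prod>i\<in>I. 1 - fps_const (b i) * fps_X) =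
     fps_const (-1) * power_sum_fps I b * (\<Prod>i\<in>I. 1 - fps_const (b i) * fps_X)"
    unfolding fps_X_deriv_prod_linear[OF assms] by (simp flip: fps_const_neg)
  from newton_recurrence[OF this] show ?thesis by simp
qed

lemma newton_inverse_prod_linear:
  fixes b :: "'i \<Rightarrow> complex"
  assumes "finite I"
  shows "of_nat n * inverse (\<Prod>i\<in>I. 1 - fps_const (b i) * fps_X) $ n =
    (\<Sum>j=1..n. (\<Sum>i\<in>I. b i ^ j) * inverse (\<Prod>i\<in>I. 1 - fps_const (b i) * fps_X) $ (n - j))"
  using newton_recurrence[of "inverse (\<Prod>i\<in>I. 1 - fps_const (b i) * fps_X)" 1 I b n]
    fps_X_deriv_inverse_prod_linear[OF assms] by simp

unbundle no fps_syntax

section \<open>The unitary group and products of traces\<close>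

definition adj :: "complex^'n^'n \<Rightarrow> complex^'n^'n" where
  "adj U = (\<chi> i j. cnj (U $ j $ i))"

lemma adj_nth [simp]: "adj U $ i $ j = cnj (U $ j $ i)"
  by (simp add: adj_def)

lemma adj_mult: "adj (A ** B) = adj B ** adj A"
  by (simp add: vec_eq_iff matrix_matrix_mult_def mult.commute)

lemma adj_mat: "adj (mat c) = mat (cnj c)"
  by (auto simp: vec_eq_iff mat_nth)

lemma adj_add: "adj (A + B) = adj A + adj B"
  by (simp add: vec_eq_iff)

lemma trace_adj: "trace (adj A) = cnj (trace A)"
  by (simp add: trace_def)

lemma unitary_group_iff: "U \<in> unitary_group \<longleftrightarrow> U ** adj U = mat 1"
  by (simp add: unitary_group_def adj_def)

lemma unitary_group_adj_mult: "U \<in> unitary_group \<Longrightarrow> adj U ** U = mat 1"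
  for U :: "complex^'n^'n"
  by (simp add: unitary_group_iff matrix_left_right_inverse)

lemma unitary_group_mult: "U \<in> unitary_group \<Longrightarrow> V \<in> unitary_group \<Longrightarrow> U ** V \<in> unitary_group"
  for U :: "complex^'n^'n"
  unfolding unitary_group_iff adj_mult by (metis matrix_mul_assoc matrix_mul_rid)

lemma matrix_power_add: "matrix_power U (i + j) = matrix_power U i ** matrix_power U j"
  by (induction i) (auto simp: matrix_mul_assoc)

lemma matrix_power_Suc_right: "matrix_power U (Suc i) = matrix_power U i ** U"
  using matrix_power_add[of U i 1] by simp

lemma adj_matrix_power: "adj (matrix_power U i) = matrix_power (adj U) i"
proof (induction i)
  case (Suc i)
  have "adj (matrix_power U (Suc i)) = adj (matrix_power U i) ** adj U"
    by (simp add: adj_mult)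
  then show ?case using Suc matrix_power_Suc_right[of "adj U" i] by simp
qed (simp add: adj_mat)

lemma unitary_matrix_power_cancel:
  fixes U :: "complex^'n^'n"
  assumes "U \<in> unitary_group"
  shows "matrix_power U n ** matrix_power (adj U) n = mat 1"
proof (induction n)
  case (Suc n)
  have "matrix_power U (Suc n) ** matrix_power (adj U) (Suc n) =
     U ** (matrix_power U n ** matrix_power (adj U) n) ** adj U"
    unfolding matrix_power_Suc_right[of "adj U"] by (simp add: matrix_mul_assoc)
  then show ?case using Suc assms by (simp add: unitary_group_iff)
qed simp

text \<open>On the unitary group the adjoint is the inverse, so the product is U^(n-m); a negative
  exponent shows up as a complex conjugate.\<close>

lemma trace_matrix_power_mult_adj:
  fixes U :: "complex^'n^'n"
  assumes "U \<in> unitary_group"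
  shows "trace (matrix_power U n ** matrix_power (adj U) m) =
    (if m \<le> n then trace (matrix_power U (n - m)) else cnj (trace (matrix_power U (m - n))))"
proof (cases "m \<le> n")
  case True
  then have "matrix_power U n = matrix_power U (n - m) ** matrix_power U m"
    using matrix_power_add[of U "n - m" m] by simp
  then have "matrix_power U n ** matrix_power (adj U) m = matrix_power U (n - m)"
    by (metis assms unitary_matrix_power_cancel matrix_mul_assoc matrix_mul_rid)
  then show ?thesis using True by simp
next
  case False
  then have "matrix_power (adj U) m = matrix_power (adj U) n ** matrix_power (adj U) (m - n)"
    using matrix_power_add[of "adj U" n "m - n"] by simp
  then have "matrix_power U n ** matrix_power (adj U) m = matrix_power (adj U) (m - n)"
    by (metis assms unitary_matrix_power_cancel matrix_mul_assoc matrix_mul_lid)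
  then show ?thesis using False by (simp add: adj_matrix_power[symmetric] trace_adj)
qed

lemma unitary_nth_le_1:
  fixes U :: "complex^'n^'n"
  assumes "U \<in> unitary_group"
  shows "cmod (U $ i $ j) \<le> 1"
proof -
  have "(\<Sum>k\<in>UNIV. U $ i $ k * cnj (U $ i $ k)) = 1"
    using assms unfolding unitary_group_iff vec_eq_iff
    by (auto simp: matrix_matrix_mult_def mat_nth dest!: spec[of _ i])
  then have "(\<Sum>k\<in>UNIV. of_real ((cmod (U $ i $ k))\<^sup>2)) = (1::complex)"
    by (simp only: complex_norm_square)
  then have "(\<Sum>k\<in>UNIV. (cmod (U $ i $ k))\<^sup>2) = 1"
    by (metis of_real_sum of_real_eq_1_iff)
  moreover have "(cmod (U $ i $ j))\<^sup>2 \<le> (\<Sum>k\<in>UNIV. (cmod (U $ i $ k))\<^sup>2)"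
    by (rule member_le_sum) auto
  ultimately show ?thesis by (simp add: power_le_one_iff)
qed

text \<open>Compactness is what makes continuous functions integrable and derivatives along flows
  uniformly bounded.\<close>

lemma compact_unitary_group: "compact (unitary_group :: (complex^'n^'n) set)"
proof -
  have "closed (unitary_group :: (complex^'n^'n) set)"
  proof -
    have *: "unitary_group = (\<Inter>i. \<Inter>j. {U :: complex^'n^'n. (\<Sum>k\<in>UNIV. U $ i $ k * cnj (U $ j $ k)) = mat 1 $ i $ j})"
      by (auto simp: unitary_group_iff vec_eq_iff matrix_matrix_mult_def)
    have "closed {U :: complex^'n^'n. (\<Sum>k\<in>UNIV. U $ i $ k * cnj (U $ j $ k)) = mat 1 $ i $ j}" for i j
      by (intro closed_Collect_eq continuous_intros)
    then show ?thesis unfolding * by (intro closed_INT ballI)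
  qed
  moreover have "bounded (unitary_group :: (complex^'n^'n) set)"
  proof (rule boundedI)
    fix U :: "complex^'n^'n" assume U: "U \<in> unitary_group"
    have "norm U \<le> (\<Sum>i\<in>UNIV. norm (U $ i))"
      by (simp add: norm_vec_def L2_set_le_sum)
    also have "\<dots> \<le> (\<Sum>i\<in>UNIV. \<Sum>j\<in>UNIV. cmod (U $ i $ j))"
      by (intro sum_mono) (simp add: norm_vec_def L2_set_le_sum)
    also have "\<dots> \<le> (\<Sum>i\<in>(UNIV::'n set). \<Sum>j\<in>(UNIV::'n set). 1)"
      by (intro sum_mono unitary_nth_le_1 U)
    finally show "norm U \<le> (\<Sum>i\<in>(UNIV::'n set). \<Sum>j\<in>(UNIV::'n set). 1)" .
  qed
  ultimately show ?thesis by (simp add: compact_eq_bounded_closed)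
qed

text \<open>Partitions are multisets of parts here, because the equations for the moments split,
  merge and remove single parts.\<close>

definition trace_prod :: "nat multiset \<Rightarrow> complex^'n^'n \<Rightarrow> complex" where
  "trace_prod M U = (\<Prod>m\<in>#M. trace (matrix_power U m))"

lemma trace_prod_empty [simp]: "trace_prod {#} U = 1"
  by (simp add: trace_prod_def)

lemma trace_prod_add_mset [simp]: "trace_prod (add_mset m M) U = trace (matrix_power U m) * trace_prod M U"
  by (simp add: trace_prod_def)

lemma continuous_matrix_mult_nth:
  assumes "\<And>i j. continuous_on S (\<lambda>U. f U $ i $ j)" "\<And>i j. continuous_on S (\<lambda>U. g U $ i $ j)"
  shows "continuous_on S (\<lambda>U. (f U ** g U) $ i $ j :: complex)"
  unfolding matrix_matrix_mult_def by (auto intro!: continuous_intros assms)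

lemma continuous_matrix_power_nth:
  assumes "\<And>i j. continuous_on S (\<lambda>U. f U $ i $ j)"
  shows "continuous_on S (\<lambda>U. matrix_power (f U) n $ i $ j)"
proof (induction n arbitrary: i j)
  case 0
  then show ?case by simp
next
  case (Suc n)
  then show ?case unfolding matrix_power.simps by (intro continuous_matrix_mult_nth assms)
qed

lemma continuous_trace_matrix_power [continuous_intros]:
  "continuous_on S (\<lambda>U. trace (matrix_power U m))"
  unfolding trace_def by (intro continuous_intros continuous_matrix_power_nth)

lemma continuous_trace_prod [continuous_intros]:
  "continuous_on S (\<lambda>U. trace_prod M U)"
  by (induction M) (auto intro!: continuous_intros)

lemma continuous_sum_mset:
  fixes f :: "'a \<Rightarrow> 'b::topological_space \<Rightarrow> complex"
  assumes "\<And>m. continuous_on S (f m)"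
  shows "continuous_on S (\<lambda>U. \<Sum>m\<in>#M. f m U)"
  by (induction M) (auto intro!: continuous_intros assms)

subsection \<open>Differentiation along one-parameter subgroups\<close>

lemma has_vector_derivative_prod_mset:
  fixes g :: "'a \<Rightarrow> real \<Rightarrow> complex"
  assumes "\<And>m. ((\<lambda>t. g m t) has_vector_derivative g' m) (at t)"
  shows "((\<lambda>t. \<Prod>m\<in>#M. g m t) has_vector_derivative
           (\<Sum>m\<in>#M. g' m * (\<Prod>k\<in>#M - {#m#}. g k t))) (at t)"
proof (induction M)
  case empty
  then show ?case by simp
next
  case (add x M)
  have "(\<Prod>k\<in>#add_mset x M - {#m#}. g k t) = g x t * (\<Prod>k\<in>#M - {#m#}. g k t)" if "m \<in># M" for m
    using that by (simp add: add_mset_diff_bothsides)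
  then have "(\<Sum>m\<in>#M. g' m * (\<Prod>k\<in>#add_mset x M - {#m#}. g k t)) =
      g x t * (\<Sum>m\<in>#M. g' m * (\<Prod>k\<in>#M - {#m#}. g k t))"
    by (simp add: sum_mset_distrib_left mult_ac cong: image_mset_cong)
  moreover have "((\<lambda>t. g x t * (\<Prod>m\<in>#M. g m t)) has_vector_derivative
      (g x t * (\<Sum>m\<in>#M. g' m * (\<Prod>k\<in>#M - {#m#}. g k t)) + g' x * (\<Prod>m\<in>#M. g m t))) (at t)"
    by (intro has_vector_derivative_mult assms add)
  ultimately show ?case by (simp add: add.commute)
qed

lemma has_vector_derivative_matrix_mult_nth:
  fixes A B :: "real \<Rightarrow> complex^'n^'n"
  assumes "\<And>i j. ((\<lambda>t. A t $ i $ j) has_vector_derivative A' $ i $ j) (at t)"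
    and "\<And>i j. ((\<lambda>t. B t $ i $ j) has_vector_derivative B' $ i $ j) (at t)"
  shows "((\<lambda>t. (A t ** B t) $ i $ j) has_vector_derivative (A t ** B' + A' ** B t) $ i $ j) (at t)"
proof -
  have "((\<lambda>t. \<Sum>k\<in>UNIV. A t $ i $ k * B t $ k $ j) has_vector_derivative
     (\<Sum>k\<in>UNIV. A t $ i $ k * B' $ k $ j + A' $ i $ k * B t $ k $ j)) (at t)"
    by (intro has_vector_derivative_sum has_vector_derivative_mult assms)
  then show ?thesis by (simp add: matrix_matrix_mult_def sum.distrib)
qed

lemma has_vector_derivative_matrix_power_nth:
  fixes W :: "real \<Rightarrow> complex^'n^'n"
  assumes W: "\<And>i j. ((\<lambda>t. W t $ i $ j) has_vector_derivative (Y ** W t) $ i $ j) (at t)"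
  shows "((\<lambda>t. matrix_power (W t) n $ a $ b) has_vector_derivative
    (\<Sum>i<n. matrix_power (W t) i ** Y ** matrix_power (W t) (n - i)) $ a $ b) (at t)"
proof (induction n arbitrary: a b)
  case (Suc n)
  have "(W t ** (\<Sum>i<n. matrix_power (W t) i ** Y ** matrix_power (W t) (n - i)) + (Y ** W t) ** matrix_power (W t) n)
     = (\<Sum>i<Suc n. matrix_power (W t) i ** Y ** matrix_power (W t) (Suc n - i))"
    unfolding sum.lessThan_Suc_shift
    by (simp add: matrix_mul_sum matrix_mul_assoc add.commute)
  with has_vector_derivative_matrix_mult_nth[OF W Suc]
  show ?case by simp
qed simp

lemma trace_mult_sum: "trace (A ** (\<Sum>i\<in>S. f i)) = (\<Sum>i\<in>S. trace (A ** f i))" for A :: "complex^'n^'n"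
  by (induction S rule: infinite_finite_induct) (auto simp: matrix_add_ldistrib trace_add, auto simp: trace_def)

text \<open>By cyclicity of the trace all n terms of the product rule coincide.\<close>

lemma has_vector_derivative_trace_power:
  fixes W :: "real \<Rightarrow> complex^'n^'n"
  assumes W: "\<And>i j. ((\<lambda>t. W t $ i $ j) has_vector_derivative (Y ** W t) $ i $ j) (at t)"
  shows "((\<lambda>t. trace (matrix_power (W t) n)) has_vector_derivative
    of_nat n * trace (Y ** matrix_power (W t) n)) (at t)"
proof -
  have "((\<lambda>t. trace (matrix_power (W t) n)) has_vector_derivative
     trace (\<Sum>i<n. matrix_power (W t) i ** Y ** matrix_power (W t) (n - i))) (at t)"
    unfolding trace_def by (intro has_vector_derivative_sum has_vector_derivative_matrix_power_nth W)
  moreover have "trace (matrix_power (W t) i ** Y ** matrix_power (W t) (n - i)) = trace (Y ** matrix_power (W t) n)"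
    if "i < n" for i
  proof -
    have "trace (matrix_power (W t) i ** Y ** matrix_power (W t) (n - i)) =
          trace (Y ** (matrix_power (W t) (n - i) ** matrix_power (W t) i))"
      by (metis matrix_mul_assoc trace_mul_sym)
    then show ?thesis using that matrix_power_add[of "W t" "n - i" i] by simp
  qed
  moreover have "trace (\<Sum>i<n. matrix_power (W t) i ** Y ** matrix_power (W t) (n - i)) =
     (\<Sum>i<n. trace (matrix_power (W t) i ** Y ** matrix_power (W t) (n - i)))"
    using trace_mult_sum[of "mat 1"] by simp
  ultimately show ?thesis by simp
qed

lemma has_vector_derivative_cnj:
  "(f has_vector_derivative f') F \<Longrightarrow> ((\<lambda>t. cnj (f t)) has_vector_derivative cnj f') F"
  by (rule bounded_linear.has_vector_derivative[OF bounded_linear_cnj])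

text \<open>This is exp(t Y) when Y^2 = -P and P Y = Y: the even powers of Y collapse to multiples
  of P and the odd ones to multiples of Y, which leaves cosine and sine.\<close>

definition flow :: "complex^'n^'n \<Rightarrow> complex^'n^'n \<Rightarrow> real \<Rightarrow> complex^'n^'n" where
  "flow P Y t = mat 1 + mat (of_real (cos t - 1)) ** P + mat (of_real (sin t)) ** Y"

lemma matrix_add_rdistrib: "(A + B) ** C = A ** C + B ** C" for A :: "complex^'n^'m"
  by (vector matrix_matrix_mult_def sum.distrib distrib_right)

lemma mat_mul_mult_mat_mul: "mat a ** A ** (mat b ** B) = mat (a * b) ** (A ** B)"
  for A B :: "complex^'n^'n"
  by (metis mat_mul_commute mat_mul_mat matrix_mul_assoc)

text \<open>Y is skew-Hermitian, and the equations force P to be the orthogonal projection onto its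
  range. All directions used later, diagonal or supported on two coordinates, have this
  form.\<close>

locale one_parameter =
  fixes P Y :: "complex^'n^'n"
  assumes YY: "Y ** Y = mat (-1) ** P" and PY: "P ** Y = Y"
    and adj_Y: "adj Y = mat (-1) ** Y"
begin

lemma P_eq: "P = mat (-1) ** (Y ** Y)"
  unfolding YY by (simp add: matrix_mul_assoc mat_mul_mat)

lemma YP: "Y ** P = Y"
proof -
  have "Y ** P = mat (-1) ** (Y ** (Y ** Y))"
    by (subst P_eq) (metis mat_mul_commute matrix_mul_assoc)
  also have "\<dots> = P ** Y"
    by (subst P_eq) (simp only: matrix_mul_assoc)
  finally show ?thesis by (simp add: PY)
qed

lemma PP: "P ** P = P"
proof -
  have "P ** P = mat (-1) ** (Y ** (Y ** P))"
    by (subst (1) P_eq) (simp only: matrix_mul_assoc)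
  then show ?thesis unfolding YP using P_eq by simp
qed

lemma adj_P: "adj P = P"
proof -
  have "adj P = (mat (-1) ** Y) ** (mat (-1) ** Y) ** mat (-1)"
    by (subst P_eq) (simp only: adj_mult adj_Y adj_mat, simp)
  also have "\<dots> = mat (-1) ** (Y ** Y)"
    unfolding mat_mul_commute[symmetric] mat_mul_mult_mat_mul by simp
  finally show ?thesis using P_eq by simp
qed

lemma flow_add: "flow P Y s ** flow P Y t = flow P Y (s + t)"
proof -
  show ?thesis
    unfolding flow_def
    by (simp add: matrix_add_ldistrib matrix_add_rdistrib mat_mul_mult_mat_mul YY YP PY PP)
       (simp add: vec_eq_iff mat_mul_nth sin_add cos_add mat_nth matrix_mul_assoc mat_mul_mat algebra_simps)
qed

lemma adj_flow: "adj (flow P Y t) = flow P Y (- t)"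
  unfolding flow_def adj_add adj_mult adj_mat adj_P adj_Y
  by (simp add: vec_eq_iff mat_mul_nth mat_mul_commute[symmetric])

lemma flow_0: "flow P Y 0 = mat 1"
  by (simp add: flow_def)

lemma flow_unitary: "flow P Y t \<in> unitary_group"
  unfolding unitary_group_iff adj_flow flow_add by (simp add: flow_0)

lemma flow_derivative_0:
  "((\<lambda>t. flow P Y t $ i $ j) has_vector_derivative Y $ i $ j) (at 0)"
proof -
  have c: "((\<lambda>t::real. complex_of_real (cos t - 1)) has_vector_derivative of_real 0) (at 0)"
    by (intro has_vector_derivative_of_real) (auto intro!: derivative_eq_intros simp: has_real_derivative_iff_has_vector_derivative[symmetric])
  have s: "((\<lambda>t::real. complex_of_real (sin t)) has_vector_derivative of_real 1) (at 0)"
    by (intro has_vector_derivative_of_real) (auto intro!: derivative_eq_intros simp: has_real_derivative_iff_has_vector_derivative[symmetric])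
  have "((\<lambda>t. mat 1 $ i $ j + of_real (cos t - 1) * P $ i $ j + of_real (sin t) * Y $ i $ j) has_vector_derivative
     0 + of_real 0 * P $ i $ j + of_real 1 * Y $ i $ j) (at 0)"
    by (intro has_vector_derivative_add has_vector_derivative_const has_vector_derivative_mult_left c s)
  then show ?thesis by (simp add: flow_def mat_mul_nth)
qed

lemma flow_derivative:
  fixes U :: "complex^'n^'n"
  shows "((\<lambda>t. (flow P Y t ** U) $ i $ j) has_vector_derivative (Y ** (flow P Y t ** U)) $ i $ j) (at t)"
proof -
  \<comment> \<open>The group law \<open>flow_add\<close> reduces the derivative at t to the one at
    0, with base point \<open>flow P Y t ** U\<close>.\<close>
  have "((\<lambda>s. (flow P Y s ** (flow P Y t ** U)) $ i $ j) has_vector_derivative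
      (flow P Y 0 ** 0 + Y ** (flow P Y t ** U)) $ i $ j) (at 0)"
    by (rule has_vector_derivative_matrix_mult_nth[where B = "\<lambda>_. flow P Y t ** U"])
      (simp_all add: flow_derivative_0)
  then have *: "((\<lambda>s. (flow P Y s ** (flow P Y t ** U)) $ i $ j) has_vector_derivative
      (Y ** (flow P Y t ** U)) $ i $ j) (at (t - t))" by simp
  have "((\<lambda>s. (flow P Y (s - t) ** (flow P Y t ** U)) $ i $ j) has_vector_derivative
      1 *\<^sub>R (Y ** (flow P Y t ** U)) $ i $ j) (at t)"
    by (rule vector_diff_chain_at[where f = "\<lambda>s. s - t" and
          g = "\<lambda>s. (flow P Y s ** (flow P Y t ** U)) $ i $ j", OF _ *, unfolded o_def]) (auto intro!: derivative_eq_intros simp: has_real_derivative_iff_has_vector_derivative[symmetric])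
  then show ?thesis by (simp add: matrix_mul_assoc flow_add)
qed

end


lemma sum_sum_mset_swap: "(\<Sum>c\<in>A. \<Sum>m\<in>#M. f c m) = (\<Sum>m\<in>#M. \<Sum>c\<in>A. f c m)"
  for f :: "'a \<Rightarrow> 'b \<Rightarrow> 'c::comm_monoid_add"
  by (induction M) (auto simp: sum.distrib)

lemma matrix_sandwich_nth:
  fixes A Y B :: "complex^'n^'n"
  shows "(A ** Y ** B) $ a $ b = (\<Sum>c\<in>UNIV. \<Sum>d\<in>UNIV. Y $ c $ d * (A $ a $ c * B $ d $ b))"
  unfolding matrix_matrix_mult_def vec_lambda_beta sum_distrib_right
  by (subst sum.swap) (simp add: mult_ac)

lemma trace_mult_eq: "trace (Y ** A) = (\<Sum>c\<in>UNIV. \<Sum>d\<in>UNIV. Y $ c $ d * A $ d $ c)"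
  for Y A :: "complex^'n^'n"
  by (simp add: trace_def matrix_matrix_mult_def)

text \<open>The coefficient of the entry \<open>Y $ c $ d\<close> in the derivative, along Y, of the
  (a,b) entry of U^n times \<open>trace_prod M U * cnj (trace_prod K U)\<close>. The three terms
  differentiate the three factors; the last one carries a minus sign because Y is
  skew-Hermitian.\<close>

definition sd_gradient ::
    "nat \<Rightarrow> nat multiset \<Rightarrow> nat multiset \<Rightarrow> 'n \<Rightarrow> 'n \<Rightarrow> 'n \<Rightarrow> 'n \<Rightarrow> complex^'n^'n \<Rightarrow> complex" where
  "sd_gradient n M K a b c d U =
     (\<Sum>i<n. matrix_power U i $ a $ c * matrix_power U (n - i) $ d $ b) * (trace_prod M U * cnj (trace_prod K U))
     + matrix_power U n $ a $ b *
        ((\<Sum>m\<in>#M. of_nat m * matrix_power U m $ d $ c * trace_prod (M - {#m#}) U) * cnj (trace_prod K U)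
       - trace_prod M U * (\<Sum>m\<in>#K. of_nat m * matrix_power (adj U) m $ d $ c * cnj (trace_prod (K - {#m#}) U)))"

lemma continuous_adj_power_nth: "continuous_on S (\<lambda>U. matrix_power (adj U) m $ i $ j)"
  by (rule continuous_matrix_power_nth) (simp, intro continuous_intros)

lemma continuous_matrix_power_nth': "continuous_on S (\<lambda>U. matrix_power U m $ i $ j)"
  by (rule continuous_matrix_power_nth) (intro continuous_intros)

lemma continuous_sd_gradient: "continuous_on S (\<lambda>U. sd_gradient n M K a b c d U)"
proof -
  have "continuous_on S (\<lambda>U. \<Sum>m\<in>#M. of_nat m * matrix_power U m $ d $ c * trace_prod (M - {#m#}) U)" for M
    by (rule continuous_sum_mset) (intro continuous_intros continuous_matrix_power_nth')
  moreover have "continuous_on S (\<lambda>U. \<Sum>m\<in>#K. of_nat m * matrix_power (adj U) m $ d $ c * cnj (trace_prod (K - {#m#}) U))"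
    by (rule continuous_sum_mset) (intro continuous_intros continuous_adj_power_nth)
  ultimately show ?thesis
    unfolding sd_gradient_def
    by (intro continuous_on_add continuous_on_mult continuous_on_diff continuous_on_sum continuous_on_cnj
        continuous_trace_prod continuous_matrix_power_nth')
qed

context one_parameter
begin

lemma cnj_Y: "cnj (Y $ c $ d) = - Y $ d $ c"
  using adj_Y by (auto simp: vec_eq_iff mat_mul_nth)

text \<open>The conjugated traces bring in the conjugated entries of Y; \<open>cnj_Y\<close> turns
  them back into entries of Y, so the derivative is one complex-linear form in Y.\<close>

lemma observable_derivative:
  fixes U :: "complex^'n^'n"
  shows "((\<lambda>t. matrix_power (flow P Y t ** U) n $ a $ b *
            (trace_prod M (flow P Y t ** U) * cnj (trace_prod K (flow P Y t ** U)))) has_vector_derivative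
     (\<Sum>c\<in>UNIV. \<Sum>d\<in>UNIV. Y $ c $ d * sd_gradient n M K a b c d (flow P Y t ** U))) (at t)"
proof -
  define W where "W t = flow P Y t ** U" for t
  have W: "((\<lambda>t. W t $ i $ j) has_vector_derivative (Y ** W t) $ i $ j) (at t)" for i j t
    unfolding W_def by (rule flow_derivative)
  have tp: "((\<lambda>t. trace_prod M (W t)) has_vector_derivative
      (\<Sum>m\<in>#M. of_nat m * trace (Y ** matrix_power (W t) m) * trace_prod (M - {#m#}) (W t))) (at t)" for M
    unfolding trace_prod_def by (intro has_vector_derivative_prod_mset has_vector_derivative_trace_power W)
  have 1: "(\<Sum>i<n. matrix_power (W t) i ** Y ** matrix_power (W t) (n - i)) $ a $ b =
      (\<Sum>c\<in>UNIV. \<Sum>d\<in>UNIV. Y $ c $ d *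
         (\<Sum>i<n. matrix_power (W t) i $ a $ c * matrix_power (W t) (n - i) $ d $ b))" (is "?l1 = ?r1")
  proof -
    have "?l1 = (\<Sum>i<n. \<Sum>c\<in>UNIV. \<Sum>d\<in>UNIV. Y $ c $ d *
         (matrix_power (W t) i $ a $ c * matrix_power (W t) (n - i) $ d $ b))"
      by (simp add: sum_component matrix_sandwich_nth)
    also have "\<dots> = (\<Sum>c\<in>UNIV. \<Sum>i<n. \<Sum>d\<in>UNIV. Y $ c $ d *
         (matrix_power (W t) i $ a $ c * matrix_power (W t) (n - i) $ d $ b))"
      by (rule sum.swap)
    also have "\<dots> = ?r1"
      by (intro sum.cong refl, subst sum.swap) (simp add: sum_distrib_left)
    finally show ?thesis .
  qed
  have 2: "(\<Sum>m\<in>#M. of_nat m * trace (Y ** matrix_power (W t) m) * trace_prod (M - {#m#}) (W t)) =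
     (\<Sum>c\<in>UNIV. \<Sum>d\<in>UNIV. Y $ c $ d *
         (\<Sum>m\<in>#M. of_nat m * matrix_power (W t) m $ d $ c * trace_prod (M - {#m#}) (W t)))"
    unfolding trace_mult_eq sum_mset_distrib_left sum_sum_mset_swap sum_distrib_left sum_distrib_right
    by (simp add: mult_ac)
  have "cnj (of_nat m * trace (Y ** matrix_power (W t) m) * x) =
     (\<Sum>c\<in>UNIV. \<Sum>d\<in>UNIV. - (Y $ c $ d * (of_nat m * matrix_power (adj (W t)) m $ d $ c * cnj x)))" for m x
  proof -
    have "cnj (trace (Y ** matrix_power (W t) m)) =
       (\<Sum>c\<in>UNIV. \<Sum>d\<in>UNIV. - (Y $ d $ c * matrix_power (adj (W t)) m $ c $ d))"
      by (simp add: trace_mult_eq cnj_Y adj_matrix_power[symmetric])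
    also have "\<dots> = (\<Sum>c\<in>UNIV. \<Sum>d\<in>UNIV. - (Y $ c $ d * matrix_power (adj (W t)) m $ d $ c))"
      by (rule sum.swap)
    finally show ?thesis by (simp add: sum_distrib_left sum_distrib_right mult_ac)
  qed
  then have 3: "cnj (\<Sum>m\<in>#K. of_nat m * trace (Y ** matrix_power (W t) m) * trace_prod (K - {#m#}) (W t)) =
     - (\<Sum>c\<in>UNIV. \<Sum>d\<in>UNIV. Y $ c $ d *
         (\<Sum>m\<in>#K. of_nat m * matrix_power (adj (W t)) m $ d $ c * cnj (trace_prod (K - {#m#}) (W t))))"
  proof -
    have c: "cnj (\<Sum>m\<in>#K. f m) = (\<Sum>m\<in>#K. cnj (f m))" for K :: "nat multiset" and f
      by (induction K) auto
    have neg: "(\<Sum>m\<in>#K. - f m) = - (\<Sum>m\<in>#K. f m)" for K :: "nat multiset" and f :: "nat \<Rightarrow> complex"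
      by (induction K) auto
    show ?thesis
      unfolding c \<open>\<And>m x. cnj (of_nat m * _ * x) = _\<close> sum_mset_distrib_left sum_negf[symmetric] 
      by (simp add: sum_sum_mset_swap[symmetric] sum_negf sum_mset_distrib_left[symmetric])
         (simp add: sum_sum_mset_swap sum_mset_distrib_left neg)
  qed
  have "((\<lambda>t. matrix_power (W t) n $ a $ b * (trace_prod M (W t) * cnj (trace_prod K (W t)))) has_vector_derivative
     (matrix_power (W t) n $ a $ b *
        (trace_prod M (W t) * cnj (\<Sum>m\<in>#K. of_nat m * trace (Y ** matrix_power (W t) m) * trace_prod (K - {#m#}) (W t)) +
         (\<Sum>m\<in>#M. of_nat m * trace (Y ** matrix_power (W t) m) * trace_prod (M - {#m#}) (W t)) * cnj (trace_prod K (W t)))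
      + (\<Sum>i<n. matrix_power (W t) i ** Y ** matrix_power (W t) (n - i)) $ a $ b * (trace_prod M (W t) * cnj (trace_prod K (W t))))) (at t)"
    by (intro has_vector_derivative_mult has_vector_derivative_matrix_power_nth W tp has_vector_derivative_cnj)
  also have "matrix_power (W t) n $ a $ b *
        (trace_prod M (W t) * cnj (\<Sum>m\<in>#K. of_nat m * trace (Y ** matrix_power (W t) m) * trace_prod (K - {#m#}) (W t)) +
         (\<Sum>m\<in>#M. of_nat m * trace (Y ** matrix_power (W t) m) * trace_prod (M - {#m#}) (W t)) * cnj (trace_prod K (W t)))
      + (\<Sum>i<n. matrix_power (W t) i ** Y ** matrix_power (W t) (n - i)) $ a $ b * (trace_prod M (W t) * cnj (trace_prod K (W t)))
      = (\<Sum>c\<in>UNIV. \<Sum>d\<in>UNIV. Y $ c $ d * sd_gradient n M K a b c d (W t))"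
    unfolding 1 2 3 sd_gradient_def
    by (simp add: sum.distrib[symmetric] sum_subtractf[symmetric] sum_distrib_left sum_distrib_right algebra_simps)
  finally show ?thesis by (simp add: W_def)
qed

end

section \<open>Invariance of Haar measure under one-parameter subgroups\<close>

locale haar_probability =
  fixes \<mu> :: "(complex^'n^'n) measure"
  assumes haar: "is_Haar_probability \<mu>"
begin

sublocale prob_space \<mu>
  using haar by (simp add: is_Haar_probability_def)

lemma sets_haar: "sets \<mu> = sets (restrict_space borel unitary_group)"
  using haar by (simp add: is_Haar_probability_def)

lemma space_haar: "space \<mu> = unitary_group"
  using sets_eq_imp_space_eq[OF sets_haar] by (simp add: space_restrict_space)

lemma borel_measurable_haar:
  "continuous_on unitary_group f \<Longrightarrow> f \<in> borel_measurable \<mu>"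
  using borel_measurable_continuous_on_restrict measurable_cong_sets[OF sets_haar refl] by blast

lemma bounded_on_unitary_group:
  fixes f :: "complex^'n^'n \<Rightarrow> complex"
  assumes "continuous_on unitary_group f"
  obtains B where "\<And>U. U \<in> unitary_group \<Longrightarrow> cmod (f U) \<le> B"
proof -
  have "bounded (f ` unitary_group)"
    using compact_continuous_image[OF assms compact_unitary_group] compact_imp_bounded by blast
  then show ?thesis using that by (auto simp: bounded_iff)
qed

lemma integrable_haar:
  fixes f :: "complex^'n^'n \<Rightarrow> complex"
  assumes "continuous_on unitary_group f"
  shows "integrable \<mu> f"
proof -
  obtain B where "\<And>U. U \<in> unitary_group \<Longrightarrow> cmod (f U) \<le> B"
    using bounded_on_unitary_group[OF assms] by blast
  then show ?thesis
    by (intro integrable_const_bound[of _ B] borel_measurable_haar assms) (auto simp: space_haar)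
qed

lemma left_mult_measurable:
  assumes "V \<in> unitary_group"
  shows "(\<lambda>U. V ** U) \<in> measurable \<mu> \<mu>"
proof -
  have "continuous_on unitary_group (\<lambda>U. V ** U)"
    unfolding matrix_matrix_mult_def by (intro continuous_intros)
  then have "(\<lambda>U. V ** U) \<in> measurable (restrict_space borel unitary_group) (restrict_space borel unitary_group)"
    using assms unitary_group_mult
    by (intro measurable_restrict_space2 borel_measurable_continuous_on_restrict) (auto simp: space_restrict_space)
  then show ?thesis using measurable_cong_sets[OF sets_haar sets_haar] by simp
qed

lemma integral_left_mult:
  fixes f :: "complex^'n^'n \<Rightarrow> complex"
  assumes "V \<in> unitary_group" "f \<in> borel_measurable \<mu>"
  shows "(\<integral>U. f (V ** U) \<partial>\<mu>) = (\<integral>U. f U \<partial>\<mu>)"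
proof -
  have "distr \<mu> \<mu> (\<lambda>U. V ** U) = \<mu>" using haar assms by (auto simp: is_Haar_probability_def)
  then show ?thesis using integral_distr[OF left_mult_measurable[OF assms(1)] assms(2)] by simp
qed

text \<open>The integral of F over the translates by \<open>flow P Y t\<close> does not depend on t;
  differentiating it at t = 0 under the integral sign gives zero.\<close>

lemma integral_sd_gradient:
  assumes "one_parameter P Y"
  shows "(\<Sum>c\<in>UNIV. \<Sum>d\<in>UNIV. Y $ c $ d * (\<integral>U. sd_gradient n M K a b c d U \<partial>\<mu>)) = 0"
proof -
  interpret one_parameter P Y by fact
  define F where "F U = matrix_power U n $ a $ b * (trace_prod M U * cnj (trace_prod K U))" for U :: "complex^'n^'n"
  define L where "L U = (\<Sum>c\<in>UNIV. \<Sum>d\<in>UNIV. Y $ c $ d * sd_gradient n M K a b c d U)" for U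
  have cont_F: "continuous_on S F" for S
    unfolding F_def by (intro continuous_intros continuous_matrix_power_nth')
  have cont_L: "continuous_on S L" for S
    unfolding L_def by (intro continuous_intros continuous_sd_gradient)
  obtain B where B: "\<And>U. U \<in> unitary_group \<Longrightarrow> cmod (L U) \<le> B"
    using bounded_on_unitary_group[OF cont_L] by blast
  have deriv: "((\<lambda>t. F (flow P Y t ** U)) has_vector_derivative L (flow P Y t ** U)) (at t)" for U t
    unfolding F_def L_def by (rule observable_derivative)
  \<comment> \<open>Difference quotients along t = 1/(k+1), a sequence, so that dominated
    convergence applies.\<close>
  define s where "s k U = (F (flow P Y (1 / Suc k) ** U) - F U) / of_real (1 / Suc k)" for k :: nat and U
  have lim: "(\<lambda>k. s k U) \<longlonglongrightarrow> L U" if "U \<in> unitary_group" for U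
  proof -
    have "((\<lambda>t. (F (flow P Y t ** U) - F U) /\<^sub>R t) \<longlongrightarrow> L U) (at 0)"
    proof -
      have "((\<lambda>h. norm (F (flow P Y h ** U) - F U - h *\<^sub>R L U) / norm h) \<longlongrightarrow> 0) (at 0)"
        using deriv[of U 0] by (simp add: has_vector_derivative_def has_derivative_at flow_0)
      then have "((\<lambda>h. norm ((F (flow P Y h ** U) - F U) /\<^sub>R h - L U)) \<longlongrightarrow> 0) (at 0)"
      proof (rule Lim_transform_eventually)
        have "norm (F (flow P Y h ** U) - F U - h *\<^sub>R L U) / norm h =
            norm ((F (flow P Y h ** U) - F U) /\<^sub>R h - L U)" if "h \<noteq> 0" for h
        proof -
          have "(F (flow P Y h ** U) - F U) /\<^sub>R h - L U = (F (flow P Y h ** U) - F U - h *\<^sub>R L U) /\<^sub>R h"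
            using that by (simp add: scaleR_diff_right)
          then show ?thesis by (simp only: norm_scaleR) (simp add: divide_inverse mult.commute)
        qed
        then show "\<forall>\<^sub>F h in at 0. norm (F (flow P Y h ** U) - F U - h *\<^sub>R L U) / norm h =
            norm ((F (flow P Y h ** U) - F U) /\<^sub>R h - L U)"
          by (auto simp: eventually_at_filter)
      qed
      then show ?thesis by (rule LIM_zero_cancel[OF tendsto_norm_zero_cancel])
    qed
    then have "((\<lambda>k. (F (flow P Y (1 / Suc k) ** U) - F U) /\<^sub>R (1 / Suc k)) \<longlongrightarrow> L U) sequentially"
      by (rule filterlim_compose) (use LIMSEQ_inverse_real_of_nat in \<open>simp add: filterlim_at inverse_eq_divide\<close>)
    then show ?thesis by (simp add: s_def scaleR_conv_of_real divide_inverse mult.commute)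
  qed
  \<comment> \<open>The mean value inequality bounds the quotients by the bound for the derivative
    \<open>L\<close> over the whole compact group, uniformly in k and U.\<close>
  have bound: "cmod (s k U) \<le> B" if U: "U \<in> unitary_group" for k U
  proof -
    have "norm (F (flow P Y (1 / Suc k) ** U) - F (flow P Y 0 ** U)) \<le> B * norm (1 / real (Suc k) - 0)"
    proof (rule differentiable_bound[where S = UNIV and f' = "\<lambda>t h. h *\<^sub>R L (flow P Y t ** U)"])
      show "((\<lambda>t. F (flow P Y t ** U)) has_derivative (\<lambda>h. h *\<^sub>R L (flow P Y t ** U))) (at t within UNIV)" for t
        using deriv[of U t] by (simp add: has_vector_derivative_def)
      show "onorm (\<lambda>h. h *\<^sub>R L (flow P Y t ** U)) \<le> B" for t
        using B[OF unitary_group_mult[OF flow_unitary U, of t]]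
        by (intro onorm_le) (simp add: mult.commute[of B] mult_left_mono)
    qed auto
    then have "norm (F (flow P Y (1 / Suc k) ** U) - F U) \<le> B * (1 / real (Suc k))"
      by (simp add: flow_0)
    moreover have "cmod (s k U) = norm (F (flow P Y (1 / Suc k) ** U) - F U) / (1 / real (Suc k))"
      unfolding s_def norm_divide norm_of_real by simp
    ultimately show ?thesis by (simp add: pos_le_divide_eq)
  qed
  have "(\<lambda>k. \<integral>U. s k U \<partial>\<mu>) \<longlonglongrightarrow> (\<integral>U. L U \<partial>\<mu>)"
  proof (rule integral_dominated_convergence[where w = "\<lambda>_. B"])
    show "L \<in> borel_measurable \<mu>" by (intro borel_measurable_haar cont_L)
    have "(\<lambda>U. F (flow P Y t ** U)) \<in> borel_measurable \<mu>" for t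
      using measurable_compose[OF left_mult_measurable[OF flow_unitary] borel_measurable_haar[OF cont_F]] .
    then show "s k \<in> borel_measurable \<mu>" for k
      unfolding s_def by (intro borel_measurable_divide borel_measurable_diff borel_measurable_const borel_measurable_haar[OF cont_F])
    show "AE U in \<mu>. (\<lambda>k. s k U) \<longlonglongrightarrow> L U" by (rule AE_I2) (simp add: lim space_haar)
    show "AE U in \<mu>. cmod (s k U) \<le> B" for k by (rule AE_I2) (simp add: bound space_haar)
  qed simp
  moreover have "(\<integral>U. s k U \<partial>\<mu>) = 0" for k
  proof -
    have "continuous_on unitary_group (\<lambda>U. F (flow P Y t ** U))" for t
      by (rule continuous_on_compose2[OF cont_F[of UNIV]])
         (auto simp: matrix_matrix_mult_def intro!: continuous_intros)
    then have "(\<integral>U. s k U \<partial>\<mu>) = ((\<integral>U. F (flow P Y (1 / Suc k) ** U) \<partial>\<mu>) - (\<integral>U. F U \<partial>\<mu>)) / of_real (1 / Suc k)"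
      unfolding s_def by (simp add: integrable_haar cont_F)
    also have "\<dots> = 0"
      by (simp add: integral_left_mult[OF flow_unitary borel_measurable_haar[OF cont_F]])
    finally show ?thesis .
  qed
  ultimately have "(\<integral>U. L U \<partial>\<mu>) = 0" by (simp add: LIMSEQ_const_iff)
  moreover have int: "integrable \<mu> (\<lambda>U. Y $ c $ d * sd_gradient n M K a b c d U)" for c d
    by (intro integrable_haar continuous_on_mult continuous_on_const continuous_sd_gradient)
  ultimately show ?thesis
    unfolding L_def by (simp add: int)
qed

end

section \<open>Lie algebra directions and the Schwinger-Dyson equations\<close>

definition unit_mat :: "'n \<Rightarrow> 'n \<Rightarrow> complex^'n^'n" where
  "unit_mat a b = (\<chi> i j. if i = a \<and> j = b then 1 else 0)"

lemma unit_mat_mult: "unit_mat a b ** unit_mat c d = (if b = c then unit_mat a d else 0)"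
proof -
  have "(\<Sum>k\<in>UNIV. (if i = a \<and> k = b then 1 else 0) * (if k = c \<and> j = d then 1 else 0)) =
     (\<Sum>k\<in>UNIV. if k = b then (if i = a \<and> b = c \<and> j = d then 1 else 0) else (0::complex))" for i j
    by (intro sum.cong) auto
  then show ?thesis
    by (simp add: vec_eq_iff unit_mat_def matrix_matrix_mult_def)
qed

lemma adj_unit_mat: "adj (unit_mat a b) = unit_mat b a"
  by (auto simp: vec_eq_iff unit_mat_def)

lemma unit_mat_nth: "unit_mat a b $ i $ j = (if i = a \<and> j = b then 1 else 0)"
  by (simp add: unit_mat_def)

lemma adj_imag:
  assumes "adj E = E"
  shows "adj (mat \<i> ** E) = mat (-1) ** (mat \<i> ** E)"
  unfolding adj_mult assms adj_mat matrix_mul_assoc mat_mul_mat by (simp add: mat_mul_commute)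

lemma one_parameter_diag: "one_parameter (unit_mat c c) (mat \<i> ** unit_mat c c)"
proof
  show "unit_mat c c ** (mat \<i> ** unit_mat c c) = mat \<i> ** unit_mat c c"
    by (metis mat_mul_commute matrix_mul_assoc unit_mat_mult)
  show "adj (mat \<i> ** unit_mat c c) = mat (-1) ** (mat \<i> ** unit_mat c c)"
    by (rule adj_imag) (rule adj_unit_mat)
qed (simp add: mat_mul_mult_mat_mul unit_mat_mult)

lemma one_parameter_real:
  assumes "c \<noteq> d"
  shows "one_parameter (unit_mat c c + unit_mat d d) (unit_mat c d - unit_mat d c)"
  using assms
  by unfold_locales
     (simp_all add: matrix_diff_ldistrib matrix_diff_rdistrib matrix_add_ldistrib matrix_add_rdistrib unit_mat_mult,
      auto simp: vec_eq_iff mat_mul_nth unit_mat_nth)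

lemma one_parameter_imag:
  assumes "c \<noteq> d"
  shows "one_parameter (unit_mat c c + unit_mat d d) (mat \<i> ** (unit_mat c d + unit_mat d c))"
proof
  let ?E = "unit_mat c d + unit_mat d c"
  have "(unit_mat c c + unit_mat d d) ** ?E = ?E"
    using assms by (simp add: matrix_add_ldistrib matrix_add_rdistrib unit_mat_mult add.commute)
  then show "(unit_mat c c + unit_mat d d) ** (mat \<i> ** ?E) = mat \<i> ** ?E"
    by (metis mat_mul_commute matrix_mul_assoc)
  have "?E ** ?E = unit_mat c c + unit_mat d d"
    using assms by (simp add: matrix_add_ldistrib matrix_add_rdistrib unit_mat_mult)
  then show "mat \<i> ** ?E ** (mat \<i> ** ?E) = mat (-1) ** (unit_mat c c + unit_mat d d)"
    by (simp add: mat_mul_mult_mat_mul)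
  show "adj (mat \<i> ** ?E) = mat (-1) ** (mat \<i> ** ?E)"
    by (rule adj_imag) (simp add: adj_add adj_unit_mat add.commute)
qed

lemma sum_unit_mat: "(\<Sum>i\<in>UNIV. \<Sum>j\<in>UNIV. unit_mat c d $ i $ j * G i j) = G c d"
proof -
  have "(\<Sum>i\<in>UNIV. \<Sum>j\<in>UNIV. unit_mat c d $ i $ j * G i j) =
      (\<Sum>i\<in>UNIV. if i = c then (\<Sum>j\<in>UNIV. if j = d then G i j else 0) else 0)"
    unfolding unit_mat_nth
    by (intro sum.cong refl) (auto simp: if_distrib[of "\<lambda>x. x * _"] cong: if_cong)
  then show ?thesis by simp
qed

lemma sum_mset_sub: "(\<Sum>m\<in>#K. f m - g m) = (\<Sum>m\<in>#K. f m) - (\<Sum>m\<in>#K. g m)"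
  for f :: "'a \<Rightarrow> complex"
  by (induction K) auto

context haar_probability
begin

text \<open>The skew-Hermitian directions i E_cc, E_cd - E_dc and i (E_cd + E_dc) span all matrices
  over the complex numbers, and the integrated derivative is complex-linear in the
  direction.\<close>

lemma integral_sd_gradient_eq_0: "(\<integral>U. sd_gradient n M K a b c d U \<partial>\<mu>) = 0"
proof -
  define G where "G c d = (\<integral>U. sd_gradient n M K a b c d U \<partial>\<mu>)" for c d
  have diag: "G c c = 0" for c
    using integral_sd_gradient[OF one_parameter_diag[of c], of n M K a b]
    by (simp add: mat_mul_nth mult.assoc sum_distrib_left[symmetric] sum_unit_mat G_def[symmetric])
  have "G c d = 0" if "c \<noteq> d" for c d
  proof -
    have 1: "G c d - G d c = 0"
      using integral_sd_gradient[OF one_parameter_real[OF that], of n M K a b]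
      by (simp add: left_diff_distrib sum_subtractf sum_unit_mat G_def[symmetric])
    have "\<i> * (G c d + G d c) = 0"
      using integral_sd_gradient[OF one_parameter_imag[OF that], of n M K a b]
      by (simp add: mat_mul_nth mult.assoc sum_distrib_left[symmetric] distrib_right sum.distrib sum_unit_mat G_def[symmetric])
    then have 2: "G c d + G d c = 0" by (simp only: mult_eq_0_iff) simp
    from 1 2 show ?thesis by simp
  qed
  with diag show ?thesis unfolding G_def[symmetric] by (cases "c = d") auto
qed

definition mom :: "nat multiset \<Rightarrow> nat multiset \<Rightarrow> complex" where
  "mom M K = (\<integral>U. trace_prod M U * cnj (trace_prod K U) \<partial>\<mu>)"

lemma integrable_trace_prod [simp]: "integrable \<mu> (\<lambda>U. trace_prod M U * cnj (trace_prod K U))"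
  by (intro integrable_haar continuous_intros)

lemma sum_trace_mult: "(\<Sum>a\<in>UNIV. \<Sum>b\<in>UNIV. A $ a $ b * B $ b $ a) = trace (A ** B)"
  for A B :: "complex^'n^'n"
  by (simp add: trace_def matrix_matrix_mult_def)

text \<open>The choice c = a, d = b contracts all indices: the derivative of U^n splits it into two
  traces, a factor from M merges with U^n, and a factor from K cancels against it because the
  adjoint is the inverse.\<close>

lemma sd_gradient_sum:
  fixes U :: "complex^'n^'n"
  assumes "n > 0" and U: "U \<in> unitary_group"
  shows "(\<Sum>a\<in>UNIV. \<Sum>b\<in>UNIV. sd_gradient n M K a b a b U) =
     of_nat CARD('n) * (trace_prod (add_mset n M) U * cnj (trace_prod K U))
     + (\<Sum>i=1..<n. trace_prod (add_mset i (add_mset (n - i) M)) U * cnj (trace_prod K U))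
     + (\<Sum>m\<in>#M. of_nat m * (trace_prod (add_mset (n + m) (M - {#m#})) U * cnj (trace_prod K U)))
     - (\<Sum>m\<in>#K. of_nat m *
          (if m < n then trace_prod (add_mset (n - m) M) U * cnj (trace_prod (K - {#m#}) U)
           else if m = n then of_nat CARD('n) * (trace_prod M U * cnj (trace_prod (K - {#m#}) U))
           else trace_prod M U * cnj (trace_prod (add_mset (m - n) (K - {#m#})) U)))"
proof -
  let ?p = "\<lambda>i. matrix_power U i" and ?q = "\<lambda>i. matrix_power (adj U) i"
  let ?h = "trace_prod M U * cnj (trace_prod K U)"
  have 1: "(\<Sum>a\<in>UNIV. \<Sum>b\<in>UNIV. (\<Sum>i<n. ?p i $ a $ a * ?p (n - i) $ b $ b)) =
      (\<Sum>i<n. trace (?p i) * trace (?p (n - i)))"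
  proof -
    have "(\<Sum>i<n. trace (?p i) * trace (?p (n - i))) =
      (\<Sum>i<n. \<Sum>a\<in>UNIV. \<Sum>b\<in>UNIV. ?p i $ a $ a * ?p (n - i) $ b $ b)"
      by (simp add: trace_def sum_product)
    also have "\<dots> = (\<Sum>a\<in>UNIV. \<Sum>i<n. \<Sum>b\<in>UNIV. ?p i $ a $ a * ?p (n - i) $ b $ b)"
      by (rule sum.swap)
    also have "\<dots> = (\<Sum>a\<in>UNIV. \<Sum>b\<in>UNIV. (\<Sum>i<n. ?p i $ a $ a * ?p (n - i) $ b $ b))"
      by (intro sum.cong refl sum.swap)
    finally show ?thesis by simp
  qed
  also have "\<dots> = of_nat CARD('n) * trace (?p n) + (\<Sum>i=1..<n. trace (?p i) * trace (?p (n - i)))"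
  proof -
    \<comment> \<open>The summand i = 0 contains the trace of the identity, the source of the factor
      \<open>CARD('n)\<close>.\<close>
    have "{..<n} = insert 0 {1..<n}" using \<open>n > 0\<close> by auto
    then show ?thesis by (simp add: trace_I)
  qed
  finally have 1: "(\<Sum>a\<in>UNIV. \<Sum>b\<in>UNIV. (\<Sum>i<n. ?p i $ a $ a * ?p (n - i) $ b $ b) * ?h) =
     of_nat CARD('n) * trace (?p n) * ?h + (\<Sum>i=1..<n. trace (?p i) * trace (?p (n - i)) * ?h)"
    by (simp only: sum_distrib_right[symmetric]) (simp add: distrib_right sum_distrib_right)
  have 2: "(\<Sum>a\<in>UNIV. \<Sum>b\<in>UNIV. ?p n $ a $ b * ((\<Sum>m\<in>#M. of_nat m * ?p m $ b $ a * trace_prod (M - {#m#}) U) * c)) =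
     (\<Sum>m\<in>#M. of_nat m * (trace (?p (n + m)) * trace_prod (M - {#m#}) U * c))" for c
  proof -
    have "(\<Sum>a\<in>UNIV. \<Sum>b\<in>UNIV. ?p n $ a $ b * ((\<Sum>m\<in>#M. of_nat m * ?p m $ b $ a * trace_prod (M - {#m#}) U) * c)) =
      (\<Sum>m\<in>#M. \<Sum>a\<in>UNIV. \<Sum>b\<in>UNIV. of_nat m * ((?p n $ a $ b * ?p m $ b $ a) * trace_prod (M - {#m#}) U * c))"
      unfolding sum_sum_mset_swap[symmetric] sum_mset_distrib_left sum_mset_distrib_right by (simp add: mult_ac)
    also have "\<dots> = (\<Sum>m\<in>#M. of_nat m * (trace (?p (n + m)) * trace_prod (M - {#m#}) U * c))"
      by (simp only: sum_distrib_left[symmetric] sum_distrib_right[symmetric] sum_trace_mult matrix_power_add)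
    finally show ?thesis .
  qed
  have 3: "(\<Sum>a\<in>UNIV. \<Sum>b\<in>UNIV. ?p n $ a $ b * (c * (\<Sum>m\<in>#K. of_nat m * ?q m $ b $ a * cnj (trace_prod (K - {#m#}) U)))) =
     (\<Sum>m\<in>#K. of_nat m * (trace (?p n ** ?q m) * c * cnj (trace_prod (K - {#m#}) U)))" for c
  proof -
    have "(\<Sum>a\<in>UNIV. \<Sum>b\<in>UNIV. ?p n $ a $ b * (c * (\<Sum>m\<in>#K. of_nat m * ?q m $ b $ a * cnj (trace_prod (K - {#m#}) U)))) =
      (\<Sum>m\<in>#K. \<Sum>a\<in>UNIV. \<Sum>b\<in>UNIV. of_nat m * ((?p n $ a $ b * ?q m $ b $ a) * c * cnj (trace_prod (K - {#m#}) U)))"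
      unfolding sum_sum_mset_swap[symmetric] sum_mset_distrib_left sum_mset_distrib_right by (simp add: mult_ac)
    also have "\<dots> = (\<Sum>m\<in>#K. of_nat m * (trace (?p n ** ?q m) * c * cnj (trace_prod (K - {#m#}) U)))"
      by (simp only: sum_distrib_left[symmetric] sum_distrib_right[symmetric] sum_trace_mult)
    finally show ?thesis .
  qed
  have "(\<Sum>a\<in>UNIV. \<Sum>b\<in>UNIV. sd_gradient n M K a b a b U) =
      (of_nat CARD('n) * trace (?p n) * ?h + (\<Sum>i=1..<n. trace (?p i) * trace (?p (n - i)) * ?h))
     + (\<Sum>m\<in>#M. of_nat m * (trace (?p (n + m)) * trace_prod (M - {#m#}) U * cnj (trace_prod K U)))
     - (\<Sum>m\<in>#K. of_nat m * (trace (?p n ** ?q m) * trace_prod M U * cnj (trace_prod (K - {#m#}) U)))"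
    unfolding sd_gradient_def sum.distrib right_diff_distrib sum_subtractf 1 2 3 by simp
  also have "(\<Sum>m\<in>#K. of_nat m * (trace (?p n ** ?q m) * trace_prod M U * cnj (trace_prod (K - {#m#}) U))) =
    (\<Sum>m\<in>#K. of_nat m *
          (if m < n then trace_prod (add_mset (n - m) M) U * cnj (trace_prod (K - {#m#}) U)
           else if m = n then of_nat CARD('n) * (trace_prod M U * cnj (trace_prod (K - {#m#}) U))
           else trace_prod M U * cnj (trace_prod (add_mset (m - n) (K - {#m#})) U)))"
    unfolding trace_matrix_power_mult_adj[OF U]
    by (intro arg_cong[where f = sum_mset] image_mset_cong) (auto simp: trace_I)
  finally show ?thesis by (simp add: mult_ac)
qed

lemma integral_sum_mset:
  fixes f :: "'a \<Rightarrow> complex^'n^'n \<Rightarrow> complex"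
  assumes "\<And>m. integrable \<mu> (f m)"
  shows "integrable \<mu> (\<lambda>U. \<Sum>m\<in>#M. f m U) \<and> (\<integral>U. (\<Sum>m\<in>#M. f m U) \<partial>\<mu>) = (\<Sum>m\<in>#M. \<integral>U. f m U \<partial>\<mu>)"
  by (induction M) (auto simp: assms)

text \<open>The contracted gradient has integral zero. On the left all terms have degree n plus the
  sum of M in the first argument, whereas on the right both degrees drop by the minimum of m and n;
  this drives the induction on the degree.\<close>

proposition schwinger_dyson:
  assumes "n > 0"
  shows "of_nat CARD('n) * mom (add_mset n M) K
     + (\<Sum>i=1..<n. mom (add_mset i (add_mset (n - i) M)) K)
     + (\<Sum>m\<in>#M. of_nat m * mom (add_mset (n + m) (M - {#m#})) K) =
     (\<Sum>m\<in>#K. of_nat m *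
          (if m < n then mom (add_mset (n - m) M) (K - {#m#})
           else if m = n then of_nat CARD('n) * mom M (K - {#m#})
           else mom M (add_mset (m - n) (K - {#m#}))))"
proof -
  let ?f = "\<lambda>m U. of_nat m * (trace_prod (add_mset (n + m) (M - {#m#})) U * cnj (trace_prod K U))"
  let ?g = "\<lambda>m U. of_nat m *
          (if m < n then trace_prod (add_mset (n - m) M) U * cnj (trace_prod (K - {#m#}) U)
           else if m = n then of_nat CARD('n) * (trace_prod M U * cnj (trace_prod (K - {#m#}) U))
           else trace_prod M U * cnj (trace_prod (add_mset (m - n) (K - {#m#})) U))"
  have f: "integrable \<mu> (?f m)" for m by (simp del: trace_prod_add_mset)
  have g: "integrable \<mu> (?g m)" for m
    by (cases "m < n"; cases "m = n") (simp_all del: trace_prod_add_mset)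
  have "0 = (\<integral>U. (\<Sum>a\<in>UNIV. \<Sum>b\<in>UNIV. sd_gradient n M K a b a b U) \<partial>\<mu>)"
    by (simp add: integrable_haar continuous_sd_gradient continuous_on_sum integral_sd_gradient_eq_0)
  also have "\<dots> = (\<integral>U. of_nat CARD('n) * (trace_prod (add_mset n M) U * cnj (trace_prod K U))
     + (\<Sum>i=1..<n. trace_prod (add_mset i (add_mset (n - i) M)) U * cnj (trace_prod K U))
     + (\<Sum>m\<in>#M. ?f m U) - (\<Sum>m\<in>#K. ?g m U) \<partial>\<mu>)"
    by (intro Bochner_Integration.integral_cong refl sd_gradient_sum assms) (simp add: space_haar)
  also have "\<dots> = of_nat CARD('n) * mom (add_mset n M) K
     + (\<Sum>i=1..<n. mom (add_mset i (add_mset (n - i) M)) K)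
     + (\<Sum>m\<in>#M. \<integral>U. ?f m U \<partial>\<mu>) - (\<Sum>m\<in>#K. \<integral>U. ?g m U \<partial>\<mu>)"
    using integral_sum_mset[of ?f M, OF f] integral_sum_mset[of ?g K, OF g]
    by (simp del: trace_prod_add_mset add: mom_def)
  also have "(\<Sum>m\<in>#M. \<integral>U. ?f m U \<partial>\<mu>) = (\<Sum>m\<in>#M. of_nat m * mom (add_mset (n + m) (M - {#m#})) K)"
    by (simp del: trace_prod_add_mset add: mom_def)
  also have "(\<Sum>m\<in>#K. \<integral>U. ?g m U \<partial>\<mu>) = (\<Sum>m\<in>#K. of_nat m *
          (if m < n then mom (add_mset (n - m) M) (K - {#m#})
           else if m = n then of_nat CARD('n) * mom M (K - {#m#})
           else mom M (add_mset (m - n) (K - {#m#}))))"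
    by (intro arg_cong[where f = sum_mset] image_mset_cong) (auto simp del: trace_prod_add_mset simp: mom_def)
  finally show ?thesis by (simp add: algebra_simps)
qed

lemma mom_empty: "mom {#} {#} = 1"
  by (simp add: mom_def prob_space)

end

section \<open>The Hall inner product of power sums and the moments of the traces\<close>

text \<open>The number z of a partition, the squared length of its power sum in the Hall inner
  product. With \<open>hall\<close>, the target values of the moments are those of independent
  complex Gaussians of variance j.\<close>

definition hall_norm :: "nat multiset \<Rightarrow> complex" where
  "hall_norm M = (\<Prod>j\<in>set_mset M. of_nat j ^ count M j * fact (count M j))"

definition hall :: "nat multiset \<Rightarrow> nat multiset \<Rightarrow> complex" where
  "hall M K = (if M = K then hall_norm M else 0)"

lemma hall_norm_add_mset:
  "hall_norm (add_mset n M) = of_nat n * of_nat (Suc (count M n)) * hall_norm M"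
proof -
  have *: "hall_norm M = (\<Prod>j\<in>insert n (set_mset M). of_nat j ^ count M j * fact (count M j))" for M
    unfolding hall_norm_def by (intro prod.mono_neutral_left) (auto simp: not_in_iff)
  have "hall_norm (add_mset n M) =
      (of_nat n ^ Suc (count M n) * fact (Suc (count M n))) *
      (\<Prod>j\<in>insert n (set_mset M) - {n}. of_nat j ^ count (add_mset n M) j * fact (count (add_mset n M) j))"
    by (simp add: hall_norm_def prod.remove[of _ n])
  also have "(\<Prod>j\<in>insert n (set_mset M) - {n}. of_nat j ^ count (add_mset n M) j * fact (count (add_mset n M) j)) =
      (\<Prod>j\<in>insert n (set_mset M) - {n}. of_nat j ^ count M j * fact (count M j))"
    by (intro prod.cong) auto
  also have "(of_nat n ^ Suc (count M n) * fact (Suc (count M n))) *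
      (\<Prod>j\<in>insert n (set_mset M) - {n}. of_nat j ^ count M j * fact (count M j)) =
      of_nat n * of_nat (Suc (count M n)) * ((of_nat n ^ count M n * fact (count M n)) *
      (\<Prod>j\<in>insert n (set_mset M) - {n}. of_nat j ^ count M j * fact (count M j) :: complex))"
    by (simp add: mult_ac)
  also have "(of_nat n ^ count M n * fact (count M n)) *
      (\<Prod>j\<in>insert n (set_mset M) - {n}. of_nat j ^ count M j * fact (count M j)) = hall_norm M"
    unfolding *[of M] by (rule prod.remove[symmetric]) auto
  finally show ?thesis .
qed

lemma hall_commute: "hall M K = hall K M"
  by (simp add: hall_def)

text \<open>Multiplication by the n-th power sum is adjoint to n times the derivative with respect
  to it; the sum over the parts of K performs that derivative.\<close>

lemma hall_add_mset:
  "hall (add_mset n M) K = (\<Sum>m\<in>#K. if m = n then of_nat m * hall M (K - {#m#}) else 0)"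
proof -
  have "(\<Sum>m\<in>#K. if m = n then of_nat m * hall M (K - {#m#}) else 0) =
     (\<Sum>m\<in>#K. if m = n then of_nat n * hall M (K - {#n#}) else 0)"
    by (intro arg_cong[where f = sum_mset] image_mset_cong) auto
  also have "\<dots> = of_nat n * hall M (K - {#n#}) * of_nat (count K n)"
    by (simp add: sum_mset_delta)
  also have "\<dots> = hall (add_mset n M) K"
  proof (cases "add_mset n M = K")
    case True
    then show ?thesis by (auto simp: hall_def hall_norm_add_mset)
  next
    case False
    then have "count K n = 0 \<or> M \<noteq> K - {#n#}"
      by (metis count_eq_zero_iff insert_DiffM)
    with False show ?thesis by (auto simp: hall_def)
  qed
  finally show ?thesis ..
qed

text \<open>The terms match according to the part m of K that they remove: those with m = n against
  the leading term, which allows an arbitrary factor c, those with m < n against the splittings,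
  those with m > n against the mergers.\<close>

lemma hall_schwinger_dyson:
  assumes n: "n > 0"
  shows "c * hall (add_mset n M) K
     + (\<Sum>i=1..<n. hall (add_mset i (add_mset (n - i) M)) K)
     + (\<Sum>m\<in>#M. of_nat m * hall (add_mset (n + m) (M - {#m#})) K) =
     (\<Sum>m\<in>#K. of_nat m *
          (if m < n then hall (add_mset (n - m) M) (K - {#m#})
           else if m = n then c * hall M (K - {#m#})
           else hall M (add_mset (m - n) (K - {#m#}))))"
proof -
  have 1: "c * hall (add_mset n M) K = (\<Sum>m\<in>#K. if m = n then of_nat m * (c * hall M (K - {#m#})) else 0)"
    unfolding hall_add_mset sum_mset_distrib_left
    by (intro arg_cong[where f = sum_mset] image_mset_cong) auto
  have 2: "(\<Sum>i=1..<n. hall (add_mset i (add_mset (n - i) M)) K) =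
     (\<Sum>m\<in>#K. if 0 < m \<and> m < n then of_nat m * hall (add_mset (n - m) M) (K - {#m#}) else 0)"
  proof -
    have "(\<Sum>i=1..<n. hall (add_mset i (add_mset (n - i) M)) K) =
       (\<Sum>m\<in>#K. \<Sum>i=1..<n. if m = i then of_nat m * hall (add_mset (n - i) M) (K - {#m#}) else 0)"
      unfolding sum_sum_mset_swap[symmetric] by (intro sum.cong refl hall_add_mset)
    also have "\<dots> = (\<Sum>m\<in>#K. if 0 < m \<and> m < n then of_nat m * hall (add_mset (n - m) M) (K - {#m#}) else 0)"
      by (intro arg_cong[where f = sum_mset] image_mset_cong) (auto simp: sum.delta')
    finally show ?thesis .
  qed
  have 3: "(\<Sum>m\<in>#M. of_nat m * hall (add_mset (n + m) (M - {#m#})) K) =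
     (\<Sum>k\<in>#K. if n < k then of_nat k * hall M (add_mset (k - n) (K - {#k#})) else 0)"
  proof -
    have "(\<Sum>m\<in>#M. of_nat m * hall (add_mset (n + m) (M - {#m#})) K) =
      (\<Sum>m\<in>#M. \<Sum>k\<in>#K. if k = n + m then of_nat m * (of_nat k * hall (M - {#m#}) (K - {#k#})) else 0)"
      unfolding hall_add_mset sum_mset_distrib_left
      by (intro arg_cong[where f = sum_mset] image_mset_cong) auto
    also have "\<dots> = (\<Sum>k\<in>#K. \<Sum>m\<in>#M. if k = n + m then of_nat m * (of_nat k * hall (M - {#m#}) (K - {#k#})) else 0)"
      by (rule sum_mset.swap)
    also have "\<dots> = (\<Sum>k\<in>#K. if n < k then of_nat k * hall M (add_mset (k - n) (K - {#k#})) else 0)"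
    proof (intro arg_cong[where f = sum_mset] image_mset_cong)
      fix k
      show "(\<Sum>m\<in>#M. if k = n + m then of_nat m * (of_nat k * hall (M - {#m#}) (K - {#k#})) else 0) =
        (if n < k then of_nat k * hall M (add_mset (k - n) (K - {#k#})) else 0)"
      proof (cases "n < k")
        case True
        have "(if k = n + m then of_nat m * (of_nat k * hall (M - {#m#}) (K - {#k#})) else 0) =
          of_nat k * (if m = k - n then of_nat m * hall (K - {#k#}) (M - {#m#}) else 0)" for m
          using True by (auto simp: hall_commute)
        then show ?thesis using True
          by (simp only: sum_mset_distrib_left[symmetric] hall_commute[of M] hall_add_mset[symmetric] if_True)
      next
        case False
        then have "(if k = n + m then of_nat m * (of_nat k * hall (M - {#m#}) (K - {#k#})) else 0) = 0" for m
          by auto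
        with False show ?thesis by simp
      qed
    qed
    finally show ?thesis .
  qed
  show ?thesis
    unfolding 1 2 3 sum_mset.distrib[symmetric]
    using n by (intro arg_cong[where f = sum_mset] image_mset_cong) auto
qed

lemma finite_partitions: "finite {M :: nat multiset. sum_mset M = d \<and> 0 \<notin># M}"
proof (rule finite_subset)
  have size: "size M \<le> sum_mset M" if "0 \<notin># M" for M :: "nat multiset"
    using that by (induction M) auto
  show "{M. sum_mset M = d \<and> 0 \<notin># M} \<subseteq> (\<Union>s\<in>{..d}. multisets_of_size {..d} s)"
    using size by (auto simp: multisets_of_size_def dest!: multi_member_split)
qed auto

lemma norm_sum_mset_le:
  fixes f :: "'a \<Rightarrow> complex"
  assumes "\<And>m. m \<in># M \<Longrightarrow> norm (f m) \<le> g m"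
  shows "norm (\<Sum>m\<in>#M. f m) \<le> (\<Sum>m\<in>#M. g m)"
  using assms
proof (induction M)
  case (add x M)
  have "norm (\<Sum>m\<in>#add_mset x M. f m) \<le> norm (f x) + norm (\<Sum>m\<in>#M. f m)"
    by (simp add: norm_triangle_ineq)
  with add show ?case by (smt (verit) image_mset_add_mset sum_mset.add_mset union_single_eq_member insert_iff set_mset_add_mset_insert)
qed simp

text \<open>
  In the Schwinger--Dyson equation the coefficients of the moments of top degree \<open>d\<close> other than the
  first one add up to \<open>d - 1 < N\<close>. So the equation with vanishing right-hand side has only the
  trivial solution.
\<close>

theorem (in haar_probability) mom_eq_hall:
  assumes "sum_mset M = sum_mset K" "0 \<notin># M" "0 \<notin># K" "sum_mset K \<le> CARD('n)"
  shows "mom M K = hall M K"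
  using assms
proof (induction "sum_mset K" arbitrary: M K rule: less_induct)
  case less
  note IH = less.hyps
  define d where "d = sum_mset K"
  show ?case
  proof (cases "d = 0")
    case True
    have "M' = {#}" if "sum_mset M' = 0" "0 \<notin># M'" for M' :: "nat multiset"
      using that by (cases M') auto
    from this[of M] this[of K] have "M = {#}" "K = {#}"
      using True less.prems unfolding d_def by argo+
    then show ?thesis by (simp add: mom_empty hall_def hall_norm_def)
  next
    case False
    define S where "S = {M :: nat multiset. sum_mset M = d \<and> 0 \<notin># M}"
    define D where "D M = mom M K - hall M K" for M
    have "finite S" unfolding S_def by (rule finite_partitions)
    have "M \<in> S" using less.prems by (simp add: S_def d_def)
    \<comment> \<open>The largest deviation over all partitions of d; the equation will bound
      \<open>CARD('n)\<close> times it by d - 1 times it.\<close>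
    define B where "B = Max ((\<lambda>M. cmod (D M)) ` S)"
    have B: "cmod (D M) \<le> B" if "M \<in> S" for M
      unfolding B_def using \<open>finite S\<close> that by simp
    have "0 \<le> B" using B[OF \<open>M \<in> S\<close>] norm_ge_zero order_trans by blast
    have key: "real CARD('n) * cmod (D M) \<le> (real d - 1) * B" if "M \<in> S" for M
    proof -
      have "M \<noteq> {#}" using that False by (auto simp: S_def)
      then obtain n M' where M: "M = add_mset n M'" by (metis multiset_cases)
      have n: "n > 0" and M': "0 \<notin># M'" "n + sum_mset M' = d"
        using that by (auto simp: S_def M)
      \<comment> \<open>Cancelling a part against K lowers the degree, so the induction hypothesis
        identifies the two right-hand sides.\<close>
      have rhs: "(\<Sum>m\<in>#K. of_nat m *
          (if m < n then mom (add_mset (n - m) M') (K - {#m#})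
           else if m = n then of_nat CARD('n) * mom M' (K - {#m#})
           else mom M' (add_mset (m - n) (K - {#m#})))) =
         (\<Sum>m\<in>#K. of_nat m *
          (if m < n then hall (add_mset (n - m) M') (K - {#m#})
           else if m = n then of_nat CARD('n) * hall M' (K - {#m#})
           else hall M' (add_mset (m - n) (K - {#m#}))))"
      proof (intro arg_cong[where f = sum_mset] image_mset_cong)
        fix m assume m: "m \<in># K"
        then obtain K' where K: "K = add_mset m K'" by (metis insert_DiffM)
        have m0: "m > 0" "0 \<notin># K'" using less.prems K by auto
        have K': "m + sum_mset K' = d" using K by (simp add: d_def)
        have sK: "sum_mset K = d" "d \<le> CARD('n)" using less.prems by (simp_all add: d_def)
        have "mom (add_mset (n - m) M') K' = hall (add_mset (n - m) M') K'" if "m < n"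
          by (rule IH) (use sK m0 M' K' that in auto)
        moreover have "mom M' K' = hall M' K'" if "m = n"
          by (rule IH) (use sK m0 M' K' that in auto)
        moreover have "mom M' (add_mset (m - n) K') = hall M' (add_mset (m - n) K')" if "\<not> m < n" "m \<noteq> n"
          by (rule IH) (use sK m0 M' K' that n in auto)
        ultimately show "of_nat m *
          (if m < n then mom (add_mset (n - m) M') (K - {#m#})
           else if m = n then of_nat CARD('n) * mom M' (K - {#m#})
           else mom M' (add_mset (m - n) (K - {#m#}))) = of_nat m *
          (if m < n then hall (add_mset (n - m) M') (K - {#m#})
           else if m = n then of_nat CARD('n) * hall M' (K - {#m#})
           else hall M' (add_mset (m - n) (K - {#m#})))"
          by (simp add: K)
      qed
      have "of_nat CARD('n) * D (add_mset n M')
         + (\<Sum>i=1..<n. D (add_mset i (add_mset (n - i) M')))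
         + (\<Sum>m\<in>#M'. of_nat m * D (add_mset (n + m) (M' - {#m#}))) = 0"
      proof -
        have *: "a1 - a2 + (b1 - b2) + (c1 - c2) = 0" if "a1 + b1 + c1 = a2 + b2 + c2"
          for a1 a2 b1 b2 c1 c2 :: complex
          using that by (simp add: algebra_simps)
        show ?thesis
          unfolding D_def right_diff_distrib sum_subtractf sum_mset_sub
          by (rule *[OF trans[OF schwinger_dyson[OF n] trans[OF rhs hall_schwinger_dyson[OF n, symmetric]]]])
      qed
      then have "of_nat CARD('n) * D M = - (\<Sum>i=1..<n. D (add_mset i (add_mset (n - i) M')))
         - (\<Sum>m\<in>#M'. of_nat m * D (add_mset (n + m) (M' - {#m#})))"
        by (simp add: M eq_neg_iff_add_eq_0 algebra_simps)
      then have "norm (of_nat CARD('n) * D M) \<le> norm (\<Sum>i=1..<n. D (add_mset i (add_mset (n - i) M')))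
         + norm (\<Sum>m\<in>#M'. of_nat m * D (add_mset (n + m) (M' - {#m#})))"
        using norm_triangle_ineq4[of "- (\<Sum>i=1..<n. D (add_mset i (add_mset (n - i) M')))"]
        by (simp only: norm_minus_cancel)
      also have "norm (\<Sum>i=1..<n. D (add_mset i (add_mset (n - i) M'))) \<le> (\<Sum>i=1..<n. B)"
        by (intro sum_norm_le B) (use M' n in \<open>auto simp: S_def\<close>)
      also have "norm (\<Sum>m\<in>#M'. of_nat m * D (add_mset (n + m) (M' - {#m#}))) \<le> (\<Sum>m\<in>#M'. real m * B)"
      proof (rule norm_sum_mset_le)
        fix m assume "m \<in># M'"
        then obtain M'' where M'': "M' = add_mset m M''" by (metis insert_DiffM)
        have "add_mset (n + m) (M' - {#m#}) \<in> S"
          using M' n unfolding M'' by (simp add: S_def)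
        then show "cmod (of_nat m * D (add_mset (n + m) (M' - {#m#}))) \<le> real m * B"
          using B by (simp add: norm_mult mult_left_mono)
      qed
      also have "(\<Sum>m\<in>#M'. real m * B) = real (sum_mset M') * B"
        by (induction M') (auto simp: algebra_simps)
      also have "(\<Sum>i=1..<n. B) + real (sum_mset M') * B = (real d - 1) * B"
        using n M'(2)[symmetric] by (simp add: algebra_simps of_nat_diff)
      finally show ?thesis by (simp add: norm_mult)
    qed
    have "B \<in> (\<lambda>M. cmod (D M)) ` S"
      unfolding B_def using \<open>finite S\<close> \<open>M \<in> S\<close> by (intro Max_in) auto
    then have "real CARD('n) * B \<le> (real d - 1) * B" using key by auto
    moreover have "d \<le> CARD('n)" using less.prems by (simp add: d_def)
    then have "real d - 1 < real CARD('n)" by linarith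
    ultimately have "B = 0" using \<open>0 \<le> B\<close>
      by (smt (verit) mult_right_less_imp_less mult_strict_right_mono)
    then show ?thesis using B[OF \<open>M \<in> S\<close>] by (simp add: D_def)
  qed
qed

section \<open>Scaling, homogeneous functions and pairings with trace products\<close>

lemma matrix_power_mat_mul: "matrix_power (mat c ** U) n = mat (c ^ n) ** matrix_power U n"
  for U :: "complex^'n^'n"
  by (induction n) (auto simp: mat_mul_mult_mat_mul)

lemma trace_mat_mul: "trace (mat c ** U) = c * trace U" for U :: "complex^'n^'n"
  by (simp add: trace_def mat_mul_nth sum_distrib_left)

lemma trace_prod_mat_mul: "trace_prod M (mat c ** U) = c ^ sum_mset M * trace_prod M U"
  by (induction M) (auto simp: matrix_power_mat_mul trace_mat_mul power_add)

context haar_probability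
begin

text \<open>Scalars of modulus 1 are unitary and multiply the integrand by c^(a-b); the angle is
  chosen to make this factor -1.\<close>

lemma mom_eq_0:
  assumes "sum_mset M \<noteq> sum_mset K"
  shows "mom M K = 0"
proof -
  define a b :: nat where "a = sum_mset M" and "b = sum_mset K"
  define c where "c = cis (pi / (real a - real b))"
  have "a \<noteq> b" using assms by (simp add: a_def b_def)
  then have ab: "real a - real b \<noteq> 0" by simp
  have "mat c \<in> unitary_group"
    by (simp add: unitary_group_iff adj_mat mat_mul_mat c_def cis_cnj cis_mult)
  then have "mom M K = (\<integral>U. trace_prod M (mat c ** U) * cnj (trace_prod K (mat c ** U)) \<partial>\<mu>)"
    unfolding mom_def
    by (subst integral_left_mult[of "mat c" "\<lambda>U. trace_prod M U * cnj (trace_prod K U)"])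
       (auto intro!: borel_measurable_haar continuous_intros)
  also have "\<dots> = (\<integral>U. (c ^ a * cnj c ^ b) * (trace_prod M U * cnj (trace_prod K U)) \<partial>\<mu>)"
    by (intro Bochner_Integration.integral_cong refl) (simp add: trace_prod_mat_mul a_def b_def mult_ac)
  also have "\<dots> = (c ^ a * cnj c ^ b) * mom M K"
    by (simp add: mom_def)
  also have "c ^ a * cnj c ^ b = -1"
  proof -
    have "c ^ a * cnj c ^ b = cis (real a * (pi / (real a - real b)) - real b * (pi / (real a - real b)))"
      unfolding c_def cis_cnj Complex.DeMoivre cis_mult by simp
    also have "real a * (pi / (real a - real b)) - real b * (pi / (real a - real b)) = pi"
      using ab unfolding left_diff_distrib[symmetric] by simp
    finally show ?thesis by simp
  qed
  finally show ?thesis by simp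
qed

text \<open>The adjointness of \<open>hall_add_mset\<close>, transported to the moments, which are
  Hall products in degrees up to \<open>CARD('n)\<close>.\<close>

lemma mom_add_mset:
  assumes "sum_mset M = n + sum_mset K" "0 \<notin># M" "0 \<notin># K" "n > 0" "sum_mset M \<le> CARD('n)"
  shows "mom M (add_mset n K) = (\<Sum>m\<in>#M. if m = n then of_nat n * mom (M - {#m#}) K else 0)"
proof -
  have "mom M (add_mset n K) = hall (add_mset n K) M"
    using assms by (subst mom_eq_hall) (auto simp: hall_commute)
  also have "\<dots> = (\<Sum>m\<in>#M. if m = n then of_nat n * mom (M - {#m#}) K else 0)"
    unfolding hall_add_mset
  proof (intro arg_cong[where f = sum_mset] image_mset_cong)
    fix m assume m: "m \<in># M"
    obtain M' where M': "M = add_mset m M'" using m by (metis insert_DiffM)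
    have "hall K (M - {#m#}) = mom (M - {#m#}) K" if "m = n"
      using assms that unfolding M' by (subst mom_eq_hall) (auto simp: hall_commute)
    then show "(if m = n then of_nat m * hall K (M - {#m#}) else 0) = (if m = n then of_nat n * mom (M - {#m#}) K else 0)"
      by simp
  qed
  finally show ?thesis .
qed

end

text \<open>Polynomials in the traces of powers, graded by the power. They are generated inductively
  as functions, so that facts about trace products extend to them by induction on the
  generation.\<close>

inductive homogeneous :: "nat \<Rightarrow> (complex^'n^'n \<Rightarrow> complex) \<Rightarrow> bool" where
  homogeneous_zero: "homogeneous e (\<lambda>_. 0)"
| homogeneous_one: "homogeneous 0 (\<lambda>_. 1)"
| homogeneous_add: "homogeneous e f \<Longrightarrow> homogeneous e g \<Longrightarrow> homogeneous e (\<lambda>U. f U + g U)"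
| homogeneous_scale: "homogeneous e f \<Longrightarrow> homogeneous e (\<lambda>U. c * f U)"
| homogeneous_trace: "n > 0 \<Longrightarrow> homogeneous e f \<Longrightarrow> homogeneous (n + e) (\<lambda>U. trace (matrix_power U n) * f U)"

lemma homogeneous_sum:
  "(\<And>i. i \<in> S \<Longrightarrow> homogeneous e (f i)) \<Longrightarrow> homogeneous e (\<lambda>U. \<Sum>i\<in>S. f i U)"
  by (induction S rule: infinite_finite_induct) (auto intro: homogeneous.intros)

lemma homogeneous_mult:
  assumes "homogeneous e f" "homogeneous e' g"
  shows "homogeneous (e + e') (\<lambda>U. f U * g U)"
  using assms(1)
proof induction
  case (homogeneous_zero e)
  then show ?case by (simp add: homogeneous.homogeneous_zero)
next
  case homogeneous_one
  then show ?case using assms(2) by simp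
next
  case (homogeneous_add e f h)
  from homogeneous.homogeneous_add[OF homogeneous_add.IH] show ?case by (simp add: distrib_right)
next
  case (homogeneous_scale e f c)
  from homogeneous.homogeneous_scale[OF homogeneous_scale.IH, of c] show ?case by (simp add: mult.assoc)
next
  case (homogeneous_trace n e f)
  from homogeneous.homogeneous_trace[OF homogeneous_trace.hyps(1) homogeneous_trace.IH]
  show ?case by (simp add: mult.assoc add.assoc)
qed

lemma homogeneous_continuous: "homogeneous e f \<Longrightarrow> continuous_on S f"
  by (induction rule: homogeneous.induct) (auto intro!: continuous_intros)

lemma homogeneous_mat_mul: "homogeneous e f \<Longrightarrow> f (mat c ** U) = c ^ e * f U"
  by (induction rule: homogeneous.induct)
     (auto simp: algebra_simps matrix_power_mat_mul trace_mat_mul power_add)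

context haar_probability
begin

definition pair :: "nat multiset \<Rightarrow> (complex^'n^'n \<Rightarrow> complex) \<Rightarrow> complex" where
  "pair M g = (\<integral>U. trace_prod M U * cnj (g U) \<partial>\<mu>)"

lemma pair_integrable:
  "homogeneous e g \<Longrightarrow> integrable \<mu> (\<lambda>U. trace_prod M U * cnj (g U))"
  by (intro integrable_haar continuous_intros homogeneous_continuous)

lemma pair_trace_prod: "pair M (trace_prod K) = mom M K"
  by (simp add: pair_def mom_def)

lemma pair_zero [simp]: "pair M (\<lambda>_. 0) = 0"
  by (simp add: pair_def)

lemma pair_add:
  "homogeneous e f \<Longrightarrow> homogeneous e' g \<Longrightarrow> pair M (\<lambda>U. f U + g U) = pair M f + pair M g"
  using pair_integrable[of e f M] pair_integrable[of e' g M] by (simp add: pair_def distrib_left)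

lemma pair_scale: "pair M (\<lambda>U. c * f U) = cnj c * pair M f"
proof -
  have "pair M (\<lambda>U. c * f U) = (\<integral>U. cnj c * (trace_prod M U * cnj (f U)) \<partial>\<mu>)"
    by (simp add: pair_def mult_ac)
  then show ?thesis by (simp add: pair_def)
qed

lemma pair_sum:
  "(\<And>i. i \<in> S \<Longrightarrow> homogeneous e (f i)) \<Longrightarrow> pair M (\<lambda>U. \<Sum>i\<in>S. f i U) = (\<Sum>i\<in>S. pair M (f i))"
proof (induction S rule: infinite_finite_induct)
  case (insert x F)
  then show ?case by (simp add: pair_add[of e _ e] homogeneous_sum)
qed auto

lemma homogeneous_trace_prod_mult:
  assumes "homogeneous e g" "0 \<notin># L"
  shows "homogeneous (sum_mset L + e) (\<lambda>U. trace_prod L U * g U)"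
  using assms(2)
proof (induction L)
  case empty
  then show ?case using assms(1) by simp
next
  case (add n L)
  then have "n > 0" "0 \<notin># L" by auto
  from homogeneous_trace[OF this(1) add.IH[OF this(2)]] show ?case by (simp add: mult.assoc add.assoc)
qed

text \<open>The factor \<open>trace_prod L\<close> collects the traces peeled off in the induction,
  so that the base case is a moment of two multisets with different sums.\<close>

lemma pair_trace_prod_mult_eq_0:
  assumes "homogeneous e g" "0 \<notin># L" "sum_mset M \<noteq> sum_mset L + e"
  shows "pair M (\<lambda>U. trace_prod L U * g U) = 0"
  using assms
proof (induction arbitrary: L)
  case homogeneous_zero
  then show ?case by simp
next
  case homogeneous_one
  then show ?case by (simp add: pair_trace_prod mom_eq_0)
next
  case (homogeneous_add e f g)
  show ?case
    unfolding distrib_left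
    by (subst pair_add[OF homogeneous_trace_prod_mult homogeneous_trace_prod_mult]) (use homogeneous_add in auto)
next
  case (homogeneous_scale e f c)
  then show ?case using pair_scale[of M c "\<lambda>U. trace_prod L U * f U"] by (simp add: mult.left_commute)
next
  case (homogeneous_trace n e f)
  have "pair M (\<lambda>U. trace_prod (add_mset n L) U * f U) = 0"
    using homogeneous_trace.prems homogeneous_trace.hyps by (intro homogeneous_trace.IH) auto
  then show ?case by (simp add: mult_ac)
qed

lemma pair_eq_0:
  assumes "homogeneous e g" "sum_mset M \<noteq> e"
  shows "pair M g = 0"
  using pair_trace_prod_mult_eq_0[OF assms(1), of "{#}" M] assms by simp

text \<open>The linear extension of \<open>mom_add_mset\<close>. Again \<open>trace_prod L\<close>
  collects the peeled traces; \<open>pair_trace_mult\<close> is the case of empty L.\<close>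

lemma pair_trace_mult_aux:
  assumes "homogeneous e g" "0 \<notin># L" "sum_mset M = n + sum_mset L + e" "0 \<notin># M" "n > 0" "sum_mset M \<le> CARD('n)"
  shows "pair M (\<lambda>U. trace (matrix_power U n) * (trace_prod L U * g U)) =
     (\<Sum>m\<in>#M. if m = n then of_nat n * pair (M - {#m#}) (\<lambda>U. trace_prod L U * g U) else 0)"
  using assms
proof (induction arbitrary: L)
  case homogeneous_zero
  then show ?case by (simp cong: if_cong)
next
  case homogeneous_one
  then have "mom M (add_mset n L) = (\<Sum>m\<in>#M. if m = n then of_nat n * mom (M - {#m#}) L else 0)"
    by (intro mom_add_mset) auto
  then show ?case by (simp add: pair_trace_prod[symmetric] trace_prod_add_mset[abs_def] cong: if_cong)
next
  case (homogeneous_add e f g)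
  have hf: "homogeneous (sum_mset L + e) (\<lambda>U. trace_prod L U * f U)"
    and hg: "homogeneous (sum_mset L + e) (\<lambda>U. trace_prod L U * g U)"
    using homogeneous_add by (auto intro: homogeneous_trace_prod_mult)
  have tf: "homogeneous (n + (sum_mset L + e)) (\<lambda>U. trace (matrix_power U n) * (trace_prod L U * f U))"
    and tg: "homogeneous (n + (sum_mset L + e)) (\<lambda>U. trace (matrix_power U n) * (trace_prod L U * g U))"
    using hf hg homogeneous_add.prems by (auto intro: homogeneous_trace)
  have "(\<Sum>m\<in>#M. if m = n then of_nat n * pair (M - {#m#}) (\<lambda>U. trace_prod L U * (f U + g U)) else 0) =
     (\<Sum>m\<in>#M. if m = n then of_nat n * pair (M - {#m#}) (\<lambda>U. trace_prod L U * f U) else 0) +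
     (\<Sum>m\<in>#M. if m = n then of_nat n * pair (M - {#m#}) (\<lambda>U. trace_prod L U * g U) else 0)"
    unfolding sum_mset.distrib[symmetric] distrib_left pair_add[OF hf hg]
    by (intro arg_cong[where f = sum_mset] image_mset_cong) auto
  then show ?case
    using homogeneous_add by (simp add: distrib_left pair_add[OF tf tg] )
next
  case (homogeneous_scale e f c)
  have 1: "pair M' (\<lambda>U. trace_prod L U * (c * f U)) = cnj c * pair M' (\<lambda>U. trace_prod L U * f U)" for M'
    using pair_scale[of M' c "\<lambda>U. trace_prod L U * f U"] by (simp add: mult.left_commute)
  have 2: "pair M (\<lambda>U. trace (matrix_power U n) * (trace_prod L U * (c * f U))) =
      cnj c * pair M (\<lambda>U. trace (matrix_power U n) * (trace_prod L U * f U))"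
    using pair_scale[of M c "\<lambda>U. trace (matrix_power U n) * (trace_prod L U * f U)"] by (simp add: mult.left_commute)
  show ?case
    unfolding 1 2 homogeneous_scale.IH[OF homogeneous_scale.prems] sum_mset_distrib_left
    by (intro arg_cong[where f = sum_mset] image_mset_cong) auto
next
  case (homogeneous_trace k e f)
  have "pair M (\<lambda>U. trace (matrix_power U n) * (trace_prod (add_mset k L) U * f U)) =
     (\<Sum>m\<in>#M. if m = n then of_nat n * pair (M - {#m#}) (\<lambda>U. trace_prod (add_mset k L) U * f U) else 0)"
    using homogeneous_trace.prems homogeneous_trace.hyps by (intro homogeneous_trace.IH) auto
  moreover have "trace_prod (add_mset k L) U * f U = trace_prod L U * (trace (matrix_power U k) * f U)" for U
    by (simp add: mult_ac)
  ultimately show ?case by (simp only:)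
qed

lemma pair_trace_mult:
  assumes "homogeneous e g" "sum_mset M = n + e" "0 \<notin># M" "n > 0" "sum_mset M \<le> CARD('n)"
  shows "pair M (\<lambda>U. trace (matrix_power U n) * g U) =
     (\<Sum>m\<in>#M. if m = n then of_nat n * pair (M - {#m#}) g else 0)"
  using pair_trace_mult_aux[of e g "{#}" M n] assms by (simp cong: if_cong)

end

subsection \<open>Elementary symmetric functions of powers of the eigenvalues\<close>

text \<open>The same choice as in \<open>omega\<close>. It comes without any regularity in U, so
  continuity of symmetric functions of the eigenvalues has to be derived from expressions in
  traces.\<close>

definition eigs :: "complex^'n^'n \<Rightarrow> 'n \<Rightarrow> complex" where
  "eigs U = (SOME x. is_eigenvalues U x)"

lemma is_eigenvalues_eigs: "is_eigenvalues U (eigs U)"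
  unfolding eigs_def using exists_eigenvalues by (rule someI_ex)

text \<open>Equals (-1)^j times the j-th elementary symmetric function of the k-th powers of the
  eigenvalues.\<close>

definition echar :: "nat \<Rightarrow> nat \<Rightarrow> complex^'n^'n \<Rightarrow> complex" where
  "echar k j U = fps_nth (\<Prod>i\<in>UNIV. 1 - fps_const (eigs U i ^ k) * fps_X) j"

lemma fps_prod_nth_0: "fps_nth (\<Prod>i\<in>A. f i) 0 = (\<Prod>i\<in>A. fps_nth (f i) 0)"
  for f :: "'i \<Rightarrow> complex fps"
  by (induction A rule: infinite_finite_induct) auto

lemma echar_0: "echar k 0 U = 1"
  by (simp add: echar_def fps_prod_nth_0)

lemma echar_rec:
  "of_nat j * echar k j U = - (\<Sum>i=1..j. trace (matrix_power U (k * i)) * echar k (j - i) U)"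
proof -
  have "(\<Sum>a\<in>UNIV. (eigs U a ^ k) ^ i) = trace (matrix_power U (k * i))" for i
    by (simp add: trace_matrix_power[OF is_eigenvalues_eigs] power_mult)
  with newton_prod_linear[of UNIV j "\<lambda>a. eigs U a ^ k"] show ?thesis
    by (simp add: echar_def)
qed

lemma echar_rec':
  assumes "j > 0"
  shows "echar k j U = (- 1 / of_nat j) * (\<Sum>i=1..j. trace (matrix_power U (k * i)) * echar k (j - i) U)"
  using echar_rec[of j k U] assms by (simp add: field_simps)

text \<open>Newton's recursion turns the function into a polynomial in the traces of U^(k i), which
  gives continuity despite the choice in \<open>eigs\<close>.\<close>

lemma homogeneous_echar:
  assumes "k > 0"
  shows "homogeneous (k * j) (echar k j :: complex^'n^'n \<Rightarrow> complex)"
proof (induction j rule: less_induct)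
  case (less j)
  show ?case
  proof (cases "j = 0")
    case True
    then have "(echar k j :: complex^'n^'n \<Rightarrow> complex) = (\<lambda>_. 1)" by (auto simp: echar_0)
    then show ?thesis using True homogeneous_one by simp
  next
    case False
    have "homogeneous (k * j) (\<lambda>U :: complex^'n^'n. trace (matrix_power U (k * i)) * echar k (j - i) U)" if "i \<in> {1..j}" for i
      using homogeneous_trace[of "k * i" "k * (j - i)" "echar k (j - i)"] less[of "j - i"] that assms False
      by (simp add: distrib_left[symmetric])
    then have "homogeneous (k * j) (\<lambda>U :: complex^'n^'n. (- 1 / of_nat j) * (\<Sum>i=1..j. trace (matrix_power U (k * i)) * echar k (j - i) U))"
      by (intro homogeneous_scale homogeneous_sum)
    then show ?thesis using False by (subst (asm) echar_rec'[symmetric]) auto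
  qed
qed

text \<open>The parts are indexed by A with sizes p. Sums over subsets of A then count equal parts
  with the right multiplicity.\<close>

definition parts :: "('i \<Rightarrow> nat) \<Rightarrow> 'i set \<Rightarrow> nat multiset" where
  "parts p A = image_mset p (mset_set A)"

lemma sum_mset_parts: "sum_mset (parts p A) = sum p A"
  by (simp add: parts_def sum_unfold_sum_mset)

lemma parts_diff:
  assumes "finite A" "a \<in> A"
  shows "parts p A - {#p a#} = parts p (A - {a})"
proof -
  have "parts p A = add_mset (p a) (parts p (A - {a}))"
    using assms by (simp add: parts_def mset_set.remove)
  then show ?thesis by simp
qed

lemma sum_over_parts:
  assumes "finite A"
  shows "(\<Sum>m\<in>#parts p A. f m) = (\<Sum>a\<in>A. f (p a))"
  by (simp add: parts_def sum_unfold_sum_mset image_mset.compositionality o_def)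

context haar_probability
begin

text \<open>Induction over Newton's recursion: each trace of U^(k i) removes a part of size k i, so
  a block B arises once for every choice of the part removed first. The sizes of these parts add up
  to k j, which cancels the factor -1/j and leaves one more factor -k.\<close>

lemma pair_echar_mult:
  assumes "finite A" "\<And>a. a \<in> A \<Longrightarrow> p a > 0" "k > 0" "homogeneous e g"
    and "sum p A = k * j + e" "sum p A \<le> CARD('n)"
  shows "pair (parts p A) (\<lambda>U. echar k j U * g U) =
    (\<Sum>B | B \<subseteq> A \<and> (\<forall>b\<in>B. k dvd p b) \<and> sum p B = k * j. (- of_nat k) ^ card B * pair (parts p (A - B)) g)"
  using assms
proof (induction j arbitrary: A rule: less_induct)
  case (less j)
  let ?S = "\<lambda>A j. {B. B \<subseteq> A \<and> (\<forall>b\<in>B. k dvd p b) \<and> sum p B = k * j}"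
  let ?t = "\<lambda>A B. (- of_nat k) ^ card B * pair (parts p (A - B)) g"
  show ?case
  proof (cases "j = 0")
    case True
    have "?S A j = {{}}"
    proof (safe, goal_cases)
      case (1 B x)
      then have "finite B" using less.prems(1) finite_subset by blast
      with 1 True less.prems(2) show ?case by (auto simp: sum_eq_0_iff) (metis less_numeral_extra(3) subsetD)
    qed (use True in auto)
    with True show ?thesis by (simp add: echar_0)
  next
    case False
    have hom: "homogeneous (k * (j - i) + e) (\<lambda>U. echar k (j - i) U * g U)" for i
      by (intro homogeneous_mult homogeneous_echar less.prems)
    have hom': "homogeneous (k * j + e) (\<lambda>U. trace (matrix_power U (k * i)) * (echar k (j - i) U * g U))"
      if "i \<in> {1..j}" for i
    proof -
      have "k * i + (k * (j - i) + e) = k * j + e"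
        using that by (simp add: add.assoc[symmetric] distrib_left[symmetric])
      with homogeneous_trace[OF _ hom, of "k * i" i] show ?thesis using that less.prems(3) by simp
    qed
    have term_i: "pair (parts p A) (\<lambda>U. trace (matrix_power U (k * i)) * (echar k (j - i) U * g U)) =
       (\<Sum>a | a \<in> A \<and> p a = k * i. \<Sum>B\<in>?S (A - {a}) (j - i). of_nat (k * i) * ?t (A - {a}) B)"
      if i: "i \<in> {1..j}" for i
    proof -
      have eq: "k * j = k * i + k * (j - i)" using i by (simp add: distrib_left[symmetric])
      have "pair (parts p A) (\<lambda>U. trace (matrix_power U (k * i)) * (echar k (j - i) U * g U)) =
         (\<Sum>m\<in>#parts p A. if m = k * i then of_nat (k * i) * pair (parts p A - {#m#}) (\<lambda>U. echar k (j - i) U * g U) else 0)"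
      proof -
        have "0 \<notin># parts p A" using less.prems(1,2) by (fastforce simp: parts_def)
        with less.prems i eq show ?thesis
          by (intro pair_trace_mult[OF hom]) (auto simp: sum_mset_parts)
      qed
      also have "\<dots> = (\<Sum>a\<in>A. if p a = k * i then of_nat (k * i) * pair (parts p (A - {a})) (\<lambda>U. echar k (j - i) U * g U) else 0)"
        unfolding sum_over_parts[OF less.prems(1)]
        by (intro sum.cong refl) (auto simp: parts_diff[symmetric] less.prems(1))
      also have "\<dots> = (\<Sum>a | a \<in> A \<and> p a = k * i. of_nat (k * i) * pair (parts p (A - {a})) (\<lambda>U. echar k (j - i) U * g U))"
        using less.prems(1) by (intro sum.inter_filter[symmetric])
      also have "\<dots> = (\<Sum>a | a \<in> A \<and> p a = k * i. of_nat (k * i) * (\<Sum>B\<in>?S (A - {a}) (j - i). ?t (A - {a}) B))"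
      proof (intro sum.cong refl arg_cong2[of _ _ _ _ "(*)"])
        fix a assume a: "a \<in> {a. a \<in> A \<and> p a = k * i}"
        have "sum p A = k * i + sum p (A - {a})"
          using a less.prems(1) sum.remove[of A a p] by auto
        then have "sum p (A - {a}) = k * (j - i) + e" "sum p (A - {a}) \<le> CARD('n)"
          using eq less.prems(5,6) by linarith+
        moreover have "j - i < j" using i by auto
        ultimately show "pair (parts p (A - {a})) (\<lambda>U. echar k (j - i) U * g U) = (\<Sum>B\<in>?S (A - {a}) (j - i). ?t (A - {a}) B)"
          by (intro less.IH) (use less.prems in auto)
      qed
      finally show ?thesis by (simp only: sum_distrib_left)
    qed
    have "pair (parts p A) (\<lambda>U. echar k j U * g U) =
      pair (parts p A) (\<lambda>U. (- 1 / of_nat j) * (\<Sum>i=1..j. trace (matrix_power U (k * i)) * (echar k (j - i) U * g U)))"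
      using False by (simp add: echar_rec'[of j k] sum_distrib_right mult.assoc)
    also have "\<dots> = (- 1 / of_nat j) * (\<Sum>i=1..j. pair (parts p A) (\<lambda>U. trace (matrix_power U (k * i)) * (echar k (j - i) U * g U)))"
      unfolding pair_scale using hom' by (subst pair_sum) auto
    also have "\<dots> = (- 1 / of_nat j) * (\<Sum>i=1..j. \<Sum>a | a \<in> A \<and> p a = k * i. \<Sum>B\<in>?S (A - {a}) (j - i). of_nat (k * i) * ?t (A - {a}) B)"
      using term_i by simp
    also have "(\<Sum>i=1..j. \<Sum>a | a \<in> A \<and> p a = k * i. \<Sum>B\<in>?S (A - {a}) (j - i). of_nat (k * i) * ?t (A - {a}) B)
       = (\<Sum>B\<in>?S A j. \<Sum>a\<in>B. of_nat (p a) * ((- of_nat k) ^ (card B - 1) * pair (parts p (A - B)) g))"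
    proof -
      have "(\<Sum>i=1..j. \<Sum>a | a \<in> A \<and> p a = k * i. \<Sum>B\<in>?S (A - {a}) (j - i). of_nat (k * i) * ?t (A - {a}) B) =
        (\<Sum>(i, a, B)\<in>(SIGMA i:{1..j}. SIGMA a:{a. a \<in> A \<and> p a = k * i}. ?S (A - {a}) (j - i)). of_nat (k * i) * ?t (A - {a}) B)"
        using less.prems(1) by (simp add: sum.Sigma)
      \<comment> \<open>A removed part a together with the block removed afterwards is the same as
        one block with the marked element a.\<close>
      also have "\<dots> = (\<Sum>(B, a)\<in>(SIGMA B:?S A j. B). of_nat (p a) * ((- of_nat k) ^ (card B - 1) * pair (parts p (A - B)) g))"
      proof (rule sum.reindex_bij_witness[where i = "\<lambda>(B, a). (p a div k, a, B - {a})" and j = "\<lambda>(i, a, B). (insert a B, a)"])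
        fix x assume "x \<in> (SIGMA i:{1..j}. SIGMA a:{a. a \<in> A \<and> p a = k * i}. ?S (A - {a}) (j - i))"
        then obtain i a B where x: "x = (i, a, B)" "1 \<le> i" "i \<le> j" "a \<in> A" "p a = k * i" "B \<subseteq> A - {a}"
          "\<forall>b\<in>B. k dvd p b" "sum p B = k * (j - i)" by auto
        have B: "finite B" "a \<notin> B"
          using x(6) less.prems(1) by (meson finite_Diff finite_subset, auto)
        show "(case case x of (i, a, B) \<Rightarrow> (insert a B, a) of (B, a) \<Rightarrow> (p a div k, a, B - {a})) = x"
          using x B less.prems(3) by simp
        show "(case x of (i, a, B) \<Rightarrow> (insert a B, a)) \<in> (SIGMA B:?S A j. B)"
          using x B by (auto simp: distrib_left[symmetric])
        have "A - insert a B = A - {a} - B" by auto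
        then show "(case case x of (i, a, B) \<Rightarrow> (insert a B, a) of (B, a) \<Rightarrow> of_nat (p a) * ((- of_nat k) ^ (card B - 1) * pair (parts p (A - B)) g)) =
           (case x of (i, a, B) \<Rightarrow> of_nat (k * i) * ?t (A - {a}) B)"
          using x B by simp
      next
        fix y assume "y \<in> (SIGMA B:?S A j. B)"
        then obtain B a where y: "y = (B, a)" "a \<in> B" "B \<subseteq> A" "\<forall>b\<in>B. k dvd p b" "sum p B = k * j" by auto
        have fB: "finite B" using y less.prems(1) finite_subset by auto
        have "k dvd p a" using y by auto
        then obtain i where i: "p a = k * i" by (rule dvdE)
        have "p a \<le> k * j" using y fB member_le_sum[of a B p] by simp
        then have ij: "1 \<le> i" "i \<le> j" using i less.prems(2,3) y by (auto simp: Suc_le_eq) (metis mult_0_right neq0_conv less.prems(2) subsetD)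
        have "sum p (B - {a}) = k * (j - i)"
          using y fB i by (simp add: sum_diff1_nat diff_mult_distrib2)
        then show "(case y of (B, a) \<Rightarrow> (p a div k, a, B - {a})) \<in> (SIGMA i:{1..j}. SIGMA a:{a. a \<in> A \<and> p a = k * i}. ?S (A - {a}) (j - i))"
          using y i ij less.prems(3) by auto
        show "(case case y of (B, a) \<Rightarrow> (p a div k, a, B - {a}) of (i, a, B) \<Rightarrow> (insert a B, a)) = y"
          using y by auto
      qed
      also have "\<dots> = (\<Sum>B\<in>?S A j. \<Sum>a\<in>B. of_nat (p a) * ((- of_nat k) ^ (card B - 1) * pair (parts p (A - B)) g))"
        using less.prems(1) by (intro sum.Sigma[symmetric]) (auto intro: finite_subset)
      finally show ?thesis .
    qed
    also have "\<dots> = (\<Sum>B\<in>?S A j. of_nat j * - ?t A B)"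
    proof (intro sum.cong refl)
      fix B assume B: "B \<in> ?S A j"
      then have "B \<noteq> {}" "finite B" using False less.prems(1,3) by (auto intro: finite_subset)
      then obtain c where c: "card B = Suc c" by (cases "card B") auto
      have "(\<Sum>a\<in>B. of_nat (p a) * ((- of_nat k) ^ (card B - 1) * pair (parts p (A - B)) g)) =
         of_nat (sum p B) * ((- of_nat k) ^ (card B - 1) * pair (parts p (A - B)) g)"
        by (simp add: sum_distrib_right)
      moreover have "sum p B = k * j" using B by simp
      ultimately show "(\<Sum>a\<in>B. of_nat (p a) * ((- of_nat k) ^ (card B - 1) * pair (parts p (A - B)) g)) = of_nat j * - ?t A B"
        using c by (simp only:) simp
    qed
    finally show ?thesis using False by (simp add: sum_distrib_left[symmetric] sum_negf)
  qed
qed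

end


subsection \<open>The power series of \<open>\<omega>\<^sub>r\<close>\<close>

text \<open>X marks the number of r-fold products of eigenvalues, so the coefficient of X^m is
  homogeneous of degree r m in the eigenvalues. For even r the exponent -1 of \<omega>_r makes the
  series an inverse.\<close>

definition omega_fps :: "nat \<Rightarrow> complex^'n^'n \<Rightarrow> complex fps" where
  "omega_fps r U =
     (let D = \<Prod>S\<in>{S. card S = r}. 1 - fps_const (\<Prod>i\<in>S. eigs U i) * fps_X
      in if odd r then D else inverse D)"

definition omega_coeff :: "nat \<Rightarrow> nat \<Rightarrow> complex^'n^'n \<Rightarrow> complex" where
  "omega_coeff r m U = fps_nth (omega_fps r U) m"

lemma prod_linear_fps_nth:
  fixes b :: "'i \<Rightarrow> complex"
  assumes "finite A"
  shows "fps_nth (\<Prod>i\<in>A. 1 - fps_const (b i) * fps_X) j = (-1) ^ j * (\<Sum>S | S \<subseteq> A \<and> card S = j. \<Prod>i\<in>S. b i)"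
proof -
  have "(\<Prod>i\<in>A. 1 - fps_const (b i) * fps_X) = (\<Prod>i\<in>A. fps_const (- b i) * fps_X + 1)"
    by (intro prod.cong refl) (simp flip: fps_const_neg)
  also have "\<dots> = (\<Sum>S\<in>Pow A. fps_const (\<Prod>i\<in>S. - b i) * fps_X ^ card S)"
  proof -
    have "(\<Prod>i\<in>S. fps_const (- b i) * fps_X) = fps_const (\<Prod>i\<in>S. - b i) * fps_X ^ card S" if "finite S" for S
      using that by (induction S) (auto simp: mult_ac fps_const_mult[symmetric] simp del: fps_const_mult)
    then show ?thesis
      using assms finite_subset by (auto simp: prod_add intro!: sum.cong)
  qed
  finally have "fps_nth (\<Prod>i\<in>A. 1 - fps_const (b i) * fps_X) j =
     (\<Sum>S\<in>Pow A. if card S = j then (\<Prod>i\<in>S. - b i) else 0)"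
    by (simp add: fps_sum_nth if_distrib cong: if_cong sum.cong) (auto intro!: sum.cong)
  also have "\<dots> = (\<Sum>S\<in>{S \<in> Pow A. card S = j}. (\<Prod>i\<in>S. - b i))"
    by (rule sum.inter_filter[symmetric]) (use assms in simp)
  also have "\<dots> = (\<Sum>S | S \<subseteq> A \<and> card S = j. (-1) ^ j * (\<Prod>i\<in>S. b i))"
    by (intro sum.cong) (auto simp: prod_uminus)
  finally show ?thesis by (simp add: sum_distrib_left)
qed

lemma omega_coeff_0: "omega_coeff r 0 U = 1"
  by (simp add: omega_coeff_def omega_fps_def Let_def fps_prod_nth_0)

text \<open>Newton's identities in the products of r eigenvalues, whose k-th power sum is (-1)^r
  times \<open>echar k r U\<close>. This sign and the exponent (-1)^(r+1) combine, so that both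
  parities obey one recursion.\<close>

lemma omega_coeff_rec:
  fixes U :: "complex^'n^'n"
  shows "of_nat m * omega_coeff r m U = (\<Sum>k=1..m. echar k r U * omega_coeff r (m - k) U)"
proof -
  let ?y = "\<lambda>S. \<Prod>i\<in>S. eigs U i"
  let ?D = "\<Prod>S\<in>{S :: 'n set. card S = r}. 1 - fps_const (?y S) * fps_X"
  have y: "(\<Sum>S\<in>{S. card S = r}. ?y S ^ k) = (-1) ^ r * echar k r U" for k
    unfolding echar_def by (subst prod_linear_fps_nth) (auto simp: prod_power_distrib)
  show ?thesis
  proof (cases "odd r")
    case True
    then show ?thesis
      using newton_prod_linear[of "{S :: 'n set. card S = r}" m ?y]
      by (simp add: omega_coeff_def omega_fps_def y sum_negf)
  next
    case False
    then show ?thesis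
      using newton_inverse_prod_linear[of "{S :: 'n set. card S = r}" m ?y]
      by (simp add: omega_coeff_def omega_fps_def y)
  qed
qed

lemma omega_coeff_rec':
  assumes "m > 0"
  shows "omega_coeff r m U = (1 / of_nat m) * (\<Sum>k=1..m. echar k r U * omega_coeff r (m - k) U)"
  using omega_coeff_rec[of m r U] assms by (simp add: field_simps)

lemma homogeneous_omega_coeff:
  shows "homogeneous (r * m) (omega_coeff r m :: complex^'n^'n \<Rightarrow> complex)"
proof (induction m rule: less_induct)
  case (less m)
  show ?case
  proof (cases "m = 0")
    case True
    then have "(omega_coeff r m :: complex^'n^'n \<Rightarrow> complex) = (\<lambda>_. 1)" by (auto simp: omega_coeff_0)
    then show ?thesis using True homogeneous_one by simp
  next
    case False
    have "homogeneous (r * m) (\<lambda>U :: complex^'n^'n. echar k r U * omega_coeff r (m - k) U)" if "k \<in> {1..m}" for k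
    proof -
      have "k * r + r * (m - k) = r * m"
        using that by (simp add: mult.commute[of k r] distrib_left[symmetric])
      with homogeneous_mult[OF homogeneous_echar[of k r] less[of "m - k"]] that show ?thesis by simp
    qed
    then have "homogeneous (r * m) (\<lambda>U :: complex^'n^'n. (1 / of_nat m) * (\<Sum>k=1..m. echar k r U * omega_coeff r (m - k) U))"
      by (intro homogeneous_scale homogeneous_sum)
    then show ?thesis using False by (subst (asm) omega_coeff_rec'[symmetric]) auto
  qed
qed

lemma omega_eq:
  "omega r U = (if odd r then \<Prod>S\<in>{S. card S = r}. 1 - (\<Prod>i\<in>S. eigs U i)
     else inverse (\<Prod>S\<in>{S. card S = r}. 1 - (\<Prod>i\<in>S. eigs U i)))"
  by (simp add: omega_def eigs_def Let_def power_int_minus prod_inversef[symmetric] o_def)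

section \<open>Eigenvalues of multiples of unitary matrices and convergence of the series\<close>

lemma eigenvector_exists:
  fixes A :: "complex^'n^'n"
  assumes "is_eigenvalues A x"
  obtains v where "v \<noteq> 0" "A *v v = x i *s v"
proof -
  have "det (mat (x i) - A) = 0"
    using assms unfolding is_eigenvalues_def by auto
  then have "\<not> (\<exists>B. B ** (mat (x i) - A) = mat 1)"
    by (metis det_I det_mul mult_zero_right zero_neq_one)
  then obtain v where v: "(mat (x i) - A) *v v = 0" "v \<noteq> 0"
    unfolding matrix_left_invertible_ker by auto
  have "(mat (x i) - A) *v v = x i *s v - A *v v"
  proof -
    have "(\<Sum>k\<in>UNIV. mat (x i) $ j $ k * v $ k) = (\<Sum>k\<in>UNIV. if k = j then x i * v $ k else 0)" for j
      by (intro sum.cong) (auto simp: mat_nth)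
    then show ?thesis
      by (simp add: vec_eq_iff matrix_vector_mult_def left_diff_distrib sum_subtractf)
  qed
  with v that show ?thesis by simp
qed

lemma unitary_norm_preserving:
  fixes U :: "complex^'n^'n"
  assumes "U \<in> unitary_group"
  shows "(\<Sum>i\<in>UNIV. (U *v v) $ i * cnj ((U *v v) $ i)) = (\<Sum>i\<in>UNIV. v $ i * cnj (v $ i))"
proof -
  have "(\<Sum>i\<in>UNIV. (U *v v) $ i * cnj ((U *v v) $ i)) =
      (\<Sum>i\<in>UNIV. \<Sum>j\<in>UNIV. \<Sum>k\<in>UNIV. v $ j * cnj (v $ k) * (adj U $ k $ i * U $ i $ j))"
    by (simp add: matrix_vector_mult_def sum_product mult_ac)
  also have "\<dots> = (\<Sum>j\<in>UNIV. \<Sum>i\<in>UNIV. \<Sum>k\<in>UNIV. v $ j * cnj (v $ k) * (adj U $ k $ i * U $ i $ j))"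
    by (rule sum.swap)
  also have "\<dots> = (\<Sum>j\<in>UNIV. \<Sum>k\<in>UNIV. \<Sum>i\<in>UNIV. v $ j * cnj (v $ k) * (adj U $ k $ i * U $ i $ j))"
    by (intro sum.cong refl sum.swap)
  also have "\<dots> = (\<Sum>j\<in>UNIV. \<Sum>k\<in>UNIV. v $ j * cnj (v $ k) * (adj U ** U) $ k $ j)"
    by (simp add: matrix_matrix_mult_def sum_distrib_left)
  also have "\<dots> = (\<Sum>j\<in>UNIV. \<Sum>k\<in>UNIV. if k = j then v $ j * cnj (v $ k) else 0)"
    unfolding unitary_group_adj_mult[OF assms] by (intro sum.cong refl) (auto simp: mat_nth)
  finally show ?thesis by simp
qed

text \<open>The length of an eigenvector is preserved by U and then scaled by the modulus of
  c.\<close>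

lemma cmod_eigenvalue_unitary:
  fixes U :: "complex^'n^'n"
  assumes U: "U \<in> unitary_group" and x: "is_eigenvalues (mat c ** U) x"
  shows "cmod (x i) = cmod c"
proof -
  obtain v where v: "v \<noteq> 0" "(mat c ** U) *v v = x i *s v" using eigenvector_exists[OF x] by blast
  have "(mat c ** U) *v v = c *s (U *v v)"
    by (simp add: vec_eq_iff matrix_vector_mult_def mat_mul_nth sum_distrib_left mult.assoc)
  with v have eq: "c * (U *v v) $ j = x i * v $ j" for j
    by (metis vector_smult_component)
  let ?n = "\<Sum>j\<in>UNIV. (cmod (v $ j))\<^sup>2"
  have n1: "(\<Sum>j\<in>UNIV. v $ j * cnj (v $ j)) = of_real ?n"
    by (simp only: complex_norm_square[symmetric] of_real_sum)
  have n2: "(\<Sum>j\<in>UNIV. (U *v v) $ j * cnj ((U *v v) $ j)) = of_real (\<Sum>j\<in>UNIV. (cmod ((U *v v) $ j))\<^sup>2)"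
    by (simp only: complex_norm_square[symmetric] of_real_sum)
  have same: "(\<Sum>j\<in>UNIV. (cmod ((U *v v) $ j))\<^sup>2) = ?n"
    using unitary_norm_preserving[OF U, of v] unfolding n1 n2 of_real_eq_iff .
  have "(cmod c)\<^sup>2 * (\<Sum>j\<in>UNIV. (cmod ((U *v v) $ j))\<^sup>2) = (cmod (x i))\<^sup>2 * ?n"
    unfolding sum_distrib_left power_mult_distrib[symmetric] norm_mult[symmetric] eq ..
  moreover have "?n > 0"
  proof -
    obtain j where "v $ j \<noteq> 0" using v by (auto simp: vec_eq_iff)
    then show ?thesis by (intro sum_pos2[of _ j]) auto
  qed
  ultimately have "(cmod c)\<^sup>2 = (cmod (x i))\<^sup>2" unfolding same by simp
  then show ?thesis by (simp add: power2_eq_iff_nonneg)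
qed

text \<open>Multiplying by one geometric series at a time, with Cauchy products, gives a bound that
  depends on the points only through \<rho>. It becomes the dominating constant for the integral
  over the unitary group.\<close>

lemma inverse_prod_linear_sums:
  fixes y :: "'i \<Rightarrow> complex"
  assumes "finite A" "\<And>i. i \<in> A \<Longrightarrow> cmod (y i) \<le> \<rho>" "0 \<le> \<rho>" "\<rho> < 1"
  defines "F \<equiv> \<lambda>A. inverse (\<Prod>i\<in>A. 1 - fps_const (y i) * fps_X)"
  shows "summable (\<lambda>m. cmod (fps_nth (F A) m)) \<and> (\<Sum>m. cmod (fps_nth (F A) m)) \<le> (1 / (1 - \<rho>)) ^ card A \<and>
     (\<lambda>m. fps_nth (F A) m) sums inverse (\<Prod>i\<in>A. 1 - y i)"
  using assms(1,2)
proof (induction A)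
  case empty
  have "(\<lambda>m. cmod (fps_nth (F {}) m)) sums cmod (fps_nth (F {}) 0)"
    by (rule sums_finite[of "{0}", simplified]) (simp add: F_def)
  moreover have "(\<lambda>m. fps_nth (F {}) m) sums fps_nth (F {}) 0"
    by (rule sums_finite[of "{0}", simplified]) (simp add: F_def)
  ultimately show ?case by (auto simp: F_def sums_iff)
next
  case (insert a A)
  let ?f = "fps_nth (F A)" and ?g = "\<lambda>m. y a ^ m"
  have IH: "summable (\<lambda>m. cmod (?f m))" "(\<Sum>m. cmod (?f m)) \<le> (1 / (1 - \<rho>)) ^ card A" "?f sums inverse (\<Prod>i\<in>A. 1 - y i)"
    using insert by auto
  have ya: "cmod (y a) \<le> \<rho>" "cmod (y a) < 1" using insert.prems assms by (auto intro: le_less_trans)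
  have g: "summable (\<lambda>m. cmod (?g m))" "?g sums (1 / (1 - y a))" "(\<Sum>m. cmod (?g m)) = 1 / (1 - cmod (y a))"
    using ya by (auto simp: norm_power summable_geometric geometric_sums suminf_geometric)
  have "inverse (1 - fps_const (y a) * fps_X) = Abs_fps ?g"
  proof -
    have "(1 - fps_const (y a) * fps_X) * Abs_fps ?g = 1"
    proof (rule fps_ext)
      fix n
      have "fps_nth ((1 - fps_const (y a) * fps_X) * Abs_fps ?g) n = fps_nth (Abs_fps ?g) n - fps_nth (fps_X * (fps_const (y a) * Abs_fps ?g)) n"
        by (simp add: algebra_simps)
      then show "fps_nth ((1 - fps_const (y a) * fps_X) * Abs_fps ?g) n = fps_nth 1 n"
        by (cases n) auto
    qed
    then show ?thesis by (metis fps_inverse_unique)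
  qed
  then have "F (insert a A) = F A * Abs_fps ?g"
    using insert by (simp add: F_def fps_inverse_mult mult.commute)
  then have nth: "fps_nth (F (insert a A)) m = (\<Sum>i\<le>m. ?f i * ?g (m - i))" for m
    by (simp add: fps_mult_nth atLeast0AtMost)
  have prod: "(\<lambda>m. \<Sum>i\<le>m. cmod (?f i) * cmod (?g (m - i))) sums ((\<Sum>m. cmod (?f m)) * (\<Sum>m. cmod (?g m)))"
    by (intro Cauchy_product_sums) (use IH g in auto)
  have le: "cmod (fps_nth (F (insert a A)) m) \<le> (\<Sum>i\<le>m. cmod (?f i) * cmod (?g (m - i)))" for m
    unfolding nth by (intro order_trans[OF norm_sum]) (simp add: norm_mult)
  have summ: "summable (\<lambda>m. cmod (fps_nth (F (insert a A)) m))"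
    by (rule summable_comparison_test'[OF sums_summable[OF prod], of 0]) (use le in simp)
  have "(\<Sum>m. cmod (fps_nth (F (insert a A)) m)) \<le> (\<Sum>m. cmod (?f m)) * (\<Sum>m. cmod (?g m))"
    using suminf_le[OF le summ sums_summable[OF prod]] sums_unique[OF prod] by simp
  also have "\<dots> \<le> (1 / (1 - \<rho>)) ^ card A * (1 / (1 - \<rho>))"
    unfolding g(3) using IH ya assms
    by (intro mult_mono) (auto intro!: frac_le suminf_nonneg)
  finally have b: "(\<Sum>m. cmod (fps_nth (F (insert a A)) m)) \<le> (1 / (1 - \<rho>)) ^ card (insert a A)"
    using insert by simp
  have "(\<lambda>m. \<Sum>i\<le>m. ?f i * ?g (m - i)) sums ((\<Sum>m. ?f m) * (\<Sum>m. ?g m))"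
    by (intro Cauchy_product_sums IH g)
  also have "(\<Sum>m. ?f m) * (\<Sum>m. ?g m) = inverse (\<Prod>i\<in>insert a A. 1 - y i)"
    using sums_unique[OF IH(3)] sums_unique[OF g(2)] insert by (simp add: divide_inverse)
  finally show ?case using summ b by (simp add: nth[symmetric])
qed

lemma prod_linear_sum:
  fixes y :: "'i \<Rightarrow> complex"
  assumes "finite A" "card A \<le> n"
  shows "(\<Sum>m\<le>n. fps_nth (\<Prod>i\<in>A. 1 - fps_const (y i) * fps_X) m) = (\<Prod>i\<in>A. 1 - y i)"
proof -
  let ?p = "\<Prod>i\<in>A. [:1, - y i:]"
  have "(\<Prod>i\<in>A. 1 - fps_const (y i) * fps_X) = fps_of_poly ?p"
    unfolding fps_of_poly_prod by (intro prod.cong refl) (simp add: fps_of_poly_pCons)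
  moreover have "Polynomial.degree ?p \<le> n"
  proof -
    have "Polynomial.degree ?p \<le> (\<Sum>i\<in>A. Polynomial.degree [:1, - y i:])"
      using degree_prod_sum_le[OF assms(1), of "\<lambda>i. [:1, - y i:]"] by (simp add: o_def)
    also have "\<dots> \<le> (\<Sum>i\<in>A. 1)" by (intro sum_mono) auto
    finally show ?thesis using assms by simp
  qed
  then have "(\<Sum>m\<le>n. Polynomial.coeff ?p m) = poly ?p 1"
    by (simp add: poly_altdef) (intro sum.mono_neutral_right; auto simp: coeff_eq_0)
  ultimately show ?thesis by (simp add: poly_prod)
qed

section \<open>Integrals against \<omega>_r\<close>

context haar_probability
begin

text \<open>By homogeneity only the coefficient whose degree is the sum of M pairs nontrivially with
  M, so this is the termwise integral against the whole series.\<close>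

definition omega_pairing :: "nat \<Rightarrow> nat multiset \<Rightarrow> complex" where
  "omega_pairing r M = (if r dvd sum_mset M then pair M (omega_coeff r (sum_mset M div r)) else 0)"

lemma pair_omega_coeff:
  assumes "r > 0"
  shows "pair M (omega_coeff r m) = (if sum_mset M = r * m then omega_pairing r M else 0)"
  using pair_eq_0[OF homogeneous_omega_coeff, of M r m] assms by (auto simp: omega_pairing_def)

lemma sum_pair_omega_coeff:
  assumes "r > 0"
  shows "(\<Sum>m<n. c m * pair M (omega_coeff r m)) =
    (if sum_mset M div r < n then c (sum_mset M div r) * omega_pairing r M else 0)"
proof (cases "r dvd sum_mset M")
  case True
  then have eq: "pair M (omega_coeff r m) = (if m = sum_mset M div r then omega_pairing r M else 0)" for m
    using assms by (auto simp: pair_omega_coeff)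
  show ?thesis unfolding eq by (simp add: if_distrib[of "\<lambda>x. c _ * x"] cong: if_cong)
next
  case False
  then have "omega_pairing r M = 0" by (simp add: omega_pairing_def)
  then show ?thesis using assms by (simp add: pair_omega_coeff cong: if_cong)
qed

lemma integral_omega_odd:
  assumes "odd r"
  shows "has_bochner_integral \<mu> (\<lambda>U. trace_prod M U * cnj (omega r U)) (omega_pairing r M)"
proof -
  have r: "r > 0" using assms odd_pos by blast
  \<comment> \<open>Large enough both for the degree of the polynomial \<omega>_r and for the single
    coefficient that pairs nontrivially with M.\<close>
  define n where "n = Suc (max (card {S :: 'n set. card S = r}) (sum_mset M div r))"
  have om: "omega r U = (\<Sum>m<n. omega_coeff r m U)" for U :: "complex^'n^'n"
    using assms unfolding n_def lessThan_Suc_atMost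
    by (simp add: omega_eq omega_coeff_def omega_fps_def prod_linear_sum)
  have int: "integrable \<mu> (\<lambda>U. trace_prod M U * cnj (omega_coeff r m U))" for m
    by (rule pair_integrable[OF homogeneous_omega_coeff])
  have "(\<integral>U. trace_prod M U * cnj (omega r U) \<partial>\<mu>) = (\<Sum>m<n. pair M (omega_coeff r m))"
    by (simp add: om pair_def sum_distrib_left int)
  also have "\<dots> = omega_pairing r M"
    using sum_pair_omega_coeff[OF r, of "\<lambda>_. 1" M n] by (simp add: n_def less_Suc_eq_le)
  finally show ?thesis
    by (simp add: has_bochner_integral_iff om sum_distrib_left int)
qed

text \<open>The eigenvalues of t U have modulus t, so the series converges absolutely with a bound
  uniform over the unitary group, and dominated convergence integrates it termwise. Homogeneity
  supplies the power of t.\<close>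

lemma integral_omega_even:
  assumes "even r" "r > 0" "t \<in> {0<..<1::real}"
  shows "has_bochner_integral \<mu> (\<lambda>U. trace_prod M U * cnj (omega r (t *\<^sub>R U))) (of_real t ^ sum_mset M * omega_pairing r M)"
proof -
  define \<rho> where "\<rho> = t ^ r"
  have \<rho>: "0 \<le> \<rho>" "\<rho> < 1" using assms by (auto simp: \<rho>_def power_less_one_iff)
  let ?C = "card {S :: 'n set. card S = r}"
  have scale: "t *\<^sub>R U = mat (of_real t) ** U" for U :: "complex^'n^'n"
    by (simp only: vec_eq_iff mat_mul_nth vector_scaleR_component) (simp add: scaleR_conv_of_real)
  have sums: "summable (\<lambda>m. cmod (omega_coeff r m (t *\<^sub>R U))) \<and>
      (\<Sum>m. cmod (omega_coeff r m (t *\<^sub>R U))) \<le> (1 / (1 - \<rho>)) ^ ?C \<and>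
      (\<lambda>m. omega_coeff r m (t *\<^sub>R U)) sums omega r (t *\<^sub>R U)" if U: "U \<in> unitary_group" for U :: "complex^'n^'n"
  proof -
    have "cmod (eigs (t *\<^sub>R U) i) = t" for i
      using cmod_eigenvalue_unitary[OF U is_eigenvalues_eigs, of "of_real t" i] assms by (simp add: scale)
    then have "cmod (\<Prod>i\<in>S. eigs (t *\<^sub>R U) i) \<le> \<rho>" if "S \<in> {S. card S = r}" for S
      using that by (simp add: \<rho>_def prod_norm[symmetric])
    from inverse_prod_linear_sums[of "{S :: 'n set. card S = r}" _ \<rho>, OF _ this \<rho>] assms
    show ?thesis by (simp add: omega_eq omega_coeff_def omega_fps_def)
  qed
  have hom: "omega_coeff r m (t *\<^sub>R U) = of_real t ^ (r * m) * omega_coeff r m U" for m and U :: "complex^'n^'n"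
    unfolding scale by (rule homogeneous_mat_mul[OF homogeneous_omega_coeff])
  define s where "s n U = trace_prod M U * cnj (\<Sum>m<n. omega_coeff r m (t *\<^sub>R U))" for n and U :: "complex^'n^'n"
  have s_eq: "s n U = (\<Sum>m<n. of_real t ^ (r * m) * (trace_prod M U * cnj (omega_coeff r m U)))" for n U
    by (simp add: s_def hom sum_distrib_left mult_ac)
  have int: "integrable \<mu> (\<lambda>U. trace_prod M U * cnj (omega_coeff r m U))" for m
    by (rule pair_integrable[OF homogeneous_omega_coeff])
  have s_int: "integrable \<mu> (s n)" for n unfolding s_eq[abs_def] by (simp add: int)
  obtain B where B: "\<And>U :: complex^'n^'n. U \<in> unitary_group \<Longrightarrow> cmod (trace_prod M U) \<le> B"
    using bounded_on_unitary_group[OF continuous_trace_prod, of M] by blast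
  let ?f = "\<lambda>U :: complex^'n^'n. trace_prod M U * cnj (omega r (t *\<^sub>R U))"
  have lim: "(\<lambda>n. s n U) \<longlonglongrightarrow> ?f U" if "U \<in> unitary_group" for U
    unfolding s_def using sums[OF that] unfolding sums_def by (intro tendsto_mult tendsto_const tendsto_cnj) blast
  have bound: "cmod (s n U) \<le> B * (1 / (1 - \<rho>)) ^ ?C" if U: "U \<in> unitary_group" for n U
  proof -
    have "cmod (\<Sum>m<n. omega_coeff r m (t *\<^sub>R U)) \<le> (\<Sum>m<n. cmod (omega_coeff r m (t *\<^sub>R U)))"
      by (rule norm_sum)
    also have "\<dots> \<le> (\<Sum>m. cmod (omega_coeff r m (t *\<^sub>R U)))"
      using sums[OF U] by (intro sum_le_suminf) auto
    also have "\<dots> \<le> (1 / (1 - \<rho>)) ^ ?C" using sums[OF U] by blast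
    finally have "cmod (\<Sum>m<n. omega_coeff r m (t *\<^sub>R U)) \<le> (1 / (1 - \<rho>)) ^ ?C" .
    then show ?thesis
      unfolding s_def norm_mult complex_mod_cnj using B[OF U]
      by (intro mult_mono) (use order_trans[OF norm_ge_zero B[OF U]] in auto)
  qed
  have f_meas: "?f \<in> borel_measurable \<mu>"
    by (rule borel_measurable_LIMSEQ_metric[of s]) (use s_int lim in \<open>auto simp: space_haar\<close>)
  have AE1: "AE U in \<mu>. (\<lambda>n. s n U) \<longlonglongrightarrow> ?f U" by (rule AE_I2) (simp add: lim space_haar)
  have AE2: "AE U in \<mu>. cmod (s n U) \<le> B * (1 / (1 - \<rho>)) ^ ?C" for n
    by (rule AE_I2) (simp only: bound space_haar)
  have s_meas: "s n \<in> borel_measurable \<mu>" for n using s_int by auto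
  note dct = f_meas s_meas integrable_const[of "B * (1 / (1 - \<rho>)) ^ ?C"] AE1 AE2
  have "integrable \<mu> ?f" by (rule integrable_dominated_convergence[OF dct])
  moreover have "integral\<^sup>L \<mu> ?f = of_real t ^ sum_mset M * omega_pairing r M"
  proof -
    have "(\<lambda>n. integral\<^sup>L \<mu> (s n)) \<longlonglongrightarrow> integral\<^sup>L \<mu> ?f"
      by (rule integral_dominated_convergence[OF dct])
    moreover have "integral\<^sup>L \<mu> (s n) = of_real t ^ sum_mset M * omega_pairing r M" if "n > sum_mset M div r" for n
    proof -
      have "integral\<^sup>L \<mu> (s n) = (\<Sum>m<n. of_real t ^ (r * m) * pair M (omega_coeff r m))"
        unfolding s_eq[abs_def] by (simp add: int pair_def)
      also have "\<dots> = of_real t ^ (r * (sum_mset M div r)) * omega_pairing r M"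
        using sum_pair_omega_coeff[OF assms(2), of "\<lambda>m. of_real t ^ (r * m)" M n] that by simp
      also have "\<dots> = of_real t ^ sum_mset M * omega_pairing r M"
        by (cases "r dvd sum_mset M") (auto simp: omega_pairing_def)
      finally show ?thesis .
    qed
    then have "(\<lambda>n. integral\<^sup>L \<mu> (s n)) \<longlonglongrightarrow> of_real t ^ sum_mset M * omega_pairing r M"
      by (intro tendsto_eventually) (auto simp: eventually_sequentially intro!: exI[of _ "Suc (sum_mset M div r)"])
    ultimately show ?thesis using LIMSEQ_unique by blast
  qed
  ultimately show ?thesis by (simp add: has_bochner_integral_iff)
qed

lemma has_omega_integral_trace_prod:
  assumes "r > 0"
  shows "has_omega_integral \<mu> r (trace_prod M) (omega_pairing r M)"
proof (cases "odd r")
  case True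
  then show ?thesis by (simp add: has_omega_integral_def integral_omega_odd)
next
  case False
  have "((\<lambda>t. complex_of_real t ^ sum_mset M * omega_pairing r M) \<longlongrightarrow>
      complex_of_real 1 ^ sum_mset M * omega_pairing r M) (at_left 1)"
    by (intro tendsto_intros)
  with False assms integral_omega_even[of r _ M] show ?thesis
    unfolding has_omega_integral_def
    by (auto intro!: exI[of _ "\<lambda>t. complex_of_real t ^ sum_mset M * omega_pairing r M"])
qed

lemma omega_pairing_empty: "omega_pairing r (parts p {}) = 1"
proof -
  have "(omega_coeff r 0 :: complex^'n^'n \<Rightarrow> complex) = (\<lambda>_. 1)" by (auto simp: omega_coeff_0)
  then show ?thesis by (simp add: omega_pairing_def parts_def pair_def prob_space)
qed

text \<open>The recursion for the coefficients of \<omega>_r is paired with the parts; each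
  \<open>echar k r\<close> removes a block of total size k r by \<open>pair_echar_mult\<close>. The
  bound by \<open>CARD('n)\<close> keeps all moments in the range of
  \<open>mom_eq_hall\<close>.\<close>

theorem omega_pairing_rec:
  assumes "finite A" "\<And>a. a \<in> A \<Longrightarrow> p a > 0" "r > 0" "sum p A = r * m" "r * m \<le> CARD('n)"
  shows "of_nat m * omega_pairing r (parts p A) =
    (\<Sum>k=1..m. \<Sum>B | B \<subseteq> A \<and> (\<forall>b\<in>B. k dvd p b) \<and> sum p B = k * r.
        (- of_nat k) ^ card B * omega_pairing r (parts p (A - B)))"
proof (cases "m = 0")
  case False
  have hom: "homogeneous (r * m) (\<lambda>U :: complex^'n^'n. echar k r U * omega_coeff r (m - k) U)" if "k \<in> {1..m}" for k
  proof -
    have "k * r + r * (m - k) = r * m"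
      using that by (simp add: mult.commute[of k r] distrib_left[symmetric])
    with homogeneous_mult[OF homogeneous_echar[of k r] homogeneous_omega_coeff[of r "m - k"]] that show ?thesis by simp
  qed
  have "of_nat m * omega_pairing r (parts p A) = of_nat m * pair (parts p A) (omega_coeff r m)"
    using assms by (simp add: omega_pairing_def sum_mset_parts)
  also have "\<dots> = of_nat m * pair (parts p A) (\<lambda>U. (1 / of_nat m) * (\<Sum>k=1..m. echar k r U * omega_coeff r (m - k) U))"
    using False by (simp only: omega_coeff_rec'[symmetric] neq0_conv)
  also have "\<dots> = (\<Sum>k=1..m. pair (parts p A) (\<lambda>U. echar k r U * omega_coeff r (m - k) U))"
    unfolding pair_scale using False hom by (subst pair_sum) auto
  also have "\<dots> = (\<Sum>k=1..m. \<Sum>B | B \<subseteq> A \<and> (\<forall>b\<in>B. k dvd p b) \<and> sum p B = k * r.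
        (- of_nat k) ^ card B * omega_pairing r (parts p (A - B)))"
  proof (intro sum.cong refl)
    fix k assume k: "k \<in> {1..m}"
    have eq: "r * m = k * r + r * (m - k)"
      using k by (simp add: mult.commute[of k r] distrib_left[symmetric])
    have "pair (parts p A) (\<lambda>U. echar k r U * omega_coeff r (m - k) U) =
      (\<Sum>B | B \<subseteq> A \<and> (\<forall>b\<in>B. k dvd p b) \<and> sum p B = k * r. (- of_nat k) ^ card B * pair (parts p (A - B)) (omega_coeff r (m - k)))"
      using k assms eq by (intro pair_echar_mult[OF _ _ _ homogeneous_omega_coeff]) auto
    also have "\<dots> = (\<Sum>B | B \<subseteq> A \<and> (\<forall>b\<in>B. k dvd p b) \<and> sum p B = k * r.
        (- of_nat k) ^ card B * omega_pairing r (parts p (A - B)))"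
    proof (intro sum.cong refl arg_cong2[of _ _ _ _ "(*)"])
      fix B assume B: "B \<in> {B. B \<subseteq> A \<and> (\<forall>b\<in>B. k dvd p b) \<and> sum p B = k * r}"
      then have "sum p A = sum p B + sum p (A - B)"
        using assms(1) by (metis (mono_tags, lifting) add.commute mem_Collect_eq sum.subset_diff)
      then have "sum p (A - B) = r * (m - k)" using B assms(4) eq by simp
      then show "pair (parts p (A - B)) (omega_coeff r (m - k)) = omega_pairing r (parts p (A - B))"
        using assms(3) by (simp add: pair_omega_coeff sum_mset_parts)
    qed
    finally show "pair (parts p A) (\<lambda>U. echar k r U * omega_coeff r (m - k) U) =
       (\<Sum>B | B \<subseteq> A \<and> (\<forall>b\<in>B. k dvd p b) \<and> sum p B = k * r.
        (- of_nat k) ^ card B * omega_pairing r (parts p (A - B)))" .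
  qed
  finally show ?thesis .
qed simp

lemma omega_pairing_not_dvd: "\<not> r dvd sum p A \<Longrightarrow> omega_pairing r (parts p A) = 0"
  by (simp add: omega_pairing_def sum_mset_parts)

end

subsection \<open>Arithmetic of abstract primes with degrees\<close>

definition mset_deg :: "('p \<Rightarrow> nat) \<Rightarrow> 'p multiset \<Rightarrow> nat" where
  "mset_deg dg G = (\<Sum>P\<in>#G. dg P)"

definition msets_of_deg :: "('p \<Rightarrow> nat) \<Rightarrow> 'p set \<Rightarrow> nat \<Rightarrow> 'p multiset set" where
  "msets_of_deg dg S n = {G. set_mset G \<subseteq> S \<and> mset_deg dg G = n}"

lemma mset_deg_simps [simp]:
  "mset_deg dg {#} = 0" "mset_deg dg (add_mset P G) = dg P + mset_deg dg G"
  "mset_deg dg (G + H) = mset_deg dg G + mset_deg dg H"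
  "mset_deg dg (replicate_mset n P) = n * dg P"
  by (simp_all add: mset_deg_def)

lemma mset_deg_eq_sum_count: "mset_deg dg G = (\<Sum>P\<in>set_mset G. count G P * dg P)"
proof (induction G)
  case (add P G)
  have *: "mset_deg dg G = (\<Sum>P\<in>insert P (set_mset G). count G P * dg P)"
    unfolding add.IH by (intro sum.mono_neutral_left) (auto simp: not_in_iff)
  have "(\<Sum>Q\<in>set_mset (add_mset P G). count (add_mset P G) Q * dg Q) =
      (\<Sum>Q\<in>insert P (set_mset G). (if Q = P then dg Q else 0) + count G Q * dg Q)"
    by (intro sum.cong) auto
  then show ?case by (simp add: sum.distrib *)
qed simp

text \<open>Monic polynomials become multisets of primes. That there are q^n of them in degree n is
  the arithmetic input for all prime counts.\<close>

locale prime_system =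
  fixes q :: nat and Pr :: "'p set" and dg :: "'p \<Rightarrow> nat"
  assumes q_ge_2: "q \<ge> 2"
    and dg_pos: "P \<in> Pr \<Longrightarrow> dg P > 0"
    and card_msets_of_deg: "card (msets_of_deg dg Pr n) = q ^ n"
begin

abbreviation mon :: "nat \<Rightarrow> 'p multiset set" where
  "mon n \<equiv> msets_of_deg dg Pr n"

lemma finite_mon: "finite (mon n)"
proof -
  have "card (mon n) \<noteq> 0" using card_msets_of_deg[of n] q_ge_2 by simp
  then show ?thesis by (meson card.infinite)
qed

lemma finite_primes_of_deg: "finite {P \<in> Pr. dg P = e}"
proof -
  have "(\<lambda>P. {#P#}) ` {P \<in> Pr. dg P = e} \<subseteq> mon e"
    by (auto simp: msets_of_deg_def)
  then have "finite ((\<lambda>P. {#P#}) ` {P \<in> Pr. dg P = e})" using finite_mon finite_subset by blast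
  then show ?thesis by (rule finite_imageD) (auto simp: inj_on_def)
qed

lemma finite_primes_dvd: "n > 0 \<Longrightarrow> finite {P \<in> Pr. dg P dvd n}"
  by (rule finite_subset[of _ "\<Union>e\<in>{..n}. {P \<in> Pr. dg P = e}"])
     (auto simp: finite_primes_of_deg dest: dvd_imp_le)

text \<open>The sum of \<Lambda>(F) h(F) over F of degree j: a prime power P^m of degree j is given
  by P alone, with m = j / deg P.\<close>

definition prime_power_sum :: "('p \<Rightarrow> complex) \<Rightarrow> nat \<Rightarrow> complex" where
  "prime_power_sum h j = (\<Sum>P | P \<in> Pr \<and> dg P dvd j. of_nat (dg P) * h P ^ (j div dg P))"

text \<open>Both sides count the pairs of a multiset \<open>G\<close> of degree \<open>n\<close> and a power of a prime dividing it.\<close>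

lemma newton_character_sum:
  "of_nat n * (\<Sum>G\<in>mon n. \<Prod>P\<in>#G. h P) =
     (\<Sum>j=1..n. prime_power_sum h j * (\<Sum>G\<in>mon (n - j). \<Prod>P\<in>#G. h P))"
proof -
  let ?h = "\<lambda>G. \<Prod>P\<in>#G. h P"
  let ?T = "SIGMA G:mon n. SIGMA P:set_mset G. {1..count G P}"
  let ?R = "SIGMA j:{1..n}. SIGMA P:{P. P \<in> Pr \<and> dg P dvd j}. mon (n - j)"
  have "of_nat n * (\<Sum>G\<in>mon n. ?h G) = (\<Sum>G\<in>mon n. \<Sum>P\<in>set_mset G. \<Sum>v\<in>{1..count G P}. of_nat (dg P) * ?h G)"
    unfolding sum_distrib_left
  proof (intro sum.cong refl)
    fix G assume "G \<in> mon n"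
    then have "n = (\<Sum>P\<in>set_mset G. count G P * dg P)"
      by (simp add: msets_of_deg_def mset_deg_eq_sum_count)
    then have "of_nat n = (\<Sum>P\<in>set_mset G. of_nat (count G P) * (of_nat (dg P) :: complex))" by simp
    then show "of_nat n * ?h G = (\<Sum>P\<in>set_mset G. \<Sum>v\<in>{1..count G P}. of_nat (dg P) * ?h G)"
      by (simp add: sum_distrib_right mult.assoc)
  qed
  also have "\<dots> = (\<Sum>(G, P, v)\<in>?T. of_nat (dg P) * ?h G)"
    using finite_mon by (simp add: sum.Sigma del: sum_constant)
  also have "\<dots> = (\<Sum>(j, P, G)\<in>?R. of_nat (dg P) * h P ^ (j div dg P) * ?h G)"
  proof (rule sum.reindex_bij_witness[where j = "\<lambda>(G, P, v). (v * dg P, P, G - replicate_mset v P)"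
        and i = "\<lambda>(j, P, G). (G + replicate_mset (j div dg P) P, P, j div dg P)"])
    fix x assume "x \<in> ?T"
    then obtain G P v where x: "x = (G, P, v)" "G \<in> mon n" "P \<in># G" "1 \<le> v" "v \<le> count G P" by auto
    then have P: "P \<in> Pr" "dg P > 0" using dg_pos by (auto simp: msets_of_deg_def)
    obtain H where H: "G = H + replicate_mset v P"
      using x(5) by (metis count_le_replicate_mset_subset_eq subset_mset.diff_add)
    show "(case case x of (G, P, v) \<Rightarrow> (v * dg P, P, G - replicate_mset v P) of
          (j, P, G) \<Rightarrow> (G + replicate_mset (j div dg P) P, P, j div dg P)) = x"
      using x P H by simp
    have "v * dg P \<le> n" "mset_deg dg H = n - v * dg P" "set_mset H \<subseteq> Pr"
      using x H by (auto simp: msets_of_deg_def)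
    moreover have "1 \<le> v * dg P" using x P by (simp add: Suc_le_eq)
    ultimately show "(case x of (G, P, v) \<Rightarrow> (v * dg P, P, G - replicate_mset v P)) \<in> ?R"
      using x P H by (auto simp: msets_of_deg_def)
    show "(case case x of (G, P, v) \<Rightarrow> (v * dg P, P, G - replicate_mset v P) of
          (j, P, G) \<Rightarrow> of_nat (dg P) * h P ^ (j div dg P) * ?h G) = (case x of (G, P, v) \<Rightarrow> of_nat (dg P) * ?h G)"
      using x P H by (simp add: image_replicate_mset)
  next
    fix y assume "y \<in> ?R"
    then obtain j P G where y: "y = (j, P, G)" "1 \<le> j" "j \<le> n" "P \<in> Pr" "dg P dvd j" "G \<in> mon (n - j)" by auto
    have P: "dg P > 0" using dg_pos y by auto
    obtain v where v: "j = v * dg P" using y(5) by (metis dvd_div_mult_self)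
    have "v > 0" using v y(2) by (cases v) auto
    show "(case case y of (j, P, G) \<Rightarrow> (G + replicate_mset (j div dg P) P, P, j div dg P) of
          (G, P, v) \<Rightarrow> (v * dg P, P, G - replicate_mset v P)) = y"
      using y P v by simp
    show "(case y of (j, P, G) \<Rightarrow> (G + replicate_mset (j div dg P) P, P, j div dg P)) \<in> ?T"
      using y P v \<open>v > 0\<close> by (auto simp: msets_of_deg_def split: if_splits)
  qed
  also have "\<dots> = (\<Sum>j=1..n. \<Sum>P | P \<in> Pr \<and> dg P dvd j. \<Sum>G\<in>mon (n - j). of_nat (dg P) * h P ^ (j div dg P) * ?h G)"
    using finite_mon finite_primes_dvd by (simp add: sum.Sigma)
  finally show ?thesis by (simp add: prime_power_sum_def sum_product)
qed

text \<open>The Newton recurrence for the trivial character. By induction each of the terms j < n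
  equals q^n, which leaves q^n for j = n.\<close>

lemma sum_dg_primes: "n > 0 \<Longrightarrow> (\<Sum>P | P \<in> Pr \<and> dg P dvd n. dg P) = q ^ n"
proof (induction n rule: less_induct)
  case (less n)
  define L where "L j = (\<Sum>P | P \<in> Pr \<and> dg P dvd j. dg P)" for j
  have L: "prime_power_sum (\<lambda>_. 1) j = of_nat (L j)" for j by (simp add: prime_power_sum_def L_def)
  have "(of_nat (n * q ^ n) :: complex) = of_nat (\<Sum>j=1..n. L j * q ^ (n - j))"
    using newton_character_sum[of n "\<lambda>_. 1"] by (simp add: L card_msets_of_deg)
  then have "n * q ^ n = (\<Sum>j=1..n. L j * q ^ (n - j))" using of_nat_eq_iff by blast
  also have "{1..n} = insert n {1..<n}" using less.prems by auto
  also have "(\<Sum>j\<in>insert n {1..<n}. L j * q ^ (n - j)) = L n + (\<Sum>j=1..<n. L j * q ^ (n - j))"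
    by simp
  also have "(\<Sum>j=1..<n. L j * q ^ (n - j)) = (\<Sum>j=1..<n. q ^ n)"
  proof (intro sum.cong refl)
    fix j assume "j \<in> {1..<n}"
    then show "L j * q ^ (n - j) = q ^ n" using less.IH[of j] by (simp add: L_def power_add[symmetric])
  qed
  also have "\<dots> = (n - 1) * q ^ n" by simp
  finally have "L n + (n - 1) * q ^ n = n * q ^ n" by simp
  moreover have "n * q ^ n = q ^ n + (n - 1) * q ^ n" using less.prems by (cases n) auto
  ultimately show ?case by (simp add: L_def)
qed

definition prime_count :: "nat \<Rightarrow> nat" where
  "prime_count e = card {P \<in> Pr. dg P = e}"

lemma prime_count_le: "e > 0 \<Longrightarrow> e * prime_count e \<le> q ^ e"
proof -
  assume e: "e > 0"
  have "e * prime_count e = (\<Sum>P | P \<in> Pr \<and> dg P = e. dg P)" by (simp add: prime_count_def)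
  also have "\<dots> \<le> (\<Sum>P | P \<in> Pr \<and> dg P dvd e. dg P)"
    by (intro sum_mono2 finite_primes_dvd e) auto
  finally show ?thesis using sum_dg_primes[OF e] by simp
qed

lemma prime_count_le': "e > 0 \<Longrightarrow> prime_count e \<le> q ^ e"
  using prime_count_le[of e] by (metis dual_order.trans le_square mult.commute mult_le_cancel2 mult_le_mono2 nat_mult_1 One_nat_def Suc_leI)

lemma card_small_primes: "card {P \<in> Pr. dg P < k} \<le> k * q ^ (k - 1)"
proof -
  have "{P \<in> Pr. dg P < k} = (\<Union>e\<in>{1..<k}. {P \<in> Pr. dg P = e})"
    using dg_pos by (auto simp: Suc_le_eq)
  then have "card {P \<in> Pr. dg P < k} \<le> (\<Sum>e\<in>{1..<k}. prime_count e)"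
    by (simp add: card_UN_le prime_count_def)
  also have "\<dots> \<le> (\<Sum>e\<in>{1..<k}. q ^ (k - 1))"
  proof (intro sum_mono)
    fix e assume "e \<in> {1..<k}"
    then have "e > 0" "e \<le> k - 1" by auto
    then show "prime_count e \<le> q ^ (k - 1)"
      using prime_count_le'[of e] power_increasing[of e "k - 1" q] q_ge_2 by linarith
  qed
  also have "\<dots> \<le> k * q ^ (k - 1)" by simp
  finally show ?thesis .
qed

lemma finite_small_primes: "finite {P \<in> Pr. dg P < k}"
  by (rule finite_subset[of _ "\<Union>e\<in>{..<k}. {P \<in> Pr. dg P = e}"]) (auto simp: finite_primes_of_deg)

text \<open>The proper divisors of k are replaced by all degrees below k; each contributes at most
  q^(k-1), which is crude but still saves a factor q.\<close>

lemma prime_count_ge: "k > 0 \<Longrightarrow> q ^ k \<le> k * prime_count k + k * q ^ (k - 1)"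
proof -
  assume k: "k > 0"
  have "q ^ k = (\<Sum>P | P \<in> Pr \<and> dg P dvd k. dg P)" using sum_dg_primes[OF k] by simp
  also have "\<dots> \<le> (\<Sum>P\<in>{P \<in> Pr. dg P = k} \<union> (\<Union>e\<in>{1..<k}. {P \<in> Pr. dg P = e}). dg P)"
  proof (intro sum_mono2)
    show "{P. P \<in> Pr \<and> dg P dvd k} \<subseteq> {P \<in> Pr. dg P = k} \<union> (\<Union>e\<in>{1..<k}. {P \<in> Pr. dg P = e})"
      using dg_pos k by (auto simp: Suc_le_eq le_neq_implies_less dvd_imp_le)
  qed (auto simp: finite_primes_of_deg)
  also have "\<dots> \<le> (\<Sum>P | P \<in> Pr \<and> dg P = k. dg P) + (\<Sum>P\<in>(\<Union>e\<in>{1..<k}. {P \<in> Pr. dg P = e}). dg P)"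
    by (subst sum.union_disjoint) (auto simp: finite_primes_of_deg)
  also have "(\<Sum>P\<in>(\<Union>e\<in>{1..<k}. {P \<in> Pr. dg P = e}). dg P) = (\<Sum>e\<in>{1..<k}. e * prime_count e)"
    by (subst sum.UNION_disjoint) (auto simp: finite_primes_of_deg prime_count_def intro!: sum.cong)
  also have "\<dots> \<le> (\<Sum>e\<in>{1..<k}. q ^ (k - 1))"
  proof (intro sum_mono)
    fix e assume "e \<in> {1..<k}"
    then have "e > 0" "e \<le> k - 1" by auto
    then show "e * prime_count e \<le> q ^ (k - 1)"
      using prime_count_le[of e] power_increasing[of e "k - 1" q] q_ge_2 by linarith
  qed
  also have "\<dots> \<le> k * q ^ (k - 1)" by simp
  finally show ?thesis by (simp add: prime_count_def mult.commute)
qed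

end

subsection \<open>Generating functions and power-free multisets\<close>

definition mset_gf :: "('p \<Rightarrow> nat) \<Rightarrow> ('p \<Rightarrow> complex) \<Rightarrow> 'p set \<Rightarrow> complex fps" where
  "mset_gf dg h S = Abs_fps (\<lambda>n. \<Sum>G\<in>msets_of_deg dg S n. \<Prod>P\<in>#G. h P)"

text \<open>Subtracting the multisets that contain P amounts to multiplying by the inverse of the
  Euler factor at P.\<close>

lemma mset_gf_remove:
  assumes "P \<in> S" "dg P > 0" and fin: "\<And>n. finite (msets_of_deg dg S n)"
  shows "mset_gf dg h (S - {P}) = (1 - fps_const (h P) * fps_X ^ dg P) * mset_gf dg h S"
proof (rule fps_ext)
  fix n
  let ?h = "\<lambda>G. \<Prod>P\<in>#G. h P"
  have "fps_nth ((1 - fps_const (h P) * fps_X ^ dg P) * mset_gf dg h S) n =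
     fps_nth (mset_gf dg h S) n - h P * fps_nth (fps_X ^ dg P * mset_gf dg h S) n"
    by (simp add: left_diff_distrib mult.assoc)
  also have "h P * fps_nth (fps_X ^ dg P * mset_gf dg h S) n = (\<Sum>G\<in>{G \<in> msets_of_deg dg S n. P \<in># G}. ?h G)"
  proof (cases "n < dg P")
    case True
    have "{G \<in> msets_of_deg dg S n. P \<in># G} = {}"
      using True by (auto simp: msets_of_deg_def dest!: multi_member_split)
    then show ?thesis using True by (simp only:) (simp add: fps_X_power_mult_nth)
  next
    case False
    have "(\<Sum>G\<in>{G \<in> msets_of_deg dg S n. P \<in># G}. ?h G) = (\<Sum>G\<in>msets_of_deg dg S (n - dg P). ?h (add_mset P G))"
    proof (rule sum.reindex_bij_witness[where i = "add_mset P" and j = "\<lambda>G. G - {#P#}"])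
      fix G assume G: "G \<in> {G \<in> msets_of_deg dg S n. P \<in># G}"
      then obtain H where "G = add_mset P H" by (auto dest: multi_member_split)
      with G show "G - {#P#} \<in> msets_of_deg dg S (n - dg P)" by (auto simp: msets_of_deg_def)
    qed (use assms False in \<open>auto simp: msets_of_deg_def\<close>)
    then show ?thesis
      using False by (simp add: fps_X_power_mult_nth mset_gf_def sum_distrib_left)
  qed
  also have "fps_nth (mset_gf dg h S) n - (\<Sum>G\<in>{G \<in> msets_of_deg dg S n. P \<in># G}. ?h G) =
     (\<Sum>G\<in>msets_of_deg dg S n - {G \<in> msets_of_deg dg S n. P \<in># G}. ?h G)"
    using fin by (simp add: mset_gf_def sum_diff)
  also have "msets_of_deg dg S n - {G \<in> msets_of_deg dg S n. P \<in># G} = msets_of_deg dg (S - {P}) n"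
    by (auto simp: msets_of_deg_def)
  finally show "fps_nth (mset_gf dg h (S - {P})) n = fps_nth ((1 - fps_const (h P) * fps_X ^ dg P) * mset_gf dg h S) n"
    by (simp add: mset_gf_def)
qed

lemma msets_of_deg_mono: "S \<subseteq> S' \<Longrightarrow> msets_of_deg dg S n \<subseteq> msets_of_deg dg S' n"
  by (auto simp: msets_of_deg_def)

lemma mset_gf_diff:
  assumes "finite T" "T \<subseteq> S" "\<And>P. P \<in> T \<Longrightarrow> dg P > 0" and fin: "\<And>n. finite (msets_of_deg dg S n)"
  shows "mset_gf dg h (S - T) = (\<Prod>P\<in>T. 1 - fps_const (h P) * fps_X ^ dg P) * mset_gf dg h S"
  using assms(1-3)
proof (induction T)
  case (insert P T)
  have "S - insert P T = (S - T) - {P}" by auto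
  then have "mset_gf dg h (S - insert P T) = (1 - fps_const (h P) * fps_X ^ dg P) * mset_gf dg h (S - T)"
    using insert finite_subset[OF msets_of_deg_mono fin, of "S - T"]
    by (simp only:) (intro mset_gf_remove, auto)
  also have "mset_gf dg h (S - T) = (\<Prod>P\<in>T. 1 - fps_const (h P) * fps_X ^ dg P) * mset_gf dg h S"
    using insert by auto
  finally show ?case using insert by (simp add: mult.assoc)
qed simp

definition power_free :: "nat \<Rightarrow> 'p multiset \<Rightarrow> bool" where
  "power_free r G \<longleftrightarrow> (\<forall>P. count G P < r)"

definition power_free_gf :: "('p \<Rightarrow> nat) \<Rightarrow> ('p \<Rightarrow> complex) \<Rightarrow> 'p set \<Rightarrow> nat \<Rightarrow> complex fps" where
  "power_free_gf dg h S r = Abs_fps (\<lambda>n. \<Sum>G\<in>{G \<in> msets_of_deg dg S n. power_free r G}. \<Prod>P\<in>#G. h P)"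

lemma prod_mset_repeat: "(\<Prod>P\<in>#repeat_mset r B. h P) = (\<Prod>P\<in>#B. h P :: complex) ^ r"
  by (induction B) (auto simp: power_mult_distrib)

lemma in_repeat_mset_iff: "P \<in># repeat_mset r B \<longleftrightarrow> r > 0 \<and> P \<in># B"
  by (simp flip: count_greater_zero_iff)

lemma mset_deg_repeat: "mset_deg dg (repeat_mset r B) = r * mset_deg dg B"
  by (induction B) (auto simp: algebra_simps)

text \<open>Every multiset is uniquely \<open>H + r B\<close> with \<open>H\<close> power-free.\<close>

lemma mset_gf_power_free:
  assumes fin: "\<And>n. finite (msets_of_deg dg S n)" and dg: "\<And>P. P \<in> S \<Longrightarrow> dg P > 0"
    and r: "r > 0" and h: "\<And>P. P \<in> S \<Longrightarrow> h P ^ r = 1"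
  shows "mset_gf dg h S = power_free_gf dg h S r * mset_gf (\<lambda>P. r * dg P) (\<lambda>_. 1) S"
proof (rule fps_ext)
  fix n
  let ?h = "\<lambda>G. \<Prod>P\<in>#G. h P"
  let ?dg' = "\<lambda>P. r * dg P"
  have dg': "mset_deg ?dg' B = r * mset_deg dg B" for B
    by (simp add: mset_deg_def sum_mset_distrib_left)
  have fin': "finite (msets_of_deg ?dg' S n)" for n
    by (rule finite_subset[OF _ fin[of "n div r"]]) (use r in \<open>auto simp: msets_of_deg_def dg'\<close>)
  let ?R = "SIGMA i:{0..n}. {G \<in> msets_of_deg dg S i. power_free r G} \<times> msets_of_deg ?dg' S (n - i)"
  define fm :: "'a multiset \<Rightarrow> 'a multiset" where "fm G = Abs_multiset (\<lambda>P. count G P mod r)" for G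
  define fd :: "'a multiset \<Rightarrow> 'a multiset" where "fd G = Abs_multiset (\<lambda>P. count G P div r)" for G
  have cm: "count (fm G) P = count G P mod r" for G P
  proof -
    have "{x. 0 < count G x mod r} \<subseteq> set_mset G"
      by (auto simp: not_in_iff intro: ccontr)
    then show ?thesis
      unfolding fm_def by (subst Abs_multiset_inverse) (auto intro: finite_subset)
  qed
  have cd: "count (fd G) P = count G P div r" for G P
  proof -
    have "{x. 0 < count G x div r} \<subseteq> set_mset G"
      by (auto simp: not_in_iff intro: ccontr)
    then show ?thesis
      unfolding fd_def by (subst Abs_multiset_inverse) (auto intro: finite_subset)
  qed
  have split: "G = fm G + repeat_mset r (fd G)" for G by (rule multiset_eqI) (simp add: cm cd)
  have subset: "set_mset (fm G) \<subseteq> set_mset G" "set_mset (fd G) \<subseteq> set_mset G" for G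
    using cm cd by (metis mod_0 div_0 count_eq_zero_iff subsetI)+
  have "fps_nth (power_free_gf dg h S r * mset_gf ?dg' (\<lambda>_. 1) S) n =
     (\<Sum>i=0..n. \<Sum>H\<in>{G \<in> msets_of_deg dg S i. power_free r G}. \<Sum>B\<in>msets_of_deg ?dg' S (n - i). ?h H)"
    unfolding fps_mult_nth
    by (simp add: power_free_gf_def mset_gf_def sum_distrib_right) (intro sum.cong refl mult.commute)
  also have "\<dots> = (\<Sum>(i, H, B)\<in>?R. ?h H)"
    using fin fin' by (simp add: sum.Sigma sum.cartesian_product split_beta del: sum_constant)
  also have "\<dots> = (\<Sum>G\<in>msets_of_deg dg S n. ?h G)"
  proof (rule sum.reindex_bij_witness[where i = "\<lambda>G. (mset_deg dg (fm G), fm G, fd G)" and j = "\<lambda>(i, H, B). H + repeat_mset r B"])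
    fix x assume "x \<in> ?R"
    then obtain i H B where x: "x = (i, H, B)" "i \<le> n" "H \<in> msets_of_deg dg S i" "power_free r H" "B \<in> msets_of_deg ?dg' S (n - i)"
      by auto
    have "fm (H + repeat_mset r B) = H" "fd (H + repeat_mset r B) = B"
      using x r by (auto intro!: multiset_eqI simp: cm cd power_free_def)
    with x show "(case case x of (i, H, B) \<Rightarrow> H + repeat_mset r B of G \<Rightarrow> (mset_deg dg (fm G), fm G, fd G)) = x"
      by (simp add: msets_of_deg_def)
    show "(case x of (i, H, B) \<Rightarrow> H + repeat_mset r B) \<in> msets_of_deg dg S n"
      using x by (auto simp: msets_of_deg_def dg' mset_deg_repeat in_repeat_mset_iff)
    \<comment> \<open>The values are r-th roots of unity on S, so the part r B contributes trivially
      and its generating series is that of the trivial character in the degrees r deg P.\<close>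
    have "?h B ^ r = 1"
    proof -
      have "set_mset B \<subseteq> S" using x by (auto simp: msets_of_deg_def)
      then show ?thesis using h by (induction B) (auto simp: power_mult_distrib)
    qed
    then show "?h (case x of (i, H, B) \<Rightarrow> H + repeat_mset r B) = (case x of (i, H, B) \<Rightarrow> ?h H)"
      using x by (simp add: prod_mset_repeat)
  next
    fix G assume G: "G \<in> msets_of_deg dg S n"
    show "(case (mset_deg dg (fm G), fm G, fd G) of (i, H, B) \<Rightarrow> H + repeat_mset r B) = G"
      using split[of G] by simp
    have "mset_deg dg (fm G) + r * mset_deg dg (fd G) = n"
      using G split[of G] by (metis (mono_tags, lifting) mem_Collect_eq mset_deg_repeat mset_deg_simps(3) msets_of_deg_def)
    then show "(mset_deg dg (fm G), fm G, fd G) \<in> ?R"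
      using G subset[of G] r by (auto simp: msets_of_deg_def dg' power_free_def cm)
  qed
  finally show "fps_nth (mset_gf dg h S) n = fps_nth (power_free_gf dg h S r * mset_gf ?dg' (\<lambda>_. 1) S) n"
    by (simp add: mset_gf_def)
qed

text \<open>An l1 norm truncated at degree N. It is submultiplicative and dominates the N-th
  coefficient, so products can be estimated factor by factor.\<close>

definition fps_norm :: "nat \<Rightarrow> complex fps \<Rightarrow> real" where
  "fps_norm N F = (\<Sum>i\<le>N. cmod (fps_nth F i))"

lemma fps_norm_nonneg [simp]: "fps_norm N F \<ge> 0"
  by (simp add: fps_norm_def sum_nonneg)

lemma fps_norm_mult: "fps_norm N (F * G) \<le> fps_norm N F * fps_norm N G"
proof -
  have "fps_norm N (F * G) \<le> (\<Sum>n\<le>N. \<Sum>i\<le>n. cmod (fps_nth F i) * cmod (fps_nth G (n - i)))"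
    unfolding fps_norm_def fps_mult_nth atLeast0AtMost
    by (intro sum_mono order_trans[OF norm_sum]) (simp add: norm_mult)
  also have "\<dots> = (\<Sum>(n, i)\<in>(SIGMA n:{..N}. {..n}). cmod (fps_nth F i) * cmod (fps_nth G (n - i)))"
    by (simp add: sum.Sigma)
  also have "\<dots> = (\<Sum>(i, j)\<in>{(i, j). i + j \<le> N}. cmod (fps_nth F i) * cmod (fps_nth G j))"
    by (rule sum.reindex_bij_witness[where i = "\<lambda>(i, j). (i + j, i)" and j = "\<lambda>(n, i). (i, n - i)"]) auto
  also have "\<dots> \<le> (\<Sum>(i, j)\<in>{..N} \<times> {..N}. cmod (fps_nth F i) * cmod (fps_nth G j))"
    by (intro sum_mono2) auto
  also have "\<dots> = fps_norm N F * fps_norm N G"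
    by (simp add: fps_norm_def sum_product sum.cartesian_product)
  finally show ?thesis .
qed

lemma fps_norm_prod_le:
  assumes "finite T" "\<And>P. P \<in> T \<Longrightarrow> fps_norm N (f P) \<le> c" "0 \<le> c"
  shows "fps_norm N (\<Prod>P\<in>T. f P) \<le> c ^ card T"
  using assms(1,2)
proof (induction T)
  case empty
  have "fps_norm N 1 = (\<Sum>i\<le>N. if i = 0 then 1 else 0)"
    unfolding fps_norm_def by (intro sum.cong) auto
  then show ?case by simp
next
  case (insert P T)
  have "fps_norm N (\<Prod>P\<in>insert P T. f P) \<le> fps_norm N (f P) * fps_norm N (\<Prod>P\<in>T. f P)"
    using insert by (simp add: fps_norm_mult)
  also have "\<dots> \<le> c * c ^ card T"
    using insert assms(3) by (intro mult_mono) auto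
  finally show ?case using insert by simp
qed

lemma fps_norm_one_minus: "fps_norm N (1 - fps_const c * fps_X ^ d) \<le> 1 + cmod c"
proof -
  have "cmod (fps_nth (1 - fps_const c * fps_X ^ d) i) \<le> (if i = 0 then 1 else 0) + (if i = d then cmod c else 0)" for i
    by (auto simp: norm_triangle_ineq4[of 1 c, simplified] intro: order_trans[OF norm_triangle_ineq4])
  then have "fps_norm N (1 - fps_const c * fps_X ^ d) \<le> (\<Sum>i\<le>N. (if i = 0 then 1 else 0) + (if i = d then cmod c else 0))"
    unfolding fps_norm_def by (intro sum_mono)
  also have "\<dots> \<le> 1 + cmod c" by (simp add: sum.distrib)
  finally show ?thesis .
qed

lemma fps_norm_geometric:
  assumes "d > 0"
  shows "fps_norm N (inverse (1 - fps_X ^ d)) \<le> real (Suc N)"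
proof -
  define G :: "complex fps" where "G = Abs_fps (\<lambda>n. if d dvd n then 1 else 0)"
  have "(1 - fps_X ^ d) * G = 1"
  proof (rule fps_ext)
    fix n
    have "fps_nth ((1 - fps_X ^ d) * G) n = fps_nth G n - fps_nth (fps_X ^ d * G) n"
      by (simp add: left_diff_distrib)
    also have "\<dots> = fps_nth 1 n"
      using assms by (auto simp: fps_X_power_mult_nth G_def dvd_imp_le dvd_minus_self)
    finally show "fps_nth ((1 - fps_X ^ d) * G) n = fps_nth 1 n" .
  qed
  then have "inverse (1 - fps_X ^ d) = G" by (rule fps_inverse_unique)
  then have "fps_norm N (inverse (1 - fps_X ^ d)) \<le> (\<Sum>i\<le>N. 1)"
    unfolding fps_norm_def by (simp only:) (intro sum_mono, simp add: G_def)
  then show ?thesis by simp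
qed

context prime_system
begin

lemma mset_gf_trivial_nth: "fps_nth (mset_gf dg (\<lambda>_. 1) Pr) n = of_nat (q ^ n)"
  by (simp add: mset_gf_def card_msets_of_deg)

lemma finite_mon_subset: "S \<subseteq> Pr \<Longrightarrow> finite (msets_of_deg dg S n)"
  using finite_mon msets_of_deg_mono finite_subset by metis

lemma finite_scaled_mon:
  assumes "r > 0"
  shows "finite (msets_of_deg (\<lambda>P. r * dg P) Pr n)"
proof (rule finite_subset[OF _ finite_mon[of "n div r"]])
  show "msets_of_deg (\<lambda>P. r * dg P) Pr n \<subseteq> mon (n div r)"
    using assms by (auto simp: msets_of_deg_def mset_deg_def sum_mset_distrib_left[symmetric])
qed

text \<open>The series is Z(u^r) for the zeta function Z(u) = 1 / (1 - q u).\<close>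

lemma mset_gf_scaled:
  assumes "r > 0"
  shows "(1 - fps_const (of_nat q) * fps_X ^ r) * mset_gf (\<lambda>P. r * dg P) (\<lambda>_. 1) Pr = 1"
proof (rule fps_ext)
  fix n
  define z where "z n = fps_nth (mset_gf (\<lambda>P. r * dg P) (\<lambda>_. 1) Pr) n" for n
  have z: "z n = (if r dvd n then of_nat (q ^ (n div r)) else 0)" for n
  proof (cases "r dvd n")
    case True
    then have "msets_of_deg (\<lambda>P. r * dg P) Pr n = mon (n div r)"
      using assms by (auto simp: msets_of_deg_def mset_deg_def sum_mset_distrib_left[symmetric])
    then show ?thesis using True by (simp add: z_def mset_gf_def card_msets_of_deg)
  next
    case False
    then have "msets_of_deg (\<lambda>P. r * dg P) Pr n = {}"
      by (auto simp: msets_of_deg_def mset_deg_def sum_mset_distrib_left[symmetric])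
    then show ?thesis using False by (simp add: z_def mset_gf_def)
  qed
  have "fps_nth ((1 - fps_const (of_nat q) * fps_X ^ r) * mset_gf (\<lambda>P. r * dg P) (\<lambda>_. 1) Pr) n =
     z n - of_nat q * (if n < r then 0 else z (n - r))"
    by (simp add: left_diff_distrib mult.assoc fps_X_power_mult_nth z_def)
  also have "\<dots> = fps_nth 1 n"
  proof (cases "n < r")
    case True
    then show ?thesis using assms by (auto simp: z dest: dvd_imp_le)
  next
    case False
    then obtain m where m: "n = m + r" by (metis add.commute le_Suc_ex not_less)
    show ?thesis using assms unfolding m z by simp
  qed
  finally show "fps_nth ((1 - fps_const (of_nat q) * fps_X ^ r) * mset_gf (\<lambda>P. r * dg P) (\<lambda>_. 1) Pr) n = fps_nth 1 n" .
qed

text \<open>In terms of L-series this is L(u,h) / Z(u^r), with the Euler factors at the primes of T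
  removed from both; the factor 1 - q u^r is 1 / Z(u^r).\<close>

theorem power_free_gf_eq:
  assumes "finite T" "T \<subseteq> Pr" "r > 0" "\<And>P. P \<in> Pr - T \<Longrightarrow> h P ^ r = 1"
  shows "power_free_gf dg h (Pr - T) r =
     (1 - fps_const (of_nat q) * fps_X ^ r) * (\<Prod>P\<in>T. 1 - fps_const (h P) * fps_X ^ dg P)
     * (\<Prod>P\<in>T. inverse (1 - fps_X ^ (r * dg P))) * mset_gf dg h Pr"
proof -
  let ?F = "power_free_gf dg h (Pr - T) r"
  let ?u = "\<Prod>P\<in>T. 1 - fps_X ^ (r * dg P) :: complex fps"
  let ?v = "\<Prod>P\<in>T. inverse (1 - fps_X ^ (r * dg P)) :: complex fps"
  let ?w = "1 - fps_const (of_nat q) * fps_X ^ r :: complex fps"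
  let ?z = "mset_gf (\<lambda>P. r * dg P) (\<lambda>_. 1) Pr"
  have "mset_gf dg h (Pr - T) = ?F * mset_gf (\<lambda>P. r * dg P) (\<lambda>_. 1) (Pr - T)"
    using assms dg_pos by (intro mset_gf_power_free finite_mon_subset) auto
  also have "mset_gf (\<lambda>P. r * dg P) (\<lambda>_. 1) (Pr - T) = ?u * ?z"
    using assms dg_pos by (subst mset_gf_diff) (auto simp: finite_scaled_mon)
  finally have eq: "(\<Prod>P\<in>T. 1 - fps_const (h P) * fps_X ^ dg P) * mset_gf dg h Pr = ?F * (?u * ?z)"
    using assms dg_pos by (subst (asm) mset_gf_diff) (auto simp: finite_mon)
  have uv: "?u * ?v = 1"
    unfolding prod.distrib[symmetric] using assms dg_pos
    by (intro prod.neutral ballI inverse_mult_eq_1') auto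
  have "?w * (\<Prod>P\<in>T. 1 - fps_const (h P) * fps_X ^ dg P) * ?v * mset_gf dg h Pr =
     ?w * ?v * ((\<Prod>P\<in>T. 1 - fps_const (h P) * fps_X ^ dg P) * mset_gf dg h Pr)" by (simp add: mult_ac)
  also have "\<dots> = ?F * (?u * ?v) * (?w * ?z)" unfolding eq by (simp add: mult_ac)
  also have "\<dots> = ?F" unfolding uv mset_gf_scaled[OF assms(3)] by simp
  finally show ?thesis ..
qed

lemma card_power_free:
  assumes "2 \<le> r" "r \<le> N"
  shows "real (card {G \<in> mon N. power_free r G}) = real q ^ N - real q ^ (N - r + 1)"
    and "real q ^ N / 2 \<le> real (card {G \<in> mon N. power_free r G})"
proof -
  have "of_nat (card {G \<in> mon N. power_free r G}) = fps_nth (power_free_gf dg (\<lambda>_. 1) Pr r) N"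
    by (simp add: power_free_gf_def)
  also have "\<dots> = of_nat (q ^ N) - of_nat q * of_nat (q ^ (N - r))"
    using power_free_gf_eq[of "{}" r "\<lambda>_. 1"] assms
    by (simp add: left_diff_distrib mult.assoc fps_X_power_mult_nth mset_gf_trivial_nth)
  finally have "of_real (real (card {G \<in> mon N. power_free r G})) = complex_of_real (real q ^ N - real q ^ (N - r + 1))"
    by simp
  then show eq: "real (card {G \<in> mon N. power_free r G}) = real q ^ N - real q ^ (N - r + 1)"
    using of_real_eq_iff by blast
  have "real q * real q ^ (N - r + 1) \<le> real q ^ N"
    using assms q_ge_2 power_increasing[of "Suc (N - r + 1)" N "real q"] by simp
  moreover have "2 * real q ^ (N - r + 1) \<le> real q * real q ^ (N - r + 1)"
    using q_ge_2 by (intro mult_right_mono) auto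
  ultimately show "real q ^ N / 2 \<le> real (card {G \<in> mon N. power_free r G})"
    unfolding eq by simp
qed

text \<open>Each factor of \<open>power_free_gf_eq\<close> is estimated separately: 1 - q u^r costs
  1 + q, and each prime of T costs 2 for its Euler factor and N + 1 for a truncated geometric
  series. The factor 1 + q is the loss of one power of q in the final exponent.\<close>

theorem power_free_sum_bound:
  assumes "finite T" "T \<subseteq> Pr" "r > 0" "\<And>P. P \<in> Pr - T \<Longrightarrow> h P ^ r = 1" "\<And>P. P \<in> T \<Longrightarrow> cmod (h P) \<le> 1"
    and B: "\<And>n. cmod (\<Sum>G\<in>mon n. \<Prod>P\<in>#G. h P) \<le> B"
  shows "cmod (\<Sum>G\<in>{G \<in> msets_of_deg dg (Pr - T) N. power_free r G}. \<Prod>P\<in>#G. h P)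
     \<le> (1 + real q) * 2 ^ card T * real (Suc N) ^ card T * (real (Suc N) * B)"
proof -
  let ?w = "1 - fps_const (of_nat q) * fps_X ^ r :: complex fps"
  let ?F = "power_free_gf dg h (Pr - T) r"
  have "cmod (\<Sum>G\<in>{G \<in> msets_of_deg dg (Pr - T) N. power_free r G}. \<Prod>P\<in>#G. h P) = cmod (fps_nth ?F N)"
    by (simp add: power_free_gf_def)
  also have "\<dots> \<le> fps_norm N ?F"
    unfolding fps_norm_def by (rule member_le_sum) auto
  also have "\<dots> \<le> fps_norm N ?w * fps_norm N (\<Prod>P\<in>T. 1 - fps_const (h P) * fps_X ^ dg P)
     * fps_norm N (\<Prod>P\<in>T. inverse (1 - fps_X ^ (r * dg P))) * fps_norm N (mset_gf dg h Pr)"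
    by (subst power_free_gf_eq[OF assms(1-4)], assumption)
       (intro order_trans[OF fps_norm_mult] mult_right_mono order.refl; simp)
  also have "\<dots> \<le> (1 + real q) * 2 ^ card T * real (Suc N) ^ card T * (real (Suc N) * B)"
  proof (intro mult_mono fps_norm_prod_le assms)
    show "fps_norm N ?w \<le> 1 + real q" using fps_norm_one_minus[of N "of_nat q" r] by simp
    show "fps_norm N (1 - fps_const (h P) * fps_X ^ dg P) \<le> 2" if "P \<in> T" for P
      using fps_norm_one_minus[of N "h P" "dg P"] assms(5)[OF that] by simp
    show "fps_norm N (inverse (1 - fps_X ^ (r * dg P))) \<le> real (Suc N)" if "P \<in> T" for P
      using that assms(2,3) dg_pos by (intro fps_norm_geometric) auto
    have "fps_norm N (mset_gf dg h Pr) \<le> (\<Sum>i\<le>N. B)"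
      unfolding fps_norm_def by (intro sum_mono) (simp add: mset_gf_def B)
    then show "fps_norm N (mset_gf dg h Pr) \<le> real (Suc N) * B" by simp
  qed auto
  finally show ?thesis .
qed

end

subsection \<open>Tuples of prime powers whose product is an \<open>r\<close>-th power\<close>

text \<open>
  A tuple of prime powers of prescribed degrees \<open>p i\<close> is given by the underlying primes \<open>\<pi> i\<close>,
  of degree dividing \<open>p i\<close>.
\<close>

definition tuples :: "('p \<Rightarrow> nat) \<Rightarrow> 'p set \<Rightarrow> ('i \<Rightarrow> nat) \<Rightarrow> 'i set \<Rightarrow> ('i \<Rightarrow> 'p) set" where
  "tuples dg S p A = (\<Pi>\<^sub>E i\<in>A. {P \<in> S. dg P dvd p i})"

definition power_tuple :: "('p \<Rightarrow> nat) \<Rightarrow> nat \<Rightarrow> ('i \<Rightarrow> nat) \<Rightarrow> 'i set \<Rightarrow> ('i \<Rightarrow> 'p) \<Rightarrow> bool" where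
  "power_tuple dg r p A \<pi> \<longleftrightarrow> (\<forall>P\<in>\<pi> ` A. r dvd (\<Sum>i\<in>{i \<in> A. \<pi> i = P}. p i div dg P))"

text \<open>The weights are the factors -\<Lambda> of the explicit formula; by
  \<open>power_tuple\<close> only tuples whose product is an r-th power are counted.\<close>

definition tuple_sum :: "('p \<Rightarrow> nat) \<Rightarrow> nat \<Rightarrow> 'p set \<Rightarrow> ('i \<Rightarrow> nat) \<Rightarrow> 'i set \<Rightarrow> complex" where
  "tuple_sum dg r S p A = (\<Sum>\<pi>\<in>{\<pi> \<in> tuples dg S p A. power_tuple dg r p A \<pi>}. \<Prod>i\<in>A. - of_nat (dg (\<pi> i)))"

lemma tuple_sum_empty: "tuple_sum dg r S p {} = 1"
  by (simp add: tuple_sum_def tuples_def power_tuple_def)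

lemma sum_image_fibres:
  fixes f :: "'i \<Rightarrow> nat"
  assumes "finite A"
  shows "sum f A = (\<Sum>P\<in>\<pi> ` A. sum f {i \<in> A. \<pi> i = P})"
  using assms by (rule sum.image_gen)

lemma power_tuple_dvd:
  assumes "finite A" "\<pi> \<in> tuples dg S p A" "power_tuple dg r p A \<pi>"
  shows "r dvd sum p A"
  unfolding sum_image_fibres[OF assms(1), of p \<pi>]
proof (rule dvd_sum)
  fix P assume P: "P \<in> \<pi> ` A"
  have "sum p {i \<in> A. \<pi> i = P} = (\<Sum>i\<in>{i \<in> A. \<pi> i = P}. dg P * (p i div dg P))"
    using assms(2) by (intro sum.cong refl) (auto simp: tuples_def PiE_iff)
  also have "\<dots> = dg P * (\<Sum>i\<in>{i \<in> A. \<pi> i = P}. p i div dg P)"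
    by (simp add: sum_distrib_left)
  also have "r dvd \<dots>"
    using assms(3) P unfolding power_tuple_def by (intro dvd_mult) blast
  finally show "r dvd sum p {i \<in> A. \<pi> i = P}" .
qed

lemma tuple_sum_not_dvd: "finite A \<Longrightarrow> \<not> r dvd sum p A \<Longrightarrow> tuple_sum dg r S p A = 0"
  unfolding tuple_sum_def using power_tuple_dvd by (intro sum.neutral) blast

text \<open>The primes that can occupy the whole block B, with the total exponent of the resulting
  power divisible by r.\<close>

definition block_primes :: "('p \<Rightarrow> nat) \<Rightarrow> nat \<Rightarrow> 'p set \<Rightarrow> ('i \<Rightarrow> nat) \<Rightarrow> 'i set \<Rightarrow> 'p set" where
  "block_primes dg r S p B = {P \<in> S. (\<forall>i\<in>B. dg P dvd p i) \<and> r dvd (\<Sum>i\<in>B. p i div dg P)}"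

text \<open>Double counting: the sum of all parts is distributed over the primes P occurring in the
  tuple. Singling out P, its fibre B and the tuple on the remaining parts, which avoids P, gives the
  right side.\<close>

lemma tuple_sum_rec:
  assumes "finite A" and fin: "\<And>i. i \<in> A \<Longrightarrow> finite {P \<in> S. dg P dvd p i}"
  shows "of_nat (sum p A) * tuple_sum dg r S p A =
    (\<Sum>B\<in>Pow A - {{}}. \<Sum>P\<in>block_primes dg r S p B.
       of_nat (sum p B) * (- of_nat (dg P)) ^ card B * tuple_sum dg r (S - {P}) p (A - B))"
proof -
  let ?U = "\<lambda>S A. {\<pi> \<in> tuples dg S p A. power_tuple dg r p A \<pi>}"
  let ?w = "\<lambda>A \<pi>. \<Prod>i\<in>A. - of_nat (dg (\<pi> i)) :: complex"
  let ?fib = "\<lambda>\<pi> P. {i \<in> A. \<pi> i = P}"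
  let ?L = "SIGMA \<pi>:?U S A. \<pi> ` A"
  let ?R = "SIGMA B:Pow A - {{}}. SIGMA P:block_primes dg r S p B. ?U (S - {P}) (A - B)"
  have finU: "finite (?U S' A')" if "S' \<subseteq> S" "A' \<subseteq> A" for S' A'
  proof -
    have "finite {P \<in> S'. dg P dvd p i}" if "i \<in> A'" for i
      by (rule finite_subset[OF _ fin[of i]]) (use that \<open>S' \<subseteq> S\<close> \<open>A' \<subseteq> A\<close> in auto)
    then have "finite (tuples dg S' p A')"
      unfolding tuples_def using finite_subset[OF \<open>A' \<subseteq> A\<close> assms(1)] by (intro finite_PiE) auto
    then show ?thesis by simp
  qed
  have finB: "finite (block_primes dg r S p B)" if B: "B \<in> Pow A - {{}}" for B
  proof -
    obtain i where "i \<in> B" "i \<in> A" using B by auto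
    then show ?thesis by (intro finite_subset[OF _ fin[of i]]) (auto simp: block_primes_def)
  qed
  have "of_nat (sum p A) * tuple_sum dg r S p A = (\<Sum>\<pi>\<in>?U S A. of_nat (sum p A) * ?w A \<pi>)"
    by (simp add: tuple_sum_def sum_distrib_left)
  also have "\<dots> = (\<Sum>\<pi>\<in>?U S A. \<Sum>P\<in>\<pi> ` A. of_nat (sum p (?fib \<pi> P)) * ?w A \<pi>)"
  proof (intro sum.cong refl)
    fix \<pi>
    show "of_nat (sum p A) * ?w A \<pi> = (\<Sum>P\<in>\<pi> ` A. of_nat (sum p (?fib \<pi> P)) * ?w A \<pi>)"
      by (subst sum_image_fibres[OF assms(1), of p \<pi>]) (simp add: sum_distrib_right)
  qed
  also have "\<dots> = (\<Sum>(\<pi>, P)\<in>?L. of_nat (sum p (?fib \<pi> P)) * ?w A \<pi>)"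
    using finU[of S A] assms(1) by (subst sum.Sigma) auto
  also have "\<dots> = (\<Sum>(B, P, \<pi>)\<in>?R. of_nat (sum p B) * (- of_nat (dg P)) ^ card B * ?w (A - B) \<pi>)"
  proof (rule sum.reindex_bij_witness[where
        j = "\<lambda>(\<pi>, P). (?fib \<pi> P, P, restrict \<pi> (A - ?fib \<pi> P))" and
        i = "\<lambda>(B, P, \<pi>). (\<lambda>i. if i \<in> B then P else \<pi> i, P)"])
    fix x assume "x \<in> ?L"
    then obtain \<pi> P where x: "x = (\<pi>, P)" "\<pi> \<in> tuples dg S p A" "power_tuple dg r p A \<pi>" "P \<in> \<pi> ` A" by auto
    let ?B = "?fib \<pi> P"
    have ext: "\<pi> i = undefined" if "i \<notin> A" for i using x(2) that by (auto simp: tuples_def PiE_def extensional_def)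
    have mem: "\<pi> i \<in> S" "dg (\<pi> i) dvd p i" if "i \<in> A" for i using x(2) that by (auto simp: tuples_def)
    show "(case case x of (\<pi>, P) \<Rightarrow> (?fib \<pi> P, P, restrict \<pi> (A - ?fib \<pi> P)) of
        (B, P, \<pi>) \<Rightarrow> (\<lambda>i. if i \<in> B then P else \<pi> i, P)) = x"
      using x ext by (auto simp: fun_eq_iff)
    have B: "?B \<in> Pow A - {{}}" using x by auto
    have "dg P dvd p i" if "i \<in> ?B" for i using mem(2)[of i] that by auto
    moreover have "P \<in> S" using x(4) mem(1) by auto
    moreover have "r dvd (\<Sum>i\<in>?B. p i div dg P)" using x(3,4) unfolding power_tuple_def by blast
    ultimately have P: "P \<in> block_primes dg r S p ?B"
      by (simp add: block_primes_def)
    have "restrict \<pi> (A - ?B) \<in> tuples dg (S - {P}) p (A - ?B)"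
      using mem by (auto simp: tuples_def)
    moreover have "power_tuple dg r p (A - ?B) (restrict \<pi> (A - ?B))"
      unfolding power_tuple_def
    proof
      fix P' assume "P' \<in> restrict \<pi> (A - ?B) ` (A - ?B)"
      then have P': "P' \<in> \<pi> ` A" "P' \<noteq> P" by auto
      then have *: "{i \<in> A - ?B. restrict \<pi> (A - ?B) i = P'} = {i \<in> A. \<pi> i = P'}" by auto
      show "r dvd (\<Sum>i\<in>{i \<in> A - ?B. restrict \<pi> (A - ?B) i = P'}. p i div dg P')"
        using x(3) P'(1) unfolding * power_tuple_def by blast
    qed
    ultimately show "(case x of (\<pi>, P) \<Rightarrow> (?fib \<pi> P, P, restrict \<pi> (A - ?fib \<pi> P))) \<in> ?R"
      using B P x(1) by simp
    have "?w A \<pi> = ?w ?B \<pi> * ?w (A - ?B) \<pi>"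
      by (subst prod.subset_diff[of ?B A]) (use assms(1) in \<open>auto simp: mult.commute\<close>)
    moreover have "?w ?B \<pi> = (- of_nat (dg P)) ^ card ?B" by simp
    moreover have "?w (A - ?B) (restrict \<pi> (A - ?B)) = ?w (A - ?B) \<pi>"
      by (intro prod.cong) auto
    ultimately show "(case case x of (\<pi>, P) \<Rightarrow> (?fib \<pi> P, P, restrict \<pi> (A - ?fib \<pi> P)) of
        (B, P, \<pi>) \<Rightarrow> of_nat (sum p B) * (- of_nat (dg P)) ^ card B * ?w (A - B) \<pi>) =
        (case x of (\<pi>, P) \<Rightarrow> of_nat (sum p (?fib \<pi> P)) * ?w A \<pi>)"
      unfolding x(1) prod.case by (simp only: mult.assoc)
  next
    fix y assume "y \<in> ?R"
    then obtain B P \<pi> where y: "y = (B, P, \<pi>)" "B \<subseteq> A" "B \<noteq> {}" "P \<in> block_primes dg r S p B"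
      "\<pi> \<in> tuples dg (S - {P}) p (A - B)" "power_tuple dg r p (A - B) \<pi>" by auto
    let ?\<pi> = "\<lambda>i. if i \<in> B then P else \<pi> i"
    have mem: "\<pi> i \<in> S" "\<pi> i \<noteq> P" "dg (\<pi> i) dvd p i" if "i \<in> A - B" for i using y(5) that by (auto simp: tuples_def)
    have ext: "\<pi> i = undefined" if "i \<notin> A - B" for i using y(5) that by (auto simp: tuples_def PiE_def extensional_def)
    have fib: "?fib ?\<pi> P = B" using y(2) mem by (auto split: if_splits)
    have "restrict ?\<pi> (A - B) = \<pi>" using ext by (auto simp: fun_eq_iff)
    then show "(case case y of (B, P, \<pi>) \<Rightarrow> (\<lambda>i. if i \<in> B then P else \<pi> i, P) of
        (\<pi>, P) \<Rightarrow> (?fib \<pi> P, P, restrict \<pi> (A - ?fib \<pi> P))) = y"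
      unfolding y(1) prod.case fib by simp
    have P: "P \<in> S" "\<And>i. i \<in> B \<Longrightarrow> dg P dvd p i" "r dvd (\<Sum>i\<in>B. p i div dg P)"
      using y(4) by (auto simp: block_primes_def)
    have "?\<pi> \<in> tuples dg S p A"
      using mem P ext y(2) by (auto simp: tuples_def PiE_def extensional_def)
    moreover have "power_tuple dg r p A ?\<pi>"
      unfolding power_tuple_def
    proof
      fix P' assume P': "P' \<in> ?\<pi> ` A"
      show "r dvd (\<Sum>i\<in>?fib ?\<pi> P'. p i div dg P')"
      proof (cases "P' = P")
        case True
        then show ?thesis using fib P(3) by simp
      next
        case False
        then have *: "?fib ?\<pi> P' = {i \<in> A - B. \<pi> i = P'}" by auto
        have "P' \<in> \<pi> ` (A - B)" using P' False by auto
        then show ?thesis using y(6) unfolding * power_tuple_def by blast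
      qed
    qed
    moreover have "P \<in> ?\<pi> ` A" using y(2,3) by force
    ultimately show "(case y of (B, P, \<pi>) \<Rightarrow> (\<lambda>i. if i \<in> B then P else \<pi> i, P)) \<in> ?L"
      unfolding y(1) by simp
  qed
  also have "\<dots> = (\<Sum>B\<in>Pow A - {{}}. \<Sum>P\<in>block_primes dg r S p B. \<Sum>\<pi>\<in>?U (S - {P}) (A - B).
       of_nat (sum p B) * (- of_nat (dg P)) ^ card B * ?w (A - B) \<pi>)"
  proof -
    have "finite (SIGMA P:block_primes dg r S p B. ?U (S - {P}) (A - B))" if "B \<in> Pow A - {{}}" for B
      using finB[OF that] finU[of "S - {_}" "A - B"] by (intro finite_SigmaI) auto
    moreover have "finite (?U (S - {P}) (A - B))" for P B by (rule finU) auto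
    ultimately show ?thesis using finB assms(1) by (simp add: sum.Sigma)
  qed
  finally show ?thesis by (simp add: tuple_sum_def sum_distrib_left)
qed

context prime_system
begin

text \<open>The entries over B multiply to some P^(r j) of degree r k, so k = j deg P.\<close>

lemma block_primes_dg_le:
  assumes "P \<in> block_primes dg r S p B" "S \<subseteq> Pr" "sum p B = r * k" "k > 0" "r > 0"
  shows "dg P \<le> k"
proof -
  have "sum p B = (\<Sum>i\<in>B. dg P * (p i div dg P))"
    using assms(1) by (intro sum.cong refl) (auto simp: block_primes_def)
  then have "r * k = dg P * (\<Sum>i\<in>B. p i div dg P)" using assms(3) by (simp add: sum_distrib_left)
  moreover obtain j where "(\<Sum>i\<in>B. p i div dg P) = r * j"
    using assms(1) by (auto simp: block_primes_def)
  ultimately have "k = dg P * j" using assms(5) by simp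
  then show ?thesis using assms(4) by (cases j) auto
qed

text \<open>Primes of degree exactly k number about q^k / k, and each has the coefficient r k
  (-k)^|B|; this gives the main term. Larger degrees do not occur by
  \<open>block_primes_dg_le\<close>, and primes of smaller degree number at most k q^(k-1). The
  constant also accounts for the at most c excluded primes of Y and for the error in
  \<sigma>.\<close>

lemma tuple_term_bound:
  assumes fin: "finite Y" "card Y \<le> c" and B: "finite B" "B \<noteq> {}" "\<And>i. i \<in> B \<Longrightarrow> p i > 0"
    and r: "r > 0" and k: "sum p B = r * k" "k > 0" "k \<le> m" and C: "C \<ge> 0"
    and IH: "\<And>P. P \<in> Pr - Y \<Longrightarrow> cmod (\<sigma> P - \<tau> * of_nat q ^ (m - k)) \<le> C * real q ^ (m - k) / real q"
  shows "cmod ((\<Sum>P\<in>block_primes dg r (Pr - Y) p B. of_nat (sum p B) * (- of_nat (dg P)) ^ card B * \<sigma> P)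
      - (if \<forall>b\<in>B. k dvd p b then of_nat r * (- of_nat k) ^ card B * \<tau> else 0) * of_nat q ^ m)
    \<le> (real r * real k ^ card B * (C + cmod \<tau> * (real k * (1 + real c)))
       + real k * (real r * real k * real k ^ card B * (cmod \<tau> + C))) * real q ^ m / real q"
proof -
  define Q where "Q = block_primes dg r (Pr - Y) p B"
  define Q1 where "Q1 = {P \<in> Q. dg P = k}"
  define Q2 where "Q2 = {P \<in> Q. dg P < k}"
  define f where "f P = of_nat (sum p B) * (- of_nat (dg P)) ^ card B * \<sigma> P" for P
  have Q: "Q = Q1 \<union> Q2" "Q1 \<inter> Q2 = {}"
    using block_primes_dg_le[of _ r "Pr - Y" p B k] r k by (fastforce simp: Q1_def Q2_def Q_def)+
  have "finite Q1" by (rule finite_subset[OF _ finite_primes_of_deg[of k]]) (auto simp: Q1_def Q_def block_primes_def)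
  have "Q2 \<subseteq> {P \<in> Pr. dg P < k}" by (auto simp: Q2_def Q_def block_primes_def)
  then have Q2: "finite Q2" "card Q2 \<le> k * q ^ (k - 1)"
    using finite_small_primes finite_subset card_small_primes[of k] card_mono[OF finite_small_primes, of Q2 k] by (auto intro: order_trans)
  have q0: "real q > 0" using q_ge_2 by simp
  have qm: "real q ^ (k - 1) * real q ^ (m - k) = real q ^ m / real q"
  proof -
    have "real q ^ (k - 1) * real q ^ (m - k) * real q = real q ^ (Suc (k - 1 + (m - k)))" by (simp add: power_add)
    also have "Suc (k - 1 + (m - k)) = m" using k by simp
    finally show ?thesis using q0 by (simp add: field_simps)
  qed
  have IH': "cmod (\<sigma> P) \<le> (cmod \<tau> + C) * real q ^ (m - k)" if "P \<in> Pr - Y" for P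
  proof -
    have "cmod (\<sigma> P) \<le> cmod (\<tau> * of_nat q ^ (m - k)) + cmod (\<sigma> P - \<tau> * of_nat q ^ (m - k))"
      by (metis add.commute norm_triangle_sub)
    also have "cmod (\<sigma> P - \<tau> * of_nat q ^ (m - k)) \<le> C * real q ^ (m - k) / real q" by (rule IH[OF that])
    also have "\<dots> \<le> C * real q ^ (m - k) / 1"
      using q_ge_2 C by (intro divide_left_mono) auto
    finally show ?thesis by (simp add: norm_mult norm_power algebra_simps)
  qed
  have bound2: "cmod (\<Sum>P\<in>Q2. f P) \<le> real k * (real r * real k * real k ^ card B * (cmod \<tau> + C)) * real q ^ m / real q"
  proof -
    have "cmod (f P) \<le> real r * real k * real k ^ card B * ((cmod \<tau> + C) * real q ^ (m - k))" if "P \<in> Q2" for P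
    proof -
      have P: "P \<in> Pr - Y" "dg P < k" using that by (auto simp: Q2_def Q_def block_primes_def)
      then have "real (dg P) ^ card B \<le> real k ^ card B" by (intro power_mono) auto
      with IH'[OF P(1)] C show ?thesis
        unfolding f_def k(1) by (simp add: norm_mult norm_power mult.assoc) (intro mult_mono mult_left_mono mult_nonneg_nonneg; simp)
    qed
    then have "cmod (\<Sum>P\<in>Q2. f P) \<le> of_nat (card Q2) * (real r * real k * real k ^ card B * ((cmod \<tau> + C) * real q ^ (m - k)))"
      by (intro order_trans[OF norm_sum] sum_bounded_above) auto
    also have "\<dots> \<le> (real k * real q ^ (k - 1)) * (real r * real k * real k ^ card B * ((cmod \<tau> + C) * real q ^ (m - k)))"
      using Q2(2) C by (intro mult_right_mono) (auto simp flip: of_nat_power of_nat_mult)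
    also have "\<dots> = real k * (real r * real k * real k ^ card B * (cmod \<tau> + C)) * (real q ^ (k - 1) * real q ^ (m - k))"
      by (simp add: mult_ac)
    finally show ?thesis unfolding qm by simp
  qed
  have bound1: "cmod ((\<Sum>P\<in>Q1. f P) - (if \<forall>b\<in>B. k dvd p b then of_nat r * (- of_nat k) ^ card B * \<tau> else 0) * of_nat q ^ m)
     \<le> real r * real k ^ card B * (C + cmod \<tau> * (real k * (1 + real c))) * real q ^ m / real q"
  proof (cases "\<forall>b\<in>B. k dvd p b")
    case False
    \<comment> \<open>No prime of degree k fits the block in this case, and the main term is 0 as
      well.\<close>
    then have "Q1 = {}" by (auto simp: Q1_def Q_def block_primes_def)
    then show ?thesis
      unfolding if_not_P[OF False] using C by (simp only: sum.empty mult_zero_left diff_zero norm_zero) simp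
  next
    case True
    \<comment> \<open>The total exponent is r k / k = r, the smallest one possible.\<close>
    have "r dvd (\<Sum>i\<in>B. p i div k)"
    proof -
      have "sum p B = (\<Sum>i\<in>B. k * (p i div k))" using True by (intro sum.cong refl) auto
      then have "k * r = k * (\<Sum>i\<in>B. p i div k)" using k(1) by (simp add: sum_distrib_left[symmetric] mult.commute[of r])
      then have "r = (\<Sum>i\<in>B. p i div k)" using k(2) by (simp only: mult_cancel1) simp
      then show ?thesis by simp
    qed
    then have Q1: "Q1 = {P \<in> Pr. dg P = k} - Y"
      using True by (auto simp: Q1_def Q_def block_primes_def)
    have card_le: "k * card Q1 \<le> q ^ k"
    proof -
      have "card Q1 \<le> prime_count k" unfolding prime_count_def Q1 by (intro card_mono finite_primes_of_deg) auto
      then show ?thesis using prime_count_le[OF k(2)] by (meson mult_le_mono2 order_trans)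
    qed
    have card_ge: "q ^ k \<le> k * card Q1 + k * (1 + c) * q ^ (k - 1)"
    proof -
      have "prime_count k \<le> card Q1 + card Y"
        unfolding prime_count_def Q1 using fin(1) diff_card_le_card_Diff[of Y "{P \<in> Pr. dg P = k}"] by linarith
      then have "k * prime_count k \<le> k * card Q1 + k * c" using fin(2)
        by (metis add_mult_distrib2 add_left_mono le_trans mult_le_mono2)
      moreover have "k * c \<le> k * c * q ^ (k - 1)" using q_ge_2 by simp
      moreover have "k * (1 + c) * q ^ (k - 1) = k * q ^ (k - 1) + k * c * q ^ (k - 1)"
        by (simp add: algebra_simps)
      ultimately show ?thesis using prime_count_ge[OF k(2)] by linarith
    qed
    have diff: "cmod (of_nat k * of_nat (card Q1) - of_nat q ^ k) \<le> real k * (1 + real c) * real q ^ (k - 1)"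
    proof -
      have "cmod (of_nat k * of_nat (card Q1) - of_nat q ^ k) = \<bar>real k * real (card Q1) - real q ^ k\<bar>"
      proof -
        have "of_nat k * of_nat (card Q1) - of_nat q ^ k = complex_of_real (real k * real (card Q1) - real q ^ k)" by simp
        then show ?thesis by (simp only: norm_of_real)
      qed
      also have "\<dots> = real q ^ k - real k * real (card Q1)"
        using card_le by (simp flip: of_nat_mult of_nat_power)
      also have "\<dots> \<le> real k * (1 + real c) * real q ^ (k - 1)"
      proof -
        have "real (q ^ k) \<le> real (k * card Q1 + k * (1 + c) * q ^ (k - 1))" using card_ge of_nat_le_iff by blast
        then show ?thesis by (simp add: distrib_left)
      qed
      finally show ?thesis .
    qed
    have "(\<Sum>P\<in>Q1. f P) = (\<Sum>P\<in>Q1. of_nat r * (- of_nat k) ^ card B * (of_nat k * \<sigma> P))"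
      by (intro sum.cong refl) (auto simp: f_def Q1_def k)
    also have "\<dots> = of_nat r * (- of_nat k) ^ card B * (of_nat k * (\<Sum>P\<in>Q1. \<sigma> P))"
      by (simp add: sum_distrib_left)
    finally have sum1: "(\<Sum>P\<in>Q1. f P) = of_nat r * (- of_nat k) ^ card B * (of_nat k * (\<Sum>P\<in>Q1. \<sigma> P))" .
    have qk: "of_nat q ^ m = (of_nat q ^ k * of_nat q ^ (m - k) :: complex)"
      using k(3) by (simp flip: power_add)
    have "(\<Sum>P\<in>Q1. f P) - of_nat r * (- of_nat k) ^ card B * \<tau> * of_nat q ^ m =
       of_nat r * (- of_nat k) ^ card B * (of_nat k * (\<Sum>P\<in>Q1. \<sigma> P - \<tau> * of_nat q ^ (m - k))
         + \<tau> * of_nat q ^ (m - k) * (of_nat k * of_nat (card Q1) - of_nat q ^ k))"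
      unfolding sum1 qk by (simp add: sum_subtractf algebra_simps)
    also have "cmod \<dots> \<le> real r * real k ^ card B * (C * real q ^ m / real q + cmod \<tau> * (real k * (1 + real c)) * (real q ^ m / real q))"
      unfolding norm_mult norm_power norm_minus_cancel norm_of_nat
    proof (intro mult_left_mono order_trans[OF norm_triangle_ineq] add_mono)
      have "cmod (\<Sum>P\<in>Q1. \<sigma> P - \<tau> * of_nat q ^ (m - k)) \<le> of_nat (card Q1) * (C * real q ^ (m - k) / real q)"
        using IH by (intro order_trans[OF norm_sum] sum_bounded_above) (auto simp: Q1)
      from mult_left_mono[OF this, of "real k"]
      have "real k * cmod (\<Sum>P\<in>Q1. \<sigma> P - \<tau> * of_nat q ^ (m - k)) \<le> real (k * card Q1) * (C * real q ^ (m - k) / real q)"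
        by (simp add: mult.assoc)
      also have "\<dots> \<le> real (q ^ k) * (C * real q ^ (m - k) / real q)"
        using card_le C of_nat_le_iff by (intro mult_right_mono) (blast, simp)
      also have "\<dots> = C * (real q ^ k * real q ^ (m - k)) / real q" by simp
      also have "real q ^ k * real q ^ (m - k) = real q ^ m" using k(3) by (simp flip: power_add)
      finally show "cmod (of_nat k * (\<Sum>P\<in>Q1. \<sigma> P - \<tau> * of_nat q ^ (m - k))) \<le> C * real q ^ m / real q"
        by (simp add: norm_mult)
      have "cmod \<tau> * real q ^ (m - k) * cmod (of_nat k * of_nat (card Q1) - of_nat q ^ k) \<le>
         cmod \<tau> * real q ^ (m - k) * (real k * (1 + real c) * real q ^ (k - 1))"
        using diff by (intro mult_left_mono) auto
      also have "\<dots> = cmod \<tau> * (real k * (1 + real c)) * (real q ^ (k - 1) * real q ^ (m - k))" by (simp add: mult_ac)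
      finally show "cmod (\<tau> * of_nat q ^ (m - k) * (of_nat k * of_nat (card Q1) - of_nat q ^ k)) \<le>
        cmod \<tau> * (real k * (1 + real c)) * (real q ^ m / real q)"
        by (simp only: norm_mult norm_power norm_of_nat qm)
    qed auto
    finally show ?thesis using True by (simp add: algebra_simps add_divide_distrib)
  qed
  have "(\<Sum>P\<in>Q. f P) = (\<Sum>P\<in>Q1. f P) + (\<Sum>P\<in>Q2. f P)"
    unfolding Q(1) using \<open>finite Q1\<close> Q2(1) Q(2) by (intro sum.union_disjoint)
  then have "cmod ((\<Sum>P\<in>Q. f P) - (if \<forall>b\<in>B. k dvd p b then of_nat r * (- of_nat k) ^ card B * \<tau> else 0) * of_nat q ^ m)
     \<le> cmod ((\<Sum>P\<in>Q1. f P) - (if \<forall>b\<in>B. k dvd p b then of_nat r * (- of_nat k) ^ card B * \<tau> else 0) * of_nat q ^ m)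
       + cmod (\<Sum>P\<in>Q2. f P)"
    by (metis (no_types, lifting) add_diff_eq add.commute norm_triangle_ineq)
  also note add_mono[OF bound1 bound2]
  finally show ?thesis
    unfolding f_def Q_def by (simp add: algebra_simps add_divide_distrib)
qed

end

text \<open>
  The sum over tuples satisfies asymptotically the recurrence which determines the integral of a
  product of traces against \<open>\<omega>\<^sub>r\<close>; the tuples in which all exponents of some prime add up to more
  than \<open>r\<close> contribute to lower order.
\<close>

theorem tuple_sum_asymptotics:
  fixes t :: "'i set \<Rightarrow> complex"
  assumes "finite A" "\<And>i. i \<in> A \<Longrightarrow> p i > 0" "r > 0" "t {} = 1"
    and t_rec: "\<And>B m. B \<subseteq> A \<Longrightarrow> sum p B = r * m \<Longrightarrow> of_nat m * t B =
      (\<Sum>k=1..m. \<Sum>D | D \<subseteq> B \<and> (\<forall>b\<in>D. k dvd p b) \<and> sum p D = k * r. (- of_nat k) ^ card D * t (B - D))"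
    and "sum p A = r * m"
  shows "\<exists>C\<ge>0. \<forall>q (Pr :: 'p set) dg Y. prime_system q Pr dg \<longrightarrow> finite Y \<longrightarrow> card Y \<le> c \<longrightarrow>
    cmod (tuple_sum dg r (Pr - Y) p A - t A * of_nat q ^ m) \<le> C * real q ^ m / real q"
  using assms(1,2,6) t_rec
proof (induction A arbitrary: c m rule: finite_psubset_induct)
  case (psubset A)
  show ?case
  proof (cases "A = {}")
    case True
    then have "m = 0" using psubset.prems assms(3) by simp
    with True show ?thesis using assms(4) by (intro exI[of _ 0]) (simp add: tuple_sum_empty)
  next
    case False
    have m: "m > 0"
    proof -
      have "sum p A > 0" using False psubset.hyps psubset.prems(1) by (simp add: sum_pos)
      then show ?thesis using psubset.prems(2) by (cases m) auto
    qed
    \<comment> \<open>A block can be good only for k = \<open>sum p B div r\<close>, which is why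
      \<open>main\<close> can be defined without k.\<close>
    define good where "good B k \<longleftrightarrow> (\<forall>b\<in>B. k dvd p b) \<and> sum p B = k * r" for B k
    define main where "main B = (if \<exists>k. good B k then of_nat r * (- of_nat (sum p B div r)) ^ card B * t (A - B) else 0)" for B
    define bt where "bt dg Pr Y B = (\<Sum>P\<in>block_primes dg r (Pr - Y) p B.
       of_nat (sum p B) * (- of_nat (dg P)) ^ card B * tuple_sum dg r (Pr - Y - {P}) p (A - B))" for dg and Pr Y :: "'p set" and B
    have ex: "\<exists>C\<ge>0. \<forall>q (Pr :: 'p set) dg Y. prime_system q Pr dg \<longrightarrow> finite Y \<longrightarrow> card Y \<le> c \<longrightarrow>
        cmod (bt dg Pr Y B - main B * of_nat q ^ m) \<le> C * real q ^ m / real q"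
      if B: "B \<in> Pow A - {{}}" for B
    proof (cases "r dvd sum p B")
      case False
      have "block_primes dg r S p B = {}" for dg and S :: "'p set"
      proof -
        have "r dvd sum p B" if "P \<in> block_primes dg r S p B" for P
        proof -
          have "sum p B = (\<Sum>i\<in>B. dg P * (p i div dg P))"
            using that by (intro sum.cong refl) (auto simp: block_primes_def)
          then show ?thesis using that by (simp add: block_primes_def sum_distrib_left[symmetric])
        qed
        with False show ?thesis by blast
      qed
      then show ?thesis using False by (intro exI[of _ 0]) (auto simp: bt_def main_def good_def)
    next
      case True
      then obtain k where k: "sum p B = r * k" by (elim dvdE)
      have finB: "finite B" using B psubset.hyps finite_subset by auto
      have pB: "p i > 0" if "i \<in> B" for i using psubset.prems(1)[of i] B that by auto
      then have "sum p B > 0" using sum_pos[OF finB, of p] B by auto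
      then have k0: "k > 0" using k by (cases k) auto
      have AB: "sum p A = sum p B + sum p (A - B)"
        using B psubset.hyps by (metis DiffD1 PowD add.commute sum.subset_diff)
      then have km: "k \<le> m" using k psubset.prems(2) assms(3) by (metis le_add1 mult_le_cancel1)
      have AB': "sum p (A - B) = r * (m - k)"
        using AB k psubset.prems(2) by (simp add: diff_mult_distrib2)
      \<comment> \<open>The remaining tuple also avoids the prime over B, so one more prime is
        excluded. For this reason the statement is uniform in sets Y of bounded size, and c is
        generalised in the induction.\<close>
      have "\<exists>C\<ge>0. \<forall>q (Pr :: 'p set) dg Y. prime_system q Pr dg \<longrightarrow> finite Y \<longrightarrow> card Y \<le> Suc c \<longrightarrow>
          cmod (tuple_sum dg r (Pr - Y) p (A - B) - t (A - B) * of_nat q ^ (m - k)) \<le> C * real q ^ (m - k) / real q"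
      proof (rule psubset.IH)
        show "A - B \<subset> A" using B by auto
        show "p i > 0" if "i \<in> A - B" for i using psubset.prems(1) that by auto
        show "sum p (A - B) = r * (m - k)" by (rule AB')
        show "of_nat m' * t D =
          (\<Sum>k=1..m'. \<Sum>E | E \<subseteq> D \<and> (\<forall>b\<in>E. k dvd p b) \<and> sum p E = k * r. (- of_nat k) ^ card E * t (D - E))"
          if "D \<subseteq> A - B" "sum p D = r * m'" for D m'
          by (rule psubset.prems(3)) (use that in auto)
      qed
      then obtain C where C: "C \<ge> 0" "\<And>q (Pr :: 'p set) dg Y. prime_system q Pr dg \<Longrightarrow> finite Y \<Longrightarrow> card Y \<le> Suc c \<Longrightarrow>
          cmod (tuple_sum dg r (Pr - Y) p (A - B) - t (A - B) * of_nat q ^ (m - k)) \<le> C * real q ^ (m - k) / real q"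
        by blast
      have main: "main B = (if \<forall>b\<in>B. k dvd p b then of_nat r * (- of_nat k) ^ card B * t (A - B) else 0)"
        using k assms(3) by (auto simp: main_def good_def)
      show ?thesis
      proof (intro exI conjI allI impI)
        fix q and Pr Y :: "'p set" and dg
        assume sys: "prime_system q Pr dg" and Y: "finite Y" "card Y \<le> c"
        interpret prime_system q Pr dg by fact
        show "cmod (bt dg Pr Y B - main B * of_nat q ^ m) \<le>
          (real r * real k ^ card B * (C + cmod (t (A - B)) * (real k * (1 + real c)))
           + real k * (real r * real k * real k ^ card B * (cmod (t (A - B)) + C))) * real q ^ m / real q"
          unfolding bt_def main
        proof (rule tuple_term_bound[OF Y finB _ _ assms(3) k k0 km C(1)])
          fix P assume "P \<in> Pr - Y"
          have "Pr - Y - {P} = Pr - insert P Y" by auto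
          moreover have "card (insert P Y) \<le> Suc c" using Y by (simp add: card_insert_if)
          ultimately show "cmod (tuple_sum dg r (Pr - Y - {P}) p (A - B) - t (A - B) * of_nat q ^ (m - k)) \<le> C * real q ^ (m - k) / real q"
            using C(2)[OF sys, of "insert P Y"] Y by simp
        qed (use B pB in auto)
      qed (use C in auto)
    qed
    then obtain C where C: "\<And>B. B \<in> Pow A - {{}} \<Longrightarrow> C B \<ge> 0 \<and> (\<forall>q (Pr :: 'p set) dg Y. prime_system q Pr dg \<longrightarrow> finite Y \<longrightarrow> card Y \<le> c \<longrightarrow>
        cmod (bt dg Pr Y B - main B * of_nat q ^ m) \<le> C B * real q ^ m / real q)"
      by metis
    \<comment> \<open>Summed over the blocks, the main terms reproduce the recurrence for t,
      multiplied by r.\<close>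
    have main_sum: "(\<Sum>B\<in>Pow A - {{}}. main B) = of_nat (r * m) * t A"
    proof -
      have "main B = (\<Sum>k=1..m. if good B k then of_nat r * (- of_nat k) ^ card B * t (A - B) else 0)"
        if B: "B \<in> Pow A - {{}}" for B
      proof (cases "\<exists>k. good B k")
        case True
        then obtain k where k: "good B k" by blast
        have finB: "finite B" using B psubset.hyps finite_subset by auto
        have pB: "p i > 0" if "i \<in> B" for i using psubset.prems(1)[of i] B that by auto
      then have "sum p B > 0" using sum_pos[OF finB, of p] B by auto
        then have k0: "k > 0" using k by (cases k) (auto simp: good_def)
        have "sum p B \<le> sum p A" using B psubset.hyps by (intro sum_mono2) auto
        then have "k * r \<le> m * r" using k psubset.prems(2) by (simp add: good_def mult.commute)
        then have km: "k \<le> m" using assms(3) by simp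
        have uniq: "good B j \<longleftrightarrow> j = k" for j using k assms(3) by (auto simp: good_def)
        have "main B = of_nat r * (- of_nat k) ^ card B * t (A - B)"
          using True k assms(3) by (auto simp: main_def good_def)
        then show ?thesis using k0 km by (simp add: uniq)
      next
        case False
        then show ?thesis by (simp add: main_def)
      qed
      then have "(\<Sum>B\<in>Pow A - {{}}. main B) = (\<Sum>B\<in>Pow A - {{}}. \<Sum>k=1..m. if good B k then of_nat r * (- of_nat k) ^ card B * t (A - B) else 0)"
        by (intro sum.cong refl)
      also have "\<dots> = (\<Sum>k=1..m. \<Sum>B\<in>Pow A - {{}}. if good B k then of_nat r * (- of_nat k) ^ card B * t (A - B) else 0)"
        by (rule sum.swap)
      also have "\<dots> = (\<Sum>k=1..m. \<Sum>B | B \<subseteq> A \<and> (\<forall>b\<in>B. k dvd p b) \<and> sum p B = k * r. of_nat r * (- of_nat k) ^ card B * t (A - B))"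
      proof (rule sum.cong[OF refl])
        fix k assume k: "k \<in> {1..m}"
        have "(\<Sum>B\<in>Pow A - {{}}. if good B k then of_nat r * (- of_nat k) ^ card B * t (A - B) else 0) =
          (\<Sum>B\<in>{B \<in> Pow A - {{}}. good B k}. of_nat r * (- of_nat k) ^ card B * t (A - B))"
          using psubset.hyps by (intro sum.inter_filter[symmetric]) auto
        also have "{B \<in> Pow A - {{}}. good B k} = {B. B \<subseteq> A \<and> (\<forall>b\<in>B. k dvd p b) \<and> sum p B = k * r}"
          using k assms(3) by (auto simp: good_def)
        finally show "(\<Sum>B\<in>Pow A - {{}}. if good B k then of_nat r * (- of_nat k) ^ card B * t (A - B) else 0) =
          (\<Sum>B | B \<subseteq> A \<and> (\<forall>b\<in>B. k dvd p b) \<and> sum p B = k * r. of_nat r * (- of_nat k) ^ card B * t (A - B))" .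
      qed
      also have "\<dots> = of_nat r * (of_nat m * t A)"
        unfolding psubset.prems(3)[OF order.refl psubset.prems(2)] by (simp add: sum_distrib_left mult.assoc)
      finally show ?thesis by (simp add: mult.assoc)
    qed
    show ?thesis
    proof (intro exI conjI allI impI)
      let ?C = "(\<Sum>B\<in>Pow A - {{}}. C B) / real (r * m)"
      show "0 \<le> ?C" using C by (intro divide_nonneg_nonneg sum_nonneg) auto
      fix q and Pr Y :: "'p set" and dg
      assume sys: "prime_system q Pr dg" and Y: "finite Y" "card Y \<le> c"
      interpret prime_system q Pr dg by fact
      have "of_nat (r * m) * tuple_sum dg r (Pr - Y) p A = (\<Sum>B\<in>Pow A - {{}}. bt dg Pr Y B)"
        unfolding bt_def psubset.prems(2)[symmetric]
      proof (rule tuple_sum_rec[OF psubset.hyps(1)])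
        fix i assume "i \<in> A"
        then show "finite {P \<in> Pr - Y. dg P dvd p i}"
          by (intro finite_subset[OF _ finite_primes_dvd[of "p i"]]) (auto simp: psubset.prems(1))
      qed
      then have "of_nat (r * m) * (tuple_sum dg r (Pr - Y) p A - t A * of_nat q ^ m) =
         (\<Sum>B\<in>Pow A - {{}}. bt dg Pr Y B - main B * of_nat q ^ m)"
        by (simp only: sum_subtractf sum_distrib_right[symmetric] main_sum) (simp add: algebra_simps)
      then have "real (r * m) * cmod (tuple_sum dg r (Pr - Y) p A - t A * of_nat q ^ m) =
         cmod (\<Sum>B\<in>Pow A - {{}}. bt dg Pr Y B - main B * of_nat q ^ m)"
        by (metis norm_mult norm_of_nat)
      also have "\<dots> \<le> (\<Sum>B\<in>Pow A - {{}}. C B * real q ^ m / real q)"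
        using C sys Y by (intro sum_norm_le) blast
      also have "\<dots> = (\<Sum>B\<in>Pow A - {{}}. C B) * real q ^ m / real q"
        by (simp add: sum_distrib_right sum_divide_distrib)
      finally have *: "real (r * m) * cmod (tuple_sum dg r (Pr - Y) p A - t A * of_nat q ^ m) \<le> (\<Sum>B\<in>Pow A - {{}}. C B) * real q ^ m / real q" .
      have rm: "real (r * m) > 0" using assms(3) m by simp
      show "cmod (tuple_sum dg r (Pr - Y) p A - t A * of_nat q ^ m) \<le> ?C * real q ^ m / real q"
      proof -
        have "cmod (tuple_sum dg r (Pr - Y) p A - t A * of_nat q ^ m) \<le> ((\<Sum>B\<in>Pow A - {{}}. C B) * real q ^ m / real q) / real (r * m)"
          using * rm by (subst pos_le_divide_eq) (simp_all only: mult.commute)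
        then show ?thesis by (simp add: mult_ac)
      qed
    qed
  qed
qed

subsection \<open>Averages of character sums over power-free multisets\<close>

text \<open>\<open>s P Q\<close> is the symbol of P modulo Q. In \<open>polya_vinogradov\<close> the
  numerator F is fixed and the modulus G varies, so reciprocity is needed to establish it; exponents
  divisible by r are ruled out because the corresponding primes would make the character
  imprimitive.\<close>

locale residue_system = prime_system q Pr dg
  for q :: nat and Pr :: "'p set" and dg :: "'p \<Rightarrow> nat" +
  fixes r :: nat and s :: "'p \<Rightarrow> 'p \<Rightarrow> complex"
  assumes r_ge_2: "r \<ge> 2"
    and s_same: "P \<in> Pr \<Longrightarrow> s P P = 0"
    and s_root: "P \<in> Pr \<Longrightarrow> Q \<in> Pr \<Longrightarrow> P \<noteq> Q \<Longrightarrow> s P Q ^ r = 1"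
    and polya_vinogradov: "set_mset F \<subseteq> Pr \<Longrightarrow> F \<noteq> {#} \<Longrightarrow> (\<And>P. P \<in># F \<Longrightarrow> \<not> r dvd count F P) \<Longrightarrow>
      cmod (\<Sum>G\<in>msets_of_deg dg Pr n. \<Prod>Q\<in>#G. \<Prod>P\<in>#F. s P Q) \<le> 3 * sqrt (real q ^ (mset_deg dg F - 1))"
begin

definition sym :: "'p multiset \<Rightarrow> 'p multiset \<Rightarrow> complex" where
  "sym F G = (\<Prod>Q\<in>#G. \<Prod>P\<in>#F. s P Q)"

abbreviation family :: "nat \<Rightarrow> 'p multiset set" where
  "family N \<equiv> {G \<in> mon N. power_free r G}"

lemma finite_family: "finite (family N)"
  using finite_mon by simp

lemma norm_s: "P \<in> Pr \<Longrightarrow> Q \<in> Pr \<Longrightarrow> P \<noteq> Q \<Longrightarrow> cmod (s P Q) = 1"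
proof -
  assume "P \<in> Pr" "Q \<in> Pr" "P \<noteq> Q"
  then show ?thesis using r_ge_2 power_eq_1_iff[OF s_root[of P Q]] by auto
qed

lemma norm_s_le: "P \<in> Pr \<Longrightarrow> Q \<in> Pr \<Longrightarrow> cmod (s P Q) \<le> 1"
  using norm_s[of P Q] s_same[of P] by (cases "P = Q") auto

lemma sym_eq_0:
  assumes "P \<in># F" "P \<in># G" "P \<in> Pr"
  shows "sym F G = 0"
proof -
  have "(\<Prod>R\<in>#F. s R P) = 0"
    using assms(1,3) s_same by (auto dest!: multi_member_split)
  then show ?thesis using assms(2) by (auto simp: sym_def dest!: multi_member_split)
qed

lemma character_power_part:
  assumes "set_mset F \<subseteq> Pr" "\<And>P. P \<in># F \<Longrightarrow> r dvd count F P" "Q \<in> Pr" "Q \<notin># F"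
  shows "(\<Prod>P\<in>#F. s P Q) = 1"
proof -
  have "(\<Prod>P\<in>#F. s P Q) = (\<Prod>P\<in>set_mset F. s P Q ^ count F P)"
    by (simp add: image_prod_mset_multiplicity)
  also have "\<dots> = 1"
  proof (intro prod.neutral ballI)
    fix P assume P: "P \<in># F"
    then have "r dvd count F P" by (rule assms(2))
    then obtain k where "count F P = r * k" by (rule dvdE)
    moreover have "s P Q ^ r = 1" using P assms by (intro s_root) auto
    ultimately show "s P Q ^ count F P = 1" by (simp add: power_mult)
  qed
  finally show ?thesis .
qed

text \<open>The primes whose exponent in F is divisible by r only enforce coprimality, so the
  character is that of the rest \<open>F0\<close>, to which \<open>polya_vinogradov\<close> applies.
  Coprimality to F is imposed by removing the set T of its primes; it has at most d elements, which
  keeps the factors coming from T independent of q.\<close>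

lemma sum_sym_non_power:
  assumes F: "set_mset F \<subseteq> Pr" "P0 \<in># F" "\<not> r dvd count F P0"
  defines "d \<equiv> mset_deg dg F"
  shows "cmod (\<Sum>G\<in>family N. sym F G) \<le> (1 + real q) * (2 * real (Suc N)) ^ d * real (Suc N) * (3 * sqrt (real q ^ (d - 1)))"
proof -
  define F0 where "F0 = filter_mset (\<lambda>P. \<not> r dvd count F P) F"
  define F1 where "F1 = filter_mset (\<lambda>P. r dvd count F P) F"
  define h where "h Q = (\<Prod>P\<in>#F0. s P Q)" for Q
  let ?T = "set_mset F"
  have split: "F = F1 + F0" unfolding F0_def F1_def by (rule multiset_partition)
  have sub: "set_mset F0 \<subseteq> Pr" "set_mset F1 \<subseteq> Pr" using F(1) by (auto simp: F0_def F1_def)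
  have card_le: "card (set_mset F) \<le> mset_deg dg F" if "set_mset F \<subseteq> Pr" for F
    using that
  proof (induction F)
    case (add P F)
    then have "dg P > 0" using dg_pos by auto
    with add show ?case by (auto simp: card_insert_if)
  qed simp
  have F0: "F0 \<noteq> {#}" "\<And>P. P \<in># F0 \<Longrightarrow> \<not> r dvd count F0 P"
    using F by (auto simp: F0_def)
  have deg_le: "mset_deg dg F0 \<le> d" using split by (simp add: d_def)
  have h_eq: "(\<Prod>P\<in>#F. s P Q) = h Q" if "Q \<in> Pr - ?T" for Q
  proof -
    have "(\<Prod>P\<in>#F1. s P Q) = 1"
      using that sub by (intro character_power_part) (auto simp: F1_def)
    then show ?thesis by (subst split) (simp add: h_def)
  qed
  have "(\<Sum>G\<in>family N. sym F G) = (\<Sum>G\<in>{G \<in> msets_of_deg dg (Pr - ?T) N. power_free r G}. sym F G)"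
  proof (rule sum.mono_neutral_right[OF finite_family])
    show "\<forall>G\<in>family N - {G \<in> msets_of_deg dg (Pr - ?T) N. power_free r G}. sym F G = 0"
    proof
      fix G assume G: "G \<in> family N - {G \<in> msets_of_deg dg (Pr - ?T) N. power_free r G}"
      then obtain P where "P \<in># G" "P \<in># F" by (auto simp: msets_of_deg_def)
      then show "sym F G = 0" using F(1) by (intro sym_eq_0) auto
    qed
  qed (auto simp: msets_of_deg_def)
  also have "\<dots> = (\<Sum>G\<in>{G \<in> msets_of_deg dg (Pr - ?T) N. power_free r G}. \<Prod>Q\<in>#G. h Q)"
  proof (intro sum.cong refl)
    fix G assume "G \<in> {G \<in> msets_of_deg dg (Pr - ?T) N. power_free r G}"
    then have "set_mset G \<subseteq> Pr - ?T" by (auto simp: msets_of_deg_def)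
    then show "sym F G = (\<Prod>Q\<in>#G. h Q)"
      unfolding sym_def using h_eq by (intro arg_cong[where f = prod_mset] image_mset_cong) auto
  qed
  also have "cmod \<dots> \<le> (1 + real q) * 2 ^ card ?T * real (Suc N) ^ card ?T * (real (Suc N) * (3 * sqrt (real q ^ (mset_deg dg F0 - 1))))"
  proof (rule power_free_sum_bound)
    show "h P ^ r = 1" if P: "P \<in> Pr - ?T" for P
    proof -
      have "P \<notin># F0" using P by (simp add: F0_def)
      with sub(1) show ?thesis using P unfolding h_def
      proof (induction F0)
        case (add Q F0)
        then have "s Q P ^ r = 1" by (intro s_root) auto
        then show ?case using add by (simp add: power_mult_distrib)
      qed simp
    qed
    show "cmod (h P) \<le> 1" if P: "P \<in> ?T" for P
      using sub(1) unfolding h_def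
    proof (induction F0)
      case (add Q F0)
      then have "cmod (s Q P) \<le> 1" using P F(1) by (intro norm_s_le) auto
      then show ?case using add by (simp add: norm_mult mult_le_one)
    qed simp
    show "cmod (\<Sum>G\<in>mon n. \<Prod>P\<in>#G. h P) \<le> 3 * sqrt (real q ^ (mset_deg dg F0 - 1))" for n
      unfolding h_def by (rule polya_vinogradov[OF sub(1) F0])
  qed (use F r_ge_2 in auto)
  also have "\<dots> \<le> (1 + real q) * 2 ^ d * real (Suc N) ^ d * (real (Suc N) * (3 * sqrt (real q ^ (d - 1))))"
  proof -
    have c: "card ?T \<le> d" using card_le[OF F(1)] by (simp add: d_def)
    have "real q ^ (mset_deg dg F0 - 1) \<le> real q ^ (d - 1)"
      using deg_le q_ge_2 by (intro power_increasing) auto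
    then show ?thesis
      using c by (intro mult_mono power_increasing) auto
  qed
  finally show ?thesis unfolding power_mult_distrib by (simp only: mult_ac)
qed

text \<open>The symbol is 1 or 0 according to coprimality, and each of the at most d primes of F
  divides at most q^(N-1) of the multisets of degree N.\<close>

lemma sum_sym_power:
  assumes F: "set_mset F \<subseteq> Pr" "\<And>P. P \<in># F \<Longrightarrow> r dvd count F P"
  defines "d \<equiv> mset_deg dg F"
  shows "cmod ((\<Sum>G\<in>family N. sym F G) - of_nat (card (family N))) \<le> real d * (real q ^ N / real q)"
proof -
  let ?M = "{G \<in> family N. \<exists>P. P \<in># F \<and> P \<in># G}"
  have sym: "sym F G = (if \<exists>P. P \<in># F \<and> P \<in># G then 0 else 1)" if "G \<in> family N" for G
  proof (cases "\<exists>P. P \<in># F \<and> P \<in># G")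
    case True
    then show ?thesis using F(1) sym_eq_0 by auto
  next
    case False
    have "(\<Prod>Q\<in>#G. \<Prod>P\<in>#F. s P Q) = (\<Prod>Q\<in>#G. 1)"
      using False that F
      by (intro arg_cong[where f = prod_mset] image_mset_cong character_power_part) (auto simp: msets_of_deg_def)
    then show ?thesis using False by (simp add: sym_def)
  qed
  have "of_nat (card (family N)) - (\<Sum>G\<in>family N. sym F G) = (\<Sum>G\<in>family N. 1 - sym F G)"
    by (simp add: sum_subtractf)
  also have "\<dots> = (\<Sum>G\<in>family N. if \<exists>P. P \<in># F \<and> P \<in># G then 1 else 0)"
    by (intro sum.cong refl) (simp add: sym)
  also have "\<dots> = of_nat (card ?M)"
    using finite_family by (simp add: sum.inter_filter[symmetric])
  finally have "cmod ((\<Sum>G\<in>family N. sym F G) - of_nat (card (family N))) = real (card ?M)"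
    unfolding norm_minus_commute[of "\<Sum>G\<in>family N. sym F G"] by (simp only: norm_of_nat)
  also have "real (card ?M) \<le> (\<Sum>P\<in>set_mset F. real q ^ N / real q)"
  proof -
    have "?M \<subseteq> (\<Union>P\<in>set_mset F. {G \<in> mon N. P \<in># G})" by auto
    then have "card ?M \<le> card (\<Union>P\<in>set_mset F. {G \<in> mon N. P \<in># G})"
      using finite_mon by (intro card_mono) auto
    also have "\<dots> \<le> (\<Sum>P\<in>set_mset F. card {G \<in> mon N. P \<in># G})"
      by (rule card_UN_le) simp
    finally have "real (card ?M) \<le> (\<Sum>P\<in>set_mset F. real (card {G \<in> mon N. P \<in># G}))"
      unfolding of_nat_sum[symmetric] of_nat_le_iff .
    also have "\<dots> \<le> (\<Sum>P\<in>set_mset F. real q ^ N / real q)"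
    proof (intro sum_mono)
      fix P assume "P \<in> set_mset F"
      then have P: "P \<in> Pr" "dg P > 0" using F(1) dg_pos by auto
      show "real (card {G \<in> mon N. P \<in># G}) \<le> real q ^ N / real q"
      proof (cases "dg P \<le> N")
        case True
        have "{G \<in> mon N. P \<in># G} \<subseteq> add_mset P ` mon (N - dg P)"
        proof
          fix G assume G: "G \<in> {G \<in> mon N. P \<in># G}"
          then obtain H where H: "G = add_mset P H" by (auto dest: multi_member_split)
          with G have "H \<in> mon (N - dg P)" by (auto simp: msets_of_deg_def)
          then show "G \<in> add_mset P ` mon (N - dg P)" using H by blast
        qed
        then have "card {G \<in> mon N. P \<in># G} \<le> card (mon (N - dg P))"
          using finite_mon by (rule surj_card_le[rotated])
        also have "\<dots> = q ^ (N - dg P)" by (rule card_msets_of_deg)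
        finally have "real (card {G \<in> mon N. P \<in># G}) \<le> real q ^ (N - dg P)"
          unfolding of_nat_power[symmetric] of_nat_le_iff .
        also have "\<dots> \<le> real q ^ (N - 1)" using P q_ge_2 by (intro power_increasing) auto
        also have "\<dots> = real q ^ N / real q" using True P q_ge_2 by (cases N) auto
        finally show ?thesis .
      next
        case False
        have "P \<notin># G" if "G \<in> mon N" for G
        proof
          assume "P \<in># G"
          then obtain H where "G = add_mset P H" by (auto dest: multi_member_split)
          with that False show False by (simp add: msets_of_deg_def)
        qed
        then have "{G \<in> mon N. P \<in># G} = {}" by blast
        then show ?thesis by (simp only:) simp
      qed
    qed
    finally show ?thesis .
  qed
  also have "\<dots> = real (card (set_mset F)) * (real q ^ N / real q)" by simp
  also have "card (set_mset F) \<le> d"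
    using F(1) unfolding d_def
  proof (induction F)
    case (add P F)
    then have "dg P > 0" using dg_pos by auto
    with add show ?case by (auto simp: card_insert_if)
  qed simp
  then have "real (card (set_mset F)) * (real q ^ N / real q) \<le> real d * (real q ^ N / real q)"
    by (intro mult_right_mono) auto
  finally show ?thesis .
qed

text \<open>The product F of the prime powers in the tuple.\<close>

definition tuple_mset :: "('i \<Rightarrow> nat) \<Rightarrow> 'i set \<Rightarrow> ('i \<Rightarrow> 'p) \<Rightarrow> 'p multiset" where
  "tuple_mset p A \<pi> = (\<Sum>i\<in>A. replicate_mset (p i div dg (\<pi> i)) (\<pi> i))"

lemma mset_deg_sum: "mset_deg dg (\<Sum>i\<in>A. f i) = (\<Sum>i\<in>A. mset_deg dg (f i))"
  by (induction A rule: infinite_finite_induct) auto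

lemma tuple_mset_props:
  assumes "finite A" "\<pi> \<in> tuples dg Pr p A" "\<And>i. i \<in> A \<Longrightarrow> p i > 0"
  shows "set_mset (tuple_mset p A \<pi>) = \<pi> ` A" "mset_deg dg (tuple_mset p A \<pi>) = sum p A"
    "power_tuple dg r p A \<pi> \<longleftrightarrow> (\<forall>P\<in>#tuple_mset p A \<pi>. r dvd count (tuple_mset p A \<pi>) P)"
proof -
  have mem: "\<pi> i \<in> Pr" "dg (\<pi> i) dvd p i" "dg (\<pi> i) > 0" "p i div dg (\<pi> i) > 0" if "i \<in> A" for i
  proof -
    show 1: "\<pi> i \<in> Pr" "dg (\<pi> i) dvd p i" using assms(2) that by (auto simp: tuples_def)
    then show 2: "dg (\<pi> i) > 0" using dg_pos by auto
    show "p i div dg (\<pi> i) > 0" using 1 2 assms(3)[OF that] by (simp add: div_greater_zero_iff dvd_imp_le)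
  qed
  have count: "count (tuple_mset p A \<pi>) P = (\<Sum>i\<in>{i \<in> A. \<pi> i = P}. p i div dg P)" for P
  proof -
    have "count (tuple_mset p A \<pi>) P = (\<Sum>i\<in>A. if \<pi> i = P then p i div dg P else 0)"
      unfolding tuple_mset_def count_sum by (intro sum.cong refl) auto
    then show ?thesis using assms(1) by (simp add: sum.inter_filter)
  qed
  show set: "set_mset (tuple_mset p A \<pi>) = \<pi> ` A"
    using assms(1) mem unfolding tuple_mset_def by (subst set_mset_sum) force+
  show "mset_deg dg (tuple_mset p A \<pi>) = sum p A"
    unfolding tuple_mset_def mset_deg_sum using mem by (intro sum.cong) auto
  show "power_tuple dg r p A \<pi> \<longleftrightarrow> (\<forall>P\<in>#tuple_mset p A \<pi>. r dvd count (tuple_mset p A \<pi>) P)"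
    unfolding power_tuple_def set count ..
qed

text \<open>The sum of \<Lambda>(F) \<chi>_G(F) over monic F of degree j, which is -q^(j/2)
  Tr(\<Theta>^j) by the explicit formula.\<close>

definition frobenius_sum :: "'p multiset \<Rightarrow> nat \<Rightarrow> complex" where
  "frobenius_sum G j = prime_power_sum (\<lambda>P. \<Prod>Q\<in>#G. s P Q) j"

lemma prod_frobenius_sum:
  assumes "finite A" "\<And>i. i \<in> A \<Longrightarrow> p i > 0"
  shows "(\<Prod>i\<in>A. - frobenius_sum G (p i)) =
    (\<Sum>\<pi>\<in>tuples dg Pr p A. (\<Prod>i\<in>A. - of_nat (dg (\<pi> i))) * sym (tuple_mset p A \<pi>) G)"
proof -
  let ?h = "\<lambda>P. \<Prod>Q\<in>#G. s P Q"
  have "(\<Prod>i\<in>A. - frobenius_sum G (p i)) =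
     (\<Prod>i\<in>A. \<Sum>P | P \<in> Pr \<and> dg P dvd p i. - of_nat (dg P) * ?h P ^ (p i div dg P))"
    by (simp add: frobenius_sum_def prime_power_sum_def sum_negf)
  also have "\<dots> = (\<Sum>\<pi>\<in>tuples dg Pr p A. \<Prod>i\<in>A. - of_nat (dg (\<pi> i)) * ?h (\<pi> i) ^ (p i div dg (\<pi> i)))"
    unfolding tuples_def using assms finite_primes_dvd by (subst prod_sum_PiE) auto
  also have "\<dots> = (\<Sum>\<pi>\<in>tuples dg Pr p A. (\<Prod>i\<in>A. - of_nat (dg (\<pi> i))) * sym (tuple_mset p A \<pi>) G)"
  proof (intro sum.cong refl)
    fix \<pi>
    have "sym (tuple_mset p A \<pi>) G = (\<Prod>P\<in>#tuple_mset p A \<pi>. ?h P)"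
      unfolding sym_def by (rule prod_mset.swap)
    also have "\<dots> = (\<Prod>i\<in>A. ?h (\<pi> i) ^ (p i div dg (\<pi> i)))"
      unfolding tuple_mset_def using assms(1) by (induction A) auto
    finally show "(\<Prod>i\<in>A. - of_nat (dg (\<pi> i)) * ?h (\<pi> i) ^ (p i div dg (\<pi> i))) =
        (\<Prod>i\<in>A. - of_nat (dg (\<pi> i))) * sym (tuple_mset p A \<pi>) G"
      by (simp only: prod.distrib)
  qed
  finally show ?thesis .
qed

lemma sum_tuples_dg:
  assumes "finite A" "\<And>i. i \<in> A \<Longrightarrow> p i > 0"
  shows "(\<Sum>\<pi>\<in>tuples dg Pr p A. \<Prod>i\<in>A. real (dg (\<pi> i))) = real q ^ sum p A"
proof -
  have "(\<Sum>\<pi>\<in>tuples dg Pr p A. \<Prod>i\<in>A. real (dg (\<pi> i))) = (\<Prod>i\<in>A. \<Sum>P | P \<in> Pr \<and> dg P dvd p i. real (dg P))"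
    unfolding tuples_def using assms finite_primes_dvd by (subst prod_sum_PiE) auto
  also have "\<dots> = (\<Prod>i\<in>A. real q ^ p i)"
  proof (intro prod.cong refl)
    fix i assume "i \<in> A"
    then have "(\<Sum>P | P \<in> Pr \<and> dg P dvd p i. dg P) = q ^ p i" using sum_dg_primes assms by auto
    then show "(\<Sum>P | P \<in> Pr \<and> dg P dvd p i. real (dg P)) = real q ^ p i"
      unfolding of_nat_sum[symmetric] of_nat_power[symmetric] of_nat_eq_iff .
  qed
  finally show ?thesis by (simp add: power_sum)
qed

lemma cmod_prod_neg: "cmod (\<Prod>i\<in>A. - of_nat (f i)) = (\<Prod>i\<in>A. real (f i))"
  by (simp add: prod_norm[symmetric])

lemma sum_power_tuples_dg:
  assumes "finite A" "\<And>i. i \<in> A \<Longrightarrow> p i > 0"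
  shows "(\<Sum>\<pi>\<in>{\<pi> \<in> tuples dg Pr p A. power_tuple dg r p A \<pi>}. \<Prod>i\<in>A. real (dg (\<pi> i))) = cmod (tuple_sum dg r Pr p A)"
proof -
  have "tuple_sum dg r Pr p A = (\<Sum>\<pi>\<in>{\<pi> \<in> tuples dg Pr p A. power_tuple dg r p A \<pi>}. (-1) ^ card A * of_real (\<Prod>i\<in>A. real (dg (\<pi> i))))"
    unfolding tuple_sum_def by (intro sum.cong refl) (simp add: prod_uminus)
  also have "\<dots> = (-1) ^ card A * of_real (\<Sum>\<pi>\<in>{\<pi> \<in> tuples dg Pr p A. power_tuple dg r p A \<pi>}. \<Prod>i\<in>A. real (dg (\<pi> i)))"
    by (simp add: sum_distrib_left)
  finally have "cmod (tuple_sum dg r Pr p A) = \<bar>\<Sum>\<pi>\<in>{\<pi> \<in> tuples dg Pr p A. power_tuple dg r p A \<pi>}. \<Prod>i\<in>A. real (dg (\<pi> i))\<bar>"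
    by (simp only: norm_mult norm_power norm_minus_cancel norm_one power_one mult_1 norm_of_real)
  then show ?thesis by (simp add: sum_nonneg prod_nonneg)
qed

text \<open>Power tuples contribute the size of the family up to the coprimality error; as their
  signs are constant, the modulus of \<open>tuple_sum\<close> is their total weight. The remaining
  tuples have total weight at most q^d, and \<open>sum_sym_non_power\<close> applies to
  each.\<close>

theorem family_sum_bound:
  assumes A: "finite A" "\<And>i. i \<in> A \<Longrightarrow> p i > 0" and d: "d = sum p A"
  shows "cmod ((\<Sum>G\<in>family N. \<Prod>i\<in>A. - frobenius_sum G (p i)) - of_nat (card (family N)) * tuple_sum dg r Pr p A)
    \<le> cmod (tuple_sum dg r Pr p A) * (real d * (real q ^ N / real q))
      + real q ^ d * ((1 + real q) * (2 * real (Suc N)) ^ d * real (Suc N) * (3 * sqrt (real q ^ (d - 1))))"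
proof -
  let ?U = "tuples dg Pr p A" and ?V = "{\<pi> \<in> tuples dg Pr p A. power_tuple dg r p A \<pi>}"
  let ?w = "\<lambda>\<pi>. \<Prod>i\<in>A. - of_nat (dg (\<pi> i)) :: complex"
  let ?S = "\<lambda>\<pi>. \<Sum>G\<in>family N. sym (tuple_mset p A \<pi>) G"
  let ?E = "(1 + real q) * (2 * real (Suc N)) ^ d * real (Suc N) * (3 * sqrt (real q ^ (d - 1)))"
  have finU: "finite ?U"
    unfolding tuples_def using A finite_primes_dvd by (intro finite_PiE) auto
  have sub: "set_mset (tuple_mset p A \<pi>) \<subseteq> Pr" if "\<pi> \<in> ?U" for \<pi>
    using tuple_mset_props(1)[where p = p, OF A(1) that A(2)] that by (auto simp: tuples_def)
  have "(\<Sum>G\<in>family N. \<Prod>i\<in>A. - frobenius_sum G (p i)) = (\<Sum>\<pi>\<in>?U. ?w \<pi> * ?S \<pi>)"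
  proof -
    have "(\<Sum>G\<in>family N. \<Prod>i\<in>A. - frobenius_sum G (p i)) = (\<Sum>G\<in>family N. \<Sum>\<pi>\<in>?U. ?w \<pi> * sym (tuple_mset p A \<pi>) G)"
      by (intro sum.cong refl prod_frobenius_sum A)
    also have "\<dots> = (\<Sum>\<pi>\<in>?U. \<Sum>G\<in>family N. ?w \<pi> * sym (tuple_mset p A \<pi>) G)"
      by (rule sum.swap)
    finally show ?thesis by (simp only: sum_distrib_left)
  qed
  also have "\<dots> = (\<Sum>\<pi>\<in>?V. ?w \<pi> * ?S \<pi>) + (\<Sum>\<pi>\<in>?U - ?V. ?w \<pi> * ?S \<pi>)"
    using finU by (subst add.commute, intro sum.subset_diff) auto
  finally have eq: "(\<Sum>G\<in>family N. \<Prod>i\<in>A. - frobenius_sum G (p i)) - of_nat (card (family N)) * tuple_sum dg r Pr p A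
     = (\<Sum>\<pi>\<in>?V. ?w \<pi> * (?S \<pi> - of_nat (card (family N)))) + (\<Sum>\<pi>\<in>?U - ?V. ?w \<pi> * ?S \<pi>)"
    by (simp add: tuple_sum_def right_diff_distrib sum_subtractf sum_distrib_left mult.commute)
  have 1: "cmod (\<Sum>\<pi>\<in>?V. ?w \<pi> * (?S \<pi> - of_nat (card (family N)))) \<le> cmod (tuple_sum dg r Pr p A) * (real d * (real q ^ N / real q))"
  proof -
    have "cmod (\<Sum>\<pi>\<in>?V. ?w \<pi> * (?S \<pi> - of_nat (card (family N)))) \<le>
       (\<Sum>\<pi>\<in>?V. (\<Prod>i\<in>A. real (dg (\<pi> i))) * (real d * (real q ^ N / real q)))"
    proof (rule sum_norm_le)
      fix \<pi> assume \<pi>: "\<pi> \<in> ?V"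
      then have U: "\<pi> \<in> ?U" by simp
      have "cmod (?S \<pi> - of_nat (card (family N))) \<le> real (mset_deg dg (tuple_mset p A \<pi>)) * (real q ^ N / real q)"
        using \<pi> tuple_mset_props(3)[where p = p, OF A(1) U A(2)] by (intro sum_sym_power sub U) auto
      then show "cmod (?w \<pi> * (?S \<pi> - of_nat (card (family N)))) \<le> (\<Prod>i\<in>A. real (dg (\<pi> i))) * (real d * (real q ^ N / real q))"
        unfolding norm_mult cmod_prod_neg d using tuple_mset_props(2)[where p = p, OF A(1) U A(2)]
        by (intro mult_left_mono prod_nonneg) auto
    qed
    then show ?thesis
      by (simp only: sum_distrib_right[symmetric] sum_power_tuples_dg[where p = p, OF A])
  qed
  have 2: "cmod (\<Sum>\<pi>\<in>?U - ?V. ?w \<pi> * ?S \<pi>) \<le> real q ^ d * ?E"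
  proof -
    have "cmod (\<Sum>\<pi>\<in>?U - ?V. ?w \<pi> * ?S \<pi>) \<le> (\<Sum>\<pi>\<in>?U - ?V. (\<Prod>i\<in>A. real (dg (\<pi> i))) * ?E)"
    proof (rule sum_norm_le)
      fix \<pi> assume \<pi>: "\<pi> \<in> ?U - ?V"
      then have U: "\<pi> \<in> ?U" by simp
      obtain P where P: "P \<in># tuple_mset p A \<pi>" "\<not> r dvd count (tuple_mset p A \<pi>) P"
        using \<pi> tuple_mset_props(3)[where p = p, OF A(1) U A(2)] by auto
      have "cmod (?S \<pi>) \<le> ?E"
        using sum_sym_non_power[OF sub[OF U] P, of N] tuple_mset_props(2)[where p = p, OF A(1) U A(2)] d by simp
      then show "cmod (?w \<pi> * ?S \<pi>) \<le> (\<Prod>i\<in>A. real (dg (\<pi> i))) * ?E"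
        unfolding norm_mult cmod_prod_neg by (intro mult_left_mono prod_nonneg) auto
    qed
    also have "\<dots> \<le> (\<Sum>\<pi>\<in>?U. (\<Prod>i\<in>A. real (dg (\<pi> i))) * ?E)"
      using finU by (intro sum_mono2) (auto intro!: mult_nonneg_nonneg prod_nonneg)
    also have "\<dots> = real q ^ d * ?E"
      by (simp only: sum_distrib_right[symmetric] sum_tuples_dg[where p = p, OF A] d)
    finally show ?thesis .
  qed
  show ?thesis unfolding eq by (intro order_trans[OF norm_triangle_ineq] add_mono 1 2)
qed

end

text \<open>The exponent collects q^d for the weight of the tuples, q for the factor 1 + q,
  q^((d-1)/2) for the Polya-Vinogradov bound, q^(-d/r) for the normalisation and q^(-N) for the
  family. The constant is chosen before the residue system and hence independent of q.\<close>

theorem family_average_asymptotics: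
  fixes t :: "'i set \<Rightarrow> complex"
  assumes A: "finite A" "\<And>i. i \<in> A \<Longrightarrow> p i > 0" and r: "2 \<le> r" "r \<le> N" and t_empty: "t {} = 1"
    and t_rec: "\<And>B m. B \<subseteq> A \<Longrightarrow> sum p B = r * m \<Longrightarrow> of_nat m * t B =
      (\<Sum>k=1..m. \<Sum>D | D \<subseteq> B \<and> (\<forall>b\<in>D. k dvd p b) \<and> sum p D = k * r. (- of_nat k) ^ card D * t (B - D))"
    and t_not_dvd: "\<not> r dvd sum p A \<Longrightarrow> t A = 0"
    and d: "d = sum p A"
  shows "\<exists>C\<ge>0. \<forall>q (Pr :: 'p set) dg s. residue_system q Pr dg r s \<longrightarrow>
     cmod ((\<Sum>G\<in>{G \<in> msets_of_deg dg Pr N. power_free r G}. \<Prod>i\<in>A. - residue_system.frobenius_sum Pr dg s G (p i))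
         / of_nat (card {G \<in> msets_of_deg dg Pr N. power_free r G}) * of_real (real q powr (- (real d / real r))) - t A)
       \<le> C / real q + C * real q powr (real d * (1 - 1 / real r) + (real d + 1) / 2 - real N)"
proof -
  have "\<exists>C\<ge>0. \<forall>q (Pr :: 'p set) dg. prime_system q Pr dg \<longrightarrow>
      cmod (tuple_sum dg r Pr p A * of_real (real q powr (- (real d / real r))) - t A) \<le> C / real q"
  proof (cases "r dvd d")
    case False
    then show ?thesis
      using A(1) t_not_dvd by (intro exI[of _ 0]) (auto simp: d tuple_sum_not_dvd)
  next
    case True
    then obtain m where m: "d = r * m" by (elim dvdE)
    have "\<exists>C\<ge>0. \<forall>q (Pr :: 'p set) dg Y. prime_system q Pr dg \<longrightarrow> finite Y \<longrightarrow> card Y \<le> 0 \<longrightarrow>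
        cmod (tuple_sum dg r (Pr - Y) p A - t A * of_nat q ^ m) \<le> C * real q ^ m / real q"
      using A r t_empty t_rec m d by (intro tuple_sum_asymptotics[where p = p]) auto
    then obtain C where C: "C \<ge> 0" "\<And>q (Pr :: 'p set) dg Y. prime_system q Pr dg \<Longrightarrow> finite Y \<Longrightarrow> card Y \<le> 0 \<Longrightarrow>
        cmod (tuple_sum dg r (Pr - Y) p A - t A * of_nat q ^ m) \<le> C * real q ^ m / real q"
      by blast
    show ?thesis
    proof (intro exI[of _ C] conjI allI impI C(1))
      fix q and Pr :: "'p set" and dg
      assume sys: "prime_system q Pr dg"
      then have q: "real q > 0" using prime_system.q_ge_2 by fastforce
      have powr: "real q powr (- (real d / real r)) = 1 / real q ^ m"
      proof -
        have "real d / real r = real m" using r m by simp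
        then show ?thesis using q by (simp add: powr_minus powr_realpow divide_inverse)
      qed
      have "tuple_sum dg r Pr p A * of_real (real q powr (- (real d / real r))) - t A =
         (tuple_sum dg r Pr p A - t A * of_nat q ^ m) / of_nat q ^ m"
        using q by (simp add: powr diff_divide_distrib)
      then have "cmod (tuple_sum dg r Pr p A * of_real (real q powr (- (real d / real r))) - t A) =
         cmod (tuple_sum dg r Pr p A - t A * of_nat q ^ m) / real q ^ m"
        by (simp add: norm_divide norm_power)
      also have "\<dots> \<le> (C * real q ^ m / real q) / real q ^ m"
        using C(2)[OF sys, of "{}"] q by (intro divide_right_mono) auto
      finally show "cmod (tuple_sum dg r Pr p A * of_real (real q powr (- (real d / real r))) - t A) \<le> C / real q"
        using q by simp
    qed
  qed
  then obtain C where C: "C \<ge> 0" "\<And>q (Pr :: 'p set) dg. prime_system q Pr dg \<Longrightarrow>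
      cmod (tuple_sum dg r Pr p A * of_real (real q powr (- (real d / real r))) - t A) \<le> C / real q"
    by blast
  \<comment> \<open>From 1 + q \<le> 2 q and the factors of \<open>family_sum_bound\<close> that do
    not involve q.\<close>
  define K where "K = 2 * (2 * real (Suc N)) ^ d * real (Suc N) * 3"
  have K: "K \<ge> 0" by (simp add: K_def)
  define C' where "C' = C + 2 * real d * (cmod (t A) + C) + 2 * K"
  show ?thesis
  proof (intro exI[of _ C'] conjI allI impI)
    show "0 \<le> C'" using C K by (simp add: C'_def)
    fix q and Pr :: "'p set" and dg s
    assume sys: "residue_system q Pr dg r s"
    interpret residue_system q Pr dg r s by fact
    have q: "real q \<ge> 2" using q_ge_2 by simp
    define H where "H = real (card (family N))"
    define S where "S = tuple_sum dg r Pr p A"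
    define Z where "Z = (\<Sum>G\<in>family N. \<Prod>i\<in>A. - frobenius_sum G (p i))"
    define y where "y = real q powr (- (real d / real r))"
    define e where "e = real d * (1 - 1 / real r) + (real d + 1) / 2 - real N"
    have y: "y > 0" using q by (simp add: y_def)
    have H1: "H \<ge> real q ^ N / 2" using card_power_free(2)[OF r] unfolding H_def .
    have "0 < real q ^ N / 2" using q by simp
    with H1 have H: "H \<ge> real q ^ N / 2" "H > 0" by linarith+
    have main: "cmod (S * of_real y - t A) \<le> C / real q"
      unfolding S_def y_def by (rule C(2)) unfold_locales
    have Sy: "cmod S * y \<le> cmod (t A) + C"
    proof -
      have "cmod S * y = cmod (S * of_real y)" using y by (simp add: norm_mult)
      also have "\<dots> \<le> cmod (t A) + cmod (S * of_real y - t A)" by (metis add.commute norm_triangle_sub)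
      also have "\<dots> \<le> cmod (t A) + C / real q" using main by simp
      also have "C / real q \<le> C" using C(1) q mult_left_mono[of 1 "real q" C] by (simp add: divide_le_eq)
      finally show ?thesis by simp
    qed
    have bound: "cmod (Z - of_real H * S) \<le> cmod S * (real d * (real q ^ N / real q)) + K * real q powr (real d + (real d + 1) / 2)"
    proof -
      have "real q ^ d * ((1 + real q) * (2 * real (Suc N)) ^ d * real (Suc N) * (3 * sqrt (real q ^ (d - 1)))) \<le>
         K * real q powr (real d + (real d + 1) / 2)" if "d > 0"
      proof -
        have "sqrt (real q ^ (d - 1)) = real q powr ((real d - 1) / 2)"
          using q that by (simp add: powr_half_sqrt[symmetric] powr_powr of_nat_diff flip: powr_realpow)
        moreover have "(1 + real q) \<le> 2 * real q powr 1" using q by simp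
        ultimately have "real q ^ d * ((1 + real q) * (2 * real (Suc N)) ^ d * real (Suc N) * (3 * sqrt (real q ^ (d - 1)))) \<le>
           real q powr real d * ((2 * real q powr 1) * (2 * real (Suc N)) ^ d * real (Suc N) * (3 * real q powr ((real d - 1) / 2)))"
          using q by (intro mult_mono mult_nonneg_nonneg) (auto simp: powr_realpow)
        also have "\<dots> = K * (real q powr real d * real q powr 1 * real q powr ((real d - 1) / 2))"
          by (simp add: K_def mult_ac)
        also have "real q powr real d * real q powr 1 * real q powr ((real d - 1) / 2) = real q powr (real d + (real d + 1) / 2)"
          unfolding powr_add[symmetric] by (simp add: field_simps)
        finally show ?thesis .
      qed
      \<comment> \<open>For d = 0 the natural number d - 1 is truncated to 0 and does not match the
        real exponent (d - 1)/2; but then there are no parts and the difference vanishes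
        exactly.\<close>
      moreover have "cmod (Z - of_real H * S) = 0" if "d = 0"
      proof -
        have "A = {}" using A that d by auto
        then show ?thesis by (simp add: Z_def H_def S_def tuple_sum_empty)
      qed
      ultimately show ?thesis
        using family_sum_bound[where p = p, OF A d, of N] K unfolding Z_def S_def H_def
        by (cases "d = 0") (simp_all add: mult_nonneg_nonneg)
    qed
    have "Z / of_real H * of_real y - t A = (Z - of_real H * S) * of_real (y / H) + (S * of_real y - t A)"
      using H by (simp add: field_simps)
    then have "cmod (Z / of_real H * of_real y - t A) \<le> cmod ((Z - of_real H * S) * of_real (y / H)) + cmod (S * of_real y - t A)"
      by (simp only: norm_triangle_ineq)
    also have "cmod ((Z - of_real H * S) * of_real (y / H)) = cmod (Z - of_real H * S) * (y / H)"
      unfolding norm_mult norm_of_real using H y by simp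
    finally have "cmod (Z / of_real H * of_real y - t A) \<le> cmod (Z - of_real H * S) * (y / H) + C / real q"
      using main by linarith
    also have "cmod (Z - of_real H * S) * (y / H) \<le> cmod (Z - of_real H * S) * (y / (real q ^ N / 2))"
      using H y q by (intro mult_left_mono divide_left_mono) auto
    also have "\<dots> \<le> (cmod S * (real d * (real q ^ N / real q)) + K * real q powr (real d + (real d + 1) / 2)) * (y / (real q ^ N / 2))"
      using bound y q by (intro mult_right_mono) auto
    also have "\<dots> = 2 * real d * (cmod S * y) / real q + 2 * K * (real q powr (real d + (real d + 1) / 2) * y / real q ^ N)"
      using q by (simp add: field_simps)
    also have "real q powr (real d + (real d + 1) / 2) * y / real q ^ N = real q powr e"
    proof -
      have "real q powr (real d + (real d + 1) / 2) * y / real q ^ N =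
        real q powr (real d + (real d + 1) / 2) * real q powr (- (real d / real r)) * real q powr (- real N)"
      proof -
        have "inverse (real q ^ N) = real q powr (- real N)" using q by (simp add: powr_minus powr_realpow)
        then show ?thesis by (simp only: y_def divide_inverse)
      qed
      also have "\<dots> = real q powr (real d + (real d + 1) / 2 + - (real d / real r) + - real N)"
        by (simp only: powr_add)
      also have "real d + (real d + 1) / 2 + - (real d / real r) + - real N = e"
        by (simp add: e_def right_diff_distrib)
      finally show ?thesis .
    qed
    also have "2 * real d * (cmod S * y) / real q + 2 * K * real q powr e \<le> 2 * real d * (cmod (t A) + C) / real q + 2 * K * real q powr e"
      using Sy q by (intro add_right_mono divide_right_mono mult_left_mono) auto
    finally have "cmod (Z / of_real H * of_real y - t A) \<le>
       (2 * real d * (cmod (t A) + C) + C) / real q + 2 * K * real q powr e"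
      by (simp add: add_divide_distrib)
    also have "\<dots> \<le> C' / real q + C' * real q powr e"
      using C K q by (intro add_mono divide_right_mono mult_right_mono) (auto simp: C'_def)
    finally show "cmod ((\<Sum>G\<in>family N. \<Prod>i\<in>A. - frobenius_sum G (p i)) / of_nat (card (family N)) * of_real (real q powr (- (real d / real r))) - t A)
       \<le> C' / real q + C' * real q powr (real d * (1 - 1 / real r) + (real d + 1) / 2 - real N)"
      by (simp add: Z_def H_def y_def e_def)
  qed
qed

subsection \<open>Polynomials over a finite field\<close>

text \<open>The value 0 at the zero polynomial \<open>[]\<close> makes it multiplicative on all
  polynomials and turns a vanishing remainder into a vanishing factor.\<close>

definition lcoeff :: "('a, 'b) ring_scheme \<Rightarrow> 'a list \<Rightarrow> 'a" where
  "lcoeff R a = (if a = [] then \<zero>\<^bsub>R\<^esub> else hd a)"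

locale finite_field_poly = field R for R :: "'a ring" (structure) +
  assumes finite_carrier: "finite (carrier R)"
begin

abbreviation K where "K \<equiv> carrier R"
abbreviation KX where "KX \<equiv> poly_ring R"
abbreviation pmult (infixl "\<star>" 70) where "a \<star> b \<equiv> a \<otimes>\<^bsub>KX\<^esub> b"
abbreviation padd (infixl "\<boxplus>" 65) where "a \<boxplus> b \<equiv> a \<oplus>\<^bsub>KX\<^esub> b"
abbreviation psub (infixl "\<boxminus>" 65) where "a \<boxminus> b \<equiv> a \<ominus>\<^bsub>KX\<^esub> b"
abbreviation cst where "cst \<equiv> poly_of_const"
abbreviation lc where "lc \<equiv> lcoeff R"

sublocale P: principal_domain KX
  by (rule univ_poly_is_principal[OF carrier_is_subfield])

definition q :: nat where "q = card K"

lemma q_ge_2: "q \<ge> 2"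
proof -
  have "card {\<zero>, \<one>} \<le> card K" by (intro card_mono finite_carrier) auto
  then show ?thesis using zero_not_one by (simp add: q_def)
qed

lemma KX_iff: "a \<in> carrier KX \<longleftrightarrow> set a \<subseteq> K \<and> (a \<noteq> [] \<longrightarrow> hd a \<noteq> \<zero>)"
  unfolding univ_poly_carrier[symmetric] polynomial_def by auto

lemma KX_set: "a \<in> carrier KX \<Longrightarrow> set a \<subseteq> K" by (simp add: KX_iff)

lemma KX_zero [simp]: "\<zero>\<^bsub>KX\<^esub> = []" by (simp add: univ_poly_zero)
lemma KX_one [simp]: "\<one>\<^bsub>KX\<^esub> = [\<one>]" by (simp add: univ_poly_one)
lemma Nil_KX [simp]: "[] \<in> carrier KX" using P.zero_closed by simp
lemma one_KX [simp]: "[\<one>] \<in> carrier KX" using P.one_closed by simp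

lemma KX_Nil_simps [simp]:
  "a \<in> carrier KX \<Longrightarrow> [] \<star> a = []" "a \<in> carrier KX \<Longrightarrow> a \<star> [] = []"
  "a \<in> carrier KX \<Longrightarrow> [] \<boxplus> a = a" "a \<in> carrier KX \<Longrightarrow> a \<boxplus> [] = a"
  "a \<in> carrier KX \<Longrightarrow> [\<one>] \<star> a = a" "a \<in> carrier KX \<Longrightarrow> a \<star> [\<one>] = a"
  using P.l_null P.r_null P.l_zero P.r_zero P.l_one P.r_one by simp_all

lemma coeff_closed [simp]: "a \<in> carrier KX \<Longrightarrow> coeff a i \<in> K"
  using KX_set by simp

lemma coeff_add: "a \<in> carrier KX \<Longrightarrow> b \<in> carrier KX \<Longrightarrow> coeff (a \<boxplus> b) i = coeff a i \<oplus> coeff b i"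
  unfolding univ_poly_add using poly_add_coeff[of a b] KX_set by simp

lemma coeff_minus: "a \<in> carrier KX \<Longrightarrow> coeff (\<ominus>\<^bsub>KX\<^esub> a) i = \<ominus> coeff a i"
proof -
  assume a: "a \<in> carrier KX"
  have "coeff (\<ominus>\<^bsub>KX\<^esub> a) i \<oplus> coeff a i = coeff (\<ominus>\<^bsub>KX\<^esub> a \<boxplus> a) i"
    using a by (simp add: coeff_add)
  also have "\<ominus>\<^bsub>KX\<^esub> a \<boxplus> a = []" using P.l_neg[OF a] by simp
  finally show ?thesis using a by (simp add: minus_equality)
qed

lemma coeff_sub: "a \<in> carrier KX \<Longrightarrow> b \<in> carrier KX \<Longrightarrow> coeff (a \<boxminus> b) i = coeff a i \<ominus> coeff b i"
  by (simp add: a_minus_def coeff_add coeff_minus)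

lemma cst_0 [simp]: "cst \<zero> = []" by (simp add: poly_of_const_def)
lemma cst_nonzero: "c \<noteq> \<zero> \<Longrightarrow> cst c = [c]" by (simp add: poly_of_const_def)
lemma cst_1 [simp]: "cst \<one> = [\<one>]" by (simp add: cst_nonzero)

lemma cst_hom: "cst \<in> ring_hom R KX"
  using canonical_embedding_is_hom[OF carrier_is_subring] by simp

lemma cst_closed [simp]: "c \<in> K \<Longrightarrow> cst c \<in> carrier KX"
  using ring_hom_closed[OF cst_hom] .

lemma cst_mult: "c \<in> K \<Longrightarrow> d \<in> K \<Longrightarrow> cst (c \<otimes> d) = cst c \<star> cst d"
  using ring_hom_mult[OF cst_hom] .

lemma coeff_cst_mult: "c \<in> K \<Longrightarrow> a \<in> carrier KX \<Longrightarrow> coeff (cst c \<star> a) i = c \<otimes> coeff a i"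
proof (cases "c = \<zero>")
  case False
  assume "c \<in> K" "a \<in> carrier KX"
  then show ?thesis
    using False poly_mult_const(1)[OF carrier_is_subring, of a c] scalar_coeff[of c a]
    by (simp add: cst_nonzero univ_poly_mult univ_poly_carrier)
qed simp

lemma length_le_iff: "a \<in> carrier KX \<Longrightarrow> length a \<le> n \<longleftrightarrow> (\<forall>i\<ge>n. coeff a i = \<zero>)"
proof
  assume a: "a \<in> carrier KX" and *: "\<forall>i\<ge>n. coeff a i = \<zero>"
  show "length a \<le> n"
  proof (rule ccontr)
    assume "\<not> length a \<le> n"
    then have "a \<noteq> []" "Polynomials.degree a \<ge> n" by auto
    then show False using * lead_coeff_simp[of a] a by (simp add: KX_iff)
  qed
qed (simp add: coeff_length)

text \<open>Polynomials of degree below n, including \<open>[]\<close>; for monic f of degree n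
  these are the remainders modulo f.\<close>

definition V :: "nat \<Rightarrow> 'a list set" where
  "V n = {a \<in> carrier KX. length a \<le> n}"

lemma V_KX: "a \<in> V n \<Longrightarrow> a \<in> carrier KX" by (simp add: V_def)

lemma V_iff: "a \<in> V n \<longleftrightarrow> a \<in> carrier KX \<and> (\<forall>i\<ge>n. coeff a i = \<zero>)"
  using length_le_iff by (auto simp: V_def)

lemma V_add: "a \<in> V n \<Longrightarrow> b \<in> V n \<Longrightarrow> a \<boxplus> b \<in> V n"
  by (auto simp: V_iff coeff_add)

lemma V_minus: "a \<in> V n \<Longrightarrow> \<ominus>\<^bsub>KX\<^esub> a \<in> V n"
  by (auto simp: V_iff coeff_minus)

lemma V_sub: "a \<in> V n \<Longrightarrow> b \<in> V n \<Longrightarrow> a \<boxminus> b \<in> V n"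
  by (simp add: a_minus_def V_add V_minus)

lemma V_cst_mult: "c \<in> K \<Longrightarrow> a \<in> V n \<Longrightarrow> cst c \<star> a \<in> V n"
  by (auto simp: V_iff coeff_cst_mult)

lemma V_mono: "m \<le> n \<Longrightarrow> V m \<subseteq> V n" by (auto simp: V_def)

lemma Nil_V [simp]: "[] \<in> V n" by (simp add: V_def)

lemma finite_V: "finite (V n)"
proof (rule finite_subset)
  show "V n \<subseteq> (\<Union>k\<in>{..n}. {a. set a \<subseteq> K \<and> length a = k})"
    by (auto simp: V_def dest: KX_set)
qed (auto intro: finite_lists_length_eq finite_carrier)

abbreviation M where "M n \<equiv> monic_polys R n"

lemma M_eq: "M n = (\<lambda>l. \<one> # l) ` {l. set l \<subseteq> K \<and> length l = n}"
proof
  show "M n \<subseteq> (\<lambda>l. \<one> # l) ` {l. set l \<subseteq> K \<and> length l = n}"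
  proof
    fix f assume f: "f \<in> M n"
    then obtain l where "f = \<one> # l" by (cases f) (auto simp: monic_polys_def)
    with f show "f \<in> (\<lambda>l. \<one> # l) ` {l. set l \<subseteq> K \<and> length l = n}"
      by (auto simp: monic_polys_def KX_iff)
  qed
qed (auto simp: monic_polys_def KX_iff)

lemma M_iff: "f \<in> M n \<longleftrightarrow> f \<in> carrier KX \<and> length f = Suc n \<and> lc f = \<one>"
  by (cases f) (auto simp: monic_polys_def lcoeff_def)

lemma M_KX: "f \<in> M n \<Longrightarrow> f \<in> carrier KX" by (simp add: M_iff)

lemma card_M: "card (M n) = q ^ n"
  unfolding M_eq by (subst card_image) (auto simp: inj_on_def card_lists_length_eq finite_carrier q_def)

lemma finite_M: "finite (M n)"
  unfolding M_eq by (simp add: finite_lists_length_eq finite_carrier)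

lemma lc_closed [simp]: "a \<in> carrier KX \<Longrightarrow> lc a \<in> K"
  by (cases a) (auto simp: lcoeff_def KX_iff)

lemma lc_Nil [simp]: "lc [] = \<zero>" by (simp add: lcoeff_def)

lemma lc_eq_0_iff: "a \<in> carrier KX \<Longrightarrow> lc a = \<zero> \<longleftrightarrow> a = []"
  by (auto simp: lcoeff_def KX_iff)

lemma lc_coeff: "a \<noteq> [] \<Longrightarrow> lc a = coeff a (length a - 1)"
  using lead_coeff_simp[of a] by (simp add: lcoeff_def)

lemma length_mult: "a \<in> carrier KX \<Longrightarrow> b \<in> carrier KX \<Longrightarrow> a \<noteq> [] \<Longrightarrow> b \<noteq> [] \<Longrightarrow>
   length (a \<star> b) = length a + length b - 1"
proof -
  assume ab: "a \<in> carrier KX" "b \<in> carrier KX" "a \<noteq> []" "b \<noteq> []"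
  then have "a \<star> b \<noteq> []" using P.integral_iff by simp
  moreover have "Polynomials.degree (a \<star> b) = Polynomials.degree a + Polynomials.degree b"
    using ab poly_mult_degree_eq[OF carrier_is_subring, of a b] by (simp add: univ_poly_mult univ_poly_carrier)
  ultimately show ?thesis using ab by (cases "a \<star> b"; cases a; cases b) auto
qed

lemma mult_eq_Nil_iff: "a \<in> carrier KX \<Longrightarrow> b \<in> carrier KX \<Longrightarrow> a \<star> b = [] \<longleftrightarrow> a = [] \<or> b = []"
  using P.integral_iff by simp

lemma lc_mult: "a \<in> carrier KX \<Longrightarrow> b \<in> carrier KX \<Longrightarrow> lc (a \<star> b) = lc a \<otimes> lc b"
proof (cases "a = [] \<or> b = []")
  case False
  assume ab: "a \<in> carrier KX" "b \<in> carrier KX"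
  with False have "a \<star> b \<noteq> []" by (simp add: mult_eq_Nil_iff)
  with False ab show ?thesis
    using poly_mult_lead_coeff[OF carrier_is_subring, of a b] by (simp add: lcoeff_def univ_poly_mult univ_poly_carrier)
qed auto

lemma M_mult: "a \<in> M m \<Longrightarrow> b \<in> M n \<Longrightarrow> a \<star> b \<in> M (m + n)"
proof -
  assume ab: "a \<in> M m" "b \<in> M n"
  then have "a \<noteq> []" "b \<noteq> []" by (auto simp: M_iff)
  with ab show ?thesis by (auto simp: M_iff length_mult lc_mult)
qed

lemma lc_add_lower:
  assumes "a \<in> carrier KX" "b \<in> carrier KX" "length b < length a"
  shows "length (a \<boxplus> b) = length a" "lc (a \<boxplus> b) = lc a"
proof -
  show len: "length (a \<boxplus> b) = length a"
    using poly_add_length_eq[OF carrier_is_subring, of a b] assms by (simp add: univ_poly_add univ_poly_carrier)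
  have ne: "a \<noteq> []" "a \<boxplus> b \<noteq> []" using assms len by auto
  have "lc (a \<boxplus> b) = coeff a (length a - 1) \<oplus> coeff b (length a - 1)"
    using ne assms by (simp add: lc_coeff len coeff_add)
  also have "coeff b (length a - 1) = \<zero>" using assms by (intro coeff_length) auto
  finally show "lc (a \<boxplus> b) = lc a" using ne assms by (simp add: lc_coeff)
qed

lemma length_minus [simp]: "a \<in> carrier KX \<Longrightarrow> length (\<ominus>\<^bsub>KX\<^esub> a) = length a"
  using univ_poly_a_inv_length[OF carrier_is_subring] .

lemma lc_minus: "a \<in> carrier KX \<Longrightarrow> lc (\<ominus>\<^bsub>KX\<^esub> a) = \<ominus> lc a"
proof (cases "a = []")
  case False
  assume a: "a \<in> carrier KX"
  then have "\<ominus>\<^bsub>KX\<^esub> a \<noteq> []" using False length_minus by (metis length_0_conv)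
  with a False show ?thesis by (simp add: lc_coeff coeff_minus)
next
  case True
  then show ?thesis using P.minus_zero by simp
qed

lemma lc_sub_lower:
  assumes "a \<in> carrier KX" "b \<in> carrier KX" "length b < length a"
  shows "length (a \<boxminus> b) = length a" "lc (a \<boxminus> b) = lc a"
  using lc_add_lower[of a "\<ominus>\<^bsub>KX\<^esub> b"] assms by (simp_all add: a_minus_def)

lemma lc_cst_mult: "c \<in> K \<Longrightarrow> a \<in> carrier KX \<Longrightarrow> lc (cst c \<star> a) = c \<otimes> lc a"
proof -
  assume "c \<in> K" "a \<in> carrier KX"
  moreover have "lc (cst c) = c" by (cases "c = \<zero>") (simp_all add: cst_nonzero lcoeff_def)
  ultimately show ?thesis by (simp add: lc_mult)
qed

definition xpow :: "nat \<Rightarrow> 'a list" where "xpow n = monom \<one> n"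

lemma xpow_M: "xpow n \<in> M n"
  by (auto simp: xpow_def monom_def M_iff KX_iff lcoeff_def)

lemma coeff_xpow: "coeff (xpow n) i = (if i = n then \<one> else \<zero>)"
  by (simp add: xpow_def monom_coeff)

text \<open>The character sums detect monic polynomials by a linear condition, which needs them as
  the affine space X^n + \<open>V n\<close>.\<close>

lemma M_eq_xpow_add: "a \<in> M n \<longleftrightarrow> a \<in> carrier KX \<and> a \<boxminus> xpow n \<in> V n"
proof
  assume a: "a \<in> M n"
  then have "coeff a i = \<zero>" if "i > n" for i using that by (intro coeff_length) (simp add: M_iff)
  moreover have "coeff a n = \<one>" using a lc_coeff[of a] by (cases "a = []") (auto simp: M_iff)
  ultimately have "coeff (a \<boxminus> xpow n) i = \<zero>" if "i \<ge> n" for i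
    using that M_KX[OF a] M_KX[OF xpow_M[of n]]
    by (cases "i = n") (simp_all add: coeff_sub coeff_xpow a_minus_def[of R] r_neg)
  then show "a \<in> carrier KX \<and> a \<boxminus> xpow n \<in> V n"
    using M_KX[OF a] M_KX[OF xpow_M[of n]] P.minus_closed by (simp add: V_iff)
next
  assume a: "a \<in> carrier KX \<and> a \<boxminus> xpow n \<in> V n"
  then have "length (a \<boxminus> xpow n) < length (xpow n)" using xpow_M[of n] by (simp add: V_def M_iff)
  then have "length (xpow n \<boxplus> (a \<boxminus> xpow n)) = length (xpow n)" "lc (xpow n \<boxplus> (a \<boxminus> xpow n)) = lc (xpow n)"
    using a xpow_M M_KX by (auto intro!: lc_add_lower)
  moreover have "xpow n \<boxplus> (a \<boxminus> xpow n) = a"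
    using a M_KX[OF xpow_M] by (simp add: a_minus_def P.a_lcomm P.r_neg)
  ultimately show "a \<in> M n" using a xpow_M[of n] by (simp add: M_iff)
qed

lemma card_V: "card (V n) = q ^ n"
proof -
  have "bij_betw (\<lambda>a. a \<boxplus> xpow n) (V n) (M n)"
  proof (rule bij_betw_byWitness[where f' = "\<lambda>a. a \<boxminus> xpow n"])
    have x: "xpow n \<in> carrier KX" by (rule M_KX[OF xpow_M])
    have *: "a \<boxplus> xpow n \<boxminus> xpow n = a" "a \<boxminus> xpow n \<boxplus> xpow n = a" if "a \<in> carrier KX" for a
      using that x by (simp_all add: a_minus_def P.a_assoc P.r_neg P.l_neg)
    show "\<forall>a\<in>V n. a \<boxplus> xpow n \<boxminus> xpow n = a" "\<forall>a\<in>M n. a \<boxminus> xpow n \<boxplus> xpow n = a"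
      using * by (auto simp: V_KX M_KX)
    show "(\<lambda>a. a \<boxplus> xpow n) ` V n \<subseteq> M n"
      using * x by (auto simp: M_eq_xpow_add V_KX)
    show "(\<lambda>a. a \<boxminus> xpow n) ` M n \<subseteq> V n"
      by (auto simp: M_eq_xpow_add)
  qed
  then show ?thesis using bij_betw_same_card card_M by metis
qed

text \<open>Representatives of the nonzero polynomials of degree below n modulo constant
  factors.\<close>

definition Mlt :: "nat \<Rightarrow> 'a list set" where "Mlt n = (\<Union>k<n. M k)"

lemma Mlt_iff: "a \<in> Mlt n \<longleftrightarrow> a \<in> V n \<and> lc a = \<one>"
proof
  assume "a \<in> V n \<and> lc a = \<one>"
  then have "a \<noteq> []" "a \<in> carrier KX" "length a \<le> n" "lc a = \<one>" by (auto simp: V_def)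
  then have "a \<in> M (length a - 1)" "length a - 1 < n"
    by (cases a; simp add: M_iff)+
  then show "a \<in> Mlt n" by (auto simp: Mlt_def)
qed (auto simp: Mlt_def M_iff V_def)

lemma finite_Mlt: "finite (Mlt n)" by (simp add: Mlt_def finite_M)

lemma Mlt_KX: "a \<in> Mlt n \<Longrightarrow> a \<in> carrier KX" by (auto simp: Mlt_iff V_def)

lemma card_Mlt: "card (Mlt n) = (\<Sum>k<n. q ^ k)"
  unfolding Mlt_def by (subst card_UN_disjoint) (auto simp: finite_M card_M, auto simp: M_iff)

subsection \<open>Residues\<close>

lemma pmod_V: "a \<in> carrier KX \<Longrightarrow> f \<in> M d \<Longrightarrow> a pmod f \<in> V d"
proof -
  assume a: "a \<in> carrier KX" and f: "f \<in> M d"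
  then have "f \<noteq> []" "Polynomials.degree f = d" by (auto simp: M_iff)
  with a f show ?thesis
    using pmod_degree[OF carrier_is_subfield a, of f] long_division_closed(2)[OF carrier_is_subfield a, of f]
    by (auto simp: V_def M_KX)
qed

lemma pdiv_closed [simp]: "a \<in> carrier KX \<Longrightarrow> f \<in> carrier KX \<Longrightarrow> a pdiv f \<in> carrier KX"
  using long_division_closed(1)[OF carrier_is_subfield] .

lemma pmod_closed [simp]: "a \<in> carrier KX \<Longrightarrow> f \<in> carrier KX \<Longrightarrow> a pmod f \<in> carrier KX"
  using long_division_closed(2)[OF carrier_is_subfield] .

lemma pdiv_pmod_eq: "a \<in> carrier KX \<Longrightarrow> f \<in> carrier KX \<Longrightarrow> f \<star> (a pdiv f) \<boxplus> (a pmod f) = a"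
  using pdiv_pmod[OF carrier_is_subfield] by metis

lemma pmod_unique:
  assumes "f \<in> M d" "b \<in> carrier KX" "x \<in> V d"
  shows "(f \<star> b \<boxplus> x) pmod f = x" "(f \<star> b \<boxplus> x) pdiv f = b"
proof -
  have f: "f \<in> carrier KX" "f \<noteq> []" "length f = Suc d" using assms by (auto simp: M_iff)
  have "long_divides (f \<star> b \<boxplus> x) f (b, x)"
  proof (rule long_dividesI)
    show "x = [] \<or> Polynomials.degree x < Polynomials.degree f"
      using assms f by (cases x) (auto simp: V_def)
  qed (use assms V_KX in auto)
  from long_divisionI[OF carrier_is_subfield _ f(1,2) this]
  show "(f \<star> b \<boxplus> x) pmod f = x" "(f \<star> b \<boxplus> x) pdiv f = b"
    using assms f V_KX by auto
qed

lemma pmod_V_id: "f \<in> M d \<Longrightarrow> x \<in> V d \<Longrightarrow> x pmod f = x"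
  using pmod_unique(1)[of f d "[]" x] by (simp add: M_KX V_KX)

lemma pmod_eq_iff: "a \<in> carrier KX \<Longrightarrow> b \<in> carrier KX \<Longrightarrow> f \<in> carrier KX \<Longrightarrow>
   a pmod f = b pmod f \<longleftrightarrow> f pdivides (a \<boxminus> b)"
  using same_pmod_iff_pdivides[OF carrier_is_subfield] .

lemma pdivides_iff_mult: "f pdivides a \<longleftrightarrow> (\<exists>b\<in>carrier KX. a = f \<star> b)"
  by (auto simp: pdivides_def factor_def)

lemma pmod_eq_Nil_iff: "a \<in> carrier KX \<Longrightarrow> f \<in> carrier KX \<Longrightarrow> a pmod f = [] \<longleftrightarrow> f pdivides a"
  using pmod_zero_iff_pdivides[OF carrier_is_subfield] .

lemma pdivides_mult_right: "f \<in> carrier KX \<Longrightarrow> f pdivides a \<Longrightarrow> b \<in> carrier KX \<Longrightarrow> f pdivides (a \<star> b)"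
  unfolding pdivides_iff_mult using P.m_assoc by blast

lemma pdivides_mult_left: "f \<in> carrier KX \<Longrightarrow> f pdivides a \<Longrightarrow> a \<in> carrier KX \<Longrightarrow> b \<in> carrier KX \<Longrightarrow> f pdivides (b \<star> a)"
  using pdivides_mult_right[of f a b] P.m_comm by simp

lemma pdivides_V_imp_Nil: "f \<in> M d \<Longrightarrow> x \<in> V d \<Longrightarrow> f pdivides x \<Longrightarrow> x = []"
  using pmod_V_id[of f d x] pmod_eq_Nil_iff[of x f] by (simp add: M_KX V_KX)

lemma pmod_mult_cong:
  assumes "f \<in> carrier KX" "a \<in> carrier KX" "a' \<in> carrier KX" "b \<in> carrier KX" "a pmod f = a' pmod f"
  shows "(a \<star> b) pmod f = (a' \<star> b) pmod f"
proof -
  have "f pdivides (a \<boxminus> a')" using assms by (simp add: pmod_eq_iff)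
  then have "f pdivides ((a \<boxminus> a') \<star> b)" using assms by (intro pdivides_mult_right) auto
  also have "(a \<boxminus> a') \<star> b = a \<star> b \<boxminus> a' \<star> b"
    using assms by (simp add: a_minus_def P.l_distr P.l_minus)
  finally show ?thesis using assms by (simp add: pmod_eq_iff)
qed

lemma pmod_pmod [simp]: "f \<in> carrier KX \<Longrightarrow> f \<noteq> [] \<Longrightarrow> a \<in> carrier KX \<Longrightarrow> (a pmod f) pmod f = a pmod f"
proof -
  assume f: "f \<in> carrier KX" "f \<noteq> []" and a: "a \<in> carrier KX"
  have "a \<boxminus> (a pmod f) = f \<star> (a pdiv f)"
    using pdiv_pmod_eq[OF a f(1)] a f
    by (metis P.add.inv_solve_right P.m_closed a_minus_def pdiv_closed pmod_closed)
  then have "f pdivides (a \<boxminus> (a pmod f))" using a f by (auto simp: pdivides_iff_mult)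
  then show ?thesis using a f pmod_eq_iff[of a "a pmod f" f] by simp
qed

lemma pmod_mult_pmod_right:
  assumes "f \<in> carrier KX" "f \<noteq> []" "a \<in> carrier KX" "b \<in> carrier KX"
  shows "(a \<star> (b pmod f)) pmod f = (a \<star> b) pmod f"
  using pmod_mult_cong[of f "b pmod f" b a] assms by (simp add: P.m_comm)

lemma pmod_cst_mult:
  assumes "f \<in> M d" "c \<in> K" "a \<in> carrier KX"
  shows "(cst c \<star> a) pmod f = cst c \<star> (a pmod f)"
proof -
  have f: "f \<in> carrier KX" "f \<noteq> []" using assms by (auto simp: M_iff)
  have "(cst c \<star> a) pmod f = (cst c \<star> (a pmod f)) pmod f"
    using pmod_mult_pmod_right[of f "cst c" a] f assms by simp
  also have "\<dots> = cst c \<star> (a pmod f)"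
    using assms by (intro pmod_V_id[of f d] V_cst_mult pmod_V)
  finally show ?thesis .
qed

lemma pmod_add: "a \<in> carrier KX \<Longrightarrow> b \<in> carrier KX \<Longrightarrow> f \<in> carrier KX \<Longrightarrow>
   (a \<boxplus> b) pmod f = (a pmod f) \<boxplus> (b pmod f)"
  using long_division_add(2)[OF carrier_is_subfield] .

lemma pmod_minus: "a \<in> carrier KX \<Longrightarrow> f \<in> carrier KX \<Longrightarrow> (\<ominus>\<^bsub>KX\<^esub> a) pmod f = \<ominus>\<^bsub>KX\<^esub> (a pmod f)"
  using long_division_a_inv(2)[OF carrier_is_subfield] .

lemma pmod_sub: "a \<in> carrier KX \<Longrightarrow> b \<in> carrier KX \<Longrightarrow> f \<in> carrier KX \<Longrightarrow>
   (a \<boxminus> b) pmod f = (a pmod f) \<boxminus> (b pmod f)"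
  by (simp add: a_minus_def pmod_add pmod_minus)

text \<open>For nonzero b this is invertibility of u modulo b, phrased as cancellation on
  remainders, the form in which it is applied.\<close>

definition regular_mod :: "'a list \<Rightarrow> 'a list \<Rightarrow> bool" where
  "regular_mod b u \<longleftrightarrow> u \<in> carrier KX \<and> (\<forall>x\<in>V (length b - 1). b pdivides (u \<star> x) \<longrightarrow> x = [])"

end

subsection \<open>The residue symbol as a Gauss product and the reciprocity law\<close>

lemma sum_lessThan_add: "(\<Sum>k<i + m. f k) = (\<Sum>k<i. f k) + (\<Sum>k<m::nat. f (k + i :: nat) :: 'b::comm_monoid_add)"
  by (induction m) (simp_all add: add.assoc add.commute[of _ i])

locale residue_field = finite_field_poly R for R :: "'a ring" (structure) +
  fixes \<psi> :: "'a \<Rightarrow> complex" and r :: nat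
  assumes embedding: "units_embedding R \<psi>"
    and r_ge_2: "r \<ge> 2"
    and q_mod: "2 * r dvd q - 1"
begin

lemma psi_mult: "c \<in> K \<Longrightarrow> d \<in> K \<Longrightarrow> c \<noteq> \<zero> \<Longrightarrow> d \<noteq> \<zero> \<Longrightarrow> \<psi> (c \<otimes> d) = \<psi> c * \<psi> d"
  using embedding by (auto simp: units_embedding_def carrier_mult_of)

lemma psi_nonzero: "c \<in> K \<Longrightarrow> c \<noteq> \<zero> \<Longrightarrow> \<psi> c \<noteq> 0"
  using embedding by (auto simp: units_embedding_def carrier_mult_of)

lemma psi_inj: "c \<in> K \<Longrightarrow> d \<in> K \<Longrightarrow> c \<noteq> \<zero> \<Longrightarrow> d \<noteq> \<zero> \<Longrightarrow> \<psi> c = \<psi> d \<Longrightarrow> c = d"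
  using embedding by (auto simp: units_embedding_def carrier_mult_of inj_on_def)

lemma psi_one: "\<psi> \<one> = 1"
proof -
  have "\<psi> \<one> = \<psi> \<one> * \<psi> \<one>" using psi_mult[of \<one> \<one>] by simp
  then show ?thesis using psi_nonzero[of \<one>] by simp
qed

lemma pow_nonzero: "c \<in> K \<Longrightarrow> c \<noteq> \<zero> \<Longrightarrow> c [^] (n::nat) \<noteq> \<zero>"
  by (induction n) (auto simp: integral_iff)

lemma psi_pow: "c \<in> K \<Longrightarrow> c \<noteq> \<zero> \<Longrightarrow> \<psi> (c [^] (n::nat)) = \<psi> c ^ n"
  by (induction n) (auto simp: psi_one psi_mult pow_nonzero)

lemma unit_pow_card: "c \<in> K \<Longrightarrow> c \<noteq> \<zero> \<Longrightarrow> c [^] (q - 1) = \<one>"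
proof -
  assume c: "c \<in> K" "c \<noteq> \<zero>"
  interpret G: group "Multiplicative_Group.mult_of R" by (rule field_mult_group)
  have "order (Multiplicative_Group.mult_of R) = q - 1"
    using finite_carrier by (simp add: order_def q_def card_Diff_singleton)
  then have "c [^]\<^bsub>Multiplicative_Group.mult_of R\<^esub> (q - 1) = \<one>\<^bsub>Multiplicative_Group.mult_of R\<^esub>"
    using G.pow_order_eq_1[of c] c by simp
  then show ?thesis by (simp add: Multiplicative_Group.nat_pow_mult_of)
qed

text \<open>The r-th power residue character of the constant field, extended by 0. Its exponent is
  even, which makes its value at -1 equal to 1.\<close>

definition lam :: "'a \<Rightarrow> complex" where
  "lam c = (if c = \<zero> then 0 else \<psi> c ^ ((q - 1) div r))"

lemma r_dvd: "r dvd q - 1" using q_mod by (meson dvd_mult_right)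

lemma even_exponent: "even ((q - 1) div r)"
  using q_mod r_ge_2 by (metis dvd_div_iff_mult mult.commute not_numeral_le_zero r_dvd)

lemma lam_zero [simp]: "lam \<zero> = 0" by (simp add: lam_def)

lemma lam_one [simp]: "lam \<one> = 1" by (simp add: lam_def psi_one)

lemma lam_mult: "c \<in> K \<Longrightarrow> d \<in> K \<Longrightarrow> lam (c \<otimes> d) = lam c * lam d"
  by (auto simp: lam_def psi_mult power_mult_distrib integral_iff)

lemma lam_root: "c \<in> K \<Longrightarrow> c \<noteq> \<zero> \<Longrightarrow> lam c ^ r = 1"
proof -
  assume c: "c \<in> K" "c \<noteq> \<zero>"
  have "lam c ^ r = \<psi> c ^ (q - 1)"
    using c r_dvd by (simp add: lam_def flip: power_mult)
  then show ?thesis using psi_pow[OF c, of "q - 1"] unit_pow_card[OF c] by (simp add: psi_one)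
qed

lemma lam_minus: "c \<in> K \<Longrightarrow> lam (\<ominus> c) = lam c"
proof -
  assume c: "c \<in> K"
  have "\<psi> (\<ominus> \<one>) ^ 2 = 1"
    using psi_mult[of "\<ominus> \<one>" "\<ominus> \<one>"] by (simp add: power2_eq_square psi_one l_minus)
  then have "lam (\<ominus> \<one>) = 1"
    using even_exponent by (auto simp: lam_def power_mult elim!: evenE)
  moreover have "\<ominus> c = \<ominus> \<one> \<otimes> c" using c by (simp add: l_minus)
  ultimately show ?thesis using c by (simp add: lam_mult)
qed

text \<open>Pairing c with its inverse shows that the product of all \<psi>(c) has square 1, and the
  exponent (q - 1)/r is even.\<close>

lemma prod_lam: "(\<Prod>c\<in>K - {\<zero>}. lam c) = 1"
proof -
  define Z where "Z = (\<Prod>c\<in>K - {\<zero>}. \<psi> c)"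
  have "Z = (\<Prod>c\<in>K - {\<zero>}. \<psi> (inv c))"
    unfolding Z_def
    by (rule prod.reindex_bij_witness[of _ "\<lambda>c. inv c" "\<lambda>c. inv c"]) (auto simp: field_Units[symmetric])
  then have "Z * Z = (\<Prod>c\<in>K - {\<zero>}. \<psi> c * \<psi> (inv c))"
    unfolding prod.distrib by (simp add: Z_def)
  also have "\<dots> = (\<Prod>c\<in>K - {\<zero>}. 1)"
  proof (intro prod.cong refl)
    fix c assume c: "c \<in> K - {\<zero>}"
    then have "c \<in> Units R" by (simp add: field_Units)
    then have "inv c \<in> K - {\<zero>}" "c \<otimes> inv c = \<one>" by (auto simp: field_Units[symmetric])
    then show "\<psi> c * \<psi> (inv c) = 1" using c psi_mult[of c "inv c"] by (simp add: psi_one)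
  qed
  finally have "Z * Z = 1" by simp
  have "(\<Prod>c\<in>K - {\<zero>}. lam c) = Z ^ ((q - 1) div r)"
    unfolding Z_def prod_power_distrib by (intro prod.cong) (auto simp: lam_def)
  also obtain k where "(q - 1) div r = 2 * k" using even_exponent by (elim evenE)
  then have "Z ^ ((q - 1) div r) = (Z * Z) ^ k" by (simp add: power_mult power2_eq_square)
  finally show ?thesis using \<open>Z * Z = 1\<close> by simp
qed

lemma prod_lam_V: "(\<Prod>E\<in>V n - {[]}. lam (lc E)) = 1"
proof -
  have V: "V n - {[]} = (\<Union>j<n. (\<lambda>(c, l). c # l) ` ((K - {\<zero>}) \<times> {l. set l \<subseteq> K \<and> length l = j}))"
  proof (intro equalityI subsetI)
    fix a assume "a \<in> V n - {[]}"
    then obtain c l where "a = c # l" "set (c # l) \<subseteq> K" "c \<noteq> \<zero>" "length l < n"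
      by (cases a) (auto simp: V_def KX_iff)
    then show "a \<in> (\<Union>j<n. (\<lambda>(c, l). c # l) ` ((K - {\<zero>}) \<times> {l. set l \<subseteq> K \<and> length l = j}))"
      by (intro UN_I[of "length l"] image_eqI[of _ _ "(c, l)"]) auto
  qed (auto simp: V_def KX_iff)
  have fin: "finite ((\<lambda>(c, l). c # l) ` ((K - {\<zero>}) \<times> {l. set l \<subseteq> K \<and> length l = j}))" for j
    by (intro finite_imageI finite_cartesian_product finite_lists_length_eq) (auto simp: finite_carrier)
  have "(\<Prod>E\<in>V n - {[]}. lam (lc E)) =
     (\<Prod>j<n. \<Prod>E\<in>(\<lambda>(c, l). c # l) ` ((K - {\<zero>}) \<times> {l. set l \<subseteq> K \<and> length l = j}). lam (lc E))"
    unfolding V using fin by (subst prod.UNION_disjoint) auto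
  also have "\<dots> = (\<Prod>j<n. 1)"
  proof (intro prod.cong refl)
    fix j
    have "(\<Prod>E\<in>(\<lambda>(c, l). c # l) ` ((K - {\<zero>}) \<times> {l. set l \<subseteq> K \<and> length l = j}). lam (lc E)) =
       (\<Prod>(c, l)\<in>(K - {\<zero>}) \<times> {l. set l \<subseteq> K \<and> length l = j}. lam c)"
      by (subst prod.reindex) (auto simp: inj_on_def lcoeff_def split_beta)
    also have "\<dots> = (\<Prod>c\<in>K - {\<zero>}. lam c ^ card {l. set l \<subseteq> K \<and> length l = j})"
      by (simp add: prod.cartesian_product[symmetric])
    also have "\<dots> = 1" by (simp add: prod_power_distrib[symmetric] prod_lam)
    finally show "(\<Prod>E\<in>(\<lambda>(c, l). c # l) ` ((K - {\<zero>}) \<times> {l. set l \<subseteq> K \<and> length l = j}). lam (lc E)) = 1" .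
  qed
  finally show ?thesis by simp
qed

text \<open>The product of Gauss's lemma, with the monic polynomials of degree below deg b as
  representatives of the nonzero residues modulo constants. It makes sense for composite b, so
  reciprocity can be proved for all pairs of monic polynomials at once.\<close>

definition gauss_symbol :: "'a list \<Rightarrow> 'a list \<Rightarrow> complex" where
  "gauss_symbol a b = (\<Prod>x\<in>Mlt (length b - 1). lam (lc ((a \<star> x) pmod b)))"

lemma gauss_symbol_eq: "b \<in> M d \<Longrightarrow> gauss_symbol a b = (\<Prod>x\<in>Mlt d. lam (lc ((a \<star> x) pmod b)))"
  by (simp add: gauss_symbol_def M_iff)

lemma gauss_symbol_cong:
  assumes "b \<in> M d" "a \<in> carrier KX" "a' \<in> carrier KX" "a pmod b = a' pmod b"
  shows "gauss_symbol a b = gauss_symbol a' b"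
  unfolding gauss_symbol_def using assms
  by (intro prod.cong refl arg_cong[where f = "\<lambda>a. lam (lc a)"] pmod_mult_cong) (auto simp: M_KX Mlt_KX)

text \<open>The bijection \<open>(y, e) \<mapsto> (b y div a) + e\<close> onto the monic polynomials \<open>x\<close> of degree at
  least \<open>n - m\<close> satisfies \<open>a x = b y + (a e - (b y mod a))\<close>; the factors with \<open>e \<noteq> 0\<close> have
  product \<open>1\<close>, and those with \<open>e = 0\<close> give the symbol with exchanged arguments.\<close>

lemma gauss_reciprocity_aux:
  assumes a: "a \<in> M m" and b: "b \<in> M n" and mn: "m \<le> n"
  shows "gauss_symbol a b = gauss_symbol b a"
proof -
  have aK: "a \<in> carrier KX" "a \<noteq> []" "length a = Suc m" "lc a = \<one>"
    and bK: "b \<in> carrier KX" "b \<noteq> []" "length b = Suc n" "lc b = \<one>"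
    using a b by (auto simp: M_iff)
  define \<Phi> where "\<Phi> = (\<lambda>(y, e). (b \<star> y) pdiv a \<boxplus> e)"
  define C where "C = (\<lambda>(y, e). a \<star> e \<boxminus> ((b \<star> y) pmod a))"
  have key: "a \<star> \<Phi> (y, e) = b \<star> y \<boxplus> C (y, e)" "C (y, e) \<in> V n" "\<Phi> (y, e) \<in> carrier KX"
    if y: "y \<in> Mlt m" and e: "e \<in> V (n - m)" for y e
  proof -
    have yK: "y \<in> carrier KX" and eK: "e \<in> carrier KX" using y e by (auto simp: Mlt_KX V_KX)
    show "\<Phi> (y, e) \<in> carrier KX" using yK eK aK bK by (simp add: \<Phi>_def)
    have by': "b \<star> y = a \<star> ((b \<star> y) pdiv a) \<boxplus> ((b \<star> y) pmod a)"
      using pdiv_pmod_eq[of "b \<star> y" a] yK aK bK by simp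
    have "b \<star> y \<boxplus> C (y, e) = a \<star> ((b \<star> y) pdiv a) \<boxplus> ((b \<star> y) pmod a) \<boxplus> (a \<star> e \<boxminus> ((b \<star> y) pmod a))"
      using by' by (simp add: C_def)
    also have "\<dots> = a \<star> ((b \<star> y) pdiv a) \<boxplus> a \<star> e"
      using yK eK aK bK by (simp add: a_minus_def P.a_assoc P.a_comm P.a_lcomm P.r_neg P.r_neg1 P.r_neg2)
    also have "\<dots> = a \<star> \<Phi> (y, e)"
      using yK eK aK bK by (simp add: \<Phi>_def P.r_distr)
    finally show "a \<star> \<Phi> (y, e) = b \<star> y \<boxplus> C (y, e)" ..
    have "a \<star> e \<in> V n"
    proof (cases "e = []")
      case False
      then have "length (a \<star> e) = m + length e" using aK eK by (simp add: length_mult)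
      then show ?thesis using e mn aK eK by (simp add: V_def)
    qed (use aK in simp)
    moreover have "(b \<star> y) pmod a \<in> V n"
      using pmod_V[of "b \<star> y" a m] V_mono[OF mn] a yK bK by auto
    ultimately show "C (y, e) \<in> V n" by (simp add: C_def V_sub)
  qed
  let ?U = "Mlt m \<times> V (n - m)"
  have \<Phi>_mod: "(a \<star> \<Phi> (y, e)) pmod b = C (y, e)" "(a \<star> \<Phi> (y, e)) pdiv b = y"
    if "y \<in> Mlt m" "e \<in> V (n - m)" for y e
    using pmod_unique[OF b, of y "C (y, e)"] key[OF that] that by (simp_all add: Mlt_KX)
  have inj: "inj_on \<Phi> ?U"
  proof (rule inj_onI, clarify)
    fix y e y' e' assume *: "y \<in> Mlt m" "e \<in> V (n - m)" "y' \<in> Mlt m" "e' \<in> V (n - m)" "\<Phi> (y, e) = \<Phi> (y', e')"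
    then have "y = y'" using \<Phi>_mod(2)[of y e] \<Phi>_mod(2)[of y' e'] by simp
    moreover have "e = e'"
    proof -
      have "(b \<star> y) pdiv a \<boxplus> e = (b \<star> y) pdiv a \<boxplus> e'" using * \<open>y = y'\<close> by (simp add: \<Phi>_def)
      then show ?thesis
        using * aK bK P.add.l_cancel[of "(b \<star> y) pdiv a" e e'] by (simp add: Mlt_KX V_KX)
    qed
    ultimately show "y = y' \<and> e = e'" by simp
  qed
  have deg: "length (\<Phi> (y, e)) = n - m + length y \<and> lc (\<Phi> (y, e)) = \<one>" if y: "y \<in> Mlt m" and e: "e \<in> V (n - m)" for y e
  proof -
    have y': "y \<in> carrier KX" "y \<noteq> []" "lc y = \<one>" "length y \<le> m" using y by (auto simp: Mlt_iff V_def)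
    have len: "length (b \<star> y) = n + length y" using y' bK by (simp add: length_mult)
    have "length (C (y, e)) < length (b \<star> y)"
      using key(2)[OF y e] len y' by (cases y) (auto simp: V_def)
    then have L: "length (a \<star> \<Phi> (y, e)) = n + length y" "lc (a \<star> \<Phi> (y, e)) = lc (b \<star> y)"
      using lc_add_lower[of "b \<star> y" "C (y, e)"] key[OF y e] y' bK len by (auto simp: V_KX)
    then have "\<Phi> (y, e) \<noteq> []" using y' aK by (cases "\<Phi> (y, e) = []") auto
    then have "length (\<Phi> (y, e)) = n - m + length y"
      using L(1) length_mult[of a "\<Phi> (y, e)"] aK key(3)[OF y e] mn by simp
    moreover have "lc (\<Phi> (y, e)) = \<one>"
      using L(2) aK bK y' key(3)[OF y e] by (simp add: lc_mult)
    ultimately show ?thesis by simp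
  qed
  \<comment> \<open>Inclusion suffices by injectivity, since both sides have the same number of
    elements.\<close>
  have image: "\<Phi> ` ?U = Mlt n - Mlt (n - m)"
  proof (rule card_subset_eq)
    show "\<Phi> ` ?U \<subseteq> Mlt n - Mlt (n - m)"
    proof clarify
      fix y e assume ye: "y \<in> Mlt m" "e \<in> V (n - m)"
      then have "length y \<le> m" "length y > 0" by (auto simp: Mlt_iff V_def)
      then show "\<Phi> (y, e) \<in> Mlt n - Mlt (n - m)"
        using deg[OF ye] key(3)[OF ye] mn by (cases y) (auto simp: Mlt_iff V_def)
    qed
    have "card (Mlt n - Mlt (n - m)) = card (Mlt n) - card (Mlt (n - m))"
      using V_mono[of "n - m" n] by (intro card_Diff_subset finite_Mlt) (auto simp: Mlt_iff)
    also have "\<dots> = (\<Sum>k<n. q ^ k) - (\<Sum>k<n - m. q ^ k)" by (simp add: card_Mlt)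
    also have "(\<Sum>k<n. q ^ k) = (\<Sum>k<n - m. q ^ k) + (\<Sum>k<m. q ^ (k + (n - m)))"
      using sum_lessThan_add[of "\<lambda>k. q ^ k" "n - m" m] mn by simp
    also have "(\<Sum>k<n - m. q ^ k) + (\<Sum>k<m. q ^ (k + (n - m))) - (\<Sum>k<n - m. q ^ k) = (\<Sum>k<m. q ^ k) * q ^ (n - m)"
      by (simp add: power_add sum_distrib_right)
    also have "\<dots> = card (\<Phi> ` ?U)"
      using card_image[OF inj] by (simp add: card_cartesian_product card_Mlt card_V)
    finally show "card (\<Phi> ` ?U) = card (Mlt n - Mlt (n - m))" ..
  qed (simp add: finite_Mlt)
  \<comment> \<open>Here a x has degree below n, so it is its own remainder, with leading
    coefficient 1.\<close>
  have low: "lam (lc ((a \<star> x) pmod b)) = 1" if x: "x \<in> Mlt (n - m)" for x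
  proof -
    have x': "x \<in> carrier KX" "x \<noteq> []" "lc x = \<one>" "length x \<le> n - m" using x by (auto simp: Mlt_iff V_def)
    then have "a \<star> x \<in> V n" using aK mn by (simp add: V_def length_mult)
    then have "(a \<star> x) pmod b = a \<star> x" by (rule pmod_V_id[OF b])
    then show ?thesis using x' aK by (simp add: lc_mult)
  qed
  have lamC: "lam (lc (C (y, e))) = (if e = [] then lam (lc ((b \<star> y) pmod a)) else lam (lc e))"
    if y: "y \<in> Mlt m" and e: "e \<in> V (n - m)" for y e
  proof -
    have K': "y \<in> carrier KX" "e \<in> carrier KX" using y e by (auto simp: Mlt_KX V_KX)
    have R: "(b \<star> y) pmod a \<in> V m" using pmod_V[OF _ a] K' bK by simp
    show ?thesis
    proof (cases "e = []")
      case True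
      \<comment> \<open>This is the place where a sign could enter reciprocity;
        \<open>lam_minus\<close> removes it.\<close>
      then have "C (y, e) = \<ominus>\<^bsub>KX\<^esub> ((b \<star> y) pmod a)" using aK R by (simp add: C_def a_minus_def V_KX)
      then show ?thesis using True R by (simp add: lc_minus lam_minus V_KX)
    next
      case False
      then have "length ((b \<star> y) pmod a) < length (a \<star> e)"
        using R aK K' by (cases e) (auto simp: V_def length_mult)
      then have "lc (C (y, e)) = lc (a \<star> e)" using R aK K' by (simp add: C_def lc_sub_lower V_KX)
      then show ?thesis using False aK K' by (simp add: lc_mult)
    qed
  qed
  have "gauss_symbol a b = (\<Prod>x\<in>Mlt n. lam (lc ((a \<star> x) pmod b)))"
    by (rule gauss_symbol_eq[OF b])
  also have "\<dots> = (\<Prod>x\<in>Mlt n - Mlt (n - m). lam (lc ((a \<star> x) pmod b)))"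
    using low by (intro prod.mono_neutral_right finite_Mlt) auto
  also have "\<dots> = (\<Prod>(y, e)\<in>?U. lam (lc ((a \<star> \<Phi> (y, e)) pmod b)))"
    unfolding image[symmetric] by (subst prod.reindex[OF inj]) (simp add: split_beta)
  also have "\<dots> = (\<Prod>(y, e)\<in>?U. if e = [] then lam (lc ((b \<star> y) pmod a)) else lam (lc e))"
    by (intro prod.cong refl) (auto simp: \<Phi>_mod lamC)
  also have "\<dots> = (\<Prod>y\<in>Mlt m. \<Prod>e\<in>V (n - m). if e = [] then lam (lc ((b \<star> y) pmod a)) else lam (lc e))"
    by (simp add: prod.cartesian_product)
  also have "\<dots> = (\<Prod>y\<in>Mlt m. lam (lc ((b \<star> y) pmod a)))"
  proof (intro prod.cong refl)
    fix y
    have "(\<Prod>e\<in>V (n - m). if e = [] then lam (lc ((b \<star> y) pmod a)) else lam (lc e)) =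
       lam (lc ((b \<star> y) pmod a)) * (\<Prod>e\<in>V (n - m) - {[]}. if e = [] then lam (lc ((b \<star> y) pmod a)) else lam (lc e))"
      by (subst prod.remove[of _ "[]"]) (auto simp: finite_V)
    also have "(\<Prod>e\<in>V (n - m) - {[]}. if e = [] then lam (lc ((b \<star> y) pmod a)) else lam (lc e)) = (\<Prod>e\<in>V (n - m) - {[]}. lam (lc e))"
      by (intro prod.cong) auto
    finally show "(\<Prod>e\<in>V (n - m). if e = [] then lam (lc ((b \<star> y) pmod a)) else lam (lc e)) = lam (lc ((b \<star> y) pmod a))"
      by (simp add: prod_lam_V)
  qed
  also have "\<dots> = gauss_symbol b a" by (rule gauss_symbol_eq[OF a, symmetric])
  finally show ?thesis .
qed

theorem gauss_reciprocity: "a \<in> M m \<Longrightarrow> b \<in> M n \<Longrightarrow> gauss_symbol a b = gauss_symbol b a"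
  using gauss_reciprocity_aux[of a m b n] gauss_reciprocity_aux[of b n a m] by (cases "m \<le> n") auto

definition monic_part :: "'a list \<Rightarrow> 'a list" where
  "monic_part a = cst (inv (lc a)) \<star> a"

lemma monic_part:
  assumes "a \<in> V d" "a \<noteq> []"
  shows "monic_part a \<in> Mlt d" "cst (lc a) \<star> monic_part a = a"
proof -
  have a: "a \<in> carrier KX" using assms V_KX by auto
  have u: "lc a \<in> Units R" using lc_eq_0_iff[OF a] assms a by (simp add: field_Units)
  show "monic_part a \<in> Mlt d"
    using assms a u by (simp add: Mlt_iff monic_part_def V_cst_mult lc_cst_mult)
  have "cst (lc a) \<star> monic_part a = (cst (lc a) \<star> cst (inv (lc a))) \<star> a"
    using a u by (simp add: monic_part_def P.m_assoc)
  then show "cst (lc a) \<star> monic_part a = a"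
    using a u by (simp add: cst_mult[symmetric])
qed

text \<open>As in the proof of Gauss's lemma, multiplication by an invertible u permutes the nonzero
  residues modulo constants: if two images agree up to a constant t, cancelling u gives x = t y, and
  both being monic forces t = 1.\<close>

lemma regular_mod_permutes:
  assumes b: "b \<in> M d" and u: "regular_mod b u"
  defines "\<sigma> \<equiv> \<lambda>x. monic_part ((u \<star> x) pmod b)"
  shows "bij_betw \<sigma> (Mlt d) (Mlt d)"
    and "\<And>x. x \<in> Mlt d \<Longrightarrow> (u \<star> x) pmod b = cst (lc ((u \<star> x) pmod b)) \<star> \<sigma> x"
    and "\<And>x. x \<in> Mlt d \<Longrightarrow> lc ((u \<star> x) pmod b) \<noteq> \<zero>"
proof -
  have bK: "b \<in> carrier KX" "length b - 1 = d" using b by (auto simp: M_iff)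
  have uK: "u \<in> carrier KX" using u by (simp add: regular_mod_def)
  have ne: "(u \<star> x) pmod b \<noteq> []" "(u \<star> x) pmod b \<in> V d" if x: "x \<in> Mlt d" for x
  proof -
    have xK: "x \<in> carrier KX" "x \<in> V d" "x \<noteq> []" using x by (auto simp: Mlt_iff V_def)
    show "(u \<star> x) pmod b \<noteq> []"
      using u xK bK uK pmod_eq_Nil_iff[of "u \<star> x" b] by (auto simp: regular_mod_def)
    show "(u \<star> x) pmod b \<in> V d" using pmod_V[OF _ b] uK xK by simp
  qed
  then show eq: "(u \<star> x) pmod b = cst (lc ((u \<star> x) pmod b)) \<star> \<sigma> x" if "x \<in> Mlt d" for x
    using monic_part(2)[OF ne(2) ne(1), OF that that] by (simp add: \<sigma>_def)
  show nz: "lc ((u \<star> x) pmod b) \<noteq> \<zero>" if "x \<in> Mlt d" for x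
    using ne[OF that] lc_eq_0_iff V_KX by blast
  have "inj_on \<sigma> (Mlt d)"
  proof (rule inj_onI)
    fix x y assume x: "x \<in> Mlt d" and y: "y \<in> Mlt d" and s: "\<sigma> x = \<sigma> y"
    have xK: "x \<in> carrier KX" "y \<in> carrier KX" "x \<in> V d" "y \<in> V d" "lc x = \<one>" "lc y = \<one>"
      using x y by (auto simp: Mlt_iff V_def)
    let ?c = "lc ((u \<star> x) pmod b)" and ?e = "lc ((u \<star> y) pmod b)"
    have c: "?c \<in> Units R" "?e \<in> Units R" using nz x y xK uK bK by (simp_all add: field_Units)
    define t where "t = ?c \<otimes> inv ?e"
    have t: "t \<in> K" "t \<otimes> ?e = ?c" using c c[THEN Units_closed] by (simp_all add: t_def m_assoc)
    have sK: "\<sigma> y \<in> carrier KX" using ne[OF y] monic_part(1)[of "(u \<star> y) pmod b" d] Mlt_KX by (simp add: \<sigma>_def)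
    have "(u \<star> x) pmod b = cst t \<star> ((u \<star> y) pmod b)"
      using eq[OF x] eq[OF y] s c t sK by (metis Units_closed P.m_assoc cst_closed cst_mult)
    also have "\<dots> = (u \<star> (cst t \<star> y)) pmod b"
      using pmod_cst_mult[OF b t(1), of "u \<star> y"] uK xK t by (simp add: P.m_lcomm)
    finally have "b pdivides (u \<star> x \<boxminus> u \<star> (cst t \<star> y))"
      using pmod_eq_iff bK uK xK t by simp
    also have "u \<star> x \<boxminus> u \<star> (cst t \<star> y) = u \<star> (x \<boxminus> cst t \<star> y)"
      using uK xK t by (simp add: a_minus_def P.r_distr P.r_minus)
    finally have "x \<boxminus> cst t \<star> y = []"
      using u xK t bK by (auto simp: regular_mod_def intro!: V_sub V_cst_mult)
    then have xy: "x = cst t \<star> y" using xK t P.r_right_minus_eq[of x "cst t \<star> y"] by simp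
    then have "t = \<one>" using xK t by (simp add: lc_cst_mult)
    then show "x = y" using xy xK by simp
  qed
  moreover have "\<sigma> ` Mlt d \<subseteq> Mlt d" using ne monic_part(1) by (auto simp: \<sigma>_def)
  ultimately show "bij_betw \<sigma> (Mlt d) (Mlt d)"
    by (simp add: bij_betw_def finite_Mlt endo_inj_surj)
qed

text \<open>A zero divisor u annihilates some nonzero remainder x, and the factor at the monic
  multiple of x is \<open>lam\<close> of zero.\<close>

lemma gauss_symbol_not_regular:
  assumes b: "b \<in> M d" and u: "u \<in> carrier KX" "\<not> regular_mod b u" and a: "a \<in> carrier KX"
  shows "gauss_symbol u b = 0" "gauss_symbol (a \<star> u) b = 0"
proof -
  have bK: "b \<in> carrier KX" "length b - 1 = d" using b by (auto simp: M_iff)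
  obtain x where x: "x \<in> V d" "x \<noteq> []" "b pdivides (u \<star> x)" using u bK by (auto simp: regular_mod_def)
  let ?y = "monic_part x"
  have y: "?y \<in> Mlt d" "?y \<in> carrier KX" using monic_part[OF x(1,2)] Mlt_KX by auto
  have "lc x \<in> Units R" using x lc_eq_0_iff V_KX by (auto simp: field_Units)
  then have "u \<star> ?y = cst (inv (lc x)) \<star> (u \<star> x)" and i: "inv (lc x) \<in> K"
    using u x V_KX by (simp_all add: monic_part_def P.m_lcomm)
  then have d1: "b pdivides (u \<star> ?y)"
    using x u V_KX bK by (simp add: pdivides_mult_left)
  then have "b pdivides (a \<star> u \<star> ?y)"
    using a u y bK pdivides_mult_left[of b "u \<star> ?y" a] by (simp add: P.m_assoc)
  with d1 have "(u \<star> ?y) pmod b = []" "(a \<star> u \<star> ?y) pmod b = []"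
    using pmod_eq_Nil_iff a u y bK by simp_all
  then show "gauss_symbol u b = 0" "gauss_symbol (a \<star> u) b = 0"
    unfolding gauss_symbol_eq[OF b] using y finite_Mlt
    by (auto intro!: prod_zero bexI[of _ ?y])
qed

text \<open>For regular u the factor of the product at x is that of a at \<open>\<sigma> x\<close>
  times \<open>lam\<close> of the constant by which u x differs from \<open>\<sigma> x\<close>; the
  factors of a are then reindexed by the permutation.\<close>

lemma gauss_symbol_mult:
  assumes b: "b \<in> M d" and a: "a \<in> carrier KX" and u: "u \<in> carrier KX"
  shows "gauss_symbol (a \<star> u) b = gauss_symbol a b * gauss_symbol u b"
proof (cases "regular_mod b u")
  case False
  then show ?thesis using gauss_symbol_not_regular[OF b u _ a] by simp
next
  case True
  have bK: "b \<in> carrier KX" "b \<noteq> []" using b by (auto simp: M_iff)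
  define \<sigma> where "\<sigma> x = monic_part ((u \<star> x) pmod b)" for x
  note perm = regular_mod_permutes[OF b True, folded \<sigma>_def]
  have "lam (lc ((a \<star> u \<star> x) pmod b)) = lam (lc ((a \<star> \<sigma> x) pmod b)) * lam (lc ((u \<star> x) pmod b))"
    if x: "x \<in> Mlt d" for x
  proof -
    let ?c = "lc ((u \<star> x) pmod b)"
    have K': "x \<in> carrier KX" "\<sigma> x \<in> carrier KX"
      using x Mlt_KX bij_betwE[OF perm(1)] by auto
    have c: "?c \<in> K" using K' u bK by simp
    have "(a \<star> u \<star> x) pmod b = (a \<star> ((u \<star> x) pmod b)) pmod b"
      using pmod_mult_pmod_right[of b a "u \<star> x"] bK a u K' by (simp add: P.m_assoc)
    also have "\<dots> = (cst ?c \<star> (a \<star> \<sigma> x)) pmod b"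
      using perm(2)[OF x] a K' c by (metis P.m_lcomm cst_closed)
    also have "\<dots> = cst ?c \<star> ((a \<star> \<sigma> x) pmod b)"
      using a K' c by (intro pmod_cst_mult[OF b]) auto
    finally show ?thesis using a K' c bK by (simp add: lc_cst_mult lam_mult mult.commute)
  qed
  then have "gauss_symbol (a \<star> u) b = (\<Prod>x\<in>Mlt d. lam (lc ((a \<star> \<sigma> x) pmod b))) * gauss_symbol u b"
    unfolding gauss_symbol_eq[OF b] by (simp add: prod.distrib)
  also have "(\<Prod>x\<in>Mlt d. lam (lc ((a \<star> \<sigma> x) pmod b))) = gauss_symbol a b"
    unfolding gauss_symbol_eq[OF b] by (rule prod.reindex_bij_betw[OF perm(1)])
  finally show ?thesis .
qed

lemma gauss_symbol_one: "b \<in> M d \<Longrightarrow> gauss_symbol [\<one>] b = 1"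
  unfolding gauss_symbol_eq
proof (rule prod.neutral, rule ballI)
  fix x assume b: "b \<in> M d" and x: "x \<in> Mlt d"
  then have "x \<in> V d" "lc x = \<one>" "x \<in> carrier KX" by (auto simp: Mlt_iff V_KX intro: Mlt_KX)
  then show "lam (lc (([\<one>] \<star> x) pmod b)) = 1" using pmod_V_id[OF b] by simp
qed

lemma gauss_symbol_root:
  assumes b: "b \<in> M d" and u: "regular_mod b u"
  shows "gauss_symbol u b ^ r = 1"
proof -
  have "gauss_symbol u b ^ r = (\<Prod>x\<in>Mlt d. lam (lc ((u \<star> x) pmod b)) ^ r)"
    by (simp add: gauss_symbol_eq[OF b] prod_power_distrib)
  also have "\<dots> = 1"
  proof (intro prod.neutral ballI lam_root)
    fix x assume "x \<in> Mlt d"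
    then show "lc ((u \<star> x) pmod b) \<noteq> \<zero>" by (rule regular_mod_permutes(3)[OF b u])
    show "lc ((u \<star> x) pmod b) \<in> K" using \<open>x \<in> Mlt d\<close> u b M_KX Mlt_KX by (simp add: regular_mod_def)
  qed
  finally show ?thesis .
qed

end

subsection \<open>A Polya-Vinogradov inequality\<close>

context finite_field_poly
begin

lemma regular_bij:
  assumes f: "f \<in> M d" and "regular_mod f u"
  shows "bij_betw (\<lambda>a. (u \<star> a) pmod f) (V d) (V d)"
proof -
  have f_KX: "f \<in> carrier KX" "length f = Suc d" using f by (auto simp: M_iff)
  have u: "u \<in> carrier KX" using assms by (simp add: regular_mod_def)
  have "inj_on (\<lambda>a. (u \<star> a) pmod f) (V d)"
  proof (rule inj_onI)
    fix a b assume a: "a \<in> V d" "b \<in> V d" and "(u \<star> a) pmod f = (u \<star> b) pmod f"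
    then have "f pdivides (u \<star> a \<boxminus> u \<star> b)" using u f_KX V_KX by (simp add: pmod_eq_iff)
    also have "u \<star> a \<boxminus> u \<star> b = u \<star> (a \<boxminus> b)"
      using u a V_KX by (simp add: a_minus_def P.r_distr P.r_minus)
    finally have "a \<boxminus> b = []" using assms a f_KX by (auto simp: regular_mod_def V_sub)
    then show "a = b" using a P.r_right_minus_eq[of a b] by (simp add: V_KX)
  qed
  moreover have "(\<lambda>a. (u \<star> a) pmod f) ` V d \<subseteq> V d"
    using u pmod_V[OF _ f] by (auto simp: V_KX)
  ultimately show ?thesis by (simp add: bij_betw_def finite_V endo_inj_surj)
qed

text \<open>A primitive character modulo f. The last clause is primitivity in the form needed for
  Gauss sums: for a non-unit b there is a unit u that fixes b modulo f and has a value different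
  from 1.\<close>

definition residue_character :: "'a list \<Rightarrow> nat \<Rightarrow> ('a list \<Rightarrow> complex) \<Rightarrow> bool" where
  "residue_character f d \<eta> \<longleftrightarrow> f \<in> M d \<and> d > 0 \<and>
     (\<forall>a\<in>carrier KX. \<forall>b\<in>carrier KX. \<eta> (a \<star> b) = \<eta> a * \<eta> b) \<and>
     (\<forall>a\<in>carrier KX. \<forall>b\<in>carrier KX. a pmod f = b pmod f \<longrightarrow> \<eta> a = \<eta> b) \<and>
     \<eta> [\<one>] = 1 \<and>
     (\<forall>a\<in>carrier KX. cmod (\<eta> a) \<le> 1) \<and>
     (\<forall>b\<in>carrier KX. (regular_mod f b \<and> cmod (\<eta> b) = 1) \<or>
       (\<eta> b = 0 \<and> (\<exists>u. regular_mod f u \<and> (u \<star> b) pmod f = b pmod f \<and> \<eta> u \<noteq> 1)))"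

context
  fixes f :: "'a list" and d :: nat and \<eta> :: "'a list \<Rightarrow> complex"
  assumes character: "residue_character f d \<eta>"
begin

lemma modulus: "f \<in> M d" and deg_pos: "d > 0"
  and char_mult: "a \<in> carrier KX \<Longrightarrow> b \<in> carrier KX \<Longrightarrow> \<eta> (a \<star> b) = \<eta> a * \<eta> b"
  and char_cong: "a \<in> carrier KX \<Longrightarrow> b \<in> carrier KX \<Longrightarrow> a pmod f = b pmod f \<Longrightarrow> \<eta> a = \<eta> b"
  and char_one: "\<eta> [\<one>] = 1"
  and char_norm_le: "a \<in> carrier KX \<Longrightarrow> cmod (\<eta> a) \<le> 1"
  using character unfolding residue_character_def by blast+

lemma char_cases:
  assumes "b \<in> carrier KX"
  obtains "regular_mod f b" "cmod (\<eta> b) = 1"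
  | u where "\<eta> b = 0" "regular_mod f u" "(u \<star> b) pmod f = b pmod f" "\<eta> u \<noteq> 1"
  using character assms unfolding residue_character_def by blast

lemma f_KX: "f \<in> carrier KX" "f \<noteq> []" "length f = Suc d"
  using modulus by (auto simp: M_iff)

text \<open>The residue of a / f at infinity up to sign: a linear form on the remainders for which
  \<open>topc\<close> of the product is a nondegenerate pairing.\<close>

definition topc :: "'a list \<Rightarrow> 'a" where "topc a = coeff (a pmod f) (d - 1)"

lemma top_closed [simp]: "a \<in> carrier KX \<Longrightarrow> topc a \<in> K"
  by (simp add: topc_def f_KX)

lemma top_cong: "a pmod f = b pmod f \<Longrightarrow> topc a = topc b"
  by (simp add: topc_def)

lemma top_add: "a \<in> carrier KX \<Longrightarrow> b \<in> carrier KX \<Longrightarrow> topc (a \<boxplus> b) = topc a \<oplus> topc b"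
  by (simp add: topc_def f_KX pmod_add coeff_add)

lemma top_sub: "a \<in> carrier KX \<Longrightarrow> b \<in> carrier KX \<Longrightarrow> topc (a \<boxminus> b) = topc a \<ominus> topc b"
  by (simp add: topc_def f_KX pmod_sub coeff_sub)

lemma top_cst_mult: "c \<in> K \<Longrightarrow> a \<in> carrier KX \<Longrightarrow> topc (cst c \<star> a) = c \<otimes> topc a"
  by (simp add: topc_def f_KX pmod_cst_mult[OF modulus] coeff_cst_mult)

lemma top_V: "a \<in> V d \<Longrightarrow> topc a = coeff a (d - 1)"
  by (simp add: topc_def pmod_V_id[OF modulus])

text \<open>The zero polynomial is a non-unit since d > 0, so primitivity there supplies a unit u
  with value different from 1, and multiplication by u permutes the remainders.\<close>

lemma sum_char_V: "(\<Sum>a\<in>V d. \<eta> a) = 0"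
proof -
  have "[\<one>] \<in> V d" using deg_pos by (simp add: V_def)
  moreover have "f pdivides ([] \<star> [\<one>])"
    unfolding pdivides_iff_mult using f_KX by (intro bexI[of _ "[]"]) auto
  ultimately have "\<not> regular_mod f []" using f_KX by (force simp: regular_mod_def)
  then obtain u where u: "regular_mod f u" "\<eta> u \<noteq> 1" using char_cases[of "[]"] by (metis Nil_KX)
  then have uK: "u \<in> carrier KX" by (simp add: regular_mod_def)
  have "(\<Sum>a\<in>V d. \<eta> a) = (\<Sum>a\<in>V d. \<eta> ((u \<star> a) pmod f))"
    by (rule sum.reindex_bij_betw[OF regular_bij[OF modulus u(1)], symmetric])
  also have "\<dots> = (\<Sum>a\<in>V d. \<eta> u * \<eta> a)"
    using uK f_KX by (intro sum.cong refl) (auto simp: V_KX char_mult[symmetric] intro!: char_cong)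
  finally show ?thesis using u by (simp flip: sum_distrib_left)
qed

text \<open>Instead of weighting with an additive character of the constant field, the sum is cut
  into the level sets of \<open>topc\<close>; the family over all c carries the same information as
  the classical Gauss sums.\<close>

definition gauss_sum :: "'a \<Rightarrow> 'a list \<Rightarrow> complex" where
  "gauss_sum c b = (\<Sum>a\<in>{a\<in>V d. topc (a \<star> b) = c}. \<eta> a)"

definition T :: "'a \<Rightarrow> complex" where
  "T c = (\<Sum>a\<in>{a\<in>V d. topc a = c}. \<eta> a)"

text \<open>For a unit b, substitute b a for a. For a non-unit, substituting u a with the u from
  primitivity multiplies the sum by a value different from 1, so it vanishes.\<close>

lemma gauss_sum_eq:
  assumes b: "b \<in> carrier KX"
  shows "gauss_sum c b = cnj (\<eta> b) * T c"
proof (cases rule: char_cases[OF b])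
  case 1
  note reg = 1(1) and n = 1(2)
  have "T c = (\<Sum>a\<in>V d. if topc a = c then \<eta> a else 0)"
    unfolding T_def by (simp add: sum.inter_filter finite_V)
  also have "\<dots> = (\<Sum>a\<in>V d. if topc ((b \<star> a) pmod f) = c then \<eta> ((b \<star> a) pmod f) else 0)"
    by (rule sum.reindex_bij_betw[OF regular_bij[OF modulus reg], symmetric])
  also have "\<dots> = (\<Sum>a\<in>V d. if topc (a \<star> b) = c then \<eta> a * \<eta> b else 0)"
  proof (intro sum.cong refl)
    fix a assume "a \<in> V d"
    then have a: "a \<in> carrier KX" by (rule V_KX)
    have "topc ((b \<star> a) pmod f) = topc (a \<star> b)" "\<eta> ((b \<star> a) pmod f) = \<eta> (a \<star> b)"
      using a b f_KX by (auto intro!: top_cong char_cong simp: P.m_comm)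
    then show "(if topc ((b \<star> a) pmod f) = c then \<eta> ((b \<star> a) pmod f) else 0) = (if topc (a \<star> b) = c then \<eta> a * \<eta> b else 0)"
      using a b by (simp add: char_mult)
  qed
  also have "\<dots> = (\<Sum>a\<in>{a\<in>V d. topc (a \<star> b) = c}. \<eta> a * \<eta> b)"
    by (simp add: sum.inter_filter finite_V)
  also have "\<dots> = gauss_sum c b * \<eta> b"
    by (simp add: gauss_sum_def sum_distrib_right)
  finally have "cnj (\<eta> b) * T c = gauss_sum c b * (\<eta> b * cnj (\<eta> b))" by simp
  then show ?thesis using n by (simp add: complex_norm_square[symmetric])
next
  case (2 u)
  note z = 2(1) and u = 2(2-4)
  have uK: "u \<in> carrier KX" using u by (simp add: regular_mod_def)
  have "gauss_sum c b = (\<Sum>a\<in>V d. if topc (a \<star> b) = c then \<eta> a else 0)"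
    unfolding gauss_sum_def by (simp add: sum.inter_filter finite_V)
  also have "\<dots> = (\<Sum>a\<in>V d. if topc (((u \<star> a) pmod f) \<star> b) = c then \<eta> ((u \<star> a) pmod f) else 0)"
    by (rule sum.reindex_bij_betw[OF regular_bij[OF modulus u(1)], symmetric])
  also have "\<dots> = (\<Sum>a\<in>V d. if topc (a \<star> b) = c then \<eta> u * \<eta> a else 0)"
  proof (intro sum.cong refl)
    fix a assume "a \<in> V d"
    then have a: "a \<in> carrier KX" by (rule V_KX)
    have "(((u \<star> a) pmod f) \<star> b) pmod f = (u \<star> a \<star> b) pmod f"
      using a b uK f_KX by (intro pmod_mult_cong) auto
    also have "u \<star> a \<star> b = a \<star> (u \<star> b)" using a b uK by (simp add: P.m_comm P.m_lcomm)
    also have "(a \<star> (u \<star> b)) pmod f = (a \<star> b) pmod f"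
      using pmod_mult_pmod_right[of f a "u \<star> b"] pmod_mult_pmod_right[of f a b] u a b uK f_KX by simp
    finally have "topc (((u \<star> a) pmod f) \<star> b) = topc (a \<star> b)" by (rule top_cong)
    moreover have "\<eta> ((u \<star> a) pmod f) = \<eta> u * \<eta> a"
      using a uK f_KX by (auto simp: char_mult[symmetric] intro!: char_cong)
    ultimately show "(if topc (((u \<star> a) pmod f) \<star> b) = c then \<eta> ((u \<star> a) pmod f) else 0) = (if topc (a \<star> b) = c then \<eta> u * \<eta> a else 0)"
      by simp
  qed
  also have "\<dots> = (\<Sum>a\<in>{a\<in>V d. topc (a \<star> b) = c}. \<eta> u * \<eta> a)"
    by (simp add: sum.inter_filter finite_V)
  also have "\<dots> = \<eta> u * gauss_sum c b" by (simp add: gauss_sum_def sum_distrib_left)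
  finally show ?thesis using u z by simp
qed

text \<open>The linear form given by a on \<open>V (d - n)\<close> maps onto the constants, so its
  kernel has index q.\<close>

lemma card_orthogonal:
  assumes a: "a \<in> V d" "a \<notin> V n" and n: "n < d"
  shows "q * card {b\<in>V (d - n). topc (a \<star> b) = \<zero>} = q ^ (d - n)"
proof -
  have aK: "a \<in> carrier KX" "a \<noteq> []" "length a \<le> d" "length a > n" using a by (auto simp: V_def)
  \<comment> \<open>A power of X chosen so that a e has degree exactly d - 1; its
    \<open>topc\<close> is then the leading coefficient of a, which is nonzero.\<close>
  define e where "e = xpow (d - length a)"
  have e: "e \<in> carrier KX" "e \<noteq> []" "length e = Suc (d - length a)" "lc e = \<one>"
    using xpow_M[of "d - length a"] by (auto simp: e_def M_iff)
  then have eV: "e \<in> V (d - n)" using aK by (simp add: V_def)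
  have len: "length (a \<star> e) = d" using aK e by (simp add: length_mult)
  then have "a \<star> e \<in> V d" "a \<star> e \<noteq> []" using aK e deg_pos by (auto simp: V_def)
  then have te: "topc (a \<star> e) = lc a"
    using lc_coeff[of "a \<star> e"] aK e len by (simp add: top_V lc_mult)
  have u: "lc a \<in> Units R" using aK lc_eq_0_iff by (simp add: field_Units)
  note uc = Units_closed[OF u]
  have t: "topc (a \<star> (b \<boxplus> cst c \<star> e)) = topc (a \<star> b) \<oplus> c \<otimes> lc a" if "b \<in> carrier KX" "c \<in> K" for b c
    using that aK e te by (simp add: P.r_distr P.m_lcomm[of a] top_add top_cst_mult)
  let ?Z = "{b\<in>V (d - n). topc (a \<star> b) = \<zero>}"
  have "bij_betw (\<lambda>(c, b). b \<boxplus> cst c \<star> e) (K \<times> ?Z) (V (d - n))"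
  proof (rule bij_betw_byWitness[where f' = "\<lambda>b. (topc (a \<star> b) \<otimes> inv (lc a), b \<boxminus> cst (topc (a \<star> b) \<otimes> inv (lc a)) \<star> e)"])
    have inv: "x \<otimes> lc a \<otimes> inv (lc a) = x" "x \<otimes> inv (lc a) \<otimes> lc a = x" if "x \<in> K" for x
      using that u uc by (simp_all add: m_assoc)
    show "\<forall>y\<in>K \<times> ?Z. (\<lambda>b. (topc (a \<star> b) \<otimes> inv (lc a), b \<boxminus> cst (topc (a \<star> b) \<otimes> inv (lc a)) \<star> e)) ((\<lambda>(c, b). b \<boxplus> cst c \<star> e) y) = y"
    proof (clarsimp)
      fix c b assume c: "c \<in> K" and b: "b \<in> V (d - n)" "topc (a \<star> b) = \<zero>"
      then have "topc (a \<star> (b \<boxplus> cst c \<star> e)) \<otimes> inv (lc a) = c"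
        using t[of b c] uc by (simp add: V_KX inv)
      then show "topc (a \<star> (b \<boxplus> cst c \<star> e)) \<otimes> inv (lc a) = c \<and>
         b \<boxplus> cst c \<star> e \<boxminus> cst (topc (a \<star> (b \<boxplus> cst c \<star> e)) \<otimes> inv (lc a)) \<star> e = b"
        using b c e by (simp add: V_KX a_minus_def P.a_assoc P.r_neg)
    qed
    show "\<forall>b\<in>V (d - n). (\<lambda>(c, b). b \<boxplus> cst c \<star> e) (topc (a \<star> b) \<otimes> inv (lc a), b \<boxminus> cst (topc (a \<star> b) \<otimes> inv (lc a)) \<star> e) = b"
      using e aK u by (simp add: V_KX a_minus_def P.a_assoc P.l_neg)
    show "(\<lambda>(c, b). b \<boxplus> cst c \<star> e) ` (K \<times> ?Z) \<subseteq> V (d - n)"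
      using eV by (auto intro!: V_add V_cst_mult)
    show "(\<lambda>b. (topc (a \<star> b) \<otimes> inv (lc a), b \<boxminus> cst (topc (a \<star> b) \<otimes> inv (lc a)) \<star> e)) ` V (d - n) \<subseteq> K \<times> ?Z"
    proof
      fix y assume "y \<in> (\<lambda>b. (topc (a \<star> b) \<otimes> inv (lc a), b \<boxminus> cst (topc (a \<star> b) \<otimes> inv (lc a)) \<star> e)) ` V (d - n)"
      then obtain b where b: "b \<in> V (d - n)" and y: "y = (topc (a \<star> b) \<otimes> inv (lc a), b \<boxminus> cst (topc (a \<star> b) \<otimes> inv (lc a)) \<star> e)"
        by blast
      let ?c = "topc (a \<star> b) \<otimes> inv (lc a)"
      have bK: "b \<in> carrier KX" and c: "?c \<in> K" using b aK u by (simp_all add: V_KX)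
      have "a \<star> (b \<boxminus> cst ?c \<star> e) = a \<star> b \<boxminus> cst ?c \<star> (a \<star> e)"
        using bK c aK e by (simp add: a_minus_def P.r_distr P.r_minus P.m_lcomm[of a])
      then have "topc (a \<star> (b \<boxminus> cst ?c \<star> e)) = topc (a \<star> b) \<ominus> ?c \<otimes> lc a"
        using bK c aK e te by (simp add: top_sub top_cst_mult)
      also have "\<dots> = \<zero>" using bK aK by (simp add: inv a_minus_def r_neg)
      finally show "y \<in> K \<times> ?Z"
        unfolding y using b c eV by (simp add: V_sub V_cst_mult)
    qed
  qed
  then have "card (K \<times> ?Z) = card (V (d - n))" by (rule bij_betw_same_card)
  then show ?thesis by (simp add: card_cartesian_product card_V q_def)
qed

text \<open>Behind the case distinction is a duality: under the pairing by \<open>topc\<close>, the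
  orthogonal complement of \<open>V (d - n)\<close> in \<open>V d\<close> is
  \<open>V n\<close>.\<close>

lemma card_orthogonal_eq:
  assumes a: "a \<in> V d" and n: "n < d"
  shows "real (card {b\<in>V (d - n). topc (a \<star> b) = \<zero>}) =
    real q ^ (d - n - 1) + (if a \<in> V n then real q ^ (d - n) - real q ^ (d - n - 1) else 0)"
proof (cases "a \<in> V n")
  case True
  have "topc (a \<star> b) = \<zero>" if b: "b \<in> V (d - n)" for b
  proof -
    have "a \<star> b \<in> V (d - 1)"
    proof (cases "a = [] \<or> b = []")
      case False
      then show ?thesis using True b by (cases a; cases b) (auto simp: V_def length_mult)
    qed (use True b in \<open>auto simp: V_KX\<close>)
    then have "coeff (a \<star> b) (d - 1) = \<zero>" "a \<star> b \<in> V d"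
      using V_mono[of "d - 1" d] by (auto simp: V_iff)
    then show ?thesis by (simp add: top_V)
  qed
  then have "{b\<in>V (d - n). topc (a \<star> b) = \<zero>} = V (d - n)" by auto
  then show ?thesis using True by (simp add: card_V)
next
  case False
  have "real q * real (card {b\<in>V (d - n). topc (a \<star> b) = \<zero>}) = real q ^ (d - n)"
    unfolding of_nat_mult[symmetric] card_orthogonal[OF a False n] by simp
  also have "\<dots> = real q * real q ^ (d - n - 1)" using n by (metis Suc_diff_1 power_Suc zero_less_diff)
  finally show ?thesis using False q_ge_2 by simp
qed

text \<open>The sum of the squared moduli of \<open>gauss_sum c b\<close> over b and c is computed
  twice. By \<open>gauss_sum_eq\<close> it factors; by counting the b at which \<open>topc\<close>
  of a b and of a' b agree, only the diagonal survives, the rest being a multiple of the squared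
  modulus of the sum of \<eta>, which is 0.\<close>

lemma parseval: "(\<Sum>c\<in>K. (cmod (T c))\<^sup>2) = real q ^ (d - 1) * (real q - 1)"
proof -
  define \<Phi> where "\<Phi> = (\<Sum>a\<in>V d. (cmod (\<eta> a))\<^sup>2)"
  have fib: "(\<Sum>c\<in>K. gauss_sum c b * cnj (gauss_sum c b)) =
      (\<Sum>a\<in>V d. \<Sum>a'\<in>V d. if topc (a \<star> b) = topc (a' \<star> b) then \<eta> a * cnj (\<eta> a') else 0)"
    if b: "b \<in> V d" for b
  proof -
    have g: "gauss_sum c b = (\<Sum>a\<in>V d. if topc (a \<star> b) = c then \<eta> a else 0)" for c
      unfolding gauss_sum_def by (simp add: sum.inter_filter finite_V)
    have "(\<Sum>c\<in>K. gauss_sum c b * cnj (gauss_sum c b)) =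
      (\<Sum>c\<in>K. \<Sum>a\<in>V d. \<Sum>a'\<in>V d. (if topc (a \<star> b) = c then \<eta> a else 0) * (if topc (a' \<star> b) = c then cnj (\<eta> a') else 0))"
      unfolding g by (simp add: sum_product if_distrib[of cnj] cong: if_cong)
    also have "\<dots> = (\<Sum>a\<in>V d. \<Sum>a'\<in>V d. \<Sum>c\<in>K. (if topc (a \<star> b) = c then \<eta> a else 0) * (if topc (a' \<star> b) = c then cnj (\<eta> a') else 0))"
      by (subst sum.swap, intro sum.cong refl, rule sum.swap)
    also have "\<dots> = (\<Sum>a\<in>V d. \<Sum>a'\<in>V d. if topc (a \<star> b) = topc (a' \<star> b) then \<eta> a * cnj (\<eta> a') else 0)"
    proof (intro sum.cong refl)
      fix a a' assume "a \<in> V d" "a' \<in> V d"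
      then have "topc (a \<star> b) \<in> K" using b by (simp add: V_KX)
      have "(\<Sum>c\<in>K. (if topc (a \<star> b) = c then \<eta> a else 0) * (if topc (a' \<star> b) = c then cnj (\<eta> a') else 0)) =
         (\<Sum>c\<in>K. if c = topc (a \<star> b) then (if topc (a \<star> b) = topc (a' \<star> b) then \<eta> a * cnj (\<eta> a') else 0) else 0)"
        by (intro sum.cong) auto
      also have "\<dots> = (if topc (a \<star> b) = topc (a' \<star> b) then \<eta> a * cnj (\<eta> a') else 0)"
        using \<open>topc (a \<star> b) \<in> K\<close> finite_carrier by simp
      finally show "(\<Sum>c\<in>K. (if topc (a \<star> b) = c then \<eta> a else 0) * (if topc (a' \<star> b) = c then cnj (\<eta> a') else 0)) = \<dots>" .
    qed
    finally show ?thesis .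
  qed
  have count: "(\<Sum>b\<in>V d. if topc (a \<star> b) = topc (a' \<star> b) then \<eta> a * cnj (\<eta> a') else 0) =
      of_real (real q ^ (d - 1)) * (\<eta> a * cnj (\<eta> a')) +
      (if a' = a then of_real ((real q ^ d - real q ^ (d - 1)) * (cmod (\<eta> a))\<^sup>2) else 0)"
    if a: "a \<in> V d" "a' \<in> V d" for a a'
  proof -
    have "topc (a \<star> b) = topc (a' \<star> b) \<longleftrightarrow> topc ((a \<boxminus> a') \<star> b) = \<zero>" if b: "b \<in> V d" for b
    proof -
      have "(a \<boxminus> a') \<star> b = a \<star> b \<boxminus> a' \<star> b"
        using a b by (simp add: V_KX a_minus_def P.l_distr P.l_minus)
      then show ?thesis using a b r_right_minus_eq[of "topc (a \<star> b)" "topc (a' \<star> b)"] by (simp add: V_KX top_sub)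
    qed
    then have "(\<Sum>b\<in>V d. if topc (a \<star> b) = topc (a' \<star> b) then \<eta> a * cnj (\<eta> a') else 0) =
        (\<Sum>b\<in>V d. if topc ((a \<boxminus> a') \<star> b) = \<zero> then \<eta> a * cnj (\<eta> a') else 0)"
      by (intro sum.cong) auto
    also have "\<dots> = of_nat (card {b\<in>V (d - 0). topc ((a \<boxminus> a') \<star> b) = \<zero>}) * (\<eta> a * cnj (\<eta> a'))"
      by (simp add: sum.inter_filter[symmetric] finite_V)
    also have "(of_nat (card {b\<in>V (d - 0). topc ((a \<boxminus> a') \<star> b) = \<zero>}) :: complex) =
        of_real (real (card {b\<in>V (d - 0). topc ((a \<boxminus> a') \<star> b) = \<zero>}))"
      by (rule of_real_of_nat_eq[symmetric])
    also have "real (card {b\<in>V (d - 0). topc ((a \<boxminus> a') \<star> b) = \<zero>}) = real q ^ (d - 1) + (if a \<boxminus> a' \<in> V 0 then real q ^ d - real q ^ (d - 1) else 0)"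
      using card_orthogonal_eq[of "a \<boxminus> a'" 0] a deg_pos by (simp add: V_sub)
    also have "a \<boxminus> a' \<in> V 0 \<longleftrightarrow> a' = a"
      using a P.r_right_minus_eq[of a a'] by (auto simp: V_def)
    finally show ?thesis by (auto simp: distrib_right complex_norm_square simp del: of_real_power)
  qed
  have pr: "(\<Sum>a\<in>V d. \<Sum>a'\<in>V d. C * (\<eta> a * cnj (\<eta> a'))) = C * ((\<Sum>a\<in>V d. \<eta> a) * (\<Sum>a'\<in>V d. cnj (\<eta> a')))" for C
    by (simp only: sum_product) (simp only: sum_distrib_left)
  have "(\<Sum>c\<in>K. \<Sum>b\<in>V d. gauss_sum c b * cnj (gauss_sum c b)) =
     (\<Sum>b\<in>V d. \<Sum>a\<in>V d. \<Sum>a'\<in>V d. if topc (a \<star> b) = topc (a' \<star> b) then \<eta> a * cnj (\<eta> a') else 0)"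
    by (subst sum.swap) (intro sum.cong refl fib)
  also have "\<dots> = (\<Sum>a\<in>V d. \<Sum>a'\<in>V d. \<Sum>b\<in>V d. if topc (a \<star> b) = topc (a' \<star> b) then \<eta> a * cnj (\<eta> a') else 0)"
    by (rule trans[OF sum.swap sum.cong[OF refl sum.swap]])
  also have "\<dots> = (\<Sum>a\<in>V d. \<Sum>a'\<in>V d. of_real (real q ^ (d - 1)) * (\<eta> a * cnj (\<eta> a')) +
      (if a' = a then of_real ((real q ^ d - real q ^ (d - 1)) * (cmod (\<eta> a))\<^sup>2) else 0))"
    by (intro sum.cong refl count)
  also have "\<dots> = of_real (real q ^ (d - 1)) * ((\<Sum>a\<in>V d. \<eta> a) * (\<Sum>a'\<in>V d. cnj (\<eta> a'))) +
      (\<Sum>a\<in>V d. of_real ((real q ^ d - real q ^ (d - 1)) * (cmod (\<eta> a))\<^sup>2))"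
    by (simp only: sum.distrib pr) (simp add: finite_V)
  also have "\<dots> = of_real ((real q ^ d - real q ^ (d - 1)) * \<Phi>)"
    by (simp add: sum_char_V \<Phi>_def sum_distrib_left)
  also have "(\<Sum>c\<in>K. \<Sum>b\<in>V d. gauss_sum c b * cnj (gauss_sum c b)) =
      (\<Sum>c\<in>K. \<Sum>b\<in>V d. of_real ((cmod (T c))\<^sup>2 * (cmod (\<eta> b))\<^sup>2))"
    by (intro sum.cong refl) (simp add: gauss_sum_eq V_KX complex_norm_square mult_ac del: of_real_power)
  also have "\<dots> = of_real ((\<Sum>c\<in>K. (cmod (T c))\<^sup>2) * \<Phi>)"
    by (simp add: \<Phi>_def sum_product)
  finally have "(\<Sum>c\<in>K. (cmod (T c))\<^sup>2) * \<Phi> = (real q ^ d - real q ^ (d - 1)) * \<Phi>"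
    using of_real_eq_iff by blast
  moreover have "\<Phi> \<noteq> 0"
  proof -
    have "(cmod (\<eta> [\<one>]))\<^sup>2 \<le> \<Phi>"
      unfolding \<Phi>_def using deg_pos finite_V[of d] by (intro member_le_sum) (simp_all add: V_def)
    then show ?thesis by (simp add: char_one)
  qed
  ultimately have "(\<Sum>c\<in>K. (cmod (T c))\<^sup>2) = real q ^ d - real q ^ (d - 1)" by simp
  also have "real q ^ d = real q ^ (d - 1) * real q" using deg_pos by (metis power_minus_mult)
  finally show ?thesis by (simp add: algebra_simps)
qed

lemma T_cst_mult:
  assumes "c \<in> K" "c \<noteq> \<zero>" "e \<in> K"
  shows "T (c \<otimes> e) = \<eta> (cst c) * T e"
proof -
  have u: "c \<in> Units R" using assms by (simp add: field_Units)
  have i: "inv c \<in> K" "c \<otimes> inv c = \<one>" "inv c \<otimes> c = \<one>" using u by auto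
  have cc: "cst x \<star> (cst y \<star> a) = cst (x \<otimes> y) \<star> a" if "x \<in> K" "y \<in> K" "a \<in> carrier KX" for x y a
    using that by (simp add: cst_mult P.m_assoc)
  have "T (c \<otimes> e) = (\<Sum>a\<in>{a\<in>V d. topc a = e}. \<eta> (cst c \<star> a))"
    unfolding T_def
  proof (rule sum.reindex_bij_witness[of _ "\<lambda>a. cst c \<star> a" "\<lambda>a. cst (inv c) \<star> a"])
    fix a assume "a \<in> {a \<in> V d. topc a = c \<otimes> e}"
    then show "cst (inv c) \<star> a \<in> {a \<in> V d. topc a = e}"
      using i assms by (auto simp: V_cst_mult top_cst_mult V_KX m_assoc[symmetric])
  qed (use i assms in \<open>auto simp: cc V_KX V_cst_mult top_cst_mult\<close>)
  also have "\<dots> = \<eta> (cst c) * T e"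
    unfolding T_def sum_distrib_left using assms by (intro sum.cong refl) (auto simp: char_mult V_KX)
  finally show ?thesis .
qed

text \<open>By \<open>T_cst_mult\<close> all T c with c nonzero have the same modulus and share the
  total of \<open>parseval\<close>. For c = 0 only the total itself is used, at the cost of a factor
  sqrt q.\<close>

lemma norm_T:
  assumes "c \<in> K"
  shows "c \<noteq> \<zero> \<Longrightarrow> cmod (T c) \<le> sqrt (real q ^ (d - 1))"
    and "cmod (T c) \<le> sqrt (real q ^ d)"
proof -
  have q1: "real q > 1" using q_ge_2 by simp
  have "(cmod (T c))\<^sup>2 \<le> (\<Sum>c\<in>K. (cmod (T c))\<^sup>2)"
    using assms finite_carrier by (intro member_le_sum) auto
  also have "\<dots> \<le> real q ^ (d - 1) * real q"
    unfolding parseval by (intro mult_left_mono) auto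
  also have "\<dots> = real q ^ d" using deg_pos by (metis power_minus_mult)
  finally show "cmod (T c) \<le> sqrt (real q ^ d)" by (rule real_le_rsqrt)
  assume c: "c \<noteq> \<zero>"
  have le: "cmod (T c) \<le> cmod (T e)" if e: "e \<in> K - {\<zero>}" for e
  proof -
    have u: "e \<in> Units R" using e by (simp add: field_Units)
    then have i: "inv e \<in> Units R" "inv e \<in> K" by auto
    have ne: "c \<otimes> inv e \<noteq> \<zero>" using i c assms by (auto simp: integral_iff field_Units)
    have "T c = T (c \<otimes> inv e \<otimes> e)" using u i assms e by (simp add: m_assoc)
    also have "\<dots> = \<eta> (cst (c \<otimes> inv e)) * T e" using ne i assms e by (intro T_cst_mult) auto
    finally have "cmod (T c) = cmod (\<eta> (cst (c \<otimes> inv e))) * cmod (T e)" by (simp add: norm_mult)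
    also have "\<dots> \<le> 1 * cmod (T e)" using i assms by (intro mult_right_mono char_norm_le) auto
    finally show ?thesis by simp
  qed
  have "(real q - 1) * (cmod (T c))\<^sup>2 = (\<Sum>e\<in>K - {\<zero>}. (cmod (T c))\<^sup>2)"
    using finite_carrier q_ge_2 by (simp add: card_Diff_singleton q_def[symmetric])
  also have "\<dots> \<le> (\<Sum>e\<in>K - {\<zero>}. (cmod (T e))\<^sup>2)"
    by (intro sum_mono power_mono le) auto
  also have "\<dots> \<le> (\<Sum>e\<in>K. (cmod (T e))\<^sup>2)"
    using finite_carrier by (intro sum_mono2) auto
  also have "\<dots> = (real q - 1) * real q ^ (d - 1)" by (simp add: parseval)
  finally have "(cmod (T c))\<^sup>2 \<le> real q ^ (d - 1)" using q1 by simp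
  then show "cmod (T c) \<le> sqrt (real q ^ (d - 1))" by (rule real_le_rsqrt)
qed

text \<open>Division by f: the remainder runs through all of \<open>V d\<close> independently of the
  quotient, and \<eta> sums to zero there.\<close>

lemma sum_char_high_degree:
  assumes "d \<le> n"
  shows "(\<Sum>a\<in>M n. \<eta> a) = 0"
proof -
  have "bij_betw (\<lambda>(b, x). f \<star> b \<boxplus> x) (M (n - d) \<times> V d) (M n)"
  proof (rule bij_betw_byWitness[where f' = "\<lambda>a. (a pdiv f, a pmod f)"])
    show "\<forall>y\<in>M (n - d) \<times> V d. ((case y of (b, x) \<Rightarrow> f \<star> b \<boxplus> x) pdiv f, (case y of (b, x) \<Rightarrow> f \<star> b \<boxplus> x) pmod f) = y"
      using pmod_unique[OF modulus] by (auto simp: M_KX)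
    show "\<forall>a\<in>M n. (case (a pdiv f, a pmod f) of (b, x) \<Rightarrow> f \<star> b \<boxplus> x) = a"
      using f_KX by (auto simp: M_KX pdiv_pmod_eq)
    have low: "length x < length (f \<star> b)" if "b \<in> carrier KX" "b \<noteq> []" "x \<in> V d" for b x
      using that f_KX by (cases b) (auto simp: length_mult V_def)
    show "(\<lambda>(b, x). f \<star> b \<boxplus> x) ` (M (n - d) \<times> V d) \<subseteq> M n"
    proof clarify
      fix b x assume b: "b \<in> M (n - d)" and x: "x \<in> V d"
      then have "f \<star> b \<in> M n" using M_mult[OF modulus b] assms by simp
      moreover have "b \<noteq> []" using b by (auto simp: M_iff)
      ultimately show "f \<star> b \<boxplus> x \<in> M n"
        using low[of b x] b x f_KX lc_add_lower[of "f \<star> b" x] by (simp add: M_iff V_KX)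
    qed
    show "(\<lambda>a. (a pdiv f, a pmod f)) ` M n \<subseteq> M (n - d) \<times> V d"
    proof clarify
      fix a assume a: "a \<in> M n"
      let ?b = "a pdiv f" and ?x = "a pmod f"
      have K': "a \<in> carrier KX" "?b \<in> carrier KX" "?x \<in> V d" "?x \<in> carrier KX" "lc a = \<one>" "length a = Suc n"
        using a f_KX pmod_V[OF _ modulus] by (auto simp: M_iff)
      have e: "f \<star> ?b \<boxplus> ?x = a" using K' f_KX by (simp add: pdiv_pmod_eq)
      have "?b \<noteq> []"
      proof
        assume "?b = []"
        then have "a = ?x" using e K' f_KX by simp
        then show False using K' assms by (simp add: V_def)
      qed
      then have "length a = length (f \<star> ?b)" "lc a = lc (f \<star> ?b)"
        using lc_add_lower[of "f \<star> ?b" ?x] low[of ?b ?x] K' f_KX e by auto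
      moreover have "lc f = \<one>" using modulus by (simp add: M_iff)
      ultimately have "length ?b = Suc (n - d)" "lc ?b = \<one>"
        using K' f_KX \<open>?b \<noteq> []\<close> assms by (auto simp: length_mult lc_mult)
      then show "?b \<in> M (n - d) \<and> ?x \<in> V d"
        using K' by (simp add: M_iff)
    qed
  qed
  from sum.reindex_bij_betw[OF this, of \<eta>]
  have "(\<Sum>a\<in>M n. \<eta> a) = (\<Sum>(b, x)\<in>M (n - d) \<times> V d. \<eta> (f \<star> b \<boxplus> x))"
    by (simp add: case_prod_unfold)
  also have "\<dots> = (\<Sum>(b, x)\<in>M (n - d) \<times> V d. \<eta> x)"
  proof (intro sum.cong refl, clarify)
    fix b x assume b: "b \<in> M (n - d)" and x: "x \<in> V d"
    then show "\<eta> (f \<star> b \<boxplus> x) = \<eta> x"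
      using f_KX pmod_unique[OF modulus] pmod_V_id[OF modulus]
      by (intro char_cong) (auto simp: M_KX V_KX)
  qed
  also have "\<dots> = (\<Sum>b\<in>M (n - d). \<Sum>x\<in>V d. \<eta> x)"
    by (rule sum.cartesian_product[symmetric])
  finally show ?thesis by (simp add: sum_char_V)
qed

text \<open>Monic polynomials \<open>a\<close> of degree \<open>n\<close> are detected by \<open>topc (a b) = coeff b (d - n - 1)\<close> for all
  \<open>b\<close> of degree less than \<open>d - n\<close>, that is, by orthogonality of \<open>a - X\<^sup>n\<close> to all these \<open>b\<close>.\<close>

lemma sum_char_dual:
  assumes n: "n < d"
  shows "of_real ((real q - 1) * real q ^ (d - n - 1)) * (\<Sum>a\<in>M n. \<eta> a) =
     (\<Sum>b\<in>V (d - n). cnj (\<eta> b) * T (coeff b (d - n - 1)))"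
proof -
  have x: "xpow n \<in> V d" "xpow n \<in> carrier KX"
    using xpow_M[of n] n by (auto simp: M_iff V_def)
  have topx: "topc (xpow n \<star> b) = coeff b (d - n - 1)" if b: "b \<in> V (d - n)" for b
  proof (cases "b = []")
    case False
    have bK: "b \<in> carrier KX" "length b \<le> d - n" "length b > 0" using b False by (auto simp: V_def)
    have "xpow n \<noteq> []" "length (xpow n) = Suc n" using xpow_M[of n] by (auto simp: M_iff)
    then have len: "length (xpow n \<star> b) = n + length b" "xpow n \<star> b \<noteq> []"
      using bK False x by (auto simp: length_mult mult_eq_Nil_iff)
    then have V: "xpow n \<star> b \<in> V d" using bK x n by (simp add: V_def)
    show ?thesis
    proof (cases "length b = d - n")
      case True
      then have "topc (xpow n \<star> b) = lc (xpow n \<star> b)" using lc_coeff[of "xpow n \<star> b"] V len n by (simp add: top_V)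
      also have "\<dots> = lc b" using bK xpow_M[of n] by (simp add: M_iff lc_mult)
      finally show ?thesis using False True lc_coeff[of b] by simp
    next
      case False
      then show ?thesis using V len bK n by (simp add: top_V coeff_length)
    qed
  qed (use x in \<open>simp add: top_V\<close>)
  have iff: "topc (a \<star> b) = coeff b (d - n - 1) \<longleftrightarrow> topc ((a \<boxminus> xpow n) \<star> b) = \<zero>"
    if a: "a \<in> V d" and b: "b \<in> V (d - n)" for a b
  proof -
    have "(a \<boxminus> xpow n) \<star> b = a \<star> b \<boxminus> xpow n \<star> b"
      using a b x by (simp add: V_KX a_minus_def P.l_distr P.l_minus)
    then show ?thesis using a b x r_right_minus_eq[of "topc (a \<star> b)" "coeff b (d - n - 1)"]
      by (simp add: V_KX top_sub topx)
  qed
  have Mn: "a \<in> M n \<longleftrightarrow> a \<boxminus> xpow n \<in> V n" if "a \<in> V d" for a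
    using that M_eq_xpow_add[of a n] by (auto simp: V_KX)
  have qq: "real q ^ (d - n) - real q ^ (d - n - 1) = (real q - 1) * real q ^ (d - n - 1)"
    using n by (metis Suc_diff_1 left_diff_distrib mult_1 power_Suc zero_less_diff)
  have "(\<Sum>b\<in>V (d - n). cnj (\<eta> b) * T (coeff b (d - n - 1))) =
      (\<Sum>b\<in>V (d - n). gauss_sum (coeff b (d - n - 1)) b)"
    by (simp add: gauss_sum_eq V_KX)
  also have "\<dots> = (\<Sum>b\<in>V (d - n). \<Sum>a\<in>V d. if topc (a \<star> b) = coeff b (d - n - 1) then \<eta> a else 0)"
    unfolding gauss_sum_def by (simp add: sum.inter_filter finite_V)
  also have "\<dots> = (\<Sum>a\<in>V d. \<Sum>b\<in>V (d - n). if topc ((a \<boxminus> xpow n) \<star> b) = \<zero> then \<eta> a else 0)"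
    by (subst sum.swap) (intro sum.cong refl if_cong iff)
  also have "\<dots> = (\<Sum>a\<in>V d. of_real (real (card {b\<in>V (d - n). topc ((a \<boxminus> xpow n) \<star> b) = \<zero>})) * \<eta> a)"
    by (simp add: sum.inter_filter[symmetric] finite_V)
  also have "\<dots> = (\<Sum>a\<in>V d. of_real (real q ^ (d - n - 1)) * \<eta> a +
      (if a \<in> M n then of_real ((real q - 1) * real q ^ (d - n - 1)) * \<eta> a else 0))"
  proof (intro sum.cong refl)
    fix a assume a: "a \<in> V d"
    then have "real (card {b\<in>V (d - n). topc ((a \<boxminus> xpow n) \<star> b) = \<zero>}) =
       real q ^ (d - n - 1) + (if a \<in> M n then (real q - 1) * real q ^ (d - n - 1) else 0)"
      using card_orthogonal_eq[of "a \<boxminus> xpow n" n] n x by (simp add: V_sub Mn qq[simplified])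
    then show "of_real (real (card {b\<in>V (d - n). topc ((a \<boxminus> xpow n) \<star> b) = \<zero>})) * \<eta> a =
      of_real (real q ^ (d - n - 1)) * \<eta> a +
      (if a \<in> M n then of_real ((real q - 1) * real q ^ (d - n - 1)) * \<eta> a else 0)"
      by (simp add: distrib_right del: of_real_power of_real_mult of_real_of_nat_eq)
  qed
  also have "\<dots> = of_real (real q ^ (d - n - 1)) * (\<Sum>a\<in>V d. \<eta> a) +
      (\<Sum>a\<in>{a\<in>V d. a \<in> M n}. of_real ((real q - 1) * real q ^ (d - n - 1)) * \<eta> a)"
    by (simp add: sum.distrib sum.inter_filter finite_V sum_distrib_left cong: if_cong)
  also have "{a\<in>V d. a \<in> M n} = M n" using n by (auto simp: V_def M_iff)
  finally show ?thesis by (simp add: sum_char_V sum_distrib_left)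
qed

text \<open>For n < d the dual sum consists of values T c with c the top coefficient of b. Only a
  fraction 1/q of the b has c = 0, where the bound for T is worse by sqrt q, so the order of
  magnitude is unaffected. The constant 3 comes from sqrt q \<le> 2 (q - 1).\<close>

theorem sum_char_le: "cmod (\<Sum>a\<in>M n. \<eta> a) \<le> 3 * sqrt (real q ^ (d - 1))"
proof (cases "n < d")
  case False
  then show ?thesis using sum_char_high_degree[of n] by simp
next
  case n: True
  define w where "w = real q ^ (d - n - 1)"
  define z where "z = sqrt (real q ^ (d - 1))"
  have q2: "real q \<ge> 2" using q_ge_2 by simp
  have w: "w > 0" and z: "z \<ge> 0" using q2 by (auto simp: w_def z_def)
  have sq: "sqrt (real q ^ d) = z * sqrt (real q)"
    using deg_pos by (metis power_minus_mult real_sqrt_mult z_def)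
  let ?c = "\<lambda>b. coeff b (d - n - 1)"
  have Z: "{b\<in>V (d - n). ?c b = \<zero>} = V (d - n - 1)"
  proof (intro equalityI subsetI)
    fix b assume b: "b \<in> {b\<in>V (d - n). ?c b = \<zero>}"
    have "coeff b i = \<zero>" if "i \<ge> d - n - 1" for i
      using b that by (cases "i = d - n - 1") (auto simp: V_iff)
    then show "b \<in> V (d - n - 1)" using b by (simp add: V_iff)
  qed (use V_mono[of "d - n - 1" "d - n"] in \<open>auto simp: V_iff\<close>)
  have cV: "real (card (V (d - n))) = real q * w"
    using n by (simp add: card_V w_def Suc_diff_Suc flip: power_Suc)
  have cV': "real (card (V (d - n - 1))) = w" by (simp add: card_V w_def)
  have "(real q - 1) * w * cmod (\<Sum>a\<in>M n. \<eta> a) =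
      cmod (of_real ((real q - 1) * real q ^ (d - n - 1)) * (\<Sum>a\<in>M n. \<eta> a))"
    using q2 w by (simp add: norm_mult w_def del: of_real_mult of_real_power)
  also have "\<dots> = cmod (\<Sum>b\<in>V (d - n). cnj (\<eta> b) * T (?c b))"
    by (simp only: sum_char_dual[OF n])
  also have "\<dots> \<le> (\<Sum>b\<in>V (d - n). z + (if ?c b = \<zero> then z * sqrt (real q) - z else 0))"
  proof (rule sum_norm_le)
    fix b assume b: "b \<in> V (d - n)"
    then have bK: "b \<in> carrier KX" by (rule V_KX)
    have "cmod (cnj (\<eta> b) * T (?c b)) \<le> 1 * cmod (T (?c b))"
      unfolding norm_mult using char_norm_le[OF bK] by (intro mult_right_mono) auto
    also have "\<dots> \<le> z + (if ?c b = \<zero> then z * sqrt (real q) - z else 0)"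
      using norm_T[of "?c b"] bK z sq by (auto simp: z_def)
    finally show "cmod (cnj (\<eta> b) * T (?c b)) \<le> z + (if ?c b = \<zero> then z * sqrt (real q) - z else 0)" .
  qed
  also have "\<dots> = real q * w * z + w * (z * sqrt (real q) - z)"
    using cV cV' by (simp add: sum.distrib sum.inter_filter[symmetric] finite_V Z[simplified])
  also have "\<dots> = w * z * (real q - 1 + sqrt (real q))" by (simp add: algebra_simps)
  also have "\<dots> \<le> w * z * (3 * (real q - 1))"
  proof (intro mult_left_mono)
    have "real q \<le> 4 * (real q - 1) * 1" using q2 by simp
    also have "\<dots> \<le> 4 * (real q - 1) * (real q - 1)" using q2 by (intro mult_left_mono) auto
    also have "\<dots> = (2 * (real q - 1))\<^sup>2" by (simp add: power2_eq_square algebra_simps)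
    finally have "real q \<le> (2 * (real q - 1))\<^sup>2" .
    then have "sqrt (real q) \<le> 2 * (real q - 1)" using q2 by (intro real_le_lsqrt) auto
    then show "real q - 1 + sqrt (real q) \<le> 3 * (real q - 1)" by simp
  qed (use w z in simp)
  finally have "(real q - 1) * w * cmod (\<Sum>a\<in>M n. \<eta> a) \<le> (real q - 1) * w * (3 * z)"
    by (simp add: mult_ac)
  then show ?thesis using w q2 by (simp add: z_def)
qed

end

end

subsection \<open>Prime polynomials\<close>

context finite_field_poly
begin

abbreviation Pr where "Pr \<equiv> prime_polys R"

abbreviation deg :: "'a list \<Rightarrow> nat" where "deg \<equiv> Polynomials.degree"

lemma unit_iff: "a \<in> Units KX \<longleftrightarrow> a \<in> carrier KX \<and> length a = 1"
  using univ_poly_units'[OF carrier_is_subfield, of a] by (cases a) auto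

lemma primeE:
  assumes "p \<in> Pr"
  shows "p \<in> M (deg p)" "p \<in> carrier KX" "p \<noteq> []" "deg p > 0" "lc p = \<one>" "length p = Suc (deg p)"
    and "pirreducible K p"
proof -
  obtain n where n: "p \<in> M n" and irr: "pirreducible K p" using assms by (auto simp: prime_polys_def)
  then have pK: "p \<in> carrier KX" "length p = Suc n" "lc p = \<one>" by (auto simp: M_iff)
  then show "p \<in> M (deg p)" "p \<in> carrier KX" "p \<noteq> []" "lc p = \<one>" "length p = Suc (deg p)" "pirreducible K p"
    using n irr by auto
  show "deg p > 0" using pirreducible_degree[OF carrier_is_subfield pK(1) irr] by simp
qed

lemma prime_dvd_mult:
  assumes "p \<in> Pr" "a \<in> carrier KX" "b \<in> carrier KX" "p pdivides (a \<star> b)"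
  shows "p pdivides a \<or> p pdivides b"
  using pprimeE(3)[OF carrier_is_subfield, of p a b] pprime_iff_pirreducible[OF carrier_is_subfield, of p]
    primeE[OF assms(1)] assms by simp

lemma prime_not_dvd_one: "p \<in> Pr \<Longrightarrow> \<not> p pdivides [\<one>]"
proof
  assume p: "p \<in> Pr" and d: "p pdivides [\<one>]"
  have "[\<one>] \<in> V (deg p)" using primeE(4)[OF p] by (simp add: V_def)
  from pdivides_V_imp_Nil[OF primeE(1)[OF p] this d] show False by simp
qed

lemma prime_dvd_prime:
  assumes p: "p \<in> Pr" and p': "p' \<in> Pr" and d: "p pdivides p'"
  shows "p = p'"
proof -
  obtain b where b: "b \<in> carrier KX" "p' = p \<star> b" using d by (auto simp: pdivides_iff_mult)
  have "b \<noteq> []" using b primeE[OF p] primeE[OF p'] by auto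
  moreover have "p \<notin> Units KX" using primeE[OF p] by (simp add: unit_iff)
  then have "b \<in> Units KX"
    using pirreducibleE(3)[OF carrier_is_subring _ _ _ b(1) b(2)] primeE[OF p] primeE[OF p'] by auto
  then have "length b = 1" by (simp add: unit_iff)
  moreover have "lc b = \<one>" using lc_mult[of p b] b primeE[OF p] primeE[OF p'] by simp
  ultimately have "b = [\<one>]" by (cases b) (auto simp: lcoeff_def)
  then show ?thesis using b primeE[OF p] by simp
qed

lemma regular_mod_prime:
  assumes "p \<in> Pr"
  shows "regular_mod p u \<longleftrightarrow> u \<in> carrier KX \<and> \<not> p pdivides u"
proof
  assume reg: "regular_mod p u"
  then have u: "u \<in> carrier KX" by (simp add: regular_mod_def)
  have "[\<one>] \<in> V (length p - 1)" using primeE[OF assms] by (simp add: V_def)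
  then have "\<not> p pdivides (u \<star> [\<one>])" using reg by (force simp: regular_mod_def)
  then show "u \<in> carrier KX \<and> \<not> p pdivides u" using u by simp
next
  assume u: "u \<in> carrier KX \<and> \<not> p pdivides u"
  have "x = []" if "x \<in> V (deg p)" "p pdivides (u \<star> x)" for x
  proof -
    have "p pdivides x" using prime_dvd_mult[OF assms _ V_KX[OF that(1)] that(2)] u by blast
    then show ?thesis using pdivides_V_imp_Nil[OF primeE(1)[OF assms] that(1)] by blast
  qed
  then show "regular_mod p u" using u primeE(6)[OF assms] by (simp add: regular_mod_def)
qed

lemma finprod_pmod_cong:
  assumes f: "f \<in> carrier KX" and "finite A" "\<And>x. x \<in> A \<Longrightarrow> g x \<in> carrier KX" "\<And>x. x \<in> A \<Longrightarrow> h x \<in> carrier KX"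
    and "\<And>x. x \<in> A \<Longrightarrow> g x pmod f = h x pmod f"
  shows "finprod KX g A pmod f = finprod KX h A pmod f"
  using assms(2-)
proof (induction A rule: finite_induct)
  case (insert x A)
  let ?G = "finprod KX g A" and ?H = "finprod KX h A"
  have c: "g x \<in> carrier KX" "h x \<in> carrier KX" "?G \<in> carrier KX" "?H \<in> carrier KX"
    using insert.prems by (auto intro!: P.finprod_closed)
  have "(g x \<star> ?G) pmod f = (h x \<star> ?G) pmod f"
    using insert.prems c f by (intro pmod_mult_cong) auto
  also have "\<dots> = (h x \<star> ?H) pmod f"
    using pmod_mult_cong[of f ?G ?H "h x"] insert c f by (simp add: P.m_comm)
  finally show ?case using insert c by (simp add: P.finprod_insert Pi_def)
qed simp

lemma finprod_cst:
  assumes "finite A" "\<And>x. x \<in> A \<Longrightarrow> c x \<in> K"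
  shows "finprod KX (\<lambda>x. cst (c x)) A = cst (finprod R c A)"
  using assms by (induction A rule: finite_induct) (auto simp: P.finprod_insert finprod_insert cst_mult Pi_def)

lemma prime_not_dvd_finprod:
  assumes p: "p \<in> Pr" and "finite A" "\<And>x. x \<in> A \<Longrightarrow> g x \<in> carrier KX" "\<And>x. x \<in> A \<Longrightarrow> \<not> p pdivides (g x)"
  shows "\<not> p pdivides (finprod KX g A)"
  using assms(2-)
proof (induction A rule: finite_induct)
  case (insert x A)
  then have "finprod KX g A \<in> carrier KX" by (auto intro!: P.finprod_closed)
  then show ?case using insert prime_dvd_mult[OF p, of "g x" "finprod KX g A"] by (auto simp: P.finprod_insert Pi_def)
qed (use prime_not_dvd_one[OF p] in simp)

lemma pow_pmod_cong:
  assumes "f \<in> carrier KX" "a \<in> carrier KX" "b \<in> carrier KX" "a pmod f = b pmod f"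
  shows "(a [^]\<^bsub>KX\<^esub> (n::nat)) pmod f = (b [^]\<^bsub>KX\<^esub> n) pmod f"
proof (induction n)
  case (Suc n)
  have "(a [^]\<^bsub>KX\<^esub> n \<star> a) pmod f = (b [^]\<^bsub>KX\<^esub> n \<star> a) pmod f"
    using assms Suc by (intro pmod_mult_cong) auto
  also have "\<dots> = (b [^]\<^bsub>KX\<^esub> n \<star> b) pmod f"
    using pmod_mult_cong[of f a b "b [^]\<^bsub>KX\<^esub> n"] assms by (simp add: P.m_comm)
  finally show ?case by simp
qed simp

lemma cst_pow: "c \<in> K \<Longrightarrow> cst c [^]\<^bsub>KX\<^esub> (n::nat) = cst (c [^] n)"
  by (induction n) (simp_all add: cst_mult)

lemma geometric_sum_nat: "0 < a \<Longrightarrow> (a - 1) * (\<Sum>k<n. a ^ k) + 1 = (a::nat) ^ n"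
proof (induction n)
  case (Suc n)
  have "(a - 1) * (\<Sum>k<Suc n. a ^ k) + 1 = ((a - 1) * (\<Sum>k<n. a ^ k) + 1) + (a - 1) * a ^ n"
    by (simp add: distrib_left)
  also have "\<dots> = (1 + (a - 1)) * a ^ n" using Suc by (simp only: distrib_right mult_1)
  finally show ?case using Suc.prems by simp
qed simp

text \<open>The residue field is the rupture field of p; its multiplicative group is cyclic, and u
  is a preimage of a generator.\<close>

lemma exists_primitive_element:
  assumes p: "p \<in> Pr"
  obtains u where "u \<in> carrier KX" "\<not> p pdivides u"
    "\<And>m. 0 < m \<Longrightarrow> m < q ^ deg p - 1 \<Longrightarrow> (u [^]\<^bsub>KX\<^esub> m) pmod p \<noteq> [\<one>]"
proof -
  note pp = primeE[OF p]
  let ?F = "Rupt K p" and ?h = "rupture_surj K p"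
  interpret F: field ?F
    using rupture_is_field_iff_pirreducible[OF carrier_is_subfield pp(2)] pp(7) by simp
  interpret h: ring_hom_ring KX ?F ?h
    by (rule rupture_surj_hom(2)[OF carrier_is_subring pp(2)])
  have V: "(\<lambda>a. a pmod p) ` carrier KX = V (deg p)"
  proof
    show "(\<lambda>a. a pmod p) ` carrier KX \<subseteq> V (deg p)" using pmod_V[OF _ pp(1)] by blast
    show "V (deg p) \<subseteq> (\<lambda>a. a pmod p) ` carrier KX"
      using pmod_V_id[OF pp(1), symmetric] V_KX by blast
  qed
  have surj: "?h ` V (deg p) = carrier ?F"
    using rupture_carrier_as_pmod_image[OF carrier_is_subfield pp(2)] V by simp
  have inj: "inj_on ?h (V (deg p))"
    using rupture_surj_inj_on[OF carrier_is_subfield pp(2)] V by simp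
  have card: "card (carrier ?F) = q ^ deg p"
    using card_image[OF inj] surj by (simp add: card_V)
  have fin: "finite (carrier ?F)" unfolding surj[symmetric] by (intro finite_imageI finite_V)
  obtain g where g: "g \<in> carrier (Multiplicative_Group.mult_of ?F)"
    and gen: "carrier (Multiplicative_Group.mult_of ?F) = {g [^]\<^bsub>?F\<^esub> i | i::nat. i \<in> UNIV}"
    using F.finite_field_mult_group_has_gen[OF fin] by blast
  obtain u where u: "u \<in> V (deg p)" "g = ?h u" using g surj by auto
  have uK: "u \<in> carrier KX" using u V_KX by auto
  have hz: "?h a = ?h (a pmod p)" if "a \<in> carrier KX" for a
    using rupture_surj_composed_with_pmod[OF carrier_is_subfield pp(2) that] .
  show ?thesis
  proof (rule that[of u])
    show "u \<in> carrier KX" by (rule uK)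
    show "\<not> p pdivides u"
    proof
      assume "p pdivides u"
      then have "u = []" using pdivides_V_imp_Nil[OF pp(1) u(1)] by simp
      then show False using g u h.hom_zero by simp
    qed
    fix m :: nat assume m: "0 < m" "m < q ^ deg p - 1"
    show "(u [^]\<^bsub>KX\<^esub> m) pmod p \<noteq> [\<one>]"
    proof
      assume "(u [^]\<^bsub>KX\<^esub> m) pmod p = [\<one>]"
      then have "?h (u [^]\<^bsub>KX\<^esub> m) = \<one>\<^bsub>?F\<^esub>"
        using hz[of "u [^]\<^bsub>KX\<^esub> m"] uK h.hom_one by simp
      then have gm: "g [^]\<^bsub>?F\<^esub> m = \<one>\<^bsub>?F\<^esub>" using u uK by (simp add: h.hom_nat_pow)
      have gF: "g \<in> carrier ?F" using g by simp
      have "g [^]\<^bsub>?F\<^esub> i = g [^]\<^bsub>?F\<^esub> (i mod m)" for i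
      proof -
        \<comment> \<open>If g^m = 1, the exponents below m exhaust the powers of g, which are then
          fewer than the q^(deg p) - 1 units.\<close>
        have "g [^]\<^bsub>?F\<^esub> i = g [^]\<^bsub>?F\<^esub> (m * (i div m) + i mod m)" by simp
        also have "\<dots> = (g [^]\<^bsub>?F\<^esub> m) [^]\<^bsub>?F\<^esub> (i div m) \<otimes>\<^bsub>?F\<^esub> g [^]\<^bsub>?F\<^esub> (i mod m)"
          using gF by (simp only: F.nat_pow_mult[symmetric] F.nat_pow_pow)
        finally show ?thesis using gm gF by simp
      qed
      then have "carrier (Multiplicative_Group.mult_of ?F) \<subseteq> (\<lambda>i. g [^]\<^bsub>?F\<^esub> i) ` {..<m}"
        unfolding gen using m by (auto simp: image_iff intro!: bexI[of _ "_ mod m"])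
      then have "card (carrier (Multiplicative_Group.mult_of ?F)) \<le> m"
        by (metis card_image_le card_lessThan card_mono finite_imageI finite_lessThan le_trans)
      moreover have "card (carrier (Multiplicative_Group.mult_of ?F)) = q ^ deg p - 1"
        using fin card by (simp add: card_Diff_singleton)
      ultimately show False using m by simp
    qed
  qed
qed

end

context residue_field
begin

text \<open>Gauss's lemma: multiplying the congruences a x = c(x) \<sigma>(x) over all monic x of
  degree below d and cancelling the product W gives a^|S| = N modulo p, where |S| = (q^d - 1)/(q -
  1). Raising this to the power (q - 1)/r yields the exponent of the residue symbol.\<close>

lemma gauss_symbol_finprod:
  assumes p: "p \<in> Pr" and a: "a \<in> carrier KX" "\<not> p pdivides a"
  obtains z where "z \<in> K" "z \<noteq> \<zero>" "z [^] r = \<one>"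
    "(a [^]\<^bsub>KX\<^esub> ((q ^ deg p - 1) div r)) pmod p = cst z" "\<psi> z = gauss_symbol a p"
proof -
  note pp = primeE[OF p]
  define d where "d = deg p"
  define S where "S = Mlt d"
  define c where "c x = lc ((a \<star> x) pmod p)" for x
  define \<sigma> where "\<sigma> x = monic_part ((a \<star> x) pmod p)" for x
  have reg: "regular_mod p a" using regular_mod_prime[OF p] a by simp
  note perm = regular_mod_permutes[OF pp(1) reg, folded \<sigma>_def c_def d_def S_def]
  have S: "finite S" "x \<in> S \<Longrightarrow> x \<in> carrier KX" for x by (auto simp: S_def finite_Mlt Mlt_KX)
  have \<sigma>: "x \<in> S \<Longrightarrow> \<sigma> x \<in> carrier KX" for x using bij_betwE[OF perm(1)] S by auto
  have c: "x \<in> S \<Longrightarrow> c x \<in> K" "x \<in> S \<Longrightarrow> c x \<noteq> \<zero>" for x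
    using perm(3) S a pp by (auto simp: c_def)
  define N where "N = finprod R c S"
  define W where "W = finprod KX (\<lambda>x. x) S"
  have NK: "N \<in> K" using c by (auto simp: N_def intro!: finprod_closed)
  have W: "W \<in> carrier KX" using S by (auto simp: W_def intro!: P.finprod_closed)
  have pW: "\<not> p pdivides W"
    unfolding W_def
  proof (rule prime_not_dvd_finprod[OF p S(1)])
    fix x assume x: "x \<in> S"
    then have "x \<in> V d" "x \<noteq> []" by (auto simp: S_def Mlt_iff)
    then show "\<not> p pdivides x" using pdivides_V_imp_Nil[OF pp(1)] by (auto simp: d_def)
  qed (use S in auto)
  have prod_c: "\<psi> (finprod R c A) = (\<Prod>x\<in>A. \<psi> (c x)) \<and> finprod R c A \<noteq> \<zero>" if "A \<subseteq> S" for A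
    using finite_subset[OF that S(1)] that
  proof (induction A rule: finite_induct)
    case empty
    then show ?case by (simp add: psi_one)
  next
    case (insert x A)
    then have "finprod R c A \<in> K" using c by (auto intro!: finprod_closed)
    then show ?case using insert c by (auto simp: finprod_insert Pi_def psi_mult integral_iff subset_iff)
  qed
  have N0: "N \<noteq> \<zero>" "\<psi> N = (\<Prod>x\<in>S. \<psi> (c x))" using prod_c[of S] by (auto simp: N_def)
  have "(a [^]\<^bsub>KX\<^esub> card S \<star> W) pmod p = finprod KX (\<lambda>x. a \<star> x) S pmod p"
    using S a by (simp add: W_def P.finprod_multf P.finprod_const Pi_def)
  also have "\<dots> = finprod KX (\<lambda>x. cst (c x) \<star> \<sigma> x) S pmod p"
    using S c \<sigma> a pp perm(2) pmod_V[of _ p d]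
    by (intro finprod_pmod_cong) (auto simp flip: perm(2))
  also have "finprod KX (\<lambda>x. cst (c x) \<star> \<sigma> x) S = cst N \<star> finprod KX \<sigma> S"
    using S c \<sigma> finprod_cst[of S c] by (subst P.finprod_multf) (auto simp: Pi_def N_def)
  also have "finprod KX \<sigma> S = W"
  proof -
    have "W = finprod KX (\<lambda>x. x) (\<sigma> ` S)" using perm(1) by (simp add: W_def bij_betw_def)
    also have "\<dots> = finprod KX \<sigma> S"
      using perm(1) S(2) by (subst P.finprod_reindex) (auto simp: bij_betw_def)
    finally show ?thesis ..
  qed
  finally have "p pdivides (a [^]\<^bsub>KX\<^esub> card S \<star> W \<boxminus> cst N \<star> W)"
    using W NK a pp by (subst (asm) pmod_eq_iff) auto
  also have "a [^]\<^bsub>KX\<^esub> card S \<star> W \<boxminus> cst N \<star> W = (a [^]\<^bsub>KX\<^esub> card S \<boxminus> cst N) \<star> W"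
    using W NK a by (simp add: a_minus_def P.l_distr P.l_minus)
  finally have "p pdivides (a [^]\<^bsub>KX\<^esub> card S \<boxminus> cst N)"
    using prime_dvd_mult[OF p _ W] pW NK a by auto
  then have aN: "(a [^]\<^bsub>KX\<^esub> card S) pmod p = cst N pmod p"
    using NK a pp by (subst pmod_eq_iff) auto
  define e where "e = (q - 1) div r"
  have qe: "q - 1 = e * r" using r_dvd by (simp add: e_def)
  have "(q - 1) * card S = q ^ d - 1"
    using geometric_sum_nat[of q d] q_ge_2 by (simp add: S_def card_Mlt)
  then have ex: "(q ^ d - 1) div r = card S * e"
    using qe r_ge_2 by (metis (no_types, lifting) mult.assoc mult.commute nonzero_mult_div_cancel_left not_numeral_le_zero)
  show ?thesis
  proof (rule that[of "N [^] e"])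
    show "N [^] e \<in> K" "N [^] e \<noteq> \<zero>" using NK N0 pow_nonzero[of N e] by auto
    show "(N [^] e) [^] r = \<one>" using NK N0 unit_pow_card[of N] qe by (simp add: nat_pow_pow)
    have "(a [^]\<^bsub>KX\<^esub> (card S * e)) pmod p = ((a [^]\<^bsub>KX\<^esub> card S) [^]\<^bsub>KX\<^esub> e) pmod p"
      using a by (simp add: P.nat_pow_pow)
    also have "\<dots> = (cst N [^]\<^bsub>KX\<^esub> e) pmod p" using aN a NK pp by (intro pow_pmod_cong) auto
    also have "\<dots> = cst (N [^] e)"
      using NK N0 pp by (simp add: cst_pow) (intro pmod_V_id[OF pp(1)], simp add: V_def cst_nonzero pow_nonzero, use cst_closed[of "N [^] e"] in \<open>simp add: cst_nonzero pow_nonzero\<close>)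
    finally show "(a [^]\<^bsub>KX\<^esub> ((q ^ deg p - 1) div r)) pmod p = cst (N [^] e)"
      using ex by (simp add: d_def)
    have "\<psi> (N [^] e) = (\<Prod>x\<in>S. \<psi> (c x) ^ e)"
      using NK N0 by (simp add: psi_pow prod_power_distrib)
    also have "\<dots> = gauss_symbol a p"
      unfolding gauss_symbol_eq[OF pp(1)] using c
      by (intro prod.cong) (auto simp: S_def d_def c_def[symmetric] lam_def e_def)
    finally show "\<psi> (N [^] e) = gauss_symbol a p" .
  qed
qed

lemma residue_symbol_eq_gauss_symbol:
  assumes p: "p \<in> Pr" and a: "a \<in> carrier KX"
  shows "residue_symbol R \<psi> r a p = gauss_symbol a p"
proof (cases "p pdivides a")
  case True
  then show ?thesis
    using gauss_symbol_not_regular(1)[OF primeE(1)[OF p] a _ a] regular_mod_prime[OF p] by (simp add: residue_symbol_def)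
next
  case False
  note pp = primeE[OF p]
  obtain z where z: "z \<in> K" "z \<noteq> \<zero>" "z [^] r = \<one>"
    "(a [^]\<^bsub>KX\<^esub> ((q ^ deg p - 1) div r)) pmod p = cst z" "\<psi> z = gauss_symbol a p"
    using gauss_symbol_finprod[OF p a False] by blast
  \<comment> \<open>Constants are their own remainders modulo p, so the congruence pins down the
    constant and the definite description is unique.\<close>
  have cV: "cst y \<in> V (deg p)" if "y \<in> K" for y
    using that pp cst_closed[of y] by (cases "y = \<zero>") (auto simp: V_def cst_nonzero)
  have "(THE y. y \<in> K \<and> y [^] r = \<one> \<and> p pdivides ((a [^]\<^bsub>KX\<^esub> ((poly_norm R p - 1) div r)) \<boxminus> cst y)) = z"
  proof (rule the_equality)
    have iff: "p pdivides ((a [^]\<^bsub>KX\<^esub> ((poly_norm R p - 1) div r)) \<boxminus> cst y) \<longleftrightarrow> cst z = cst y" if "y \<in> K" for y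
      using that pmod_eq_iff[of "a [^]\<^bsub>KX\<^esub> ((poly_norm R p - 1) div r)" "cst y" p] a pp z(4) pmod_V_id[OF pp(1) cV[OF that]]
      by (simp add: poly_norm_def q_def)
    show "z \<in> K \<and> z [^] r = \<one> \<and> p pdivides ((a [^]\<^bsub>KX\<^esub> ((poly_norm R p - 1) div r)) \<boxminus> cst z)"
      using z iff by simp
    show "y = z" if "y \<in> K \<and> y [^] r = \<one> \<and> p pdivides ((a [^]\<^bsub>KX\<^esub> ((poly_norm R p - 1) div r)) \<boxminus> cst y)" for y
      using that z iff[of y] by (auto simp: cst_nonzero poly_of_const_def split: if_splits)
  qed
  then show ?thesis using False z by (simp add: residue_symbol_def)
qed

text \<open>For a primitive element u the symbol has exact order r: with e r the order of the group,
  an m-th power equal to 1 would make u^(e (m mod r)) congruent to 1, although this exponent lies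
  strictly between 0 and e r.\<close>

lemma exists_nontrivial_residue:
  assumes p: "p \<in> Pr" and m: "\<not> r dvd m"
  obtains u where "u \<in> carrier KX" "\<not> p pdivides u" "gauss_symbol u p ^ m \<noteq> 1"
proof -
  note pp = primeE[OF p]
  obtain u where u: "u \<in> carrier KX" "\<not> p pdivides u"
    "\<And>m. 0 < m \<Longrightarrow> m < q ^ deg p - 1 \<Longrightarrow> (u [^]\<^bsub>KX\<^esub> m) pmod p \<noteq> [\<one>]"
    using exists_primitive_element[OF p] by blast
  obtain z where z: "z \<in> K" "z \<noteq> \<zero>" "z [^] r = \<one>"
    "(u [^]\<^bsub>KX\<^esub> ((q ^ deg p - 1) div r)) pmod p = cst z" "\<psi> z = gauss_symbol u p"
    using gauss_symbol_finprod[OF p u(1,2)] by blast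
  define e where "e = (q ^ deg p - 1) div r"
  have "q - 1 dvd q ^ deg p - 1"
    using geometric_sum_nat[of q "deg p"] q_ge_2 by (metis diff_add_inverse2 dvd_triv_left not_numeral_le_zero gr0I)
  then have e: "q ^ deg p - 1 = e * r" using r_dvd by (auto simp: e_def)
  have "q ^ 1 \<le> q ^ deg p" using q_ge_2 pp(4) by (intro power_increasing) auto
  then have "e > 0" using e q_ge_2 by (cases "e = 0") auto
  show ?thesis
  proof (rule that[OF u(1,2)])
    have m': "0 < m mod r" "m mod r < r" using m r_ge_2 by (auto simp: dvd_eq_mod_eq_0)
    show "gauss_symbol u p ^ m \<noteq> 1"
    proof
      assume "gauss_symbol u p ^ m = 1"
      moreover have "gauss_symbol u p ^ r = 1" using gauss_symbol_root[OF pp(1)] regular_mod_prime[OF p] u by simp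
      moreover have "gauss_symbol u p ^ m = (gauss_symbol u p ^ r) ^ (m div r) * gauss_symbol u p ^ (m mod r)"
        by (simp flip: power_mult power_add)
      ultimately have "\<psi> (z [^] (m mod r)) = \<psi> \<one>" using z by (simp add: psi_pow psi_one)
      then have z1: "z [^] (m mod r) = \<one>" using psi_inj[of "z [^] (m mod r)" \<one>] z by (simp add: pow_nonzero)
      have "(u [^]\<^bsub>KX\<^esub> (e * (m mod r))) pmod p = ((u [^]\<^bsub>KX\<^esub> e) [^]\<^bsub>KX\<^esub> (m mod r)) pmod p"
        using u by (simp add: P.nat_pow_pow)
      also have "\<dots> = (cst z [^]\<^bsub>KX\<^esub> (m mod r)) pmod p"
      proof (intro pow_pmod_cong)
        show "(u [^]\<^bsub>KX\<^esub> e) pmod p = cst z pmod p"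
          using z(4) pmod_pmod[of p "u [^]\<^bsub>KX\<^esub> e"] pp u by (simp add: e_def)
      qed (use u z pp in auto)
      also have "\<dots> = [\<one>]"
        using z z1 pmod_V_id[OF pp(1), of "[\<one>]"] pp by (simp add: cst_pow V_def)
      finally have "\<not> (0 < e * (m mod r) \<and> e * (m mod r) < q ^ deg p - 1)" using u(3) by blast
      then show False using m' \<open>e > 0\<close> e by simp
    qed
  qed
qed

end

subsection \<open>Unique factorization and the residue system\<close>

context finite_field_poly
begin

definition poly_of_mset :: "'a list multiset \<Rightarrow> 'a list" where
  "poly_of_mset G = finprod KX (\<lambda>p. p [^]\<^bsub>KX\<^esub> count G p) (set_mset G)"

lemma poly_of_mset_superset:
  assumes "finite A" "set_mset G \<subseteq> A" "A \<subseteq> carrier KX"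
  shows "poly_of_mset G = finprod KX (\<lambda>p. p [^]\<^bsub>KX\<^esub> count G p) A"
  unfolding poly_of_mset_def using assms
  by (intro P.finprod_mono_neutral_cong_left) (auto simp: not_in_iff)

lemma poly_of_mset_empty [simp]: "poly_of_mset {#} = [\<one>]"
  by (simp add: poly_of_mset_def)

lemma poly_of_mset_closed [simp]: "set_mset G \<subseteq> carrier KX \<Longrightarrow> poly_of_mset G \<in> carrier KX"
  unfolding poly_of_mset_def by (rule P.finprod_closed) auto

lemma poly_of_mset_add_mset:
  assumes p: "p \<in> carrier KX" and G: "set_mset G \<subseteq> carrier KX"
  shows "poly_of_mset (add_mset p G) = p \<star> poly_of_mset G"
proof -
  define A where "A = set_mset G - {p}"
  have A: "finite A" "p \<notin> A" "A \<subseteq> carrier KX" using G by (auto simp: A_def)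
  have eq: "poly_of_mset H = p [^]\<^bsub>KX\<^esub> count H p \<star> finprod KX (\<lambda>p. p [^]\<^bsub>KX\<^esub> count H p) A"
    if "set_mset H \<subseteq> insert p A" for H
    using poly_of_mset_superset[of "insert p A" H] that A p
      P.finprod_insert[of A p "\<lambda>p. p [^]\<^bsub>KX\<^esub> count H p"] by (auto simp: Pi_def subset_iff)
  have "finprod KX (\<lambda>x. x [^]\<^bsub>KX\<^esub> count (add_mset p G) x) A = finprod KX (\<lambda>x. x [^]\<^bsub>KX\<^esub> count G x) A"
    using A by (intro P.finprod_cong') auto
  moreover have "finprod KX (\<lambda>x. x [^]\<^bsub>KX\<^esub> count G x) A \<in> carrier KX"
    using A by (intro P.finprod_closed) auto
  moreover have "set_mset G \<subseteq> insert p A" "set_mset (add_mset p G) \<subseteq> insert p A" by (auto simp: A_def)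
  ultimately show ?thesis
    using eq[of G] eq[of "add_mset p G"] p by (simp add: P.m_assoc P.m_comm[of p] P.m_lcomm)
qed

lemma Pr_KX: "Pr \<subseteq> carrier KX" using primeE(2) by auto

lemma poly_of_mset_M:
  "set_mset G \<subseteq> Pr \<Longrightarrow> poly_of_mset G \<in> M (mset_deg deg G)"
proof (induction G)
  case empty
  then show ?case by (simp add: M_iff mset_deg_def lcoeff_def)
next
  case (add p G)
  then have "poly_of_mset (add_mset p G) = p \<star> poly_of_mset G"
    using Pr_KX by (intro poly_of_mset_add_mset) auto
  then show ?case using add M_mult[of p "deg p" "poly_of_mset G"] primeE(1)[of p] by simp
qed

lemma poly_of_mset_union:
  "set_mset G \<subseteq> carrier KX \<Longrightarrow> set_mset H \<subseteq> carrier KX \<Longrightarrow> poly_of_mset (G + H) = poly_of_mset G \<star> poly_of_mset H"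
  by (induction G) (auto simp: poly_of_mset_add_mset P.m_assoc)

lemma poly_of_mset_replicate: "p \<in> carrier KX \<Longrightarrow> poly_of_mset (replicate_mset n p) = p [^]\<^bsub>KX\<^esub> n"
  by (induction n) (auto simp: poly_of_mset_add_mset P.m_comm)

lemma prime_dvd_poly_of_mset:
  assumes "p \<in> Pr" "set_mset G \<subseteq> Pr"
  shows "p pdivides poly_of_mset G \<longleftrightarrow> p \<in># G"
  using assms(2)
proof (induction G)
  case empty
  then show ?case using prime_not_dvd_one[OF assms(1)] by simp
next
  case (add p' G)
  have K': "p' \<in> carrier KX" "set_mset G \<subseteq> carrier KX" "p \<in> carrier KX"
    using add.prems Pr_KX assms by auto
  have "p pdivides p" unfolding pdivides_iff_mult using K'(3) by (intro bexI[of _ "[\<one>]"]) auto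
  then have "p pdivides p' \<longleftrightarrow> p = p'"
    using prime_dvd_prime[of p p'] add.prems assms by auto
  moreover have "p pdivides (p' \<star> poly_of_mset G) \<longleftrightarrow> p pdivides p' \<or> p pdivides poly_of_mset G"
    using prime_dvd_mult[OF assms(1), of p' "poly_of_mset G"] K'
      pdivides_mult_right[of p p' "poly_of_mset G"] pdivides_mult_left[of p "poly_of_mset G" p'] by auto
  ultimately show ?case using add K' by (auto simp: poly_of_mset_add_mset)
qed

text \<open>After splitting off p to its multiplicity in G the cofactor is prime to p; if a higher
  power divided the product, cancellation would make p divide the cofactor.\<close>

lemma prime_power_dvd_poly_of_mset:
  assumes p: "p \<in> Pr" and G: "set_mset G \<subseteq> Pr"
  shows "(p [^]\<^bsub>KX\<^esub> k) pdivides poly_of_mset G \<longleftrightarrow> k \<le> count G p"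
proof -
  define H where "H = filter_mset (\<lambda>x. x \<noteq> p) G"
  have split: "G = replicate_mset (count G p) p + H"
    by (rule multiset_eqI) (auto simp: H_def)
  have K': "p \<in> carrier KX" "p \<noteq> []" "set_mset H \<subseteq> carrier KX" "set_mset H \<subseteq> Pr" "p \<notin># H"
    using primeE[OF p] G Pr_KX by (auto simp: H_def)
  then have pH: "\<not> p pdivides poly_of_mset H" using prime_dvd_poly_of_mset[OF p, of H] by simp
  have eq: "poly_of_mset G = p [^]\<^bsub>KX\<^esub> count G p \<star> poly_of_mset H"
    using K' by (subst split) (simp add: poly_of_mset_union poly_of_mset_replicate)
  show ?thesis
  proof
    assume "k \<le> count G p"
    then have "p [^]\<^bsub>KX\<^esub> count G p = p [^]\<^bsub>KX\<^esub> k \<star> p [^]\<^bsub>KX\<^esub> (count G p - k)"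
      using K' by (simp add: P.nat_pow_mult)
    then have "poly_of_mset G = p [^]\<^bsub>KX\<^esub> k \<star> (p [^]\<^bsub>KX\<^esub> (count G p - k) \<star> poly_of_mset H)"
      using K' by (simp add: eq P.m_assoc)
    then show "(p [^]\<^bsub>KX\<^esub> k) pdivides poly_of_mset G"
      using K' unfolding pdivides_iff_mult by auto
  next
    assume d: "(p [^]\<^bsub>KX\<^esub> k) pdivides poly_of_mset G"
    show "k \<le> count G p"
    proof (rule ccontr)
      assume "\<not> k \<le> count G p"
      define l where "l = k - Suc (count G p)"
      have k: "k = count G p + Suc l" using \<open>\<not> k \<le> count G p\<close> by (simp add: l_def)
      obtain b where b: "b \<in> carrier KX" "poly_of_mset G = p [^]\<^bsub>KX\<^esub> k \<star> b"
        using d by (auto simp: pdivides_iff_mult)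
      have "p [^]\<^bsub>KX\<^esub> k = p [^]\<^bsub>KX\<^esub> count G p \<star> (p \<star> p [^]\<^bsub>KX\<^esub> l)"
        using K' by (simp add: k P.nat_pow_mult[symmetric] P.m_comm[of p] P.m_assoc)
      then have "p [^]\<^bsub>KX\<^esub> count G p \<star> poly_of_mset H = p [^]\<^bsub>KX\<^esub> count G p \<star> (p \<star> (p [^]\<^bsub>KX\<^esub> l \<star> b))"
        using b K' by (simp add: eq P.m_assoc)
      moreover have "p [^]\<^bsub>KX\<^esub> count G p \<noteq> \<zero>\<^bsub>KX\<^esub>"
      proof -
        have "p [^]\<^bsub>KX\<^esub> (i::nat) \<noteq> []" for i using K'(1,2) by (induction i) (auto simp: mult_eq_Nil_iff)
        then show ?thesis by simp
      qed
      ultimately have "poly_of_mset H = p \<star> (p [^]\<^bsub>KX\<^esub> l \<star> b)"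
        using P.m_lcancel[of "p [^]\<^bsub>KX\<^esub> count G p"] K' b by auto
      then have "p pdivides poly_of_mset H" using K' b by (auto simp: pdivides_iff_mult)
      with pH show False ..
    qed
  qed
qed

text \<open>A monic divisor of least positive degree is irreducible.\<close>

lemma exists_prime_divisor:
  assumes "f \<in> M n" "n > 0"
  obtains p where "p \<in> Pr" "p pdivides f"
proof -
  define Q where "Q j \<longleftrightarrow> j > 0 \<and> (\<exists>g\<in>M j. g pdivides f)" for j
  have fK: "f \<in> carrier KX" using assms M_KX by auto
  have "f pdivides f" using fK by (auto simp: pdivides_iff_mult intro!: bexI[of _ "[\<one>]"])
  then have "Q n" using assms by (auto simp: Q_def)
  define j where "j = (LEAST j. Q j)"
  have "Q j" unfolding j_def by (rule LeastI[of Q n, OF \<open>Q n\<close>])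
  have least: "\<not> Q i" if "i < j" for i using that not_less_Least unfolding j_def by blast
  obtain g where g: "g \<in> M j" "g pdivides f" "j > 0" using \<open>Q j\<close> by (auto simp: Q_def)
  have gK: "g \<in> carrier KX" "length g = Suc j" using g by (auto simp: M_iff)
  have "pirreducible K g"
  proof (rule pirreducibleI[OF carrier_is_subring gK(1)])
    show "g \<noteq> []" using gK by auto
    show "g \<notin> Units KX" using gK g by (simp add: unit_iff)
    fix a b assume ab: "a \<in> carrier KX" "b \<in> carrier KX" "g = a \<star> b"
    show "a \<in> Units KX \<or> b \<in> Units KX"
    proof (rule ccontr)
      assume "\<not> (a \<in> Units KX \<or> b \<in> Units KX)"
      moreover have ne: "a \<noteq> []" "b \<noteq> []" using ab gK by auto
      ultimately have len: "length a > 1" "length b > 1" using ab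
        by (auto simp: unit_iff) (metis One_nat_def length_0_conv nat_neq_iff less_one)+
      have lg: "length a + length b = Suc (Suc j)" using length_mult[of a b] ab ne gK by simp
      have u: "lc a \<in> Units R" using lc_eq_0_iff[of a] ab ne by (simp add: field_Units)
      then have i: "inv (lc a) \<in> K" "lc a \<in> K" "inv (lc a) \<otimes> lc a = \<one>" "lc a \<otimes> inv (lc a) = \<one>" by auto
      \<comment> \<open>A factor of g need not be monic; dividing by its leading coefficient makes
        it a competitor for the least degree.\<close>
      define a' where "a' = cst (inv (lc a)) \<star> a"
      have a': "a' \<in> carrier KX" "lc a' = \<one>" "cst (lc a) \<star> a' = a"
        using ab i by (auto simp: a'_def lc_cst_mult P.m_assoc[symmetric] cst_mult[symmetric])
      have "a' \<in> V (length a)" using ab i by (auto simp: a'_def V_def intro!: V_cst_mult[unfolded V_def, simplified, THEN conjunct2])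
      moreover have "a \<in> V (length a')" using V_cst_mult[of "lc a" a' "length a'"] a' i by (simp add: V_def)
      ultimately have "length a' = length a" by (simp add: V_def)
      then have "a' \<in> M (length a - 1)" using a' len by (simp add: M_iff)
      moreover have "a' pdivides f"
      proof -
        obtain h where h: "h \<in> carrier KX" "f = g \<star> h" using g by (auto simp: pdivides_iff_mult)
        then have "f = a' \<star> (cst (lc a) \<star> (b \<star> h))"
          using ab a' i by (metis P.m_assoc P.m_lcomm P.m_closed cst_closed)
        then show ?thesis using h ab i by (auto simp: pdivides_iff_mult)
      qed
      ultimately have "Q (length a - 1)" using len by (auto simp: Q_def)
      moreover have "length a - 1 < j" using lg len by linarith
      ultimately show False using least by blast
    qed
  qed
  then have "g \<in> Pr" using g by (auto simp: prime_polys_def)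
  then show ?thesis using that g by blast
qed

lemma poly_of_mset_surj: "f \<in> M n \<Longrightarrow> \<exists>G\<in>msets_of_deg deg Pr n. poly_of_mset G = f"
proof (induction n arbitrary: f rule: less_induct)
  case (less n)
  show ?case
  proof (cases "n = 0")
    case True
    then have "f = [\<one>]" using less.prems by (cases f) (auto simp: M_iff lcoeff_def)
    then show ?thesis using True by (intro bexI[of _ "{#}"]) (auto simp: msets_of_deg_def mset_deg_def)
  next
    case False
    then obtain p where p: "p \<in> Pr" "p pdivides f" using exists_prime_divisor[OF less.prems] by auto
    note pp = primeE[OF p(1)]
    obtain b where b: "b \<in> carrier KX" "f = p \<star> b" using p by (auto simp: pdivides_iff_mult)
    have f: "f \<in> carrier KX" "length f = Suc n" "lc f = \<one>" using less.prems by (auto simp: M_iff)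
    have "b \<noteq> []" using b f pp by auto
    then have len: "Suc n = deg p + length b" using length_mult[of p b] b f pp by simp
    moreover have "lc b = \<one>" using lc_mult[of p b] b f pp by simp
    moreover have "length b > 0" using \<open>b \<noteq> []\<close> by simp
    ultimately have "n - deg p < n" "deg p \<le> n" "length b = Suc (n - deg p)" "lc b = \<one>"
      using pp(4) by linarith+
    then have "b \<in> M (n - deg p)" using b by (simp add: M_iff)
    then obtain G where G: "G \<in> msets_of_deg deg Pr (n - deg p)" "poly_of_mset G = b"
      using less.IH[OF \<open>n - deg p < n\<close>] by blast
    then show ?thesis
      using p b pp Pr_KX \<open>deg p \<le> n\<close>
      by (intro bexI[of _ "add_mset p G"]) (auto simp: msets_of_deg_def poly_of_mset_add_mset subset_iff)
  qed
qed

text \<open>Unique factorization: the multiplicity of each prime is recovered from the polynomial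
  through the powers dividing it.\<close>

lemma bij_poly_of_mset: "bij_betw poly_of_mset (msets_of_deg deg Pr n) (M n)"
proof -
  have "inj_on poly_of_mset (msets_of_deg deg Pr n)"
  proof (rule inj_onI, rule multiset_eqI)
    fix G H p assume *: "G \<in> msets_of_deg deg Pr n" "H \<in> msets_of_deg deg Pr n" "poly_of_mset G = poly_of_mset H"
    then have s: "set_mset G \<subseteq> Pr" "set_mset H \<subseteq> Pr" by (auto simp: msets_of_deg_def)
    show "count G p = count H p"
    proof (cases "p \<in> Pr")
      case True
      then have "k \<le> count G p \<longleftrightarrow> k \<le> count H p" for k
        using prime_power_dvd_poly_of_mset[OF True s(1)] prime_power_dvd_poly_of_mset[OF True s(2)] *(3) by simp
      then show ?thesis by (metis order_antisym order_refl)
    next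
      case False
      then have "p \<notin># G" "p \<notin># H" using s by auto
      then show ?thesis by (simp add: not_in_iff)
    qed
  qed
  moreover have "poly_of_mset ` msets_of_deg deg Pr n = M n"
  proof
    show "poly_of_mset ` msets_of_deg deg Pr n \<subseteq> M n"
      using poly_of_mset_M by (auto simp: msets_of_deg_def)
    show "M n \<subseteq> poly_of_mset ` msets_of_deg deg Pr n"
      using poly_of_mset_surj by blast
  qed
  ultimately show ?thesis by (simp add: bij_betw_def)
qed

lemma prime_system_poly: "prime_system q Pr deg"
proof
  show "q \<ge> 2" by (rule q_ge_2)
  show "p \<in> Pr \<Longrightarrow> deg p > 0" for p by (rule primeE(4))
  show "card (msets_of_deg deg Pr n) = q ^ n" for n
    using bij_betw_same_card[OF bij_poly_of_mset, of n] by (simp add: card_M)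
qed

lemma prime_multiplicity_poly_of_mset:
  assumes "p \<in> Pr" "set_mset G \<subseteq> Pr"
  shows "prime_multiplicity R p (poly_of_mset G) = count G p"
  unfolding prime_multiplicity_def prime_power_dvd_poly_of_mset[OF assms]
  by (rule Greatest_equality) auto

lemma bij_power_free:
  assumes "r > 0"
  shows "bij_betw poly_of_mset {G \<in> msets_of_deg deg Pr N. power_free r G} (power_free_polys R r N)"
proof -
  have "poly_of_mset G \<in> power_free_polys R r N \<longleftrightarrow> power_free r G" if "G \<in> msets_of_deg deg Pr N" for G
  proof -
    have s: "set_mset G \<subseteq> Pr" using that by (simp add: msets_of_deg_def)
    have "poly_of_mset G \<in> M N" using bij_betwE[OF bij_poly_of_mset] that by blast
    then have "poly_of_mset G \<in> power_free_polys R r N \<longleftrightarrow> (\<forall>p\<in>Pr. count G p < r)"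
      using prime_power_dvd_poly_of_mset[OF _ s] by (auto simp: power_free_polys_def not_le)
    also have "\<dots> \<longleftrightarrow> power_free r G"
      unfolding power_free_def using s assms by (metis count_eq_zero_iff subsetD)
    finally show ?thesis .
  qed
  moreover have "power_free_polys R r N \<subseteq> poly_of_mset ` msets_of_deg deg Pr N"
    using bij_betw_imp_surj_on[OF bij_poly_of_mset[of N]] by (auto simp: power_free_polys_def)
  ultimately have "poly_of_mset ` {G \<in> msets_of_deg deg Pr N. power_free r G} = power_free_polys R r N"
    by blast
  then show ?thesis
    using inj_on_subset[OF bij_betw_imp_inj_on[OF bij_poly_of_mset[of N]]] by (simp add: bij_betw_def)
qed

end

context finite_field_poly
begin

text \<open>The character attached to G will have the product of the distinct primes as its modulus;
  this reduces congruences modulo it to congruences modulo each prime.\<close>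

lemma squarefree_dvd_iff:
  assumes "finite S" "S \<subseteq> Pr" "a \<in> carrier KX"
  shows "poly_of_mset (mset_set S) pdivides a \<longleftrightarrow> (\<forall>p\<in>S. p pdivides a)"
  using assms(1,2)
proof (induction S rule: finite_induct)
  case empty
  then show ?case using assms(3) by (auto simp: pdivides_iff_mult)
next
  case (insert p S)
  define g where "g = poly_of_mset (mset_set S)"
  have K': "p \<in> carrier KX" "g \<in> carrier KX" using insert Pr_KX by (auto simp: g_def subset_iff)
  have eq: "poly_of_mset (mset_set (insert p S)) = p \<star> g"
    using insert Pr_KX by (simp add: g_def poly_of_mset_add_mset subset_iff)
  have pg: "\<not> p pdivides g" using prime_dvd_poly_of_mset[of p "mset_set S"] insert by (simp add: g_def)
  show ?case
  proof
    assume "poly_of_mset (mset_set (insert p S)) pdivides a"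
    then obtain b where b: "b \<in> carrier KX" "a = p \<star> g \<star> b" by (auto simp: eq pdivides_iff_mult)
    then have "a = p \<star> (g \<star> b)" "a = g \<star> (p \<star> b)" using K' by (simp_all add: P.m_assoc P.m_lcomm)
    then have "p pdivides a" "g pdivides a" unfolding pdivides_iff_mult using K' b(1) by blast+
    then show "\<forall>p\<in>insert p S. p pdivides a" using insert by (auto simp: g_def)
  next
    assume *: "\<forall>p\<in>insert p S. p pdivides a"
    then have "g pdivides a" using insert by (simp add: g_def)
    then obtain b where b: "b \<in> carrier KX" "a = g \<star> b" by (auto simp: pdivides_iff_mult)
    have "p pdivides b" using prime_dvd_mult[of p g b] pg * b K' insert.prems by auto
    then obtain c where c: "c \<in> carrier KX" "b = p \<star> c" by (auto simp: pdivides_iff_mult)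
    have "a = p \<star> g \<star> c" using b c K' by (simp add: P.m_assoc P.m_lcomm)
    then show "poly_of_mset (mset_set (insert p S)) pdivides a" using c by (auto simp: eq pdivides_iff_mult)
  qed
qed

end

context residue_field
begin

lemma gauss_symbol_prime_cases:
  assumes "p \<in> Pr" "a \<in> carrier KX"
  shows "p pdivides a \<Longrightarrow> gauss_symbol a p = 0" and "\<not> p pdivides a \<Longrightarrow> gauss_symbol a p ^ r = 1"
    and "\<not> p pdivides a \<Longrightarrow> cmod (gauss_symbol a p) = 1"
proof -
  show "p pdivides a \<Longrightarrow> gauss_symbol a p = 0"
    using gauss_symbol_not_regular(1)[OF primeE(1)[OF assms(1)] assms(2) _ assms(2)] regular_mod_prime[OF assms(1)] by simp
  show root: "\<not> p pdivides a \<Longrightarrow> gauss_symbol a p ^ r = 1"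
    using gauss_symbol_root[OF primeE(1)[OF assms(1)], of a] regular_mod_prime[OF assms(1)] assms(2) by simp
  show "\<not> p pdivides a \<Longrightarrow> cmod (gauss_symbol a p) = 1"
    using power_eq_1_iff[OF root] r_ge_2 by auto
qed

definition mset_char :: "'a list multiset \<Rightarrow> 'a list \<Rightarrow> complex" where
  "mset_char G a = (\<Prod>p\<in>set_mset G. gauss_symbol a p ^ count G p)"

text \<open>Where the character vanishes at \<open>b\<close>, because a prime \<open>p\<close> of the modulus divides \<open>b\<close>, the
  unit \<open>u\<close> is congruent to \<open>1\<close> modulo the other primes and a nonresidue modulo \<open>p\<close>.\<close>

lemma residue_character_mset_char:
  assumes G: "set_mset G \<subseteq> Pr" "G \<noteq> {#}" "\<And>p. p \<in># G \<Longrightarrow> \<not> r dvd count G p"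
  shows "residue_character (poly_of_mset (mset_set (set_mset G))) (\<Sum>p\<in>set_mset G. deg p) (mset_char G)"
proof -
  define S where "S = set_mset G"
  define f where "f = poly_of_mset (mset_set S)"
  define d where "d = (\<Sum>p\<in>S. deg p)"
  have S: "finite S" "S \<subseteq> Pr" "S \<noteq> {}" using G by (auto simp: S_def)
  have pp: "p \<in> M (deg p)" "p \<in> carrier KX" "deg p > 0" "p \<in> Pr" if "p \<in> S" for p
    using primeE[of p] that S by auto
  have f: "f \<in> M d"
    using poly_of_mset_M[of "mset_set S"] S by (simp add: f_def d_def mset_deg_def sum_unfold_sum_mset)
  then have fK: "f \<in> carrier KX" "length f - 1 = d" by (auto simp: M_iff)
  have d: "d > 0" unfolding d_def using S pp(3) by (intro sum_pos) auto
  note dvd = squarefree_dvd_iff[OF S(1,2), folded f_def]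
  have reg: "regular_mod f b" "cmod (mset_char G b) = 1" if b: "b \<in> carrier KX" "\<forall>p\<in>S. \<not> p pdivides b" for b
  proof -
    have "x = []" if x: "x \<in> V d" "f pdivides (b \<star> x)" for x
    proof -
      have xK: "x \<in> carrier KX" using x V_KX by auto
      have "p pdivides x" if "p \<in> S" for p
        using prime_dvd_mult[OF pp(4)[OF that] b(1) xK] dvd[of "b \<star> x"] x(2) b xK that by auto
      then have "f pdivides x" using dvd[OF xK] by blast
      then show ?thesis using pdivides_V_imp_Nil[OF f x(1)] by blast
    qed
    then show "regular_mod f b" using b fK by (simp add: regular_mod_def)
    have "cmod (mset_char G b) = (\<Prod>p\<in>S. cmod (gauss_symbol b p) ^ count G p)"
      by (simp add: mset_char_def S_def prod_norm[symmetric] norm_power)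
    also have "\<dots> = 1"
      using gauss_symbol_prime_cases(3)[OF pp(4) b(1)] b(2) by (intro prod.neutral) auto
    finally show "cmod (mset_char G b) = 1" .
  qed
  have nreg: "\<exists>u. regular_mod f u \<and> (u \<star> b) pmod f = b pmod f \<and> mset_char G u \<noteq> 1"
    if b: "b \<in> carrier KX" and p: "p \<in> S" "p pdivides b" for b p
  proof -
    define g where "g = poly_of_mset (mset_set (S - {p}))"
    have gK: "g \<in> carrier KX" unfolding g_def using S Pr_KX by (intro poly_of_mset_closed) auto
    have gdvd: "g pdivides a \<longleftrightarrow> (\<forall>p'\<in>S - {p}. p' pdivides a)" if "a \<in> carrier KX" for a
      unfolding g_def using S that by (intro squarefree_dvd_iff) auto
    have "\<not> p pdivides g"
      using prime_dvd_poly_of_mset[of p "mset_set (S - {p})"] S pp(4)[OF p(1)] by (auto simp: g_def)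
    then have "regular_mod p g" using regular_mod_prime[OF pp(4)[OF p(1)]] gK by simp
    from regular_bij[OF pp(1)[OF p(1)] this]
    have "(\<lambda>a. (g \<star> a) pmod p) ` V (deg p) = V (deg p)" by (simp add: bij_betw_def)
    moreover have one: "[\<one>] \<in> V (deg p)" using pp(3)[OF p(1)] by (simp add: V_def)
    ultimately have "[\<one>] \<in> (\<lambda>a. (g \<star> a) pmod p) ` V (deg p)" by simp
    then obtain h where h: "h \<in> V (deg p)" "(g \<star> h) pmod p = [\<one>]" by auto
    have hK: "h \<in> carrier KX" using h V_KX by auto
    obtain u0 where u0: "u0 \<in> carrier KX" "\<not> p pdivides u0" "gauss_symbol u0 p ^ count G p \<noteq> 1"
      using exists_nontrivial_residue[OF pp(4)[OF p(1)], of "count G p"] G(3)[of p] p by (auto simp: S_def)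
    \<comment> \<open>The product g h is 1 modulo p and divisible by the other primes, so u = 1 + w
      is u0 modulo p and 1 modulo the others.\<close>
    define w where "w = (u0 \<boxminus> [\<one>]) \<star> (g \<star> h)"
    define u where "u = [\<one>] \<boxplus> w"
    have wK: "w \<in> carrier KX" using u0 gK hK by (simp add: w_def)
    have uK: "u \<in> carrier KX" using wK by (simp add: u_def)
    have "w pmod p = ((u0 \<boxminus> [\<one>]) \<star> ((g \<star> h) pmod p)) pmod p"
      unfolding w_def using u0 gK hK pp(2)[OF p(1)] primeE(3)[OF pp(4)[OF p(1)]]
      by (intro pmod_mult_pmod_right[symmetric]) auto
    also have "\<dots> = (u0 \<boxminus> [\<one>]) pmod p" using u0 by (simp add: h)
    finally have "u pmod p = ([\<one>] pmod p) \<boxplus> ((u0 \<boxminus> [\<one>]) pmod p)"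
      using wK pp(2)[OF p(1)] by (simp add: u_def pmod_add)
    also have "\<dots> = ([\<one>] \<boxplus> (u0 \<boxminus> [\<one>])) pmod p"
      using u0 pp(2)[OF p(1)] by (simp add: pmod_add)
    also have "[\<one>] \<boxplus> (u0 \<boxminus> [\<one>]) = u0"
      using u0 by (simp add: a_minus_def P.a_lcomm P.r_neg)
    finally have up: "u pmod p = u0 pmod p" .
    have dw: "p' pdivides w" if p': "p' \<in> S - {p}" for p'
    proof -
      have "g pdivides w" unfolding w_def
        using u0 gK hK pdivides_mult_left[of g "g \<star> h" "u0 \<boxminus> [\<one>]"] by (auto simp: pdivides_iff_mult)
      then show ?thesis using gdvd[OF wK] p' by blast
    qed
    have up': "u pmod p' = [\<one>] pmod p'" if p': "p' \<in> S - {p}" for p'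
    proof -
      have "u \<boxminus> [\<one>] = w" using wK by (simp add: u_def a_minus_def P.a_ac P.r_neg P.r_neg2 P.r_neg1)
      then show ?thesis using pmod_eq_iff[of u "[\<one>]" p'] dw[OF p'] uK pp(2) p' by simp
    qed
    have ndvd: "\<not> p' pdivides u" if p': "p' \<in> S" for p'
    proof (cases "p' = p")
      case True
      then show ?thesis using u0 uK up pp(2)[OF p(1)] pmod_eq_Nil_iff[of u p] pmod_eq_Nil_iff[of u0 p] by simp
    next
      case False
      then have "u pmod p' = [\<one>] pmod p'" using up' p' by simp
      then show ?thesis
        using prime_not_dvd_one[OF pp(4)[OF p']] uK pp(2)[OF p'] pmod_eq_Nil_iff[of u p'] pmod_eq_Nil_iff[of "[\<one>]" p'] by simp
    qed
    have r1: "regular_mod f u" using reg(1)[OF uK] ndvd by blast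
    have r2: "(u \<star> b) pmod f = b pmod f"
    proof -
      have "u \<star> b \<boxminus> b = w \<star> b" using b wK by (simp add: u_def P.l_distr a_minus_def P.a_ac P.r_neg P.r_neg2 P.r_neg1)
      moreover have "p' pdivides (w \<star> b)" if "p' \<in> S" for p'
        using that dw[of p'] p(2) pdivides_mult_right[of p' w b] pdivides_mult_left[of p' b w] b wK pp(2)[OF that]
        by (cases "p' = p") auto
      then have "f pdivides (w \<star> b)" using dvd[of "w \<star> b"] wK b by simp
      ultimately show ?thesis using pmod_eq_iff[of "u \<star> b" b f] uK b fK by simp
    qed
    have "mset_char G u = gauss_symbol u p ^ count G p * (\<Prod>p'\<in>S - {p}. gauss_symbol u p' ^ count G p')"
      unfolding mset_char_def S_def[symmetric] using S p by (intro prod.remove) auto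
    also have "gauss_symbol u p = gauss_symbol u0 p"
      using gauss_symbol_cong[OF pp(1)[OF p(1)] uK u0(1) up] .
    also have "(\<Prod>p'\<in>S - {p}. gauss_symbol u p' ^ count G p') = 1"
    proof (intro prod.neutral ballI)
      fix p' assume p': "p' \<in> S - {p}"
      then have "gauss_symbol u p' = gauss_symbol [\<one>] p'"
        using gauss_symbol_cong[of p' "deg p'" u "[\<one>]"] pp(1)[of p'] uK up' by simp
      then show "gauss_symbol u p' ^ count G p' = 1" using gauss_symbol_one[OF pp(1)] p' by simp
    qed
    finally have "mset_char G u \<noteq> 1" using u0 by simp
    with r1 r2 show ?thesis by blast
  qed
  have zero: "mset_char G b = 0" if "b \<in> carrier KX" "p \<in> S" "p pdivides b" for b p
    unfolding mset_char_def S_def[symmetric] using S that gauss_symbol_prime_cases(1)[OF pp(4)[OF that(2)] that(1)]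
    by (intro prod_zero bexI[of _ p]) (auto simp: S_def)
  have "residue_character f d (mset_char G)"
    unfolding residue_character_def
  proof (intro conjI ballI impI)
    fix a b assume ab: "a \<in> carrier KX" "b \<in> carrier KX"
    show "mset_char G (a \<star> b) = mset_char G a * mset_char G b"
      unfolding mset_char_def S_def[symmetric] prod.distrib[symmetric] power_mult_distrib[symmetric]
      using gauss_symbol_mult[OF pp(1) ab] by (intro prod.cong) auto
    assume "a pmod f = b pmod f"
    then have "f pdivides (a \<boxminus> b)" using pmod_eq_iff ab fK by simp
    then have "a pmod p = b pmod p" if "p \<in> S" for p
      using dvd[of "a \<boxminus> b"] pmod_eq_iff[of a b p] pp(2)[OF that] ab that by simp
    then show "mset_char G a = mset_char G b"
      unfolding mset_char_def S_def[symmetric] using gauss_symbol_cong[OF pp(1) ab] by (intro prod.cong) auto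
  next
    show "mset_char G [\<one>] = 1"
      unfolding mset_char_def S_def[symmetric] using gauss_symbol_one[OF pp(1)] by (intro prod.neutral) auto
    fix a assume a: "a \<in> carrier KX"
    show "cmod (mset_char G a) \<le> 1" using reg(2)[OF a] zero[OF a] by (cases "\<forall>p\<in>S. \<not> p pdivides a") auto
    show "(regular_mod f a \<and> cmod (mset_char G a) = 1) \<or>
       (mset_char G a = 0 \<and> (\<exists>u. regular_mod f u \<and> (u \<star> a) pmod f = a pmod f \<and> mset_char G u \<noteq> 1))"
      using reg[OF a] zero[OF a] nreg[OF a] by blast
  qed (use f d in auto)
  then show ?thesis by (simp add: f_def d_def S_def)
qed

lemma gauss_symbol_poly_of_mset:
  assumes "b \<in> M d" "set_mset F \<subseteq> Pr"
  shows "gauss_symbol (poly_of_mset F) b = (\<Prod>p\<in>#F. gauss_symbol p b)"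
  using assms(2)
proof (induction F)
  case empty
  then show ?case using gauss_symbol_one[OF assms(1)] by simp
next
  case (add p F)
  then have "p \<in> carrier KX" "set_mset F \<subseteq> carrier KX" using Pr_KX by auto
  then show ?case using add by (simp add: poly_of_mset_add_mset gauss_symbol_mult[OF assms(1)])
qed

lemma mset_char_eq: "mset_char G a = (\<Prod>p\<in>#G. gauss_symbol a p)"
  by (simp add: mset_char_def image_prod_mset_multiplicity)

lemma mset_char_poly_of_mset:
  assumes "set_mset G \<subseteq> Pr" "set_mset F \<subseteq> Pr"
  shows "mset_char G (poly_of_mset F) = (\<Prod>Q\<in>#F. \<Prod>P\<in>#G. gauss_symbol Q P)"
proof -
  have "mset_char G (poly_of_mset F) = (\<Prod>P\<in>#G. \<Prod>Q\<in>#F. gauss_symbol Q P)"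
    unfolding mset_char_eq using assms primeE(1)
    by (intro arg_cong[where f = prod_mset] image_mset_cong gauss_symbol_poly_of_mset) auto
  also have "\<dots> = (\<Prod>Q\<in>#F. \<Prod>P\<in>#G. gauss_symbol Q P)" by (rule prod_mset.swap)
  finally show ?thesis .
qed

lemma sum_mset_char:
  assumes "set_mset G \<subseteq> Pr"
  shows "(\<Sum>F\<in>msets_of_deg deg Pr n. \<Prod>Q\<in>#F. \<Prod>P\<in>#G. gauss_symbol Q P) = (\<Sum>a\<in>M n. mset_char G a)"
proof -
  have "(\<Sum>a\<in>M n. mset_char G a) = (\<Sum>F\<in>msets_of_deg deg Pr n. mset_char G (poly_of_mset F))"
    by (rule sum.reindex_bij_betw[OF bij_poly_of_mset, symmetric])
  also have "\<dots> = (\<Sum>F\<in>msets_of_deg deg Pr n. \<Prod>Q\<in>#F. \<Prod>P\<in>#G. gauss_symbol Q P)"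
    using assms by (intro sum.cong refl mset_char_poly_of_mset) (auto simp: msets_of_deg_def)
  finally show ?thesis ..
qed

lemma conductor_deg_le: "(\<Sum>p\<in>set_mset G. deg p) \<le> mset_deg deg G"
  unfolding mset_deg_eq_sum_count by (intro sum_mono) (simp add: Suc_leI)

text \<open>Reciprocity exchanges the arguments, so that the sum over moduli G becomes the sum of
  one character over monic polynomials. Its conductor is the product of the distinct primes of F, of
  degree at most that of F.\<close>

theorem residue_system_gauss_symbol: "residue_system q Pr deg r gauss_symbol"
proof -
  interpret prime_system q Pr deg by (rule prime_system_poly)
  show ?thesis
  proof
    show "r \<ge> 2" by (rule r_ge_2)
    show "gauss_symbol p p = 0" if "p \<in> Pr" for p
    proof (rule gauss_symbol_prime_cases(1)[OF that primeE(2)[OF that]])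
      show "p pdivides p" unfolding pdivides_iff_mult using primeE(2)[OF that] by (intro bexI[of _ "[\<one>]"]) auto
    qed
    show "gauss_symbol p p' ^ r = 1" if "p \<in> Pr" "p' \<in> Pr" "p \<noteq> p'" for p p'
      using gauss_symbol_prime_cases(2)[OF that(2) primeE(2)[OF that(1)]] prime_dvd_prime[OF that(2,1)] that(3) by blast
    fix F :: "'a list multiset" and n :: nat
    assume F: "set_mset F \<subseteq> Pr" "F \<noteq> {#}" "\<And>P. P \<in># F \<Longrightarrow> \<not> r dvd count F P"
    have "(\<Sum>G\<in>msets_of_deg deg Pr n. \<Prod>Q\<in>#G. \<Prod>P\<in>#F. gauss_symbol P Q) =
        (\<Sum>G\<in>msets_of_deg deg Pr n. \<Prod>Q\<in>#G. \<Prod>P\<in>#F. gauss_symbol Q P)"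
    proof (intro sum.cong refl arg_cong[where f = prod_mset] image_mset_cong)
      fix G Q P assume "G \<in> msets_of_deg deg Pr n" "Q \<in># G" "P \<in># F"
      then have "Q \<in> Pr" "P \<in> Pr" using F by (auto simp: msets_of_deg_def)
      then show "gauss_symbol P Q = gauss_symbol Q P" using gauss_reciprocity primeE(1) by blast
    qed
    also have "\<dots> = (\<Sum>a\<in>M n. mset_char F a)" by (rule sum_mset_char[OF F(1)])
    also have "cmod \<dots> \<le> 3 * sqrt (real q ^ ((\<Sum>p\<in>set_mset F. deg p) - 1))"
      by (rule sum_char_le[OF residue_character_mset_char[OF F]])
    also have "\<dots> \<le> 3 * sqrt (real q ^ (mset_deg deg F - 1))"
      using conductor_deg_le[of F] q_ge_2
      by (intro mult_left_mono real_sqrt_le_mono power_increasing) auto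
    finally show "cmod (\<Sum>G\<in>msets_of_deg deg Pr n. \<Prod>Q\<in>#G. \<Prod>P\<in>#F. gauss_symbol P Q) \<le> 3 * sqrt (real q ^ (mset_deg deg F - 1))" .
  qed
qed

lemma residue_char_eq_mset_char:
  assumes "set_mset G \<subseteq> Pr" "a \<in> carrier KX"
  shows "residue_char R \<psi> r (poly_of_mset G) a = mset_char G a"
proof -
  have "{p \<in> Pr. p pdivides poly_of_mset G} = set_mset G"
    using prime_dvd_poly_of_mset[OF _ assms(1)] assms(1) by auto
  then show ?thesis
    unfolding residue_char_def mset_char_def using assms
    by (intro prod.cong) (auto simp: residue_symbol_eq_gauss_symbol prime_multiplicity_poly_of_mset subset_iff)
qed

text \<open>The multiplicities in a power-free G lie strictly between 0 and r, so its character is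
  primitive, with a conductor of positive degree at most N.\<close>

lemma sum_mset_char_vanishes:
  assumes "G \<in> msets_of_deg deg Pr N" "power_free r G" "0 < N" "N \<le> n"
  shows "(\<Sum>a\<in>M n. mset_char G a) = 0"
proof -
  have G: "set_mset G \<subseteq> Pr" "mset_deg deg G = N" using assms by (auto simp: msets_of_deg_def)
  have "residue_character (poly_of_mset (mset_set (set_mset G))) (\<Sum>p\<in>set_mset G. deg p) (mset_char G)"
  proof (rule residue_character_mset_char[OF G(1)])
    show "G \<noteq> {#}" using G assms by (auto simp: mset_deg_def)
    show "\<not> r dvd count G p" if "p \<in># G" for p
      using that assms(2) by (auto simp: power_free_def dest!: dvd_imp_le)  (meson linorder_not_le)
  qed
  from sum_char_high_degree[OF this] show ?thesis using conductor_deg_le[of G] G assms by simp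
qed

end

subsection \<open>Frobenius matrices\<close>

lemma det_one_minus_scaled:
  fixes U :: "complex^'n^'n"
  assumes "is_eigenvalues U x"
  shows "det (mat 1 - mat c ** U) = (\<Prod>i\<in>UNIV. 1 - c * x i)"
  using det_peval[OF assms, of "1 - Polynomial.monom c 1"]
  by (simp add: peval_one_minus_monom poly_monom)

text \<open>Since a 0 = 1, the j-th identity determines f j from the earlier values.\<close>

lemma newton_sums_unique:
  fixes a f g :: "nat \<Rightarrow> complex"
  assumes a0: "a 0 = 1"
    and f: "\<And>n. of_nat n * a n = (\<Sum>j=1..n. f j * a (n - j))"
    and g: "\<And>n. of_nat n * a n = (\<Sum>j=1..n. g j * a (n - j))"
  shows "j > 0 \<Longrightarrow> f j = g j"
proof (induction j rule: less_induct)
  case (less j)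
  have split: "(\<Sum>i=1..j. h i * a (j - i)) = (\<Sum>i\<in>{1..<j}. h i * a (j - i)) + h j" for h :: "nat \<Rightarrow> complex"
  proof -
    have "{1..j} = insert j {1..<j}" using less.prems by auto
    then show ?thesis by (simp add: a0 add.commute)
  qed
  have "(\<Sum>i\<in>{1..<j}. f i * a (j - i)) = (\<Sum>i\<in>{1..<j}. g i * a (j - i))"
    using less.IH by (intro sum.cong) auto
  then show ?case using f[of j] g[of j] split[of f] split[of g] by simp
qed

text \<open>There is one index for each single part, so a partition with repeated parts becomes a
  set of parts with sizes \<open>fst\<close>.\<close>

lemma power_sum_eq_prod: "power_sum k l U = (\<Prod>i\<in>(SIGMA j:{1..k}. {..<l j}). trace (matrix_power U (fst i)))"
proof -
  have "(\<Prod>i\<in>(SIGMA j:{1..k}. {..<l j}). trace (matrix_power U (fst i))) = (\<Prod>j=1..k. \<Prod>i<l j. trace (matrix_power U j))"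
    by (subst prod.Sigma) (auto simp: split_beta)
  then show ?thesis by (simp add: power_sum_def)
qed

lemma partition_size_eq_sum: "sum fst (SIGMA j:{1..k}. {..<l j}) = partition_size k l"
proof -
  have "sum fst (SIGMA j:{1..k}. {..<l j}) = (\<Sum>j=1..k. \<Sum>i<l j. j)"
    by (subst sum.Sigma) (auto simp: split_beta)
  then show ?thesis by (simp add: partition_size_def mult.commute)
qed

context residue_field
begin

text \<open>The coefficients a of the L-function and b of the characteristic polynomial agree. Both
  satisfy Newton's identities, one with the Frobenius sums and the other with minus the power sums
  of the scaled eigenvalues, so the traces of all powers follow from the characteristic
  polynomial.\<close>

lemma trace_Frobenius:
  fixes \<Theta> :: "complex^'n^'n"
  assumes G: "G \<in> msets_of_deg deg Pr N" "power_free r G" and N: "CARD('n) = N"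
    and frob: "is_Frobenius R \<psi> r (poly_of_mset G) \<Theta>" and j: "j > 0"
  shows "trace (matrix_power \<Theta> j) * complex_of_real (sqrt (real q)) ^ j = - residue_system.frobenius_sum Pr deg gauss_symbol G j"
proof -
  interpret residue_system q Pr deg r gauss_symbol by (rule residue_system_gauss_symbol)
  define s where "s = complex_of_real (sqrt (real q))"
  obtain x where x: "is_eigenvalues \<Theta> x" using exists_eigenvalues by blast
  have G': "set_mset G \<subseteq> Pr" using G by (simp add: msets_of_deg_def)
  have N0: "N > 0" using N by auto
  define a where "a n = (\<Sum>F\<in>msets_of_deg deg Pr n. \<Prod>P\<in>#F. \<Prod>Q\<in>#G. gauss_symbol P Q)" for n
  define b where "b n = fps_nth (\<Prod>i\<in>UNIV. 1 - fps_const (s * x i) * fps_X) n" for n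
  have a_newton: "of_nat n * a n = (\<Sum>j=1..n. frobenius_sum G j * a (n - j))" for n
    unfolding a_def frobenius_sum_def by (rule newton_character_sum)
  have b_newton: "of_nat n * b n = (\<Sum>j=1..n. - (\<Sum>i\<in>UNIV. (s * x i) ^ j) * b (n - j))" for n
    unfolding b_def by (simp only: newton_prod_linear[OF finite] sum_negf mult_minus_left)
  have a_eq: "a n = (\<Sum>f\<in>M n. mset_char G f)" for n
    unfolding a_def by (rule sum_mset_char[OF G'])
  \<comment> \<open>The L-function has degree below N, so comparing the coefficients up to N settles
    all of them.\<close>
  have a_zero: "a n = 0" if "n \<ge> N" for n
    unfolding a_eq using sum_mset_char_vanishes[OF G N0 that] .
  have L: "L_function R \<psi> r (poly_of_mset G) u = (\<Sum>n\<le>N. a n * u ^ n)" for u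
  proof -
    have "(\<Sum>f\<in>M n. residue_char R \<psi> r (poly_of_mset G) f) = a n" for n
      unfolding a_eq by (intro sum.cong refl residue_char_eq_mset_char[OF G'] M_KX)
    then have "L_function R \<psi> r (poly_of_mset G) u = (\<Sum>n. a n * u ^ n)" by (simp add: L_function_def)
    also have "\<dots> = (\<Sum>n\<le>N. a n * u ^ n)" by (rule suminf_finite) (auto simp: a_zero)
    finally show ?thesis .
  qed
  have b_scale: "fps_nth (\<Prod>i\<in>UNIV. 1 - fps_const (s * u * x i) * fps_X) m = b m * u ^ m" for m u
  proof -
    have "(\<Prod>i\<in>S. s * u * x i) = (\<Prod>i\<in>S. s * x i) * u ^ m" if "card S = m" for S
      using that by (simp add: prod.distrib power_mult_distrib)
    then show ?thesis
      unfolding b_def by (simp add: prod_linear_fps_nth sum_distrib_right mult.assoc)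
  qed
  have "(\<Sum>n\<le>N. a n * u ^ n) = (\<Sum>n\<le>N. b n * u ^ n)" for u
  proof -
    have "(\<Sum>n\<le>N. a n * u ^ n) = det (mat 1 - mat (s * u) ** \<Theta>)"
      using frob L[of u] by (simp add: is_Frobenius_def s_def q_def)
    also have "\<dots> = (\<Prod>i\<in>UNIV. 1 - s * u * x i)" by (rule det_one_minus_scaled[OF x])
    also have "\<dots> = (\<Sum>n\<le>N. b n * u ^ n)"
      using prod_linear_sum[of "UNIV :: 'n set" N "\<lambda>i. s * u * x i"] N by (simp add: b_scale)
    finally show ?thesis .
  qed
  then have eq_le: "\<forall>n\<le>N. a n = b n" using polyfun_eq_coeffs[of a N b] by simp
  have "a n = b n" for n
  proof (cases "n \<le> N")
    case False
    then have "{S. card S = n \<and> S \<subseteq> (UNIV :: 'n set)} = {}"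
      using N card_mono[of "UNIV :: 'n set"] by auto
    then have "b n = 0" by (simp add: b_def prod_linear_fps_nth conj_commute)
    then show ?thesis using False a_zero by simp
  qed (use eq_le in simp)
  then have "a = b" by blast
  moreover have "b 0 = 1" by (simp add: b_def fps_prod_nth_0)
  ultimately have "frobenius_sum G j = - (\<Sum>i\<in>UNIV. (s * x i) ^ j)"
    using newton_sums_unique[of a "frobenius_sum G" "\<lambda>j. - (\<Sum>i\<in>UNIV. (s * x i) ^ j)" j] a_newton b_newton j by simp
  then show ?thesis
    by (simp add: trace_matrix_power[OF x] s_def power_mult_distrib sum_distrib_right mult.commute)
qed

text \<open>The powers of q combine as d/2 - d/r = (r - 2) d / (2 r): the first comes from the
  scaling of \<Theta> by sqrt q, the second is the normalisation of the tuple sums.\<close>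

lemma family_average_eq:
  fixes \<Theta> :: "'a list \<Rightarrow> complex^'n^'n" and k :: nat and l :: "nat \<Rightarrow> nat"
  assumes N: "CARD('n) = N"
    and frob: "\<And>g. g \<in> power_free_polys R r N \<Longrightarrow> is_Frobenius R \<psi> r g (\<Theta> g)"
  defines "A \<equiv> (SIGMA j:{1..k}. {..<l j})" and "H \<equiv> {G \<in> msets_of_deg deg Pr N. power_free r G}"
  shows "family_average R r N k l \<Theta> =
    (\<Sum>G\<in>H. \<Prod>i\<in>A. - residue_system.frobenius_sum Pr deg gauss_symbol G (fst i)) / of_nat (card H)
      * of_real (real q powr (- (real (partition_size k l) / real r)))"
proof -
  interpret residue_system q Pr deg r gauss_symbol by (rule residue_system_gauss_symbol)
  define d where "d = partition_size k l"
  have r0: "r > 0" using r_ge_2 by simp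
  have q0: "real q > 0" using q_ge_2 by simp
  have bij: "bij_betw poly_of_mset H (power_free_polys R r N)"
    unfolding H_def by (rule bij_power_free[OF r0])
  have summand: "of_real (real q powr ((real r - 2) / (2 * real r) * real d)) * power_sum k l (\<Theta> (poly_of_mset G)) =
      (\<Prod>i\<in>A. - frobenius_sum G (fst i)) * of_real (real q powr (- (real d / real r)))"
    if G: "G \<in> H" for G
  proof -
    let ?s = "complex_of_real (sqrt (real q))" and ?U = "\<Theta> (poly_of_mset G)"
    have fr: "is_Frobenius R \<psi> r (poly_of_mset G) ?U" using frob bij_betwE[OF bij] G by blast
    have "(\<Prod>i\<in>A. - frobenius_sum G (fst i)) = (\<Prod>i\<in>A. trace (matrix_power ?U (fst i)) * ?s ^ fst i)"
      using G by (intro prod.cong refl trace_Frobenius[OF _ _ N fr, symmetric]) (auto simp: A_def H_def)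
    also have "\<dots> = power_sum k l ?U * ?s ^ sum fst A"
      by (simp add: prod.distrib power_sum_eq_prod A_def power_sum)
    also have "sum fst A = d" by (simp only: A_def d_def partition_size_eq_sum)
    also have "sqrt (real q) ^ d = real q powr (real d / 2)"
      using q0 powr_realpow[of "sqrt (real q)" d] by (simp add: powr_half_sqrt[symmetric] powr_powr)
    then have "?s ^ d = of_real (real q powr (real d / 2))" by (metis of_real_power)
    finally have "(\<Prod>i\<in>A. - frobenius_sum G (fst i)) * of_real (real q powr (- (real d / real r))) =
       power_sum k l ?U * of_real (real q powr (real d / 2) * real q powr (- (real d / real r)))"
      by (simp add: mult.assoc)
    also have "real q powr (real d / 2) * real q powr (- (real d / real r)) = real q powr ((real r - 2) / (2 * real r) * real d)"
      using r0 by (simp add: powr_add[symmetric] field_simps)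
    finally show ?thesis by (simp add: mult.commute)
  qed
  have "(\<Sum>g\<in>power_free_polys R r N. of_real (real q powr ((real r - 2) / (2 * real r) * real d)) * power_sum k l (\<Theta> g)) =
      (\<Sum>G\<in>H. of_real (real q powr ((real r - 2) / (2 * real r) * real d)) * power_sum k l (\<Theta> (poly_of_mset G)))"
    by (rule sum.reindex_bij_betw[OF bij, symmetric])
  also have "\<dots> = (\<Sum>G\<in>H. \<Prod>i\<in>A. - frobenius_sum G (fst i)) * of_real (real q powr (- (real d / real r)))"
    unfolding sum_distrib_right by (intro sum.cong refl summand)
  finally show ?thesis
    unfolding family_average_def bij_betw_same_card[OF bij, symmetric] d_def[symmetric] q_def[symmetric] by simp
qed

end

section \<open>The error exponent and the limit\<close>

text \<open>Multiplied by 2 r the claim reads d (3 r - 2) + r < 2 r N, while twice the hypothesis is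
  2 d (2 r - 2) < 2 r N. This suffices if r \<le> d (r - 2); otherwise either r = 2, where d < N are
  integers, or d \<le> 2 and N \<ge> r \<ge> 3.\<close>

lemma error_exponent_negative:
  fixes r N d :: nat
  assumes r: "r \<ge> 2" "N \<ge> r" and d: "real d < real r * real N / (2 * real r - 2)"
  shows "real d * (1 - 1 / real r) + (real d + 1) / 2 - real N < 0"
proof -
  have r0: "real r > 0" "2 * real r - 2 > 0" using r by auto
  have dN: "real d * (2 * real r - 2) < real r * real N" using d r0 by (simp add: pos_less_divide_eq)
  have "real d * (3 * real r - 2) + real r < 2 * real r * real N"
  proof (cases "r = 2")
    case True
    then have "d < N" using dN by simp
    then show ?thesis using True by simp
  next
    case False
    then have r3: "r \<ge> 3" using r by simp
    show ?thesis
    proof (cases "r \<le> d * (r - 2)")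
      case True
      then have "real r \<le> real (d * (r - 2))" by linarith
      also have "\<dots> = real d * (real r - 2)" using r by (simp add: of_nat_diff)
      finally have "real d * (3 * real r - 2) + real r \<le> 2 * (real d * (2 * real r - 2))" by (simp add: algebra_simps)
      then show ?thesis using dN by simp
    next
      case small: False
      have "d \<le> 2"
      proof (rule ccontr)
        assume "\<not> d \<le> 2"
        then have "3 * (r - 2) \<le> d * (r - 2)" by (intro mult_right_mono) auto
        then show False using small r3 by linarith
      qed
      then consider "d = 0" | "d = 1" | "d = 2" by linarith
      then show ?thesis
      proof cases
        case 1
        then show ?thesis using r r0 by (simp add: less_mult_imp_div_less)
      next
        case 2
        then have "real d * (3 * real r - 2) + real r < 2 * (real r * 3)" using r0 by simp
        also have "\<dots> \<le> 2 * (real r * real N)" using r r3 by (intro mult_left_mono) auto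
        finally show ?thesis by (simp only: mult.assoc)
      next
        case 3
        \<comment> \<open>From 2 (r - 2) < r and r \<ge> 3; here 17 < 6 N holds because N \<ge>
          3.\<close>
        then have "r = 3" using small r3 by simp
        then show ?thesis using 3 r by simp
      qed
    qed
  qed
  then show ?thesis using r0 by (simp add: field_simps)
qed

theorem theorem1p1:
  fixes r N k :: nat
    and l :: "nat \<Rightarrow> nat"
    and Fq :: "nat \<Rightarrow> 'a ring"
    and \<psi> :: "nat \<Rightarrow> 'a \<Rightarrow> complex"
    and \<Theta> :: "nat \<Rightarrow> 'a list \<Rightarrow> complex^'n^'n"
    and \<mu> :: "(complex^'n^'n) measure"
  assumes "r \<ge> 2" and "N \<ge> r" and "CARD('n) = N"
    and "real (partition_size k l) < real r * real N / (2 * real r - 2)"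
    and "\<And>q. q \<in> admissible_q r \<Longrightarrow> Ring.field (Fq q) \<and> card (carrier (Fq q)) = q"
    and "\<And>q. q \<in> admissible_q r \<Longrightarrow> units_embedding (Fq q) (\<psi> q)"
    and "\<And>q G. q \<in> admissible_q r \<Longrightarrow> G \<in> power_free_polys (Fq q) r N \<Longrightarrow>
           is_Frobenius (Fq q) (\<psi> q) r G (\<Theta> q G)"
    and "is_Haar_probability \<mu>"
  shows "\<exists>I. has_omega_integral \<mu> r (power_sum k l) I \<and>
           ((\<lambda>q. family_average (Fq q) r N k l (\<Theta> q)) \<longlongrightarrow> I)
             (inf at_top (principal (admissible_q r)))"
proof -
  interpret haar_probability \<mu> by unfold_locales (rule assms(8))
  define A where "A = (SIGMA j:{1..k}. {..<l j})"
  define d where "d = partition_size k l"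
  define t where "t B = omega_pairing r (parts fst B)" for B :: "(nat \<times> nat) set"
  define E where "E = real d * (1 - 1 / real r) + (real d + 1) / 2 - real N"
  have A: "finite A" "\<And>i. i \<in> A \<Longrightarrow> fst i > 0" by (auto simp: A_def)
  have dA: "d = sum fst A" by (simp only: A_def d_def partition_size_eq_sum)
  have E: "E < 0" unfolding E_def d_def by (rule error_exponent_negative[OF assms(1,2,4)])
  \<comment> \<open>From r \<le> 2 r - 2; it puts all moments involved in the range of
    \<open>mom_eq_hall\<close>.\<close>
  have dN: "d \<le> N"
  proof -
    have "real r * real N \<le> (2 * real r - 2) * real N" using assms(1) by (intro mult_right_mono) auto
    moreover have "real d * (2 * real r - 2) < real r * real N"
      using assms(1,4) by (simp add: pos_less_divide_eq d_def)
    ultimately have "real d * (2 * real r - 2) < real N * (2 * real r - 2)" by (simp add: mult.commute)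
    then show ?thesis using assms(1) by simp
  qed
  have "trace_prod (parts fst A) = (power_sum k l :: complex^'n^'n \<Rightarrow> complex)"
  proof
    fix U :: "complex^'n^'n"
    show "trace_prod (parts fst A) U = power_sum k l U"
      unfolding power_sum_eq_prod A_def[symmetric]
      by (simp add: trace_prod_def parts_def image_mset.compositionality o_def prod_unfold_prod_mset)
  qed
  then have integral: "has_omega_integral \<mu> r (power_sum k l) (t A)"
    using has_omega_integral_trace_prod[of r "parts fst A"] assms(1) by (simp add: t_def)
  \<comment> \<open>All the fields share the type \<open>'a\<close>, so one instance, and with it
    one constant, serves every q.\<close>
  have "\<exists>C\<ge>0. \<forall>q (Pr :: 'a list set) dg s. residue_system q Pr dg r s \<longrightarrow>
     cmod ((\<Sum>G\<in>{G \<in> msets_of_deg dg Pr N. power_free r G}. \<Prod>i\<in>A. - residue_system.frobenius_sum Pr dg s G (fst i))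
         / of_nat (card {G \<in> msets_of_deg dg Pr N. power_free r G}) * of_real (real q powr (- (real d / real r))) - t A)
       \<le> C / real q + C * real q powr (real d * (1 - 1 / real r) + (real d + 1) / 2 - real N)"
  proof (rule family_average_asymptotics[OF A assms(1,2) _ _ _ dA])
    show "t {} = 1" by (simp add: t_def omega_pairing_empty)
    show "\<not> r dvd sum fst A \<Longrightarrow> t A = 0" by (simp add: t_def omega_pairing_not_dvd)
    fix B m assume B: "B \<subseteq> A" "sum fst B = r * m"
    have "sum fst B \<le> d" unfolding dA using B A by (intro sum_mono2) auto
    then have "r * m \<le> CARD('n)" using B dN assms(3) by simp
    then show "of_nat m * t B = (\<Sum>k=1..m. \<Sum>D | D \<subseteq> B \<and> (\<forall>b\<in>D. k dvd fst b) \<and> sum fst D = k * r. (- of_nat k) ^ card D * t (B - D))"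
      unfolding t_def using B A assms(1) finite_subset[OF B(1) A(1)]
      by (intro omega_pairing_rec) auto
  qed
  then obtain C where C: "\<And>q (Pr :: 'a list set) dg s. residue_system q Pr dg r s \<Longrightarrow>
     cmod ((\<Sum>G\<in>{G \<in> msets_of_deg dg Pr N. power_free r G}. \<Prod>i\<in>A. - residue_system.frobenius_sum Pr dg s G (fst i))
         / of_nat (card {G \<in> msets_of_deg dg Pr N. power_free r G}) * of_real (real q powr (- (real d / real r))) - t A)
       \<le> C / real q + C * real q powr E"
    unfolding E_def by blast
  have bound: "cmod (family_average (Fq q) r N k l (\<Theta> q) - t A) \<le> C / real q + C * real q powr E"
    if q: "q \<in> admissible_q r" for q
  proof -
    have field: "Ring.field (Fq q)" and card: "card (carrier (Fq q)) = q" using assms(5)[OF q] by auto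
    have "q > 0" "[q = 1] (mod (2 * r))" using q by (auto simp: admissible_q_def primepow_gt_0_nat)
    then have "2 * r dvd q - 1" by (intro cong_to_1_nat)
    have "residue_field (Fq q) (\<psi> q) r"
    proof -
      have "finite_field_poly (Fq q)"
        using field card \<open>q > 0\<close> card_ge_0_finite[of "carrier (Fq q)"]
        by (simp add: finite_field_poly_def finite_field_poly_axioms_def)
      moreover from this have "finite_field_poly.q (Fq q) = q" using card by (simp add: finite_field_poly.q_def)
      ultimately show ?thesis
        using assms(1) assms(6)[OF q] \<open>2 * r dvd q - 1\<close> by (simp add: residue_field_def residue_field_axioms_def)
    qed
    then interpret F: residue_field "Fq q" "\<psi> q" r .
    have "F.q = q" using card by (simp add: F.q_def)
    then show ?thesis
      using C[OF F.residue_system_gauss_symbol] F.family_average_eq[OF assms(3), of "\<Theta> q" k l] assms(7)[OF q]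
      by (simp add: A_def d_def)
  qed
  \<comment> \<open>The bound tends to 0 along all natural numbers, hence along the admissible
    q.\<close>
  have "((\<lambda>q. C / real q + C * real q powr E) \<longlongrightarrow> 0 + C * 0) at_top"
    using E by (intro tendsto_intros tendsto_divide_0[OF tendsto_const] filterlim_at_top_imp_at_infinity
      filterlim_real_sequentially tendsto_neg_powr) auto
  then have "((\<lambda>q. C / real q + C * real q powr E) \<longlongrightarrow> 0) (inf at_top (principal (admissible_q r)))"
    by (intro tendsto_mono[OF inf_le1]) simp
  then have "((\<lambda>q. family_average (Fq q) r N k l (\<Theta> q) - t A) \<longlongrightarrow> 0) (inf at_top (principal (admissible_q r)))"
    by (rule Lim_null_comparison[rotated]) (use bound in \<open>auto simp: eventually_inf_principal\<close>)
  then have "((\<lambda>q. family_average (Fq q) r N k l (\<Theta> q)) \<longlongrightarrow> t A) (inf at_top (principal (admissible_q r)))"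
    by (rule LIM_zero_cancel)
  with integral show ?thesis by blast
qed

end
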